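(* Let $0<\lambda\le\Lambda$, $s>1$, $N_+=\frac{\lambda}{\Lambda}(N-1)+1$, and let $f$ be a radial function satisfying, for all $R>0$, $$\int_0^R r^{N_+-1}|f(r)|\,dr<\infty.$$ Then the equation $$-(\rho u')'+\tilde\rho|u|^{s-1}u=\tilde\rho f(r)$$ (the radial form of $-\mathcal{M}^+_{\lambda,\Lambda}(D^2u)+|u|^{s-1}u=f$ in $\mathbb{R}^N$) has a unique weak solution $u$, and if $f$ is nonnegative then $u$ is also nonnegative. Additionally, for any $1<q<2s/(s+1)$, $$\int_0^R\rho|u'|^q\,dr<\infty\quad\text{for all }R>0.$$ Moreover, the function $\rho u'$ is differentiable a.e. in $(0,\infty)$ and satisfies $$\lim_{r\to0}(\rho u')(r)=0,\qquad \lim_{r\to0}\int_0^r\rho|u'|\,dr=0.$$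
   Context: Pucci operator: for a symmetric matrix $X$ with eigenvalues $e_i$, $\mathcal{M}^+_{\lambda,\Lambda}(X)=\Lambda\sum_{e_i>0}e_i+\lambda\sum_{e_i<0}e_i$. Radial form and weights: let $\theta(t)=\Lambda$ if $t\ge0$ and $\theta(t)=\lambda$ if $t<0$. For a radial function $u=u(r)$ (differentiable a.e.) define $$\Theta(r,u(r),u'(r))=\theta\Big(-\theta(u'(r))(N-1)\tfrac{u'(r)}{r}+|u(r)|^{s-1}u(r)-f(r)\Big),$$ $$N(r,u(r),u'(r))=\frac{\theta(u'(r))}{\Theta(r,u(r),u'(r))}(N-1)+1,$$ $$\rho(r)=\rho(r,u(r),u'(r))=\exp\Big(\int_1^r\frac{N(\tau,u(\tau),u'(\tau))-1}{\tau}\,d\tau\Big),\qquad \tilde\rho(r)=\frac{\rho(r)}{\Theta(r,u(r),u'(r))}.$$ Test functions: $H$ is the set of $\varphi:[0,\infty)\to\mathbb{R}$ such that $\phi(x)=\varphi(|x|)$ defines a function in $W^{1,\infty}(\mathbb{R}^N)$ with compact support. Weak solution: a function $u:(0,\infty)\to\mathbb{R}$, absolutely continuous on each compact subinterval of $(0,\infty)$, such that for all $R>0$, $\int_0^R\rho|u|^s\,dr<\infty$ and $\int_0^R\rho|u'|\,dr<\infty$, and $$\int_0^\infty\big(\rho u'\varphi'+\tilde\rho|u|^{s-1}u\varphi\big)\,dr=\int_0^\infty\tilde\rho f\varphi\,dr\quad\text{for all }\varphi\in H.$$ *)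

theory Defs
  imports "HOL-Analysis.Analysis"
begin

text \<open>Absolute continuity on \<open>[a, b]\<close>: the division \<open>d\<close> ranges over all finite families of
  non-overlapping compact subintervals of \<open>[a, b]\<close>.\<close>

definition abs_cont_on_interval :: "real \<Rightarrow> real \<Rightarrow> (real \<Rightarrow> real) \<Rightarrow> bool" where
  "abs_cont_on_interval a b u \<longleftrightarrow>
     (\<forall>\<epsilon>>0. \<exists>\<delta>>0. \<forall>d. d division_of \<Union>d \<and> \<Union>d \<subseteq> {a..b} \<and> (\<Sum>k\<in>d. Sup k - Inf k) < \<delta>
        \<longrightarrow> (\<Sum>k\<in>d. \<bar>u (Sup k) - u (Inf k)\<bar>) < \<epsilon>)"

primrec Ck :: "nat \<Rightarrow> ('a::euclidean_space \<Rightarrow> real) \<Rightarrow> bool" where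
  "Ck 0 \<psi> \<longleftrightarrow> continuous_on UNIV \<psi>"
| "Ck (Suc k) \<psi> \<longleftrightarrow>
     (\<exists>\<psi>'. (\<forall>x. (\<psi> has_derivative \<psi>' x) (at x)) \<and> (\<forall>b\<in>Basis. Ck k (\<lambda>x. \<psi>' x b)))"

definition compact_support :: "('a::euclidean_space \<Rightarrow> real) \<Rightarrow> bool" where
  "compact_support \<psi> \<longleftrightarrow> compact (closure {x. \<psi> x \<noteq> 0})"

definition Cc_infinity :: "('a::euclidean_space \<Rightarrow> real) set" where
  "Cc_infinity = {\<psi>. (\<forall>k. Ck k \<psi>) \<and> compact_support \<psi>}"

definition L_infinity :: "('a::euclidean_space \<Rightarrow> real) set" where
  "L_infinity = {g \<in> borel_measurable lebesgue. \<exists>C. AE x in lebesgue. \<bar>g x\<bar> \<le> C}"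

definition has_weak_partial ::
    "('a::euclidean_space \<Rightarrow> real) \<Rightarrow> 'a \<Rightarrow> ('a \<Rightarrow> real) \<Rightarrow> bool" where
  "has_weak_partial \<phi> b g \<longleftrightarrow>
     (\<forall>\<psi>\<in>Cc_infinity.
        (LINT x|lebesgue. \<phi> x * frechet_derivative \<psi> (at x) b) = - (LINT x|lebesgue. g x * \<psi> x))"

definition W1_infinity :: "('a::euclidean_space \<Rightarrow> real) set" where
  "W1_infinity = {\<phi> \<in> L_infinity. \<forall>b\<in>Basis. \<exists>g\<in>L_infinity. has_weak_partial \<phi> b g}"

text \<open>The test space \<open>H\<close> for dimension \<open>N = DIM('a)\<close>. Elements of \<open>W\<^sup>1\<^sup>,\<^sup>\<infinity>\<close> are
  represented by their continuous representatives, so that the pointwise derivative of \<open>\<phi>\<close>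
  exists almost everywhere. Values of \<open>\<phi>\<close> on negative numbers are irrelevant.\<close>

definition radial_test_functions :: "'a::euclidean_space itself \<Rightarrow> (real \<Rightarrow> real) set" where
  "radial_test_functions _ =
     {\<phi>. continuous_on {0..} \<phi> \<and> (\<lambda>x::'a. \<phi> (norm x)) \<in> W1_infinity
        \<and> compact_support (\<lambda>x::'a. \<phi> (norm x))}"

definition theta :: "real \<Rightarrow> real \<Rightarrow> real \<Rightarrow> real" where
  "theta lam Lam t = (if t \<ge> 0 then Lam else lam)"

definition N_plus :: "real \<Rightarrow> real \<Rightarrow> nat \<Rightarrow> real" where
  "N_plus lam Lam N = lam / Lam * (real N - 1) + 1"

text \<open>In the next two definitions \<open>a\<close> and \<open>p\<close> stand for the values \<open>u(r)\<close> and \<open>u'(r)\<close>.\<close>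

definition Theta ::
    "real \<Rightarrow> real \<Rightarrow> nat \<Rightarrow> real \<Rightarrow> (real \<Rightarrow> real) \<Rightarrow> real \<Rightarrow> real \<Rightarrow> real \<Rightarrow> real" where
  "Theta lam Lam N s f r a p =
     theta lam Lam
       (- theta lam Lam p * (real N - 1) * (p / r) + \<bar>a\<bar> powr (s - 1) * a - f r)"

definition variable_dim ::
    "real \<Rightarrow> real \<Rightarrow> nat \<Rightarrow> real \<Rightarrow> (real \<Rightarrow> real) \<Rightarrow> real \<Rightarrow> real \<Rightarrow> real \<Rightarrow> real" where
  "variable_dim lam Lam N s f r a p =
     theta lam Lam p / Theta lam Lam N s f r a p * (real N - 1) + 1"

text \<open>The interval integral is oriented: for \<open>r < 1\<close> it is minus the integral over \<open>(r, 1)\<close>.\<close>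

definition rho ::
    "real \<Rightarrow> real \<Rightarrow> nat \<Rightarrow> real \<Rightarrow> (real \<Rightarrow> real) \<Rightarrow> (real \<Rightarrow> real) \<Rightarrow> real \<Rightarrow> real" where
  "rho lam Lam N s f u r =
     exp (interval_lebesgue_integral lebesgue (ereal 1) (ereal r)
            (\<lambda>t. (variable_dim lam Lam N s f t (u t) (deriv u t) - 1) / t))"

definition rho_tilde ::
    "real \<Rightarrow> real \<Rightarrow> nat \<Rightarrow> real \<Rightarrow> (real \<Rightarrow> real) \<Rightarrow> (real \<Rightarrow> real) \<Rightarrow> real \<Rightarrow> real" where
  "rho_tilde lam Lam N s f u r =
     rho lam Lam N s f u r / Theta lam Lam N s f r (u r) (deriv u r)"

text \<open>Weak solutions of \<open>-(\<rho>u')' + \<rho>~|u|\<^sup>s\<^sup>-\<^sup>1u = \<rho>~f\<close> with \<open>N = DIM('a)\<close>. Only the values of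
  \<open>u\<close> and \<open>f\<close> on \<open>(0, \<infinity>)\<close> matter.\<close>

definition weak_solution ::
    "'a::euclidean_space itself \<Rightarrow> real \<Rightarrow> real \<Rightarrow> real \<Rightarrow> (real \<Rightarrow> real) \<Rightarrow> (real \<Rightarrow> real) \<Rightarrow> bool" where
  "weak_solution T lam Lam s f u \<longleftrightarrow>
     (let \<rho> = rho lam Lam DIM('a) s f u; \<rho>t = rho_tilde lam Lam DIM('a) s f u in
       (\<forall>a b. 0 < a \<longrightarrow> a \<le> b \<longrightarrow> abs_cont_on_interval a b u) \<and>
       (\<forall>R>0. set_integrable lebesgue {0<..<R} (\<lambda>r. \<rho> r * \<bar>u r\<bar> powr s)) \<and>
       (\<forall>R>0. set_integrable lebesgue {0<..<R} (\<lambda>r. \<rho> r * \<bar>deriv u r\<bar>)) \<and>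
       (\<forall>\<phi>\<in>radial_test_functions T.
          (LINT r:{0<..}|lebesgue.
             \<rho> r * deriv u r * deriv \<phi> r + \<rho>t r * (\<bar>u r\<bar> powr (s - 1) * u r) * \<phi> r)
          = (LINT r:{0<..}|lebesgue. \<rho>t r * f r * \<phi> r)))"

end

theory Submission
  imports Defs "HOL-Complex_Analysis.Great_Picard" "HOL-Real_Asymp.Real_Asymp"
begin

text \<open>
  Outside the origin a radial solution is a Caratheodory solution of a second-order equation whose
  right-hand side is Lipschitz in the slope, and the difference of two solutions satisfies a linear
  differential inequality with bounded drift away from \<open>0\<close>, hence a maximum principle. Existence:
  solve on compact intervals exhausting \<open>(0, \<infinity>)\<close> with vanishing slope at the left end, bound the solutions locally by
  Keller-Osserman barriers (the superlinear absorption makes the bounds independent of boundary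
  data), and pass to the limit. The vanishing slope survives as a one-sided bound for the
  slope, which forces the flux \<open>\<rho> u'\<close> to vanish at \<open>0\<close> along a sequence; testing with bounded functions
  of \<open>u\<close> then yields all integrability statements. Uniqueness: a weak solution has flux \<open>\<rho> u' \<rightarrow> 0\<close>
  by testing with ramps, and for two solutions the function \<open>u - v - \<psi>\<close>, with \<open>\<psi>\<close> a barrier blowing
  up at a large radius, cannot be positive: with nonnegative slope it would stay positive up to that
  radius, and with negative slope the weighted slope would stay away from \<open>0\<close> near the origin.
\<close>

section \<open>Absolutely continuous functions\<close>

text \<open>Two facts shape the argument. The coefficient \<open>th\<close> jumps at 0, but
  \<open>th x * x\<close> is Lipschitz with a Lipschitz inverse \<open>K\<close>, so the equation
  can be solved for u''. Dividing by \<open>th u''\<close> gives u'' + c u' = (|u|^(s-1) u - f) / th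
  u'' with a drift c of order 1/t, and rho is exactly the integrating factor of c; this is the
  divergence form. Secondly, rho depends on the solution, so two solutions carry different weights.
  Their only common control comes from c >= \<open>kexp\<close> / t with \<open>kexp\<close> = N_+ -
  1: the quotient rho(t) / t^kexp is nondecreasing, hence rho <= t^kexp on (0, 1]. Here the
  integrability condition on f enters, and this bound lets the comparison argument replace the
  weight of u by a power of the radius. As u'' exists only almost everywhere, the calculus is done
  with \<open>primitive_on\<close>, which carries a function together with an integrable density;
  the epsilon-delta notion used for weak solutions is shown to be equivalent to having such a
  density.\<close>

definition primitive_on :: "real \<Rightarrow> real \<Rightarrow> (real \<Rightarrow> real) \<Rightarrow> (real \<Rightarrow> real) \<Rightarrow> bool" where
  "primitive_on a b u g \<longleftrightarrow>
     g absolutely_integrable_on {a..b} \<and> (\<forall>x\<in>{a..b}. integral {a..x} g = u x - u a)"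

lemma primitive_on_abs_integrable: "primitive_on a b u g \<Longrightarrow> g absolutely_integrable_on {a..b}"
  by (simp add: primitive_on_def)

lemma absolutely_integrable_on_subset_real:
  fixes g :: "real \<Rightarrow> real"
  assumes "g absolutely_integrable_on {a..b}" "{x..y} \<subseteq> {a..b}"
  shows "g absolutely_integrable_on {x..y}"
  by (rule set_integrable_subset[OF assms(1) _ assms(2)]) simp

lemma primitive_on_diff:
  assumes "primitive_on a b u g" "a \<le> x" "x \<le> y" "y \<le> b"
  shows "integral {x..y} g = u y - u x"
proof -
  have "g integrable_on {a..y}"
    using absolutely_integrable_on_subset_real[of a b g a y] assms
    by (auto simp: primitive_on_def set_lebesgue_integral_eq_integral)
  then have "integral {a..x} g + integral {x..y} g = integral {a..y} g"
    using Henstock_Kurzweil_Integration.integral_combine[of a x y g] assms by auto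
  then show ?thesis
    using assms unfolding primitive_on_def by auto
qed

lemma primitive_on_subinterval:
  assumes "primitive_on a b u g" "a \<le> x" "y \<le> b"
  shows "primitive_on x y u g"
  unfolding primitive_on_def
proof (intro conjI ballI)
  show "g absolutely_integrable_on {x..y}"
    using absolutely_integrable_on_subset_real[of a b g x y] assms by (auto simp: primitive_on_def)
  fix t assume "t \<in> {x..y}"
  then show "integral {x..t} g = u t - u x"
    using primitive_on_diff[OF assms(1), of x t] assms by auto
qed

lemma primitive_on_continuous:
  assumes "primitive_on a b u g"
  shows "continuous_on {a..b} u"
proof -
  have "g integrable_on {a..b}"
    using assms by (auto simp: primitive_on_def set_lebesgue_integral_eq_integral)
  then have "continuous_on {a..b} (\<lambda>x. u a + integral {a..x} g)"
    by (intro continuous_intros indefinite_integral_continuous_1)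
  then show ?thesis
    by (rule continuous_on_eq) (use assms in \<open>auto simp: primitive_on_def\<close>)
qed

lemma primitive_on_combine:
  assumes "primitive_on a b u g" "primitive_on b c u g" "a \<le> b" "b \<le> c"
  shows "primitive_on a c u g"
  unfolding primitive_on_def
proof (intro conjI ballI)
  have "g absolutely_integrable_on ({a..b} \<union> {b..c})"
    using assms by (intro absolutely_integrable_Un) (auto simp: primitive_on_def)
  then show I: "g absolutely_integrable_on {a..c}"
    using assms by (simp add: ivl_disj_un_two_touch)
  fix x assume x: "x \<in> {a..c}"
  show "integral {a..x} g = u x - u a"
  proof (cases "x \<le> b")
    case True
    then show ?thesis using assms(1) x by (auto simp: primitive_on_def)
  next
    case False
    have "g integrable_on {a..x}"
      using absolutely_integrable_on_subset_real[OF I, of a x] x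
      by (auto simp: set_lebesgue_integral_eq_integral)
    then have "integral {a..b} g + integral {b..x} g = integral {a..x} g"
      using Henstock_Kurzweil_Integration.integral_combine[of a b x g] assms False by auto
    then show ?thesis
      using primitive_on_diff[OF assms(1), of a b] primitive_on_diff[OF assms(2), of b x] assms x False
      by auto
  qed
qed

lemma primitive_on_spike:
  assumes "primitive_on a b u g" "negligible N" "\<And>x. x \<in> {a..b} - N \<Longrightarrow> h x = g x"
  shows "primitive_on a b u h"
  unfolding primitive_on_def
proof (intro conjI ballI)
  show "h absolutely_integrable_on {a..b}"
    by (rule absolutely_integrable_spike[OF primitive_on_abs_integrable[OF assms(1)] assms(2,3)])
  fix x assume "x \<in> {a..b}"
  moreover have "integral {a..x} h = integral {a..x} g"
    by (rule integral_spike[OF assms(2)]) (use assms(3) \<open>x \<in> {a..b}\<close> in auto)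
  ultimately show "integral {a..x} h = u x - u a"
    using assms(1) by (auto simp: primitive_on_def)
qed

text \<open>Averages over cubes with lower corner x control only the right difference quotient, so
  the differentiation theorem is applied both to the density and to its reflection. The exceptional
  set is one null set together with the mirror image of another.\<close>

lemma primitive_on_has_real_derivative:
  assumes P: "primitive_on a b u g"
  obtains N where "negligible N" "\<And>x. x \<in> {a<..<b} - N \<Longrightarrow> (u has_real_derivative g x) (at x)"
proof -
  \<comment> \<open>Extension by zero makes the density integrable on every interval of the line,
    also after reflection.\<close>
  define G where "G = (\<lambda>t. if t \<in> {a..b} then g t else 0)"
  have gi: "g integrable_on {a..b}"
    using P by (auto simp: primitive_on_def set_lebesgue_integral_eq_integral)
  then have "G integrable_on UNIV"
    unfolding G_def using integrable_restrict_UNIV by blast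
  then have G1: "G integrable_on cbox c d" for c d
    using integrable_on_subcbox by blast
  then have G2: "(\<lambda>t. G (- t)) integrable_on cbox c d" for c d
    using Henstock_Kurzweil_Integration.integrable_reflect_real[of G "-c" "-d"] by simp
  obtain N1 where N1: "negligible N1" "\<And>x e. \<lbrakk>x \<notin> N1; 0 < e\<rbrakk> \<Longrightarrow>
      \<exists>d>0. \<forall>h. 0 < h \<and> h < d \<longrightarrow> norm(integral (cbox x (x + h *\<^sub>R One)) G /\<^sub>R h ^ DIM(real) - G x) < e"
    using integrable_ccontinuous_explicit[OF G1] by blast
  obtain N2 where N2: "negligible N2" "\<And>x e. \<lbrakk>x \<notin> N2; 0 < e\<rbrakk> \<Longrightarrow>
      \<exists>d>0. \<forall>h. 0 < h \<and> h < d \<longrightarrow>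
        norm(integral (cbox x (x + h *\<^sub>R One)) (\<lambda>t. G (- t)) /\<^sub>R h ^ DIM(real) - G (- x)) < e"
    using integrable_ccontinuous_explicit[OF G2] by blast
  have "negligible (uminus ` N2)"
    using N2(1) by (intro negligible_differentiable_image_negligible) (auto intro!: derivative_intros simp: differentiable_on_minus)
  then have N: "negligible (N1 \<union> uminus ` N2)"
    using N1(1) by auto
  have Gu: "integral {x..y} G = u y - u x" if "a \<le> x" "x \<le> y" "y \<le> b" for x y
  proof -
    have "integral {x..y} G = integral {x..y} g"
      using that by (intro integral_cong) (auto simp: G_def)
    then show ?thesis using primitive_on_diff[OF P] that by simp
  qed
  show thesis
  proof (rule that[OF N])
    fix x assume x: "x \<in> {a<..<b} - (N1 \<union> uminus ` N2)"
    then have "x \<notin> N1" and xab: "a < x" "x < b" by auto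
    have "- x \<notin> N2" using x by (metis DiffE UnI2 image_eqI minus_minus)
    have Gx: "G x = g x" using x by (auto simp: G_def)
    show "(u has_real_derivative g x) (at x)"
      unfolding DERIV_def
    proof (rule LIM_I)
      fix e :: real assume "0 < e"
      have sc: "integral (cbox y (y + h *\<^sub>R One)) k /\<^sub>R h ^ DIM(real) = integral {y..y + h} k / h"
        for h y :: real and k :: "real \<Rightarrow> real"
        by (simp add: divide_inverse)
      obtain d1 where d1: "d1 > 0" "\<And>h. 0 < h \<and> h < d1 \<Longrightarrow> \<bar>integral {x..x + h} G / h - g x\<bar> < e"
        using N1(2)[OF \<open>x \<notin> N1\<close> \<open>0 < e\<close>] unfolding sc Gx real_norm_def by blast
      obtain d2 where d2: "d2 > 0"
        "\<And>h. 0 < h \<and> h < d2 \<Longrightarrow> \<bar>integral {- x..- x + h} (\<lambda>t. G (- t)) / h - g x\<bar> < e"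
        using N2(2)[OF \<open>- x \<notin> N2\<close> \<open>0 < e\<close>] unfolding sc Gx real_norm_def minus_minus by blast
      define d where "d = min (min d1 d2) (min (b - x) (x - a))"
      have "d > 0" using d1 d2 xab by (auto simp: d_def)
      moreover have "norm ((u (x + h) - u x) / h - g x) < e" if h: "h \<noteq> 0 \<and> norm (h - 0) < d" for h
      proof (cases "h > 0")
        case True
        then have "integral {x..x + h} G = u (x + h) - u x"
          using h xab by (intro Gu) (auto simp: d_def)
        then show ?thesis using d1(2)[of h] True h by (auto simp: d_def)
      next
        case False
        have "integral {- x..- x + (- h)} (\<lambda>t. G (- t)) = integral {x + h..x} G"
          using Henstock_Kurzweil_Integration.integral_reflect_real[of x "x + h" G] by simp
        also have "\<dots> = u x - u (x + h)"
          using h False xab by (intro Gu) (auto simp: d_def)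
        finally have "integral {- x..- x + (- h)} (\<lambda>t. G (- t)) / (- h) = (u (x + h) - u x) / h"
          by (simp add: divide_simps)
        then show ?thesis using d2(2)[of "- h"] False h by (auto simp: d_def)
      qed
      ultimately show "\<exists>r>0. \<forall>h. h \<noteq> 0 \<and> norm (h - 0) < r \<longrightarrow> norm ((u (x + h) - u x) / h - g x) < e"
        by blast
    qed
  qed
qed

section \<open>From the epsilon-delta condition to an integrable density\<close>

lemma division_of_real_interval:
  fixes S :: "real set"
  assumes "d division_of S" "k \<in> d"
  obtains x y where "x \<le> y" "k = {x..y}" "Inf k = x" "Sup k = y"
proof -
  obtain x y where "k = cbox x y" "k \<noteq> {}"
    using division_ofD(3,4)[OF assms] by blast
  then show thesis
    by (intro that[of x y]) (auto simp: cInf_atLeastAtMost cSup_atLeastAtMost)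
qed

lemma division_sum_lengths:
  fixes S :: "real set"
  assumes "d division_of S"
  shows "(\<Sum>k\<in>d. Sup k - Inf k) = sum (measure lborel) d"
proof (intro sum.cong refl)
  fix k assume "k \<in> d"
  then obtain x y where "x \<le> y" "k = {x..y}" "Inf k = x" "Sup k = y"
    using division_of_real_interval[OF assms] by blast
  then show "Sup k - Inf k = measure lborel k" by simp
qed

lemma abs_cont_on_interval_sub:
  assumes "abs_cont_on_interval a b u" "a \<le> x" "y \<le> b"
  shows "abs_cont_on_interval x y u"
proof -
  have "{x..y} \<subseteq> {a..b}" using assms by auto
  then show ?thesis
    using assms(1) unfolding abs_cont_on_interval_def by (meson order_trans)
qed

lemma abs_cont_on_interval_two_points:
  assumes "abs_cont_on_interval a b u" "e > 0"
  obtains \<delta> where "\<delta> > 0"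
    "\<And>x y. x \<in> {a..b} \<Longrightarrow> y \<in> {a..b} \<Longrightarrow> \<bar>x - y\<bar> < \<delta> \<Longrightarrow> \<bar>u x - u y\<bar> < e"
proof -
  obtain \<delta> where \<delta>: "\<delta> > 0" "\<And>d. d division_of \<Union>d \<Longrightarrow> \<Union>d \<subseteq> {a..b} \<Longrightarrow>
      (\<Sum>k\<in>d. Sup k - Inf k) < \<delta> \<Longrightarrow> (\<Sum>k\<in>d. \<bar>u (Sup k) - u (Inf k)\<bar>) < e"
    using assms unfolding abs_cont_on_interval_def by meson
  have *: "\<bar>u y - u x\<bar> < e" if "x \<in> {a..b}" "y \<in> {a..b}" "x \<le> y" "y - x < \<delta>" for x y
  proof -
    have "{{x..y}} division_of \<Union>{{x..y}}"
      using division_of_self[of x y] that by simp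
    from \<delta>(2)[OF this] that show ?thesis
      by (auto simp: cInf_atLeastAtMost cSup_atLeastAtMost)
  qed
  show thesis
  proof (rule that[OF \<delta>(1)])
    fix x y assume "x \<in> {a..b}" "y \<in> {a..b}" "\<bar>x - y\<bar> < \<delta>"
    then show "\<bar>u x - u y\<bar> < e"
      using *[of x y] *[of y x] by (cases "x \<le> y") (auto simp: abs_minus_commute)
  qed
qed

lemma abs_cont_on_interval_continuous:
  assumes "abs_cont_on_interval a b u"
  shows "continuous_on {a..b} u"
  unfolding continuous_on_iff dist_real_def
proof (intro ballI allI impI)
  fix x e :: real assume "x \<in> {a..b}" "0 < e"
  with abs_cont_on_interval_two_points[OF assms \<open>0 < e\<close>]
  show "\<exists>d>0. \<forall>x'\<in>{a..b}. \<bar>x' - x\<bar> < d \<longrightarrow> \<bar>u x' - u x\<bar> < e"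
    by (smt (verit, best))
qed

text \<open>Cutting |g| at height n leaves the excess \<open>h n\<close>, whose integral tends to 0
  by dominated convergence. On intervals of total length below \<delta> the excess contributes less
  than e / 2 and the bounded part at most n * \<delta> <= e / 2.\<close>

lemma primitive_on_imp_abs_cont:
  assumes P: "primitive_on a b u g"
  shows "abs_cont_on_interval a b u"
  unfolding abs_cont_on_interval_def
proof (intro allI impI)
  fix e :: real assume "e > 0"
  have ga: "g absolutely_integrable_on {a..b}" using P by (rule primitive_on_abs_integrable)
  then have gn: "(\<lambda>x. \<bar>g x\<bar>) absolutely_integrable_on {a..b}"
    by (rule set_integrable_abs)
  define h where "h = (\<lambda>(n::nat) x. max (\<bar>g x\<bar> - n) 0)"
  have h: "h n absolutely_integrable_on {a..b}" for n
    unfolding h_def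
    by (intro absolutely_integrable_max_1 set_integral_diff(1) gn absolutely_integrable_on_const) auto
  have lim: "(\<lambda>n. integral {a..b} (h n)) \<longlonglongrightarrow> integral {a..b} (\<lambda>x. 0)"
  proof (rule dominated_convergence(2))
    show "h n integrable_on {a..b}" for n
      using h by (simp add: set_lebesgue_integral_eq_integral)
    show "(\<lambda>x. \<bar>g x\<bar>) integrable_on {a..b}"
      using gn by (simp add: set_lebesgue_integral_eq_integral)
    show "norm (h n x) \<le> \<bar>g x\<bar>" for n x
      by (simp add: h_def)
    show "(\<lambda>n. h n x) \<longlonglongrightarrow> 0" for x
    proof (rule tendsto_eventually)
      obtain N where "\<bar>g x\<bar> \<le> real N" using real_arch_simple by blast
      then show "\<forall>\<^sub>F n in sequentially. h n x = 0"
        unfolding h_def eventually_sequentially by (intro exI[of _ N]) auto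
    qed
  qed
  then obtain n where n: "integral {a..b} (h n) < e / 2"
    using \<open>e > 0\<close> order_tendstoD(2)[OF lim, of "e/2"] by (auto simp: eventually_sequentially)
  define \<delta> where "\<delta> = e / (2 * (real n + 1))"
  have "\<delta> > 0" using \<open>e > 0\<close> by (simp add: \<delta>_def)
  moreover have "(\<Sum>k\<in>d. \<bar>u (Sup k) - u (Inf k)\<bar>) < e"
    if d: "d division_of \<Union>d" "\<Union>d \<subseteq> {a..b}" and len: "(\<Sum>k\<in>d. Sup k - Inf k) < \<delta>" for d
  proof -
    have "\<bar>u (Sup k) - u (Inf k)\<bar> \<le> integral k (h n) + real n * (Sup k - Inf k)" if k: "k \<in> d" for k
    proof -
      obtain x y where xy: "x \<le> y" "k = {x..y}" "Inf k = x" "Sup k = y"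
        using division_of_real_interval[OF d(1) k] by blast
      have sub: "{x..y} \<subseteq> {a..b}" using order.trans[OF Union_upper[OF k] d(2)] xy(2) by simp
      with xy(1) have ab: "a \<le> x" "y \<le> b" by auto
      have gi: "g absolutely_integrable_on {x..y}" "h n absolutely_integrable_on {x..y}"
        using absolutely_integrable_on_subset_real[OF _ sub] ga h by auto
      have "\<bar>u y - u x\<bar> = \<bar>integral {x..y} g\<bar>"
        using primitive_on_diff[OF P ab(1) xy(1) ab(2)] by simp
      also have "\<dots> \<le> integral {x..y} (\<lambda>t. h n t + real n)"
      proof -
        have "norm (integral {x..y} g) \<le> integral {x..y} (\<lambda>t. h n t + real n)"
          by (rule integral_norm_bound_integral)
            (use gi in \<open>auto intro!: integrable_add simp: set_lebesgue_integral_eq_integral h_def\<close>)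
        then show ?thesis by simp
      qed
      also have "\<dots> = integral {x..y} (h n) + real n * (y - x)"
        using gi xy by (subst Henstock_Kurzweil_Integration.integral_add)
          (auto simp: set_lebesgue_integral_eq_integral)
      finally show ?thesis using xy by simp
    qed
    then have "(\<Sum>k\<in>d. \<bar>u (Sup k) - u (Inf k)\<bar>) \<le> (\<Sum>k\<in>d. integral k (h n) + real n * (Sup k - Inf k))"
      by (rule sum_mono)
    also have "\<dots> = (\<Sum>k\<in>d. integral k (h n)) + real n * (\<Sum>k\<in>d. Sup k - Inf k)"
      by (simp add: sum.distrib sum_distrib_left)
    also have "(\<Sum>k\<in>d. integral k (h n)) = integral (\<Union>d) (h n)"
    proof -
      have "h n integrable_on \<Union>d"
      proof (rule integrable_on_subdivision[OF d(1)])
        show "h n integrable_on {a..b}"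
          using h by (simp add: set_lebesgue_integral_eq_integral)
      qed (use d in auto)
      then show ?thesis
        using integral_combine_division_topdown[OF _ d(1)] by metis
    qed
    also have "\<dots> \<le> integral {a..b} (h n)"
    proof (rule integral_subset_le[OF d(2)])
      show "h n integrable_on \<Union>d"
      proof (rule integrable_on_subdivision[OF d(1)])
        show "h n integrable_on {a..b}"
          using h by (simp add: set_lebesgue_integral_eq_integral)
      qed (use d in auto)
      show "h n integrable_on {a..b}"
        using h by (simp add: set_lebesgue_integral_eq_integral)
    qed (auto simp: h_def)
    finally have "(\<Sum>k\<in>d. \<bar>u (Sup k) - u (Inf k)\<bar>) < e / 2 + real n * (\<Sum>k\<in>d. Sup k - Inf k)"
      using n by linarith
    also have "real n * (\<Sum>k\<in>d. Sup k - Inf k) \<le> real n * \<delta>"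
      using len by (intro mult_left_mono) auto
    also have "real n * \<delta> \<le> e / 2"
      using \<open>e > 0\<close> by (simp add: \<delta>_def field_simps)
    finally show ?thesis by simp
  qed
  ultimately show "\<exists>\<delta>>0. \<forall>d. d division_of \<Union>d \<and> \<Union>d \<subseteq> {a..b} \<and> (\<Sum>k\<in>d. Sup k - Inf k) < \<delta>
        \<longrightarrow> (\<Sum>k\<in>d. \<bar>u (Sup k) - u (Inf k)\<bar>) < e"
    by blast
qed

text \<open>The Stieltjes measure of F is absolutely continuous with respect to Lebesgue measure,
  and its Radon-Nikodym density is the required g. Inner regularity reduces a Borel null set to its
  compact subsets K. A finite cover of K inside a thin open set is refined to non-overlapping
  intervals, because the definition of absolute continuity controls only such families.\<close>

lemma mono_abs_cont_primitive:
  fixes F :: "real \<Rightarrow> real"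
  assumes "a \<le> b" and mono: "\<And>x y. a \<le> x \<Longrightarrow> x \<le> y \<Longrightarrow> y \<le> b \<Longrightarrow> F x \<le> F y"
    and ac: "abs_cont_on_interval a b F"
  shows "\<exists>g. primitive_on a b F g"
proof -
  \<comment> \<open>Freezing F outside [a, b] gives a distribution function on the whole line whose
    measure has no mass outside [a, b].\<close>
  define G where "G = (\<lambda>x. F (max a (min x b)))"
  have mG: "G x \<le> G y" if "x \<le> y" for x y
    unfolding G_def using that assms(1) by (intro mono) auto
  have cG: "continuous_on UNIV G"
    unfolding G_def
    by (rule continuous_on_compose2[OF abs_cont_on_interval_continuous[OF ac]])
      (use assms(1) in \<open>auto intro!: continuous_intros\<close>)
  define M where "M = interval_measure G"
  have Icc: "emeasure M {x..y} = ennreal (G y - G x)" if "x \<le> y" for x y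
    unfolding M_def by (rule emeasure_interval_measure_Icc[OF that mG cG])
  have setsM: "sets M = sets borel" by (simp add: M_def)
  have fin: "emeasure M UNIV \<le> ennreal (F b - F a)"
  proof -
    have "(\<lambda>n::nat. emeasure M {- real n..real n}) \<longlonglongrightarrow> emeasure M (\<Union>n. {- real n..real n})"
      by (rule Lim_emeasure_incseq) (auto simp: setsM incseq_def)
    moreover have "(\<Union>n::nat. {- real n..real n}) = UNIV"
    proof (intro set_eqI iffI UNIV_I)
      fix x :: real
      obtain n where "\<bar>x\<bar> \<le> real n" using real_arch_simple by blast
      then show "x \<in> (\<Union>n::nat. {- real n..real n})" by (auto intro!: exI[of _ n])
    qed
    moreover have "emeasure M {- real n..real n} \<le> ennreal (F b - F a)" for n
    proof -
      have "G (real n) - G (- real n) \<le> F b - F a"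
        unfolding G_def using assms(1) mono[of "max a (min (real n) b)" b]
          mono[of a "max a (min (- real n) b)"] by auto
      then show ?thesis by (subst Icc) (auto intro: ennreal_leI)
    qed
    ultimately show ?thesis by (intro LIMSEQ_le_const2[of "\<lambda>n. emeasure M {- real n..real n}"]) auto
  qed
  then have finM: "emeasure M (space M) \<noteq> \<infinity>"
    by (auto simp: M_def top_unique)
  have "absolutely_continuous lborel M"
    unfolding absolutely_continuous_def
  proof
    fix A assume A: "A \<in> null_sets (lborel::real measure)"
    then have "A \<in> sets borel" by auto
    have "emeasure M A \<le> 0"
    proof (rule ennreal_le_epsilon)
      fix e :: real assume "0 < e"
      obtain \<delta> where \<delta>: "\<delta> > 0" "\<And>d. d division_of \<Union>d \<Longrightarrow> \<Union>d \<subseteq> {a..b} \<Longrightarrow>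
          (\<Sum>k\<in>d. Sup k - Inf k) < \<delta> \<Longrightarrow> (\<Sum>k\<in>d. \<bar>F (Sup k) - F (Inf k)\<bar>) < e"
        using ac \<open>0 < e\<close> unfolding abs_cont_on_interval_def by meson
      have "emeasure M K \<le> ennreal e" if K: "K \<subseteq> A" "compact K" for K
      proof -
        have "A \<in> sets lebesgue" using A by auto
        then obtain U where U: "open U" "A \<subseteq> U" "U - A \<in> lmeasurable" "emeasure lebesgue (U - A) < ennreal \<delta>"
          using sets_lebesgue_outer_open \<delta>(1) by metis
        have An: "A \<in> null_sets lebesgue" using A by (rule null_sets_completionI)
        have "emeasure lebesgue U \<le> emeasure lebesgue (U - A \<union> A)"
          using U An by (intro emeasure_mono) auto
        also have "\<dots> \<le> emeasure lebesgue (U - A) + emeasure lebesgue A"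
          using U An by (intro emeasure_subadditive) auto
        finally have U\<delta>: "emeasure lebesgue U < ennreal \<delta>"
          using U(4) An by (auto simp: null_sets_def)
        have "\<forall>x\<in>U. \<exists>c d. cbox c d \<subseteq> U \<and> x \<in> box c d"
          using open_contains_cbox[OF U(1)] by metis
        then obtain c d where cd: "\<And>x. x \<in> U \<Longrightarrow> cbox (c x) (d x) \<subseteq> U \<and> x \<in> box (c x) (d x)"
          by metis
        have cov: "K \<subseteq> (\<Union>x\<in>K. box (c x) (d x))"
          using cd K(1) U(2) by blast
        obtain T where T: "T \<subseteq> K" "finite T" "K \<subseteq> (\<Union>x\<in>T. box (c x) (d x))"
          by (rule compactE_image[OF K(2) _ cov]) auto
        obtain p where p: "p division_of (\<Union>((\<lambda>x. cbox (c x) (d x) \<inter> cbox a b) ` T))"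
          by (rule elementary_unions_intervals[of "(\<lambda>x. cbox (c x) (d x) \<inter> cbox a b) ` T"])
            (use T(2) in \<open>auto simp: Int_interval\<close>)
        have Up: "\<Union>p = (\<Union>((\<lambda>x. cbox (c x) (d x) \<inter> cbox a b) ` T))"
          using division_ofD(6)[OF p] .
        have pU: "\<Union>p \<subseteq> U" "\<Union>p \<subseteq> {a..b}"
          unfolding Up using cd T(1) K(1) U(2) by (blast, simp add: SUP_le_iff)
        have finp: "finite p" using p by auto
        have pB: "k \<in> sets borel" if "k \<in> p" for k
          using division_ofD(4)[OF p that] by auto
        have UpB: "\<Union>p \<in> sets borel" using finp pB by (intro sets.finite_Union) auto
        have p': "p division_of \<Union>p" using p by auto
        have pm: "k \<in> p \<Longrightarrow> k \<in> lmeasurable" for k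
          using division_ofD(4)[OF p] lmeasurable_cbox by metis
        have "sum (measure lborel) p = measure lebesgue (\<Union>p)"
          using content_division[OF p'] pB by (metis (no_types, lifting) measure_completion sets_lborel sum.cong)
        also have "\<dots> < \<delta>"
        proof -
          have "emeasure lebesgue (\<Union>p) \<le> emeasure lebesgue U"
            using pU U by (intro emeasure_mono) auto
          then have "emeasure lebesgue (\<Union>p) < ennreal \<delta>"
            using U\<delta> by simp
          moreover have "\<Union>p \<in> lmeasurable" using pm finp by (intro fmeasurable.finite_Union) auto
          ultimately show ?thesis
            by (simp add: emeasure_eq_measure2 ennreal_less_iff)
        qed
        finally have "(\<Sum>k\<in>p. Sup k - Inf k) < \<delta>"
          by (simp add: division_sum_lengths[OF p'])
        from \<delta>(2)[OF p' pU(2) this] have sumF: "(\<Sum>k\<in>p. \<bar>F (Sup k) - F (Inf k)\<bar>) < e" .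
        have Mp: "emeasure M k = ennreal \<bar>F (Sup k) - F (Inf k)\<bar>" if k: "k \<in> p" for k
        proof -
          obtain x y where xy: "x \<le> y" "k = {x..y}" "Inf k = x" "Sup k = y"
            using division_of_real_interval[OF p' k] by blast
          have "{x..y} \<subseteq> {a..b}" using order.trans[OF Union_upper[OF k] pU(2)] xy(2) by simp
          then have "a \<le> x" "y \<le> b" using xy(1) by auto
          then have "G y = F y" "G x = F x" "F x \<le> F y"
            using xy mono[of x y] by (auto simp: G_def)
          then show ?thesis using Icc[of x y] xy by simp
        qed
        have "emeasure M K \<le> emeasure M ((\<Union>p) \<union> ({..<a} \<union> {b<..}))"
        proof (rule emeasure_mono)
          show "K \<subseteq> (\<Union>p) \<union> ({..<a} \<union> {b<..})"
          proof
            fix x assume "x \<in> K"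
            then obtain t where "t \<in> T" "x \<in> box (c t) (d t)" using T by auto
            then show "x \<in> (\<Union>p) \<union> ({..<a} \<union> {b<..})"
              unfolding Up using box_subset_cbox by fastforce
          qed
          from UpB show "(\<Union>p) \<union> ({..<a} \<union> {b<..}) \<in> sets M"
            by (simp add: setsM)
        qed
        also have "\<dots> \<le> emeasure M (\<Union>p) + emeasure M ({..<a} \<union> {b<..})"
          using UpB by (intro emeasure_subadditive) (auto simp: setsM)
        also have "emeasure M ({..<a} \<union> {b<..}) = 0"
        proof -
          have "{..<a} = (\<Union>n::nat. {a - real n..a} - {a})"
          proof (intro set_eqI iffI)
            fix x assume "x \<in> {..<a}"
            moreover obtain n where "a - x \<le> real n" using real_arch_simple by blast
            ultimately show "x \<in> (\<Union>n::nat. {a - real n..a} - {a})" by (auto intro!: exI[of _ n])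
          qed auto
          moreover have "{a - real n..a} \<in> null_sets M" for n
            using Icc[of "a - real n" a] assms(1) by (auto simp: null_sets_def setsM G_def)
          moreover have "{b<..} = (\<Union>n::nat. {b..b + real n} - {b})"
          proof (intro set_eqI iffI)
            fix x assume "x \<in> {b<..}"
            moreover obtain n where "x - b \<le> real n" using real_arch_simple by blast
            ultimately show "x \<in> (\<Union>n::nat. {b..b + real n} - {b})" by (auto intro!: exI[of _ n])
          qed auto
          moreover have "{b..b + real n} \<in> null_sets M" for n
            using Icc[of b "b + real n"] assms(1) by (auto simp: null_sets_def setsM G_def)
          ultimately have "{..<a} \<in> null_sets M" "{b<..} \<in> null_sets M"
            by (auto intro!: null_sets_UN null_set_Diff simp: setsM)
          then show ?thesis by (metis null_sets.Un null_setsD1)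
        qed
        also have "emeasure M (\<Union>p) \<le> (\<Sum>k\<in>p. emeasure M k)"
        proof -
          have "emeasure M (\<Union>k\<in>p. k) \<le> (\<Sum>k\<in>p. emeasure M k)"
            using finp pB by (intro emeasure_subadditive_finite) (auto simp: setsM)
          then show ?thesis by simp
        qed
        also have "(\<Sum>k\<in>p. emeasure M k) = ennreal (\<Sum>k\<in>p. \<bar>F (Sup k) - F (Inf k)\<bar>)"
          by (simp add: Mp sum_ennreal)
        finally show ?thesis using sumF by (simp add: order_trans ennreal_leI)
      qed
      then have "(SUP K \<in> {K. K \<subseteq> A \<and> compact K}. emeasure M K) \<le> ennreal e"
        by (intro SUP_least) auto
      then show "emeasure M A \<le> 0 + ennreal e"
        using inner_regular[OF setsM finM \<open>A \<in> sets borel\<close>] by simp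
    qed
    then show "A \<in> null_sets M" using \<open>A \<in> sets borel\<close> by (auto simp: setsM null_sets_def)
  qed
  moreover have "sets M = sets lborel" by (simp add: setsM)
  moreover have fM: "finite_measure M" using finM by (intro finite_measureI)
  ultimately obtain D where D: "D \<in> borel_measurable lborel"
      "AE x in lborel. RN_deriv lborel M x = ennreal (D x)" "\<And>x. 0 \<le> D x"
    using sigma_finite_measure.real_RN_deriv[OF sigma_finite_lborel] by metis
  have dens: "density lborel (\<lambda>x. ennreal (D x)) = M"
  proof -
    have "density lborel (\<lambda>x. ennreal (D x)) = density lborel (RN_deriv lborel M)"
      using D by (intro density_cong) auto
    also have "\<dots> = M"
      using \<open>absolutely_continuous lborel M\<close> \<open>sets M = sets lborel\<close> by (rule sigma_finite_measure.density_RN_deriv[OF sigma_finite_lborel])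
    finally show ?thesis .
  qed
  have hi: "(D has_integral F y - F x) {x..y}" if "a \<le> x" "x \<le> y" "y \<le> b" for x y
  proof -
    have "G y = F y" "G x = F x" "F x \<le> F y"
      using that mono[of x y] by (auto simp: G_def)
    then have "ennreal (F y - F x) = emeasure (density lborel (\<lambda>x. ennreal (D x))) {x..y}"
      using Icc[of x y] that dens by simp
    also have "\<dots> = (\<integral>\<^sup>+t. ennreal (D t) * indicator {x..y} t \<partial>lborel)"
      using D by (subst emeasure_density) auto
    also have "\<dots> = (\<integral>\<^sup>+t. ennreal (D t * indicator {x..y} t) \<partial>lborel)"
      by (intro nn_integral_cong) (auto simp: indicator_def)
    finally have "((\<lambda>t. D t * indicator {x..y} t) has_integral (F y - F x)) UNIV"
      using D \<open>F x \<le> F y\<close> by (intro nn_integral_has_integral) auto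
    moreover have "(\<lambda>t. D t * indicator {x..y} t) = (\<lambda>t. if t \<in> {x..y} then D t else 0)"
      by (auto simp: indicator_def)
    ultimately show ?thesis by (simp only: has_integral_restrict_UNIV)
  qed
  have "primitive_on a b F D"
    unfolding primitive_on_def
  proof (intro conjI ballI)
    show "D absolutely_integrable_on {a..b}"
      using hi[of a b] assms(1) D(3) by (intro nonnegative_absolutely_integrable_1) auto
    show "integral {a..x} D = F x - F a" if "x \<in> {a..b}" for x
      using hi[of a x] that by (auto intro: integral_unique)
  qed
  then show ?thesis by blast
qed

text \<open>Pieces of length zero are dropped. The remaining restricted intervals have nonempty
  interior, so distinct members of d have distinct restrictions and the sum can be
  reindexed.\<close>

lemma division_restrict_interval:
  fixes d :: "real set set" and u :: "real \<Rightarrow> real"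
  assumes d: "d division_of \<Union>d"
  shows "\<exists>d'. d' division_of \<Union>d' \<and> \<Union>d' \<subseteq> {p..q} \<and> (\<forall>k\<in>d'. Inf k < Sup k) \<and>
    (\<Sum>k\<in>d'. \<bar>u (Sup k) - u (Inf k)\<bar>) =
    (\<Sum>k\<in>d. if max (Inf k) p < min (Sup k) q then \<bar>u (min (Sup k) q) - u (max (Inf k) p)\<bar> else 0)"
proof -
  define E where "E = {k\<in>d. max (Inf k) p < min (Sup k) q}"
  define r where "r = (\<lambda>k::real set. {max (Inf k) p..min (Sup k) q})"
  have fin: "finite d" using d by auto
  have rk: "r k \<subseteq> k" "r k \<subseteq> {p..q}" "r k \<noteq> {}" "interior (r k) \<noteq> {}"
      "Inf (r k) = max (Inf k) p" "Sup (r k) = min (Sup k) q" if "k \<in> E" for k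
  proof -
    have "k \<in> d" using that by (simp add: E_def)
    then obtain x y where "x \<le> y" "k = {x..y}" "Inf k = x" "Sup k = y"
      using division_of_real_interval[OF d] by blast
    with that show "r k \<subseteq> k" "r k \<subseteq> {p..q}" "r k \<noteq> {}" "interior (r k) \<noteq> {}"
      "Inf (r k) = max (Inf k) p" "Sup (r k) = min (Sup k) q"
      by (auto simp: r_def E_def interior_atLeastAtMost_real)
  qed
  have dis: "interior (r k) \<inter> interior (r l) = {}" if "k \<in> E" "l \<in> E" "k \<noteq> l" for k l
  proof -
    have "interior k \<inter> interior l = {}"
      using division_ofD(5)[OF d, of k l] that by (auto simp: E_def)
    then show ?thesis using interior_mono[OF rk(1)[OF that(1)]] interior_mono[OF rk(1)[OF that(2)]] by blast
  qed
  have inj: "inj_on r E"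
  proof (rule inj_onI)
    fix k l assume kl: "k \<in> E" "l \<in> E" "r k = r l"
    show "k = l"
    proof (rule ccontr)
      assume "k \<noteq> l"
      then show False using dis[OF kl(1,2)] kl rk(4)[OF kl(1)] by auto
    qed
  qed
  show ?thesis
  proof (intro exI[of _ "r ` E"] conjI ballI)
    show "r ` E division_of \<Union> (r ` E)"
    proof (rule division_ofI)
      show "finite (r ` E)" using fin by (simp add: E_def)
      fix K assume "K \<in> r ` E"
      then show "K \<noteq> {}" "\<exists>a b. K = cbox a b" "K \<subseteq> \<Union> (r ` E)"
        using rk(3) by (auto simp: r_def)
      fix L assume "L \<in> r ` E" "K \<noteq> L"
      then show "interior K \<inter> interior L = {}"
        using \<open>K \<in> r ` E\<close> dis by auto
    qed auto
    show "\<Union> (r ` E) \<subseteq> {p..q}" using rk(2) by auto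
    show "Inf k < Sup k" if "k \<in> r ` E" for k
      using that rk(5,6) by (auto simp: E_def)
    have "(\<Sum>k\<in>r ` E. \<bar>u (Sup k) - u (Inf k)\<bar>) = (\<Sum>k\<in>E. \<bar>u (min (Sup k) q) - u (max (Inf k) p)\<bar>)"
      by (subst sum.reindex[OF inj]) (auto intro!: sum.cong simp: rk(5,6))
    also have "\<dots> = (\<Sum>k\<in>d. if max (Inf k) p < min (Sup k) q then \<bar>u (min (Sup k) q) - u (max (Inf k) p)\<bar> else 0)"
      unfolding E_def by (rule sum.inter_filter[OF fin])
    finally show "(\<Sum>k\<in>r ` E. \<bar>u (Sup k) - u (Inf k)\<bar>) = \<dots>" .
  qed
qed

text \<open>A single criterion for all closure properties below: sums, products, compositions with
  C1 functions and Lipschitz functions have increments dominated by those of absolutely continuous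
  functions.\<close>

lemma abs_cont_on_interval_dominated:
  assumes "abs_cont_on_interval a b u" "abs_cont_on_interval a b v"
    and C: "\<And>x y. x \<in> {a..b} \<Longrightarrow> y \<in> {a..b} \<Longrightarrow> \<bar>w x - w y\<bar> \<le> C * (\<bar>u x - u y\<bar> + \<bar>v x - v y\<bar>)" "C > 0"
  shows "abs_cont_on_interval a b w"
  unfolding abs_cont_on_interval_def
proof (intro allI impI)
  fix e :: real assume "e > 0"
  then have e2: "e / (2 * C) > 0" using C(2) by simp
  obtain \<delta>1 where \<delta>1: "\<delta>1 > 0" "\<And>d. d division_of \<Union>d \<Longrightarrow> \<Union>d \<subseteq> {a..b} \<Longrightarrow>
      (\<Sum>k\<in>d. Sup k - Inf k) < \<delta>1 \<Longrightarrow> (\<Sum>k\<in>d. \<bar>u (Sup k) - u (Inf k)\<bar>) < e / (2 * C)"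
    using assms(1) e2 unfolding abs_cont_on_interval_def by meson
  obtain \<delta>2 where \<delta>2: "\<delta>2 > 0" "\<And>d. d division_of \<Union>d \<Longrightarrow> \<Union>d \<subseteq> {a..b} \<Longrightarrow>
      (\<Sum>k\<in>d. Sup k - Inf k) < \<delta>2 \<Longrightarrow> (\<Sum>k\<in>d. \<bar>v (Sup k) - v (Inf k)\<bar>) < e / (2 * C)"
    using assms(2) e2 unfolding abs_cont_on_interval_def by meson
  show "\<exists>\<delta>>0. \<forall>d. d division_of \<Union>d \<and> \<Union>d \<subseteq> {a..b} \<and> (\<Sum>k\<in>d. Sup k - Inf k) < \<delta>
        \<longrightarrow> (\<Sum>k\<in>d. \<bar>w (Sup k) - w (Inf k)\<bar>) < e"
  proof (intro exI[of _ "min \<delta>1 \<delta>2"] conjI allI impI)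
    fix d assume d: "d division_of \<Union>d \<and> \<Union>d \<subseteq> {a..b} \<and> (\<Sum>k\<in>d. Sup k - Inf k) < min \<delta>1 \<delta>2"
    then have dd: "d division_of \<Union>d" "\<Union>d \<subseteq> {a..b}" by auto
    have "(\<Sum>k\<in>d. \<bar>w (Sup k) - w (Inf k)\<bar>)
        \<le> (\<Sum>k\<in>d. C * (\<bar>u (Sup k) - u (Inf k)\<bar> + \<bar>v (Sup k) - v (Inf k)\<bar>))"
    proof (rule sum_mono)
      fix k assume k: "k \<in> d"
      obtain x y where xy: "x \<le> y" "k = {x..y}" "Inf k = x" "Sup k = y"
        using division_of_real_interval[OF dd(1) k] by blast
      have "{x..y} \<subseteq> {a..b}" using order.trans[OF Union_upper[OF k] dd(2)] xy by simp
      then have "x \<in> {a..b}" "y \<in> {a..b}" using xy(1) by auto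
      then show "\<bar>w (Sup k) - w (Inf k)\<bar> \<le> C * (\<bar>u (Sup k) - u (Inf k)\<bar> + \<bar>v (Sup k) - v (Inf k)\<bar>)"
        using C(1) xy by simp
    qed
    also have "\<dots> = C * ((\<Sum>k\<in>d. \<bar>u (Sup k) - u (Inf k)\<bar>) + (\<Sum>k\<in>d. \<bar>v (Sup k) - v (Inf k)\<bar>))"
      by (simp add: sum.distrib flip: sum_distrib_left)
    also have "\<dots> < C * (e / (2 * C) + e / (2 * C))"
      using \<delta>1(2)[of d] \<delta>2(2)[of d] d C(2) by (intro mult_strict_left_mono add_strict_mono) auto
    also have "\<dots> = e" using C(2) by simp
    finally show "(\<Sum>k\<in>d. \<bar>w (Sup k) - w (Inf k)\<bar>) < e" .
  qed (use \<delta>1 \<delta>2 in auto)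
qed

text \<open>Total variation is finite on short intervals, so the Jordan decomposition reduces the claim
  to the monotone case.\<close>

lemma abs_cont_short_interval_primitive:
  assumes "a \<le> b" and ac: "abs_cont_on_interval a b u"
    and \<delta>: "\<And>d. d division_of \<Union>d \<Longrightarrow> \<Union>d \<subseteq> {a..b} \<Longrightarrow>
      (\<Sum>k\<in>d. Sup k - Inf k) < \<delta> \<Longrightarrow> (\<Sum>k\<in>d. \<bar>u (Sup k) - u (Inf k)\<bar>) < 1" "b - a < \<delta>"
  shows "\<exists>g. primitive_on a b u g"
proof -
  define T where "T = (\<lambda>d. \<Sum>k\<in>d. \<bar>u (Sup k) - u (Inf k)\<bar>)"
  define S where "S = (\<lambda>x. {T d | d. d division_of \<Union>d \<and> \<Union>d \<subseteq> {a..x}})"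
  define V where "V = (\<lambda>x. Sup (S x))"
  \<comment> \<open>The whole interval is shorter than \<delta>, so every division has variation at
    most 1 and the supremum V is finite.\<close>
  have T1: "T d \<le> 1" if "d division_of \<Union>d" "\<Union>d \<subseteq> {a..b}" for d
  proof -
    have "(\<Sum>k\<in>d. Sup k - Inf k) \<le> measure lborel {a..b}"
      using subadditive_content_division[OF that(1), of a b] that(2)
      by (simp add: division_sum_lengths[OF that(1)])
    then show ?thesis using \<delta>(1)[OF that] \<delta>(2) assms(1) by (simp add: T_def)
  qed
  have bdd: "bdd_above (S x)" if "x \<le> b" for x
  proof -
    have "{a..x} \<subseteq> {a..b}" using that by auto
    have "t \<le> 1" if "t \<in> S x" for t
    proof -
      from that obtain d where "d division_of \<Union>d" "\<Union>d \<subseteq> {a..x}" "t = T d"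
        unfolding S_def by blast
      then show ?thesis using T1[of d] order.trans[OF _ \<open>{a..x} \<subseteq> {a..b}\<close>] by metis
    qed
    then show ?thesis by (auto simp: bdd_above_def)
  qed
  have ne: "S x \<noteq> {}" for x
    unfolding S_def using division_of_trivial by (auto intro!: exI[of _ "{}"])
  have VT: "T d \<le> V x" if "d division_of \<Union>d" "\<Union>d \<subseteq> {a..x}" "x \<le> b" for d x
    unfolding V_def using that by (intro cSup_upper bdd) (auto simp: S_def)
  have V2: "V x + \<bar>u y - u x\<bar> \<le> V y" if "a \<le> x" "x \<le> y" "y \<le> b" for x y
  proof (cases "x = y")
    case False
    have "Sup (S x) \<le> V y - \<bar>u y - u x\<bar>"
    proof (rule cSup_least[OF ne])
      fix t assume "t \<in> S x"
      then obtain d where d: "d division_of \<Union>d" "\<Union>d \<subseteq> {a..x}" "t = T d" by (auto simp: S_def)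
      have "interior (\<Union>d) \<inter> interior (cbox x y) = {}"
        using interior_mono[OF d(2)] by (auto simp: interior_atLeastAtMost_real)
      from division_disjoint_union[OF d(1) division_of_self[of x y] this] False that
      have dd: "insert {x..y} d division_of (\<Union>d \<union> {x..y})" by simp
      have notin: "{x..y} \<notin> d"
      proof
        assume "{x..y} \<in> d"
        then have "{x..y} \<subseteq> {a..x}" using d(2) by (meson Union_upper subset_trans)
        then show False using False that by auto
      qed
      have "T (insert {x..y} d) \<le> V y"
      proof (rule VT)
        show "insert {x..y} d division_of \<Union>(insert {x..y} d)"
          using dd by (metis Un_commute Union_insert)
        have "{a..x} \<subseteq> {a..y}" "{x..y} \<subseteq> {a..y}" using that by simp_all
        then show "\<Union>(insert {x..y} d) \<subseteq> {a..y}"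
          using d(2) by (metis Union_insert Un_least order.trans)
      qed (use that in simp)
      moreover have "T (insert {x..y} d) = T d + \<bar>u y - u x\<bar>"
        unfolding T_def using notin d(1) that
        by (subst sum.insert) (auto simp: cInf_atLeastAtMost cSup_atLeastAtMost)
      ultimately show "t \<le> V y - \<bar>u y - u x\<bar>" using d(3) by simp
    qed
    then show ?thesis by (simp add: V_def)
  qed auto
  \<comment> \<open>A nearly optimal division of [a, y] is cut at x. Its left part contributes at
    most V x, so its right part already realizes V y - V x up to e.\<close>
  have V3: "\<exists>d. d division_of \<Union>d \<and> \<Union>d \<subseteq> {x..y} \<and> (\<forall>k\<in>d. Inf k < Sup k) \<and> V y - V x \<le> T d + e"
    if "a \<le> x" "x \<le> y" "y \<le> b" "e > 0" for x y e
  proof -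
    have "V y - e < Sup (S y)" using that by (simp add: V_def)
    then obtain t where "t \<in> S y" "V y - e < t" using less_cSupE[OF _ ne] by blast
    then obtain d where d: "d division_of \<Union>d" "\<Union>d \<subseteq> {a..y}" "V y - e < T d" by (auto simp: S_def)
    have "\<exists>d'. d' division_of \<Union>d' \<and> \<Union>d' \<subseteq> {a..x} \<and> (\<forall>k\<in>d'. Inf k < Sup k) \<and>
      T d' = (\<Sum>k\<in>d. if max (Inf k) a < min (Sup k) x then \<bar>u (min (Sup k) x) - u (max (Inf k) a)\<bar> else 0)"
      unfolding T_def by (rule division_restrict_interval[OF d(1)])
    then obtain d1 where d1: "d1 division_of \<Union>d1" "\<Union>d1 \<subseteq> {a..x}" "\<forall>k\<in>d1. Inf k < Sup k"
      "T d1 = (\<Sum>k\<in>d. if max (Inf k) a < min (Sup k) x then \<bar>u (min (Sup k) x) - u (max (Inf k) a)\<bar> else 0)"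
      by blast
    have "\<exists>d'. d' division_of \<Union>d' \<and> \<Union>d' \<subseteq> {x..y} \<and> (\<forall>k\<in>d'. Inf k < Sup k) \<and>
      T d' = (\<Sum>k\<in>d. if max (Inf k) x < min (Sup k) y then \<bar>u (min (Sup k) y) - u (max (Inf k) x)\<bar> else 0)"
      unfolding T_def by (rule division_restrict_interval[OF d(1)])
    then obtain d2 where d2: "d2 division_of \<Union>d2" "\<Union>d2 \<subseteq> {x..y}" "\<forall>k\<in>d2. Inf k < Sup k"
      "T d2 = (\<Sum>k\<in>d. if max (Inf k) x < min (Sup k) y then \<bar>u (min (Sup k) y) - u (max (Inf k) x)\<bar> else 0)"
      by blast
    have "T d \<le> T d1 + T d2"
      unfolding d1(4) d2(4) unfolding T_def sum.distrib[symmetric]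
    proof (rule sum_mono)
      fix k assume "k \<in> d"
      then obtain p q where pq: "p \<le> q" "k = {p..q}" "Inf k = p" "Sup k = q"
        using division_of_real_interval[OF d(1)] by blast
      have "{p..q} \<subseteq> {a..y}" using order.trans[OF Union_upper[OF \<open>k \<in> d\<close>] d(2)] pq by simp
      then have pq': "a \<le> p" "q \<le> y" using pq(1) by auto
      have imp: "q \<le> x \<Longrightarrow> x \<le> p \<Longrightarrow> u q = u p"
        using pq(1) by (metis order_antisym order_trans)
      show "\<bar>u (Sup k) - u (Inf k)\<bar> \<le>
         (if max (Inf k) a < min (Sup k) x then \<bar>u (min (Sup k) x) - u (max (Inf k) a)\<bar> else 0) +
         (if max (Inf k) x < min (Sup k) y then \<bar>u (min (Sup k) y) - u (max (Inf k) x)\<bar> else 0)"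
        unfolding pq(3,4) using pq' pq(1) imp
        by (cases "q \<le> x"; cases "x \<le> p") (auto simp: max_def min_def)
    qed
    moreover have "T d1 \<le> V x" using VT[OF d1(1,2)] that by simp
    ultimately show ?thesis using d2(1-3) d(3) by (intro exI[of _ d2] conjI ballI) auto
  qed
  have Vac: "abs_cont_on_interval a b V"
    unfolding abs_cont_on_interval_def
  proof (intro allI impI)
    fix e :: real assume "e > 0"
    then have "e / 2 > 0" by simp
    obtain \<eta> where \<eta>: "\<eta> > 0" "\<And>d. d division_of \<Union>d \<Longrightarrow> \<Union>d \<subseteq> {a..b} \<Longrightarrow>
        (\<Sum>k\<in>d. Sup k - Inf k) < \<eta> \<Longrightarrow> T d < e / 2"
      using ac \<open>e / 2 > 0\<close> unfolding abs_cont_on_interval_def T_def by meson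
    have "(\<Sum>k\<in>d. \<bar>V (Sup k) - V (Inf k)\<bar>) < e"
      if d: "d division_of \<Union>d" "\<Union>d \<subseteq> {a..b}" "(\<Sum>k\<in>d. Sup k - Inf k) < \<eta>" for d
    proof -
      have fin: "finite d" using d by auto
      define c where "c = e / (2 * (real (card d) + 1))"
      have "c > 0" using \<open>e > 0\<close> by (simp add: c_def)
      have kab: "a \<le> Inf k \<and> Inf k \<le> Sup k \<and> Sup k \<le> b \<and> k = {Inf k..Sup k}" if kd: "k \<in> d" for k
      proof -
        obtain x y where xy: "x \<le> y" "k = {x..y}" "Inf k = x" "Sup k = y"
          using division_of_real_interval[OF d(1) kd] by blast
        have "{x..y} \<subseteq> {a..b}" using order.trans[OF Union_upper[OF kd] d(2)] xy by simp
        then show ?thesis using xy by auto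
      qed
      \<comment> \<open>Each k receives a division that nearly realizes the increment of V, with
        total error card d * c <= e / 2. Its members are nondegenerate, so the divisions belonging
        to different k are disjoint families, and their union is again a division, to which the
        absolute continuity of u applies.\<close>
      have "\<forall>k\<in>d. \<exists>D. D division_of \<Union>D \<and> \<Union>D \<subseteq> k \<and> (\<forall>K\<in>D. Inf K < Sup K) \<and>
          V (Sup k) - V (Inf k) \<le> T D + c"
      proof
        fix k assume "k \<in> d"
        show "\<exists>D. D division_of \<Union>D \<and> \<Union>D \<subseteq> k \<and> (\<forall>K\<in>D. Inf K < Sup K) \<and>
          V (Sup k) - V (Inf k) \<le> T D + c"
          using V3[of "Inf k" "Sup k" c] kab[OF \<open>k \<in> d\<close>] \<open>c > 0\<close> by metis
      qed
      from bchoice[OF this] obtain D where D: "\<And>k. k \<in> d \<Longrightarrow> D k division_of \<Union>(D k)" "\<And>k. k \<in> d \<Longrightarrow> \<Union>(D k) \<subseteq> k"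
          "\<And>k K. k \<in> d \<Longrightarrow> K \<in> D k \<Longrightarrow> Inf K < Sup K"
          "\<And>k. k \<in> d \<Longrightarrow> V (Sup k) - V (Inf k) \<le> T (D k) + c"
        by blast
      have Kk: "K \<subseteq> k" if "k \<in> d" "K \<in> D k" for k K
        using D(2)[OF that(1)] that(2) by auto
      have int: "interior K \<noteq> {}" if kK: "k \<in> d" "K \<in> D k" for k K
      proof -
        obtain x y where "K = {x..y}" "Inf K = x" "Sup K = y"
          using division_of_real_interval[OF D(1)[OF kK(1)] kK(2)] by blast
        then show ?thesis using D(3)[OF that] by (simp add: interior_atLeastAtMost_real)
      qed
      have dis: "interior K \<inter> interior L = {}" if "k \<in> d" "l \<in> d" "k \<noteq> l" "K \<in> D k" "L \<in> D l" for k l K L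
        using division_ofD(5)[OF d(1) that(1,2,3)] interior_mono[OF Kk[OF that(1,4)]]
          interior_mono[OF Kk[OF that(2,5)]] by blast
      define E where "E = (\<Union>k\<in>d. D k)"
      have finD: "finite (D k)" if "k \<in> d" for k using D(1)[OF that] by auto
      have disD: "\<forall>k\<in>d. \<forall>l\<in>d. k \<noteq> l \<longrightarrow> D k \<inter> D l = {}"
        using dis int by (metis disjoint_iff inf.idem)
      have E: "E division_of \<Union>E"
      proof (rule division_ofI)
        show "finite E" using fin finD by (simp add: E_def)
        fix K assume "K \<in> E"
        then obtain k where k: "k \<in> d" "K \<in> D k" by (auto simp: E_def)
        then show "K \<noteq> {}" "\<exists>a b. K = cbox a b" using division_ofD(3,4)[OF D(1)] by auto
        show "K \<subseteq> \<Union>E" using \<open>K \<in> E\<close> by auto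
        fix L assume "L \<in> E" "K \<noteq> L"
        then obtain l where l: "l \<in> d" "L \<in> D l" by (auto simp: E_def)
        show "interior K \<inter> interior L = {}"
          using dis[of k l K L] k l division_ofD(5)[OF D(1)[OF k(1)], of K L] \<open>K \<noteq> L\<close> by metis
      qed auto
      have "\<Union>E \<subseteq> {a..b}"
      proof
        fix t assume "t \<in> \<Union>E"
        then obtain k where "k \<in> d" "t \<in> \<Union>(D k)" by (auto simp: E_def)
        then have "t \<in> \<Union>d" using D(2) by blast
        then show "t \<in> {a..b}" using d(2) by blast
      qed
      have sumE: "sum F E = (\<Sum>k\<in>d. sum F (D k))" for F :: "real set \<Rightarrow> real"
        unfolding E_def using fin finD disD by (intro sum.UNION_disjoint) auto
      have "(\<Sum>K\<in>E. Sup K - Inf K) \<le> (\<Sum>k\<in>d. Sup k - Inf k)"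
        unfolding sumE
      proof (rule sum_mono)
        fix k assume k: "k \<in> d"
        have "measure lborel k = Sup k - Inf k" using kab[OF k] by (metis content_real)
        moreover have "\<Union>(D k) \<subseteq> cbox (Inf k) (Sup k)" using D(2)[OF k] kab[OF k] by simp
        ultimately show "(\<Sum>K\<in>D k. Sup K - Inf K) \<le> Sup k - Inf k"
          using subadditive_content_division[OF D(1)[OF k], of "Inf k" "Sup k"] kab[OF k]
          by (simp add: division_sum_lengths[OF D(1)[OF k]])
      qed
      then have TE: "T E < e / 2" using \<eta>(2)[OF E \<open>\<Union>E \<subseteq> {a..b}\<close>] d(3) by simp
      have "(\<Sum>k\<in>d. \<bar>V (Sup k) - V (Inf k)\<bar>) \<le> (\<Sum>k\<in>d. T (D k) + c)"
      proof (rule sum_mono)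
        fix k assume k: "k \<in> d"
        show "\<bar>V (Sup k) - V (Inf k)\<bar> \<le> T (D k) + c"
          using D(4)[OF k] V2[of "Inf k" "Sup k"] kab[OF k] by auto
      qed
      also have "\<dots> = T E + real (card d) * c"
        by (simp add: sum.distrib T_def sumE)
      also have "real (card d) * c \<le> e / 2"
        using \<open>e > 0\<close> by (simp add: c_def field_simps)
      finally show ?thesis using TE by simp
    qed
    then show "\<exists>\<eta>>0. \<forall>d. d division_of \<Union>d \<and> \<Union>d \<subseteq> {a..b} \<and> (\<Sum>k\<in>d. Sup k - Inf k) < \<eta>
        \<longrightarrow> (\<Sum>k\<in>d. \<bar>V (Sup k) - V (Inf k)\<bar>) < e"
      using \<eta>(1) by blast
  qed
  \<comment> \<open>Jordan decomposition u = (V + u) - V; both terms are nondecreasing because V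
    grows at least as much as |u| changes.\<close>
  have Vuac: "abs_cont_on_interval a b (\<lambda>x. V x + u x)"
    by (rule abs_cont_on_interval_dominated[OF Vac ac, where C = 1]) auto
  obtain g1 where g1: "primitive_on a b V g1"
    using mono_abs_cont_primitive[OF assms(1) _ Vac] V2 by (smt (verit, best))
  obtain g2 where g2: "primitive_on a b (\<lambda>x. V x + u x) g2"
    using mono_abs_cont_primitive[OF assms(1) _ Vuac] V2 by (smt (verit, best))
  have "primitive_on a b u (\<lambda>x. g2 x - g1 x)"
    unfolding primitive_on_def
  proof (intro conjI ballI)
    show "(\<lambda>x. g2 x - g1 x) absolutely_integrable_on {a..b}"
      using g1 g2 by (intro set_integral_diff(1)) (auto simp: primitive_on_def)
    fix x assume x: "x \<in> {a..b}"
    have "g1 integrable_on {a..x}" "g2 integrable_on {a..x}"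
      using primitive_on_subinterval[OF g1, of a x] primitive_on_subinterval[OF g2, of a x] x
      by (auto simp: primitive_on_def set_lebesgue_integral_eq_integral)
    then show "integral {a..x} (\<lambda>x. g2 x - g1 x) = u x - u a"
      using primitive_on_diff[OF g1, of a x] primitive_on_diff[OF g2, of a x] x
      by (simp add: Henstock_Kurzweil_Integration.integral_diff)
  qed
  then show ?thesis by blast
qed

text \<open>Densities on consecutive pieces shorter than \<delta> are glued together; the induction
  counts steps of length \<delta> / 2.\<close>

theorem abs_cont_on_interval_primitive:
  assumes "a \<le> b" "abs_cont_on_interval a b u"
  shows "\<exists>g. primitive_on a b u g"
proof -
  obtain \<delta> where \<delta>: "\<delta> > 0" "\<And>d. d division_of \<Union>d \<Longrightarrow> \<Union>d \<subseteq> {a..b} \<Longrightarrow>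
      (\<Sum>k\<in>d. Sup k - Inf k) < \<delta> \<Longrightarrow> (\<Sum>k\<in>d. \<bar>u (Sup k) - u (Inf k)\<bar>) < 1"
    using assms(2) unfolding abs_cont_on_interval_def by (meson zero_less_one)
  have "\<exists>g. primitive_on a c u g" if "a \<le> c" "c \<le> b" "c - a \<le> real n * (\<delta> / 2)" for n c
    using that
  proof (induction n arbitrary: c)
    case 0
    then have "c = a" by simp
    then show ?case by (auto simp: primitive_on_def intro!: exI[of _ "\<lambda>x. 0"])
  next
    case (Suc n)
    define m where "m = max a (c - \<delta> / 2)"
    have m: "a \<le> m" "m \<le> c" "m \<le> b" "m - a \<le> real n * (\<delta> / 2)" "c - m < \<delta>"
      using Suc.prems \<delta>(1) by (auto simp: m_def max_def algebra_simps)
    obtain g where g: "primitive_on a m u g" using Suc.IH m by blast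
    have sub: "{m..c} \<subseteq> {a..b}" using m Suc.prems by auto
    have "\<exists>g. primitive_on m c u g"
    proof (rule abs_cont_short_interval_primitive)
      show "abs_cont_on_interval m c u"
        by (rule abs_cont_on_interval_sub[OF assms(2)]) (use m Suc.prems in auto)
      show "(\<Sum>k\<in>d. \<bar>u (Sup k) - u (Inf k)\<bar>) < 1"
        if "d division_of \<Union> d" "\<Union> d \<subseteq> {m..c}" "(\<Sum>k\<in>d. Sup k - Inf k) < \<delta>" for d
        using \<delta>(2)[OF that(1) order.trans[OF that(2) sub] that(3)] .
    qed (use m in auto)
    then obtain h where h: "primitive_on m c u h" by blast
    define w where "w = (\<lambda>x. if x \<le> m then g x else h x)"
    have "primitive_on a m u w"
      by (rule primitive_on_spike[OF g, of "{}"]) (auto simp: w_def)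
    moreover have "primitive_on m c u w"
      by (rule primitive_on_spike[OF h, of "{m}"]) (auto simp: w_def)
    ultimately show ?case using primitive_on_combine m by blast
  qed
  moreover obtain n where "(b - a) / (\<delta> / 2) \<le> real n" using real_arch_simple by blast
  moreover have "\<delta> / 2 > 0" using \<delta>(1) by simp
  ultimately show ?thesis using assms(1) pos_divide_le_eq[of "\<delta> / 2" "b - a"] by blast
qed

section \<open>Calculus with densities: products, chain rule, integrating factors\<close>

lemma abs_cont_on_interval_id: "abs_cont_on_interval a b (\<lambda>x. x)"
  unfolding abs_cont_on_interval_def
proof (intro allI impI)
  fix e :: real assume "e > 0"
  have "(\<Sum>k\<in>d. \<bar>Sup k - Inf k\<bar>) = (\<Sum>k\<in>d. Sup k - Inf k)" if "d division_of \<Union>d" for d :: "real set set"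
  proof (rule sum.cong[OF refl])
    fix k assume k: "k \<in> d"
    show "\<bar>Sup k - Inf k\<bar> = Sup k - Inf k"
      using division_of_real_interval[OF that k] by force
  qed
  then show "\<exists>\<delta>>0. \<forall>d. d division_of \<Union>d \<and> \<Union>d \<subseteq> {a..b} \<and> (\<Sum>k\<in>d. Sup k - Inf k) < \<delta>
        \<longrightarrow> (\<Sum>k\<in>d. \<bar>Sup k - Inf k\<bar>) < e"
    using \<open>e > 0\<close> by (intro exI[of _ e]) auto
qed

lemma lipschitz_imp_abs_cont:
  assumes "\<And>x y. x \<in> {a..b} \<Longrightarrow> y \<in> {a..b} \<Longrightarrow> \<bar>w x - w y\<bar> \<le> L * \<bar>x - y\<bar>"
  shows "abs_cont_on_interval a b w"
proof (rule abs_cont_on_interval_dominated[OF abs_cont_on_interval_id abs_cont_on_interval_id])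
  fix x y assume xy: "x \<in> {a..b}" "y \<in> {a..b}"
  have "\<bar>w x - w y\<bar> \<le> L * \<bar>x - y\<bar>" using assms xy .
  also have "\<dots> \<le> (\<bar>L\<bar> + 1) * (\<bar>x - y\<bar> + \<bar>x - y\<bar>)" by (intro mult_mono) auto
  finally show "\<bar>w x - w y\<bar> \<le> (\<bar>L\<bar> + 1) * (\<bar>x - y\<bar> + \<bar>x - y\<bar>)" .
qed auto

text \<open>An almost everywhere derivative alone does not determine the increments, as the Cantor
  function shows. Absolute continuity supplies some density, and that density must agree with g
  almost everywhere.\<close>

lemma primitive_onI_derivative:
  assumes "a \<le> b" "abs_cont_on_interval a b w" "negligible N"
    and "\<And>x. x \<in> {a<..<b} - N \<Longrightarrow> (w has_real_derivative g x) (at x)"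
  shows "primitive_on a b w g"
proof -
  obtain h where h: "primitive_on a b w h"
    using abs_cont_on_interval_primitive[OF assms(1,2)] by blast
  obtain M where M: "negligible M" "\<And>x. x \<in> {a<..<b} - M \<Longrightarrow> (w has_real_derivative h x) (at x)"
    using primitive_on_has_real_derivative[OF h] by blast
  have "negligible (N \<union> M \<union> {a, b})" using assms(3) M(1) by auto
  then show ?thesis
  proof (rule primitive_on_spike[OF h])
    fix x assume x: "x \<in> {a..b} - (N \<union> M \<union> {a, b})"
    then have "(w has_real_derivative g x) (at x)" "(w has_real_derivative h x) (at x)"
      using assms(4) M(2) by auto
    then show "g x = h x" by (rule DERIV_unique)
  qed
qed

lemma primitive_on_bounded:
  assumes "primitive_on a b u g"
  obtains B where "B > 0" "\<And>x. x \<in> {a..b} \<Longrightarrow> \<bar>u x\<bar> \<le> B"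
proof -
  have "bounded (u ` {a..b})"
    using compact_continuous_image[OF primitive_on_continuous[OF assms]] compact_imp_bounded by blast
  then show thesis using that by (auto simp: bounded_pos)
qed

lemma primitive_on_mult:
  assumes "a \<le> b" "primitive_on a b u g" "primitive_on a b v h"
  shows "primitive_on a b (\<lambda>x. u x * v x) (\<lambda>x. g x * v x + u x * h x)"
proof -
  obtain B where B: "B > 0" "\<And>x. x \<in> {a..b} \<Longrightarrow> \<bar>u x\<bar> \<le> B" using primitive_on_bounded[OF assms(2)] by blast
  obtain C where C: "C > 0" "\<And>x. x \<in> {a..b} \<Longrightarrow> \<bar>v x\<bar> \<le> C" using primitive_on_bounded[OF assms(3)] by blast
  obtain N where N: "negligible N" "\<And>x. x \<in> {a<..<b} - N \<Longrightarrow> (u has_real_derivative g x) (at x)"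
    using primitive_on_has_real_derivative[OF assms(2)] by blast
  obtain M where M: "negligible M" "\<And>x. x \<in> {a<..<b} - M \<Longrightarrow> (v has_real_derivative h x) (at x)"
    using primitive_on_has_real_derivative[OF assms(3)] by blast
  show ?thesis
  proof (rule primitive_onI_derivative[OF assms(1)])
    show "abs_cont_on_interval a b (\<lambda>x. u x * v x)"
    proof (rule abs_cont_on_interval_dominated)
      fix x y assume xy: "x \<in> {a..b}" "y \<in> {a..b}"
      have "u x * v x - u y * v y = (u x - u y) * v x + u y * (v x - v y)" by (simp add: algebra_simps)
      then have "\<bar>u x * v x - u y * v y\<bar> \<le> \<bar>u x - u y\<bar> * \<bar>v x\<bar> + \<bar>u y\<bar> * \<bar>v x - v y\<bar>"
        by (metis abs_mult abs_triangle_ineq)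
      also have "\<dots> \<le> \<bar>u x - u y\<bar> * (B + C) + (B + C) * \<bar>v x - v y\<bar>"
        using B(1) C(1) B(2)[OF xy(2)] C(2)[OF xy(1)] by (intro add_mono mult_mono) auto
      finally show "\<bar>u x * v x - u y * v y\<bar> \<le> (B + C) * (\<bar>u x - u y\<bar> + \<bar>v x - v y\<bar>)"
        by (simp add: algebra_simps)
    qed (use assms B C in \<open>auto intro: primitive_on_imp_abs_cont\<close>)
    show "negligible (N \<union> M)" using N M by auto
    show "((\<lambda>x. u x * v x) has_real_derivative g x * v x + u x * h x) (at x)"
      if "x \<in> {a<..<b} - (N \<union> M)" for x
      using DERIV_mult[OF N(2) M(2), of x] that by (simp add: algebra_simps)
  qed
qed

text \<open>The values of u lie in a compact interval, on which \<phi> is Lipschitz.\<close>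

lemma primitive_on_compose:
  assumes "a \<le> b" "primitive_on a b u g"
    and \<phi>: "\<And>x. (\<phi> has_real_derivative \<phi>' x) (at x)" "continuous_on UNIV \<phi>'"
  shows "primitive_on a b (\<lambda>x. \<phi> (u x)) (\<lambda>x. \<phi>' (u x) * g x)"
proof -
  obtain B where B: "B > 0" "\<And>x. x \<in> {a..b} \<Longrightarrow> \<bar>u x\<bar> \<le> B" using primitive_on_bounded[OF assms(2)] by blast
  obtain N where N: "negligible N" "\<And>x. x \<in> {a<..<b} - N \<Longrightarrow> (u has_real_derivative g x) (at x)"
    using primitive_on_has_real_derivative[OF assms(2)] by blast
  have "bounded (\<phi>' ` {-B..B})"
    using compact_continuous_image[of "{-B..B}" \<phi>'] \<phi>(2) compact_imp_bounded continuous_on_subset by blast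
  then obtain C where C: "C > 0" "\<And>x. x \<in> {-B..B} \<Longrightarrow> \<bar>\<phi>' x\<bar> \<le> C" by (auto simp: bounded_pos)
  have Lip: "\<bar>\<phi> s - \<phi> t\<bar> \<le> C * \<bar>s - t\<bar>" if "s \<in> {-B..B}" "t \<in> {-B..B}" for s t
  proof -
    have "norm (\<phi> s - \<phi> t) \<le> C * norm (s - t)"
    proof (rule field_differentiable_bound[of "{-B..B}" \<phi> \<phi>' C])
      show "(\<phi> has_field_derivative \<phi>' z) (at z within {-B..B})" for z
        using \<phi>(1) by (rule has_field_derivative_at_within)
    qed (use C that in auto)
    then show ?thesis by simp
  qed
  show ?thesis
  proof (rule primitive_onI_derivative[OF assms(1) _ N(1)])
    show "abs_cont_on_interval a b (\<lambda>x. \<phi> (u x))"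
    proof (rule abs_cont_on_interval_dominated)
      fix x y assume xy: "x \<in> {a..b}" "y \<in> {a..b}"
      have "u x \<in> {-B..B}" "u y \<in> {-B..B}" using B(2)[OF xy(1)] B(2)[OF xy(2)] by auto
      then have "\<bar>\<phi> (u x) - \<phi> (u y)\<bar> \<le> C * \<bar>u x - u y\<bar>" by (rule Lip)
      also have "\<dots> \<le> C * (\<bar>u x - u y\<bar> + \<bar>u x - u y\<bar>)" using C by (intro mult_left_mono) auto
      finally show "\<bar>\<phi> (u x) - \<phi> (u y)\<bar> \<le> C * (\<bar>u x - u y\<bar> + \<bar>u x - u y\<bar>)" .
    qed (use assms C in \<open>auto intro: primitive_on_imp_abs_cont\<close>)
    show "((\<lambda>x. \<phi> (u x)) has_real_derivative \<phi>' (u x) * g x) (at x)" if "x \<in> {a<..<b} - N" for x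
      using DERIV_chain2[OF \<phi>(1) N(2)[OF that]] .
  qed
qed

lemma integral_le_off_negligible:
  fixes f g :: "real \<Rightarrow> real"
  assumes "f integrable_on S" "g integrable_on S" "negligible N" "\<And>x. x \<in> S - N \<Longrightarrow> f x \<le> g x"
  shows "integral S f \<le> integral S g"
proof -
  define h where "h = (\<lambda>x. if x \<in> N then g x else f x)"
  have "integral S h = integral S f" "h integrable_on S"
    by (auto intro!: integral_spike[OF assms(3)] integrable_spike[OF assms(1,3)] simp: h_def)
  moreover have "integral S h \<le> integral S g"
    by (rule integral_le[OF \<open>h integrable_on S\<close> assms(2)]) (use assms(4) in \<open>auto simp: h_def\<close>)
  ultimately show ?thesis by simp
qed

lemma primitive_on_indefinite:
  assumes "c absolutely_integrable_on {a..b}"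
  shows "primitive_on a b (\<lambda>x. integral {a..x} c) c"
  using assms by (auto simp: primitive_on_def)

lemma primitive_on_exp_integral:
  assumes "a \<le> b" "c absolutely_integrable_on {a..b}"
  shows "primitive_on a b (\<lambda>x. exp (integral {a..x} c)) (\<lambda>x. exp (integral {a..x} c) * c x)"
  by (rule primitive_on_compose[OF assms(1) primitive_on_indefinite[OF assms(2)]])
    (auto intro!: derivative_eq_intros continuous_intros)

lemma primitive_on_has_integral:
  assumes "primitive_on a b u g" "a \<le> x" "x \<le> y" "y \<le> b"
  shows "(g has_integral u y - u x) {x..y}"
proof -
  have "g integrable_on {x..y}"
    using primitive_on_subinterval[OF assms(1,2,4)] by (simp add: primitive_on_def set_lebesgue_integral_eq_integral)
  then show ?thesis using primitive_on_diff[OF assms] by (simp add: has_integral_integrable_integral)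
qed

lemma integrating_factor:
  assumes "a \<le> b" "primitive_on a b p q" "c absolutely_integrable_on {a..b}"
  shows "primitive_on a b (\<lambda>x. exp (integral {a..x} c) * p x) (\<lambda>x. exp (integral {a..x} c) * (q x + c x * p x))"
  using primitive_on_mult[OF assms(1) primitive_on_exp_integral[OF assms(1,3)] assms(2)]
  by (simp add: algebra_simps)

text \<open>The exponential factor turns q + c p into an exact derivative, so a pointwise inequality
  can be integrated although c is merely integrable.\<close>

lemma linear_differential_inequality:
  assumes "a \<le> b" "primitive_on a b p q" "c absolutely_integrable_on {a..b}" "negligible N"
    and "\<And>x. x \<in> {a..b} - N \<Longrightarrow> q x + c x * p x \<le> G x"
    and "(\<lambda>x. exp (integral {a..x} c) * G x) integrable_on {a..b}"
  shows "exp (integral {a..b} c) * p b \<le> p a + integral {a..b} (\<lambda>x. exp (integral {a..x} c) * G x)"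
proof -
  note I = primitive_on_has_integral[OF integrating_factor[OF assms(1-3)] order.refl assms(1) order.refl]
  have "integral {a..b} (\<lambda>x. exp (integral {a..x} c) * (q x + c x * p x))
      \<le> integral {a..b} (\<lambda>x. exp (integral {a..x} c) * G x)"
    by (rule integral_le_off_negligible[OF _ assms(6) assms(4)]) (use I assms(5) in auto)
  then show ?thesis using I by (simp add: integral_unique)
qed

lemma linear_differential_inequality_mono:
  assumes "primitive_on a b p q" "c absolutely_integrable_on {a..b}" "negligible N"
    and "\<And>x. x \<in> {a<..<b} - N \<Longrightarrow> 0 \<le> q x + c x * p x"
    and "a \<le> x" "x \<le> y" "y \<le> b"
  shows "exp (integral {a..x} c) * p x \<le> exp (integral {a..y} c) * p y"
proof -
  have "a \<le> b" using assms by simp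
  note I = primitive_on_has_integral[OF integrating_factor[OF \<open>a \<le> b\<close> assms(1,2)] assms(5-7)]
  have "integral {x..y} (\<lambda>x. 0) \<le> integral {x..y} (\<lambda>x. exp (integral {a..x} c) * (q x + c x * p x))"
    by (rule integral_le_off_negligible[of _ _ _ "N \<union> {a, b}"]) (use I assms in auto)
  then show ?thesis using I by (simp add: integral_unique)
qed

section \<open>Maximum principle and initial value problems\<close>

text \<open>The slope times its integrating factor is nondecreasing, so a nonnegative slope at x
  stays nonnegative up to y.\<close>

lemma max_principle_step_right:
  assumes "primitive_on x y D D1" "primitive_on x y D1 D2" "c absolutely_integrable_on {x..y}" "negligible N"
    and "\<And>t. t \<in> {x<..<y} - N \<Longrightarrow> 0 \<le> D2 t + c t * D1 t"
    and "x \<le> y" "0 \<le> D1 x"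
  shows "D x \<le> D y"
proof -
  have "0 \<le> D1 t" if "t \<in> {x..y}" for t
  proof -
    have "exp (integral {x..x} c) * D1 x \<le> exp (integral {x..t} c) * D1 t"
      using linear_differential_inequality_mono[OF assms(2,3,4,5), of x t] that by auto
    then have "0 \<le> exp (integral {x..t} c) * D1 t" using assms(7) by simp
    then show ?thesis by (simp add: zero_le_mult_iff)
  qed
  then have "0 \<le> integral {x..y} D1"
    by (intro Henstock_Kurzweil_Integration.integral_nonneg)
      (use assms(1) in \<open>auto simp: primitive_on_def set_lebesgue_integral_eq_integral\<close>)
  then show ?thesis using primitive_on_diff[OF assms(1), of x y] assms(6) by simp
qed

text \<open>Read from right to left, the same monotonicity keeps a nonpositive slope nonpositive.
  The quantitative bound on the slope is recorded because it later keeps the weighted slope away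
  from 0 near the origin.\<close>

lemma max_principle_step_left:
  assumes "primitive_on x y D D1" "primitive_on x y D1 D2" "c absolutely_integrable_on {x..y}" "negligible N"
    and "\<And>t. t \<in> {x<..<y} - N \<Longrightarrow> 0 \<le> D2 t + c t * D1 t"
    and "x \<le> y" "D1 y \<le> 0"
  shows "D y \<le> D x" "D1 x \<le> exp (integral {x..y} c) * D1 y"
proof -
  have le: "exp (integral {x..s} c) * D1 s \<le> exp (integral {x..t} c) * D1 t"
    if "s \<in> {x..y}" "t \<in> {s..y}" for s t
    using linear_differential_inequality_mono[OF assms(2,3,4,5), of s t] that by auto
  then show "D1 x \<le> exp (integral {x..y} c) * D1 y" using le[of x y] assms(6) by simp
  have "0 \<le> - D1 t" if "t \<in> {x..y}" for t
  proof -
    have "exp (integral {x..t} c) * D1 t \<le> exp (integral {x..y} c) * D1 y" using le[of t y] that by auto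
    also have "\<dots> \<le> 0" using assms(7) by (simp add: mult_le_0_iff)
    finally have "exp (integral {x..t} c) * D1 t \<le> 0" .
    then show ?thesis by (simp add: mult_le_0_iff)
  qed
  moreover have "D1 integrable_on {x..y}"
    using assms(1) by (auto simp: primitive_on_def set_lebesgue_integral_eq_integral)
  ultimately have "0 \<le> integral {x..y} (\<lambda>t. - D1 t)"
    by (intro Henstock_Kurzweil_Integration.integral_nonneg integrable_neg) auto
  then show "D y \<le> D x" using primitive_on_diff[OF assms(1), of x y] assms(6) by simp
qed

text \<open>The differential inequality is available only where D is positive. If D had a first
  nonpositive point after r0, the inequality would hold up to that point, and by the previous step D
  could not have decreased there.\<close>

lemma max_principle_right:
  assumes P: "primitive_on a b D D1" "primitive_on a b D1 D2" and c: "c absolutely_integrable_on {a..b}"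
    and N: "negligible N" "\<And>t. t \<in> {a..b} - N \<Longrightarrow> 0 < D t \<Longrightarrow> 0 \<le> D2 t + c t * D1 t"
    and r: "a \<le> r0" "r0 \<le> r" "r \<le> b" and D: "0 < D r0" "0 \<le> D1 r0"
  shows "D r0 \<le> D r"
proof -
  have step: "D r0 \<le> D y" if "y \<in> {r0..r}" "\<And>t. t \<in> {r0<..<y} \<Longrightarrow> 0 < D t" for y
  proof -
    have p: "primitive_on r0 y D D1" "primitive_on r0 y D1 D2"
      using primitive_on_subinterval[OF P(1)] primitive_on_subinterval[OF P(2)] r that by auto
    have cc: "c absolutely_integrable_on {r0..y}"
      using absolutely_integrable_on_subset_real[OF c] r that by auto
    have q: "0 \<le> D2 t + c t * D1 t" if "t \<in> {r0<..<y} - N" for t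
      using that N(2)[of t] \<open>y \<in> {r0..r}\<close> r \<open>\<And>t. t \<in> {r0<..<y} \<Longrightarrow> 0 < D t\<close> by auto
    show ?thesis
      using max_principle_step_right[OF p cc N(1) q] that D by auto
  qed
  define Z where "Z = {t \<in> {r0..r}. D t \<le> 0}"
  have "continuous_on {r0..r} D"
    using primitive_on_continuous[OF primitive_on_subinterval[OF P(1)]] r by auto
  then have "closed ({r0..r} \<inter> D -` {..0})"
    by (rule continuous_closed_preimage) auto
  moreover have "{r0..r} \<inter> D -` {..0} = Z" by (auto simp: Z_def)
  moreover have "bounded Z" by (rule bounded_subset[of "{r0..r}"]) (auto simp: Z_def)
  ultimately have Z: "compact Z" by (simp add: compact_eq_bounded_closed)
  have "Z = {}"
  proof (rule ccontr)
    assume "Z \<noteq> {}"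
    then obtain z where z: "z \<in> Z" "\<And>t. t \<in> Z \<Longrightarrow> z \<le> t" using compact_attains_inf[OF Z] by blast
    have "D r0 \<le> D z"
    proof (rule step)
      show "z \<in> {r0..r}" using z(1) by (auto simp: Z_def)
      show "0 < D t" if "t \<in> {r0<..<z}" for t
        using z(2)[of t] that z(1) by (force simp: Z_def)
    qed
    then show False using D z(1) by (auto simp: Z_def)
  qed
  then have "0 < D t" if "t \<in> {r0..r}" for t
    using that unfolding Z_def by (metis (mono_tags, lifting) empty_iff mem_Collect_eq not_le)
  then show ?thesis using r by (intro step) auto
qed

lemma max_principle_left:
  assumes P: "primitive_on a b D D1" "primitive_on a b D1 D2" and c: "c absolutely_integrable_on {a..b}"
    and N: "negligible N" "\<And>t. t \<in> {a..b} - N \<Longrightarrow> 0 < D t \<Longrightarrow> 0 \<le> D2 t + c t * D1 t"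
    and r: "a \<le> r" "r \<le> r0" "r0 \<le> b" and D: "0 < D r0" "D1 r0 \<le> 0"
  shows "D r0 \<le> D r" "D1 r \<le> exp (integral {r..r0} c) * D1 r0"
proof -
  have step: "D r0 \<le> D y \<and> D1 y \<le> exp (integral {y..r0} c) * D1 r0"
    if "y \<in> {r..r0}" "\<And>t. t \<in> {y<..<r0} \<Longrightarrow> 0 < D t" for y
  proof -
    have p: "primitive_on y r0 D D1" "primitive_on y r0 D1 D2"
      using primitive_on_subinterval[OF P(1)] primitive_on_subinterval[OF P(2)] r that by auto
    have cc: "c absolutely_integrable_on {y..r0}"
      using absolutely_integrable_on_subset_real[OF c] r that by auto
    have q: "0 \<le> D2 t + c t * D1 t" if "t \<in> {y<..<r0} - N" for t
      using that N(2)[of t] \<open>y \<in> {r..r0}\<close> r \<open>\<And>t. t \<in> {y<..<r0} \<Longrightarrow> 0 < D t\<close> by auto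
    show ?thesis
      using max_principle_step_left[OF p cc N(1) q] that D by auto
  qed
  define Z where "Z = {t \<in> {r..r0}. D t \<le> 0}"
  have "continuous_on {r..r0} D"
    using primitive_on_continuous[OF primitive_on_subinterval[OF P(1)]] r by auto
  then have "closed ({r..r0} \<inter> D -` {..0})"
    by (rule continuous_closed_preimage) auto
  moreover have "{r..r0} \<inter> D -` {..0} = Z" by (auto simp: Z_def)
  moreover have "bounded Z" by (rule bounded_subset[of "{r..r0}"]) (auto simp: Z_def)
  ultimately have Z: "compact Z" by (simp add: compact_eq_bounded_closed)
  have "Z = {}"
  proof (rule ccontr)
    assume "Z \<noteq> {}"
    then obtain z where z: "z \<in> Z" "\<And>t. t \<in> Z \<Longrightarrow> t \<le> z" using compact_attains_sup[OF Z] by blast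
    have "D r0 \<le> D z \<and> D1 z \<le> exp (integral {z..r0} c) * D1 r0"
    proof (rule step)
      show "z \<in> {r..r0}" using z(1) by (auto simp: Z_def)
      show "0 < D t" if "t \<in> {z<..<r0}" for t
        using z(2)[of t] that z(1) by (force simp: Z_def)
    qed
    then show False using D z(1) by (auto simp: Z_def)
  qed
  then have "0 < D t" if "t \<in> {r..r0}" for t
    using that unfolding Z_def by (metis (mono_tags, lifting) empty_iff mem_Collect_eq not_le)
  then have "D r0 \<le> D r \<and> D1 r \<le> exp (integral {r..r0} c) * D1 r0" using r by (intro step) auto
  then show "D r0 \<le> D r" "D1 r \<le> exp (integral {r..r0} c) * D1 r0" by auto
qed

section \<open>Caratheodory initial value problems\<close>

lemma integral_exp_le:
  fixes B :: real
  assumes "B > 0" "a \<le> t"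
  shows "integral {a..t} (\<lambda>x. exp (B * x)) \<le> exp (B * t) / B"
proof -
  have "((\<lambda>x. exp (B * x)) has_integral (exp (B * t) / B - exp (B * a) / B)) {a..t}"
    using assms by (intro fundamental_theorem_of_calculus)
      (auto intro!: derivative_eq_intros simp flip: has_real_derivative_iff_has_vector_derivative)
  then have "integral {a..t} (\<lambda>x. exp (B * x)) = exp (B * t) / B - exp (B * a) / B" by (rule integral_unique)
  then show ?thesis using assms by simp
qed

text \<open>The Picard operator acts on
  the weighted slope \<open>q t = exp (- B t) u' t\<close>; for large \<open>B\<close> it is a contraction, uniformly in the
  initial value.\<close>

theorem lipschitz_initial_value_problem:
  fixes F :: "real \<Rightarrow> real \<Rightarrow> real \<Rightarrow> real"
  assumes ab: "a \<le> b" and "L \<ge> 0"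
    and lip: "\<And>t x y x' y'. t \<in> {a..b} \<Longrightarrow> \<bar>F t x y - F t x' y'\<bar> \<le> L * (\<bar>x - x'\<bar> + \<bar>y - y'\<bar>)"
    and meas: "\<And>u p. continuous_on {a..b} u \<Longrightarrow> continuous_on {a..b} p \<Longrightarrow>
      (\<lambda>t. F t (u t) (p t)) \<in> borel_measurable (lebesgue_on {a..b})"
    and m: "m integrable_on {a..b}" "\<And>t. t \<in> {a..b} \<Longrightarrow> \<bar>F t 0 0\<bar> \<le> m t"
  obtains U P :: "real \<Rightarrow> real \<Rightarrow> real"
  where "\<And>\<alpha>. primitive_on a b (U \<alpha>) (P \<alpha>)"
    "\<And>\<alpha>. primitive_on a b (P \<alpha>) (\<lambda>t. F t (U \<alpha> t) (P \<alpha> t))"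
    "\<And>\<alpha>. U \<alpha> a = \<alpha>" "\<And>\<alpha>. P \<alpha> a = 0" "continuous_on UNIV (\<lambda>\<alpha>. U \<alpha> b)"
proof -
  \<comment> \<open>Differences of u and of u' each contribute L times the distance, and integrating
    exp (B x) gains a factor 1 / B. Since 2 * L / B <= 1 / 2, the Picard map contracts by 1 /
    2.\<close>
  define B where "B = 4 * L + 1"
  have B: "B \<ge> 1" "L / B \<le> 1 / 4" using \<open>L \<ge> 0\<close> by (auto simp: B_def field_simps)
  \<comment> \<open>Clamping to [a, b] turns the iterates into bounded continuous functions on the
    line, the complete space in which the fixed point is found.\<close>
  define cl where "cl = (\<lambda>t. max a (min t b))"
  have cl: "cl t \<in> {a..b}" for t using ab by (auto simp: cl_def)
  have clid: "cl t = t" if "t \<in> {a..b}" for t using that by (auto simp: cl_def)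
  have ccl: "continuous_on UNIV cl" unfolding cl_def by (intro continuous_intros)
  define p where "p = (\<lambda>(q::real \<Rightarrow>\<^sub>C real) t. exp (B * t) * q t)"
  define u where "u = (\<lambda>\<alpha> (q::real \<Rightarrow>\<^sub>C real) t. \<alpha> + integral {a..t} (p q))"
  define G where "G = (\<lambda>\<alpha> q t. F t (u \<alpha> q t) (p q t))"
  have cp: "continuous_on S (p q)" for S q
    unfolding p_def by (intro continuous_intros continuous_on_apply_bcontfun)
  have ip: "p q integrable_on {x..y}" for x y q
    using cp by (rule integrable_continuous_real)
  have cu: "continuous_on {a..b} (u \<alpha> q)" for \<alpha> q
    unfolding u_def by (intro continuous_intros indefinite_integral_continuous_1 ip)
  have G: "G \<alpha> q absolutely_integrable_on {a..b}" for \<alpha> q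
  proof (rule measurable_bounded_by_integrable_imp_absolutely_integrable)
    show "G \<alpha> q \<in> borel_measurable (lebesgue_on {a..b})"
      unfolding G_def by (rule meas[OF cu cp])
    show "(\<lambda>t. m t + L * (\<bar>u \<alpha> q t\<bar> + \<bar>p q t\<bar>)) integrable_on {a..b}"
      by (intro integrable_add m integrable_continuous_real continuous_intros cu cp)
    fix t assume t: "t \<in> {a..b}"
    show "norm (G \<alpha> q t) \<le> m t + L * (\<bar>u \<alpha> q t\<bar> + \<bar>p q t\<bar>)"
      using lip[OF t, of "u \<alpha> q t" "p q t" 0 0] m(2)[OF t] unfolding G_def by simp
  qed auto
  have Gi: "G \<alpha> q integrable_on {a..x}" if "x \<in> {a..b}" for \<alpha> q x
    using absolutely_integrable_on_subset_real[OF G, of a x] that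
    by (auto simp: set_lebesgue_integral_eq_integral)
  define T where "T = (\<lambda>\<alpha> q t. exp (- (B * cl t)) * integral {a..cl t} (G \<alpha> q))"
  have cT: "continuous_on UNIV (T \<alpha> q)" for \<alpha> q
    unfolding T_def
    by (intro continuous_intros ccl continuous_on_compose2[OF indefinite_integral_continuous_1[OF Gi[of b]] ccl])
      (use cl ab in auto)
  have bT: "T \<alpha> q \<in> bcontfun" for \<alpha> q
  proof -
    have "continuous_on {a..b} (T \<alpha> q)" using continuous_on_subset[OF cT] by blast
    then have "bounded (T \<alpha> q ` {a..b})"
      using compact_continuous_image[of "{a..b}"] compact_imp_bounded by blast
    then obtain M where "\<forall>x\<in>T \<alpha> q ` {a..b}. norm x \<le> M" unfolding bounded_iff by blast
    then have M: "norm (T \<alpha> q t) \<le> M" if "t \<in> {a..b}" for t using that by blast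
    have "T \<alpha> q t = T \<alpha> q (cl t)" for t using clid[OF cl] by (simp add: T_def)
    then have "norm (T \<alpha> q t) \<le> M" for t using M[OF cl] by metis
    then show ?thesis using cT by (rule bcontfun_normI[rotated])
  qed
  define TT where "TT = (\<lambda>\<alpha> q. Bcontfun (T \<alpha> q))"
  have TT: "apply_bcontfun (TT \<alpha> q) = T \<alpha> q" for \<alpha> q
    unfolding TT_def using bT by (simp add: Bcontfun_inverse)
  have ud: "\<bar>u \<alpha> q t - u \<beta> q' t\<bar> \<le> \<bar>\<alpha> - \<beta>\<bar> + dist q q' * exp (B * t)" if "t \<in> {a..b}" for \<alpha> \<beta> q q' t
  proof -
    have "\<bar>integral {a..t} (p q) - integral {a..t} (p q')\<bar> = norm (integral {a..t} (\<lambda>x. p q x - p q' x))"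
      by (simp add: Henstock_Kurzweil_Integration.integral_diff ip)
    also have "\<dots> \<le> integral {a..t} (\<lambda>x. dist q q' * exp (B * x))"
    proof (rule integral_norm_bound_integral)
      fix x
      have "norm (p q x - p q' x) = \<bar>q x - q' x\<bar> * exp (B * x)"
        by (simp add: p_def abs_mult flip: right_diff_distrib)
      also have "\<dots> \<le> dist q q' * exp (B * x)"
        using dist_bounded[of q x q'] by (intro mult_right_mono) (auto simp: dist_real_def)
      finally show "norm (p q x - p q' x) \<le> dist q q' * exp (B * x)" .
    qed (auto intro!: integrable_continuous_real continuous_intros cp)
    also have "\<dots> = dist q q' * integral {a..t} (\<lambda>x. exp (B * x))" by simp
    also have "\<dots> \<le> dist q q' * exp (B * t)"
    proof (rule mult_left_mono)
      have "exp (B * t) / B \<le> exp (B * t)" using B by (simp add: field_simps)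
      then show "integral {a..t} (\<lambda>x. exp (B * x)) \<le> exp (B * t)"
        using integral_exp_le[of B a t] B that by auto
    qed simp
    finally show ?thesis unfolding u_def by linarith
  qed
  define C where "C = L * (b - a) * exp (- (B * a))"
  \<comment> \<open>Two different initial values are allowed: for equal ones this is the contraction
    property, for different ones it makes the fixed point Lipschitz in the initial value
    (\<open>Qd\<close>), which gives the continuity needed for shooting.\<close>
  have Td: "dist (TT \<alpha> q) (TT \<beta> q') \<le> C * \<bar>\<alpha> - \<beta>\<bar> + 1/2 * dist q q'" for \<alpha> \<beta> q q'
  proof (rule dist_bound)
    fix t
    define r where "r = cl t"
    have r: "r \<in> {a..b}" using cl by (simp add: r_def)
    have "norm (integral {a..r} (\<lambda>x. G \<alpha> q x - G \<beta> q' x))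
       \<le> integral {a..r} (\<lambda>x. L * \<bar>\<alpha> - \<beta>\<bar> + 2 * L * dist q q' * exp (B * x))"
    proof (rule integral_norm_bound_integral)
      show "(\<lambda>x. G \<alpha> q x - G \<beta> q' x) integrable_on {a..r}"
        using Gi[OF r] by (intro integrable_diff)
      show "(\<lambda>x. L * \<bar>\<alpha> - \<beta>\<bar> + 2 * L * dist q q' * exp (B * x)) integrable_on {a..r}"
        by (intro integrable_continuous_real continuous_intros)
      fix x assume "x \<in> {a..r}"
      then have x: "x \<in> {a..b}" using r by auto
      have "\<bar>p q x - p q' x\<bar> = \<bar>q x - q' x\<bar> * exp (B * x)"
        by (simp add: p_def abs_mult flip: right_diff_distrib)
      also have "\<dots> \<le> dist q q' * exp (B * x)"
        using dist_bounded[of q x q'] by (intro mult_right_mono) (auto simp: dist_real_def)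
      finally have "\<bar>u \<alpha> q x - u \<beta> q' x\<bar> + \<bar>p q x - p q' x\<bar> \<le> \<bar>\<alpha> - \<beta>\<bar> + 2 * (dist q q' * exp (B * x))"
        using ud[OF x, of \<alpha> q \<beta> q'] by linarith
      then have "L * (\<bar>u \<alpha> q x - u \<beta> q' x\<bar> + \<bar>p q x - p q' x\<bar>) \<le> L * (\<bar>\<alpha> - \<beta>\<bar> + 2 * (dist q q' * exp (B * x)))"
        using \<open>L \<ge> 0\<close> by (rule mult_left_mono)
      then show "norm (G \<alpha> q x - G \<beta> q' x) \<le> L * \<bar>\<alpha> - \<beta>\<bar> + 2 * L * dist q q' * exp (B * x)"
        using lip[OF x, of "u \<alpha> q x" "p q x" "u \<beta> q' x" "p q' x"] unfolding G_def by (simp add: algebra_simps)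
    qed
    also have "\<dots> = L * \<bar>\<alpha> - \<beta>\<bar> * (r - a) + 2 * L * dist q q' * integral {a..r} (\<lambda>x. exp (B * x))"
      using r by (subst Henstock_Kurzweil_Integration.integral_add)
        (auto intro!: integrable_continuous_real continuous_intros)
    also have "\<dots> \<le> L * \<bar>\<alpha> - \<beta>\<bar> * (r - a) + 2 * L * dist q q' * (exp (B * r) / B)"
      using integral_exp_le[of B a r] r B \<open>L \<ge> 0\<close> by (intro add_left_mono mult_left_mono) auto
    finally have I: "norm (integral {a..r} (\<lambda>x. G \<alpha> q x - G \<beta> q' x)) \<le> \<dots>" .
    have "dist (TT \<alpha> q t) (TT \<beta> q' t) = exp (- (B * r)) * norm (integral {a..r} (\<lambda>x. G \<alpha> q x - G \<beta> q' x))"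
      using Gi[OF r] by (simp add: TT T_def dist_real_def r_def[symmetric] abs_mult
          Henstock_Kurzweil_Integration.integral_diff flip: right_diff_distrib)
    also have "\<dots> \<le> exp (- (B * r)) * (L * \<bar>\<alpha> - \<beta>\<bar> * (r - a) + 2 * L * dist q q' * (exp (B * r) / B))"
      using I by (intro mult_left_mono) auto
    also have "\<dots> = exp (- (B * r)) * (L * (r - a)) * \<bar>\<alpha> - \<beta>\<bar> + 2 * (L / B) * dist q q'"
      by (simp add: algebra_simps exp_minus divide_simps)
    also have "\<dots> \<le> C * \<bar>\<alpha> - \<beta>\<bar> + 1/2 * dist q q'"
    proof (intro add_mono mult_right_mono)
      have "exp (- (B * r)) * (L * (r - a)) \<le> exp (- (B * a)) * (L * (b - a))"
        using r B \<open>L \<ge> 0\<close> by (intro mult_mono) auto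
      then show "exp (- (B * r)) * (L * (r - a)) \<le> C" by (simp add: C_def mult_ac)
    qed (use B in auto)
    finally show "dist (TT \<alpha> q t) (TT \<beta> q' t) \<le> C * \<bar>\<alpha> - \<beta>\<bar> + 1/2 * dist q q'" .
  qed
  have "\<exists>!q. TT \<alpha> q = q" for \<alpha>
    by (rule banach_fix_type[of "1/2"]) (use Td[of \<alpha> _ \<alpha>] in auto)
  then obtain Q where Q: "\<And>\<alpha>. TT \<alpha> (Q \<alpha>) = Q \<alpha>" by metis
  have Qd: "dist (Q \<alpha>) (Q \<beta>) \<le> 2 * C * \<bar>\<alpha> - \<beta>\<bar>" for \<alpha> \<beta>
    using Td[of \<alpha> "Q \<alpha>" \<beta> "Q \<beta>"] by (simp add: Q)
  show thesis
  proof (rule that[of "\<lambda>\<alpha>. u \<alpha> (Q \<alpha>)" "\<lambda>\<alpha>. p (Q \<alpha>)"])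
    fix \<alpha>
    show "primitive_on a b (u \<alpha> (Q \<alpha>)) (p (Q \<alpha>))"
      by (auto simp: primitive_on_def u_def intro!: absolutely_integrable_continuous_real cp)
    have pT: "p (Q \<alpha>) t = integral {a..t} (G \<alpha> (Q \<alpha>))" if "t \<in> {a..b}" for t
    proof -
      have "Q \<alpha> t = T \<alpha> (Q \<alpha>) t" using Q TT by metis
      then show ?thesis unfolding p_def T_def clid[OF that] by (simp add: exp_minus)
    qed
    show "primitive_on a b (p (Q \<alpha>)) (\<lambda>t. F t (u \<alpha> (Q \<alpha>) t) (p (Q \<alpha>) t))"
      using G[of \<alpha> "Q \<alpha>"] pT ab unfolding G_def by (auto simp: primitive_on_def)
    show "u \<alpha> (Q \<alpha>) a = \<alpha>" by (simp add: u_def)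
    show "p (Q \<alpha>) a = 0" using pT[of a] ab by simp
  next
    have "\<bar>u \<alpha> (Q \<alpha>) b - u \<beta> (Q \<beta>) b\<bar> \<le> (1 + 2 * C * exp (B * b)) * \<bar>\<alpha> - \<beta>\<bar>" for \<alpha> \<beta>
    proof -
      have "dist (Q \<alpha>) (Q \<beta>) * exp (B * b) \<le> 2 * C * \<bar>\<alpha> - \<beta>\<bar> * exp (B * b)"
        using Qd by (intro mult_right_mono) auto
      moreover have "\<bar>u \<alpha> (Q \<alpha>) b - u \<beta> (Q \<beta>) b\<bar> \<le> \<bar>\<alpha> - \<beta>\<bar> + dist (Q \<alpha>) (Q \<beta>) * exp (B * b)"
        using ud[of b \<alpha> "Q \<alpha>" \<beta> "Q \<beta>"] ab by auto
      moreover have "(1 + 2 * C * exp (B * b)) * \<bar>\<alpha> - \<beta>\<bar> = \<bar>\<alpha> - \<beta>\<bar> + 2 * C * \<bar>\<alpha> - \<beta>\<bar> * exp (B * b)"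
        by (simp add: algebra_simps)
      ultimately show ?thesis by linarith
    qed
    moreover have "0 \<le> C" using \<open>L \<ge> 0\<close> ab by (simp add: C_def)
    ultimately have "(1 + 2 * C * exp (B * b))-lipschitz_on UNIV (\<lambda>\<alpha>. u \<alpha> (Q \<alpha>) b)"
      by (intro lipschitz_onI) (auto simp: dist_real_def)
    then show "continuous_on UNIV (\<lambda>\<alpha>. u \<alpha> (Q \<alpha>) b)" by (rule lipschitz_on_continuous_on)
  qed
qed

section \<open>The radial Pucci operator\<close>

definition pw :: "real \<Rightarrow> real \<Rightarrow> real" where
  "pw s a = \<bar>a\<bar> powr (s - 1) * a"

lemma pw_minus: "pw s (- a) = - pw s a"
  by (simp add: pw_def)

lemma pw_nonneg: "0 \<le> a \<Longrightarrow> pw s a = a powr s"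
  by (cases "a = 0") (auto simp: pw_def powr_diff)

lemma abs_pw: "\<bar>pw s a\<bar> = \<bar>a\<bar> powr s"
  using pw_nonneg[of "\<bar>a\<bar>" s] by (simp add: pw_def abs_mult)

lemma pw_0 [simp]: "pw s 0 = 0"
  by (simp add: pw_def)

lemma pw_mono:
  assumes "a \<le> b" "0 < s"
  shows "pw s a \<le> pw s b"
proof -
  consider "0 \<le> a" | "a < 0" "0 \<le> b" | "b < 0" using assms by linarith
  then show ?thesis
  proof cases
    case 1
    then show ?thesis using assms by (simp add: pw_nonneg powr_mono2)
  next
    case 2
    then have "pw s a \<le> 0" "0 \<le> pw s b" by (auto simp: pw_def mult_le_0_iff)
    then show ?thesis by simp
  next
    case 3
    then have "pw s (- b) \<le> pw s (- a)" using assms by (simp add: pw_nonneg powr_mono2)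
    then show ?thesis by (simp add: pw_minus)
  qed
qed

lemma pw_has_derivative:
  assumes "1 < s"
  shows "(pw s has_real_derivative s * \<bar>a\<bar> powr (s - 1)) (at a)"
proof -
  consider "0 < a" | "a = 0" | "a < 0" by linarith
  then show ?thesis
  proof cases
    case 1
    then have "((\<lambda>a. a powr s) has_real_derivative s * \<bar>a\<bar> powr (s - 1)) (at a)"
      by (auto intro!: derivative_eq_intros)
    then show ?thesis
      by (rule has_field_derivative_transform_within_open[of _ _ _ "{0<..}"]) (use 1 in \<open>auto simp: pw_nonneg\<close>)
  next
    case 2
    have "((\<lambda>h. \<bar>h\<bar> powr (s - 1)) \<longlongrightarrow> 0) (at (0::real))"
      using assms by (intro tendsto_zero_powrI[of _ _ _ "s - 1"])
        (auto intro!: tendsto_eq_intros tendsto_rabs_zero)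
    then have "((\<lambda>h. (pw s (0 + h) - pw s 0) / h) \<longlongrightarrow> 0) (at 0)"
      by (rule Lim_transform_eventually) (auto simp: eventually_at_filter pw_def)
    then show ?thesis using 2 assms by (simp add: DERIV_def)
  next
    case 3
    then have "((\<lambda>a. - ((- a) powr s)) has_real_derivative s * \<bar>a\<bar> powr (s - 1)) (at a)"
      by (auto intro!: derivative_eq_intros)
    then show ?thesis
    proof (rule has_field_derivative_transform_within_open[of _ _ _ "{..<0}"])
      fix x :: real assume "x \<in> {..<0}"
      then show "- ((- x) powr s) = pw s x" using pw_nonneg[of "- x" s] by (simp add: pw_minus)
    qed (use 3 in auto)
  qed
qed

lemma pw_continuous [continuous_intros]:
  assumes "1 < s" "continuous_on S f"
  shows "continuous_on S (\<lambda>x. pw s (f x))"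
proof -
  have "continuous_on UNIV (pw s)"
    using pw_has_derivative[OF assms(1)] by (auto intro!: continuous_at_imp_continuous_on DERIV_isCont)
  then show ?thesis by (rule continuous_on_compose2[OF _ assms(2)]) auto
qed

lemma pw_lipschitz:
  assumes "1 < s" "\<bar>a\<bar> \<le> M" "\<bar>b\<bar> \<le> M"
  shows "\<bar>pw s a - pw s b\<bar> \<le> s * M powr (s - 1) * \<bar>a - b\<bar>"
proof -
  have "norm (pw s a - pw s b) \<le> s * M powr (s - 1) * norm (a - b)"
  proof (rule field_differentiable_bound[of "{-M..M}" _ "\<lambda>a. s * \<bar>a\<bar> powr (s - 1)"])
    show "(pw s has_field_derivative s * \<bar>z\<bar> powr (s - 1)) (at z within {-M..M})" for z
      using pw_has_derivative[OF assms(1)] by (rule has_field_derivative_at_within)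
    show "norm (s * \<bar>z\<bar> powr (s - 1)) \<le> s * M powr (s - 1)" if "z \<in> {-M..M}" for z
      using that assms by (auto simp: abs_mult intro!: mult_left_mono powr_mono2)
  qed (use assms in auto)
  then show ?thesis by simp
qed

text \<open>For arguments of equal sign, superadditivity of the power on the nonnegative reals even
  gives \<open>pw s d\<close>. For opposite signs only one of u and -v is sure to be at least half
  of the gap; this is the origin of d / 2 and of the factor 2 powr s in the barrier
  constants.\<close>

lemma pw_superadditive:
  assumes "1 < s" "0 < d" "d \<le> u - v"
  shows "pw s (d / 2) \<le> pw s u - pw s v"
proof -
  have super: "pw s x + pw s d \<le> pw s (x + d)" if "0 \<le> x" for x
  proof -
    have "pw s (x + d) = x * (x + d) powr (s - 1) + d * (x + d) powr (s - 1)"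
      using that assms by (simp add: pw_def algebra_simps)
    also have "\<dots> \<ge> x * x powr (s - 1) + d * d powr (s - 1)"
      using that assms by (intro add_mono mult_left_mono powr_mono2) auto
    finally show ?thesis using that assms by (simp add: pw_def mult.commute)
  qed
  have half: "pw s (d / 2) \<le> pw s d" using assms by (intro pw_mono) auto
  have d0: "0 \<le> pw s (d / 2)" using assms by (simp add: pw_def)
  consider "0 \<le> v" | "u \<le> 0" | "v < 0" "0 < u" by linarith
  then show ?thesis
  proof cases
    case 1
    have "pw s (v + d) \<le> pw s u" using assms by (intro pw_mono) auto
    then show ?thesis using super[OF 1] half by linarith
  next
    case 2
    then have "pw s (- u) + pw s d \<le> pw s (- u + d)" by (intro super) simp
    moreover have "pw s (- u + d) \<le> pw s (- v)" using assms by (intro pw_mono) auto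
    ultimately show ?thesis using half by (simp add: pw_minus)
  next
    case 3
    have "0 \<le> pw s u" "0 \<le> - pw s v" using 3 by (auto simp: pw_def mult_le_0_iff)
    moreover have "d / 2 \<le> u \<or> d / 2 \<le> - v" using assms by linarith
    moreover have "d / 2 \<le> u \<Longrightarrow> pw s (d / 2) \<le> pw s u" using assms by (intro pw_mono) auto
    moreover have "d / 2 \<le> - v \<Longrightarrow> pw s (d / 2) \<le> pw s (- v)" using assms by (intro pw_mono) auto
    ultimately show ?thesis using pw_minus[of s v] by auto
  qed
qed

lemma absolutely_integrable_minus_real:
  fixes g :: "real \<Rightarrow> real"
  shows "g absolutely_integrable_on S \<Longrightarrow> (\<lambda>x. - g x) absolutely_integrable_on S"
  using set_integrable_mult_right[of "-1" lebesgue S g] by simp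

lemma primitive_on_minus:
  assumes "primitive_on a b u g"
  shows "primitive_on a b (\<lambda>x. - u x) (\<lambda>x. - g x)"
  using assms unfolding primitive_on_def by (auto simp: absolutely_integrable_minus_real)

lemma primitive_on_subtract:
  assumes "primitive_on a b u g" "primitive_on a b v h"
  shows "primitive_on a b (\<lambda>x. u x - v x) (\<lambda>x. g x - h x)"
  unfolding primitive_on_def
proof (intro conjI ballI)
  show "(\<lambda>x. g x - h x) absolutely_integrable_on {a..b}"
    using assms by (intro set_integral_diff(1)) (auto simp: primitive_on_def)
  fix x assume "x \<in> {a..b}"
  then have "((\<lambda>x. g x - h x) has_integral (u x - u a) - (v x - v a)) {a..x}"
    by (intro has_integral_diff primitive_on_has_integral[OF assms(1)] primitive_on_has_integral[OF assms(2)]) auto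
  then show "integral {a..x} (\<lambda>x. g x - h x) = u x - v x - (u a - v a)" by (simp add: integral_unique)
qed

text \<open>n stands for the space dimension minus 1, the multiplicity of the eigenvalue u' / r of
  the Hessian.\<close>

locale pucci =
  fixes lam Lam s n :: real
  assumes lam: "0 < lam" and lamLam: "lam \<le> Lam" and s: "1 < s" and n: "0 \<le> n"
begin

abbreviation "th \<equiv> theta lam Lam"

lemma Lam: "0 < Lam" using lam lamLam by simp

lemma th_bounds: "lam \<le> th x" "th x \<le> Lam" "0 < th x" "th x \<noteq> 0"
  using lam lamLam by (auto simp: theta_def)

text \<open>\<open>th x * x\<close> is the maximum of c * x over the coefficients c in [lam, Lam].
  Subadditivity, the Lipschitz bound and the linearization below all come from this.\<close>

lemma th_ge: "lam \<le> c \<Longrightarrow> c \<le> Lam \<Longrightarrow> c * x \<le> th x * x"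
  by (auto simp: theta_def intro: mult_right_mono mult_right_mono_neg)

lemma th_ge_th: "th y * x \<le> th x * x"
  by (rule th_ge) (use th_bounds in auto)

lemma th_subadd: "th (x + y) * (x + y) \<le> th x * x + th y * y"
  using th_ge_th[of "x + y" x] th_ge_th[of "x + y" y] by (simp add: distrib_left)

lemma th_mult_lipschitz: "\<bar>th x * x - th y * y\<bar> \<le> Lam * \<bar>x - y\<bar>"
proof -
  have "th z * z \<le> Lam * \<bar>z\<bar>" for z
  proof (cases "0 \<le> z")
    case False
    then have "lam * z \<le> 0" "0 \<le> Lam * \<bar>z\<bar>" using lam Lam by (auto simp: mult_le_0_iff)
    then show ?thesis using False by (simp add: theta_def)
  qed (simp add: theta_def)
  moreover have "th x * x - th y * y \<le> th (x - y) * (x - y)" for x y using th_subadd[of "x - y" y] by simp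
  ultimately have "th x * x - th y * y \<le> Lam * \<bar>x - y\<bar>" for x y by (meson order_trans)
  from this[of x y] this[of y x] show ?thesis by (simp add: abs_minus_commute abs_le_iff)
qed

text \<open>The inverse of \<open>th x * x\<close>. It preserves the sign, so
  \<open>th (K w) = th w\<close>; therefore Theta, which is defined from the lower-order terms, is
  the coefficient belonging to u''.\<close>

definition K :: "real \<Rightarrow> real" where "K w = w / th w"

lemma th_K: "th (K w) = th w" using lam Lam by (auto simp: K_def theta_def zero_le_divide_iff)

lemma th_K_mult: "th (K w) * K w = w"
  using th_bounds[of w] by (simp add: th_K) (simp add: K_def)

text \<open>K is piecewise linear with the slopes 1 / Lam and 1 / lam, both positive and at most 1 /
  lam.\<close>

lemma K_lipschitz: "\<bar>K x - K y\<bar> \<le> \<bar>x - y\<bar> / lam"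
proof -
  have le: "w / Lam \<le> w / lam" if "0 \<le> w" for w
    using that lam lamLam by (intro divide_left_mono) auto
  have *: "K x - K y \<le> (x - y) / lam" if "y \<le> x" for x y
  proof -
    consider "0 \<le> y" | "x < 0" | "y < 0" "0 \<le> x" by linarith
    then show ?thesis
    proof cases
      case 1 then show ?thesis using le[of "x - y"] that by (simp add: K_def theta_def diff_divide_distrib)
    next
      case 2 then show ?thesis using that by (simp add: K_def theta_def diff_divide_distrib)
    next
      case 3 then show ?thesis using le[of x] by (simp add: K_def theta_def diff_divide_distrib)
    qed
  qed
  have mono: "K y \<le> K x" if "y \<le> x" for x y
  proof -
    consider "0 \<le> y" | "x < 0" | "y < 0" "0 \<le> x" by linarith
    then show ?thesis
    proof cases
      case 3
      then have "y / lam \<le> 0" "0 \<le> x / Lam" using lam Lam by (auto simp: divide_le_0_iff)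
      then show ?thesis using 3 by (simp add: K_def theta_def)
    qed (use that lam Lam in \<open>auto simp: K_def theta_def intro: divide_right_mono\<close>)
  qed
  show ?thesis
  proof (cases "y \<le> x")
    case True then show ?thesis using *[OF True] mono[OF True] by simp
  next
    case False then have "x \<le> y" by simp
    then show ?thesis using *[of x y] mono[of x y] by (simp add: abs_minus_commute)
  qed
qed

lemma K_continuous: "continuous_on UNIV K"
proof -
  have "(1 / lam)-lipschitz_on UNIV K"
    using K_lipschitz lam by (intro lipschitz_onI) (auto simp: dist_real_def)
  then show ?thesis by (rule lipschitz_on_continuous_on)
qed

lemma th_mult_continuous: "continuous_on UNIV (\<lambda>p. th p * p)"
proof -
  have "Lam-lipschitz_on UNIV (\<lambda>p. th p * p)"
    using th_mult_lipschitz Lam by (intro lipschitz_onI) (auto simp: dist_real_def)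
  then show ?thesis by (rule lipschitz_on_continuous_on)
qed

lemma abs_th_mult: "\<bar>th p * p\<bar> \<le> Lam * \<bar>p\<bar>"
  using th_mult_lipschitz[of p 0] by simp

lemma abs_K: "\<bar>K w\<bar> \<le> \<bar>w\<bar> / lam"
  using K_lipschitz[of w 0] by (simp add: K_def)

text \<open>The Hessian of a radial function has the eigenvalue q = u'' once and p / t = u' / t with
  multiplicity n. For t > 0 the sign of p / t is that of p, so \<open>th\<close> may be evaluated at
  p.\<close>

definition pucci_op :: "real \<Rightarrow> real \<Rightarrow> real \<Rightarrow> real" where
  "pucci_op t p q = th q * q + n / t * (th p * p)"

lemma pucci_op_subadd:
  assumes "0 < t"
  shows "pucci_op t (p + p') (q + q') \<le> pucci_op t p q + pucci_op t p' q'"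
proof -
  have "n / t * (th (p + p') * (p + p')) \<le> n / t * (th p * p + th p' * p')"
    using assms n by (intro mult_left_mono th_subadd) auto
  then show ?thesis unfolding pucci_op_def using th_subadd[of q q'] by (simp add: algebra_simps)
qed

lemma pucci_op_diff:
  assumes "0 < t"
  shows "pucci_op t p q - pucci_op t p' q' \<le> pucci_op t (p - p') (q - q')"
  using pucci_op_subadd[OF assms, of "p - p'" p' "q - q'" q'] by simp

text \<open>Bellman form: the operator is the supremum of its linearizations.\<close>

lemma pucci_op_linearize:
  assumes "0 < t"
  shows "pucci_op t p q - pucci_op t p' q' \<le> th q * (q - q') + n / t * (th p * (p - p'))"
proof -
  have "n / t * (th p * p') \<le> n / t * (th p' * p')"
    using assms n by (intro mult_left_mono th_ge_th) auto
  then show ?thesis unfolding pucci_op_def using th_ge_th[of q q'] by (simp add: algebra_simps)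
qed

text \<open>The coefficient of u' after division by that of u''. It equals (N(t) - 1) / t for the
  variable dimension N(t).\<close>

definition drift :: "real \<Rightarrow> real \<Rightarrow> real \<Rightarrow> real" where
  "drift t p q = th p / th q * n / t"

text \<open>The upper bound makes the drift integrable away from 0; the lower bound compares every
  weight with a power of t.\<close>

lemma drift_bounds:
  assumes "0 < t"
  shows "lam / Lam * n / t \<le> drift t p q" "drift t p q \<le> Lam / lam * n / t" "0 \<le> drift t p q"
proof -
  have "lam / Lam \<le> th p / th q" "th p / th q \<le> Lam / lam"
    using th_bounds[of p] th_bounds[of q] lam Lam by (auto intro!: frac_le)
  then show "lam / Lam * n / t \<le> drift t p q" "drift t p q \<le> Lam / lam * n / t"
    unfolding drift_def using mult_right_mono[of _ _ "n / t"] assms n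
    by (simp_all only: times_divide_eq_right divide_nonneg_pos)
  show "0 \<le> drift t p q" using th_bounds[of p] th_bounds[of q] n assms by (simp add: drift_def)
qed

lemma drift_nonneg_of_op:
  assumes "0 \<le> th q * q' + n / t * (th p * p')"
  shows "0 \<le> q' + drift t p q * p'"
proof -
  have "th q * q' + n / t * (th p * p') = th q * (q' + drift t p q * p')"
    using th_bounds[of q] by (simp add: drift_def field_simps)
  then show ?thesis using assms th_bounds(3)[of q] by (simp add: zero_le_mult_iff)
qed

lemma drift_measurable:
  assumes "p \<in> borel_measurable (lebesgue_on S)" "q \<in> borel_measurable (lebesgue_on S)"
  shows "(\<lambda>t. drift t (p t) (q t)) \<in> borel_measurable (lebesgue_on S)"
proof -
  have "th \<in> borel_measurable borel" unfolding theta_def by measurable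
  note m = this
  have th: "(\<lambda>t. th (g t)) \<in> borel_measurable (lebesgue_on S)" if "g \<in> borel_measurable (lebesgue_on S)" for g
    by (rule measurable_compose[OF that m])
  have "(\<lambda>t. t) \<in> borel_measurable lebesgue" by (intro measurable_completion) simp
  then have "(\<lambda>t. t) \<in> borel_measurable (lebesgue_on S)" by (rule measurable_restrict_space1)
  then show ?thesis unfolding drift_def
    using th[OF assms(1)] th[OF assms(2)] by (intro borel_measurable_divide borel_measurable_times borel_measurable_const)
qed

lemma drift_absolutely_integrable:
  assumes "0 < a" "p \<in> borel_measurable (lebesgue_on {a..b})" "q \<in> borel_measurable (lebesgue_on {a..b})"
  shows "(\<lambda>t. drift t (p t) (q t)) absolutely_integrable_on {a..b}"
proof (rule measurable_bounded_by_integrable_imp_absolutely_integrable[OF drift_measurable[OF assms(2,3)]])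
  show "(\<lambda>t. Lam / lam * n / t) integrable_on {a..b}"
    using assms(1) by (intro integrable_continuous_real continuous_intros) auto
  show "norm (drift t (p t) (q t)) \<le> Lam / lam * n / t" if "t \<in> {a..b}" for t
    using drift_bounds[of t "p t" "q t"] that assms(1) by auto
qed auto

lemma absolutely_integrable_imp_measurable_on:
  fixes g :: "real \<Rightarrow> real"
  assumes "g absolutely_integrable_on {a..b}"
  shows "g \<in> borel_measurable (lebesgue_on {a..b})"
  using assms absolutely_integrable_measurable[of "{a..b}" g] by simp

lemma primitive_on_measurable:
  assumes "primitive_on a b u g"
  shows "u \<in> borel_measurable (lebesgue_on {a..b})"
  using continuous_imp_measurable_on_sets_lebesgue[OF primitive_on_continuous[OF assms]] by simp

text \<open>Dividing the nonlinear inequality by \<open>th (D2 t)\<close> makes it linear, with the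
  drift formed from D itself, so the maximum principle applies.\<close>

lemma comparison_right:
  assumes "0 < a" "primitive_on a b D D1" "primitive_on a b D1 D2" "negligible N"
    and "\<And>t. t \<in> {a..b} - N \<Longrightarrow> 0 < D t \<Longrightarrow> 0 \<le> pucci_op t (D1 t) (D2 t)"
    and "a \<le> r0" "r0 \<le> r" "r \<le> b" "0 < D r0" "0 \<le> D1 r0"
  shows "D r0 \<le> D r"
proof (rule max_principle_right[OF assms(2,3) _ assms(4) _ assms(6-10)])
  show "(\<lambda>t. drift t (D1 t) (D2 t)) absolutely_integrable_on {a..b}"
    using assms by (intro drift_absolutely_integrable primitive_on_measurable absolutely_integrable_imp_measurable_on)
      (auto simp: primitive_on_def)
  show "0 \<le> D2 t + drift t (D1 t) (D2 t) * D1 t" if "t \<in> {a..b} - N" "0 < D t" for t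
    using assms(5)[OF that] by (intro drift_nonneg_of_op) (simp add: pucci_op_def)
qed

lemma comparison_left:
  assumes "0 < a" "primitive_on a b D D1" "primitive_on a b D1 D2" "negligible N"
    and "\<And>t. t \<in> {a..b} - N \<Longrightarrow> 0 < D t \<Longrightarrow> 0 \<le> pucci_op t (D1 t) (D2 t)"
    and "a \<le> r" "r \<le> r0" "r0 \<le> b" "0 < D r0" "D1 r0 < 0"
  shows "D r0 \<le> D r \<and> D1 r < 0"
proof -
  have c: "(\<lambda>t. drift t (D1 t) (D2 t)) absolutely_integrable_on {a..b}"
    using assms by (intro drift_absolutely_integrable primitive_on_measurable absolutely_integrable_imp_measurable_on)
      (auto simp: primitive_on_def)
  have op: "0 \<le> D2 t + drift t (D1 t) (D2 t) * D1 t" if "t \<in> {a..b} - N" "0 < D t" for t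
    using assms(5)[OF that] by (intro drift_nonneg_of_op) (simp add: pucci_op_def)
  note L = max_principle_left[OF assms(2,3) c assms(4) op assms(6-9) less_imp_le[OF assms(10)]]
  have "D1 r \<le> exp (integral {r..r0} (\<lambda>t. drift t (D1 t) (D2 t))) * D1 r0" by (rule L(2))
  also have "\<dots> < 0" using assms(10) by (simp add: mult_pos_neg)
  finally show ?thesis using L(1) by simp
qed

text \<open>The equation solved for u'', with a and p for the values of u and u'. The absorption g
  is a parameter because existence is first shown for a truncated power.\<close>

definition rhs :: "(real \<Rightarrow> real) \<Rightarrow> (real \<Rightarrow> real) \<Rightarrow> real \<Rightarrow> real \<Rightarrow> real \<Rightarrow> real" where
  "rhs g f t a p = K (- th p * n * (p / t) + g a - f t)"

lemma pucci_op_rhs: "pucci_op t p (rhs g f t a p) = g a - f t"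
  unfolding pucci_op_def rhs_def th_K_mult by simp

text \<open>The equation after division by the coefficient of u''. Multiplied by the weight, it
  becomes the divergence form.\<close>

lemma rhs_drift:
  "rhs (pw s) f t a p + drift t p (rhs (pw s) f t a p) * p = (pw s a - f t) / th (rhs (pw s) f t a p)"
proof -
  let ?q = "rhs (pw s) f t a p"
  have "th ?q * (?q + drift t p ?q * p) = pw s a - f t"
    using pucci_op_rhs[of t p "pw s" f a] th_bounds[of ?q] by (simp add: pucci_op_def drift_def field_simps)
  then show ?thesis using th_bounds[of ?q] by (simp add: field_simps)
qed

definition sol_on :: "(real \<Rightarrow> real) \<Rightarrow> real \<Rightarrow> real \<Rightarrow> (real \<Rightarrow> real) \<Rightarrow> (real \<Rightarrow> real) \<Rightarrow> bool" where
  "sol_on f a b u p \<longleftrightarrow>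
     primitive_on a b u p \<and> primitive_on a b p (\<lambda>t. rhs (pw s) f t (u t) (p t))"

lemma rhs_measurable:
  assumes "v \<in> borel_measurable (lebesgue_on S)" "p \<in> borel_measurable (lebesgue_on S)"
    "f \<in> borel_measurable (lebesgue_on S)" "continuous_on UNIV g"
  shows "(\<lambda>t. rhs g f t (v t) (p t)) \<in> borel_measurable (lebesgue_on S)"
proof -
  have th: "th \<in> borel_measurable borel" unfolding theta_def by measurable
  have K: "K \<in> borel_measurable borel" by (rule borel_measurable_continuous_onI[OF K_continuous])
  have g: "g \<in> borel_measurable borel" by (rule borel_measurable_continuous_onI[OF assms(4)])
  have "(\<lambda>t. t) \<in> borel_measurable lebesgue" by (intro measurable_completion) simp
  then have id: "(\<lambda>t. t) \<in> borel_measurable (lebesgue_on S)" by (rule measurable_restrict_space1)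
  have "(\<lambda>t. - th (p t) * n * (p t / t) + g (v t) - f t) \<in> borel_measurable (lebesgue_on S)"
    using measurable_compose[OF assms(2) th] measurable_compose[OF assms(1) g] assms(2,3) id
    by (intro borel_measurable_diff borel_measurable_add borel_measurable_times borel_measurable_divide
        borel_measurable_uminus borel_measurable_const)
  then show ?thesis unfolding rhs_def by (rule measurable_compose[OF _ K])
qed

lemma rhs_bound:
  assumes "0 < t"
  shows "\<bar>rhs g f t a p\<bar> \<le> (Lam * n * \<bar>p\<bar> / t + \<bar>g a\<bar> + \<bar>f t\<bar>) / lam"
proof -
  have "\<bar>- th p * n * (p / t)\<bar> = \<bar>th p * p\<bar> * (n / t)" using assms n by (simp add: abs_mult)
  also have "\<dots> \<le> Lam * \<bar>p\<bar> * (n / t)" using abs_th_mult[of p] assms n by (intro mult_right_mono) auto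
  finally have "\<bar>- th p * n * (p / t)\<bar> \<le> Lam * n * \<bar>p\<bar> / t" by (simp add: mult_ac)
  then have "\<bar>- th p * n * (p / t) + g a - f t\<bar> \<le> Lam * n * \<bar>p\<bar> / t + \<bar>g a\<bar> + \<bar>f t\<bar>" by linarith
  then show ?thesis unfolding rhs_def
    using abs_K[of "- th p * n * (p / t) + g a - f t"] lam by (meson divide_right_mono less_imp_le order_trans)
qed

text \<open>z'' = -|f| / lam and z' is its integral from a, so both are nonpositive; the operator
  then acts with the coefficient lam and yields at most -|f|. The slope vanishes at a to match the
  shooting problem.\<close>

lemma linear_supersolution:
  assumes a: "0 < a" "a \<le> b" and f: "f absolutely_integrable_on {a..b}"
  obtains z z1 where "primitive_on a b z z1" "primitive_on a b z1 (\<lambda>t. - (\<bar>f t\<bar> / lam))"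
    "z1 a = 0" "z b = 0" "\<And>r. r \<in> {a..b} \<Longrightarrow> 0 \<le> z r" "\<And>r. r \<in> {a..b} \<Longrightarrow> z r \<le> z a"
    "\<And>t. t \<in> {a..b} \<Longrightarrow> pucci_op t (z1 t) (- (\<bar>f t\<bar> / lam)) \<le> - \<bar>f t\<bar>"
proof -
  define Z1 where "Z1 = (\<lambda>r. integral {a..r} (\<lambda>t. \<bar>f t\<bar> / lam))"
  have fa: "(\<lambda>t. \<bar>f t\<bar> / lam) absolutely_integrable_on {a..b}"
    using set_integrable_abs[OF f] by simp
  then have PZ1: "primitive_on a b Z1 (\<lambda>t. \<bar>f t\<bar> / lam)"
    unfolding Z1_def by (rule primitive_on_indefinite)
  have Z1n: "0 \<le> Z1 r" if "r \<in> {a..b}" for r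
    unfolding Z1_def using lam absolutely_integrable_on_subset_real[OF fa, of a r] that
    by (intro Henstock_Kurzweil_Integration.integral_nonneg) (auto simp: set_lebesgue_integral_eq_integral)
  have Z1i: "Z1 absolutely_integrable_on {a..b}"
    by (rule absolutely_integrable_continuous_real[OF primitive_on_continuous[OF PZ1]])
  define z where "z = (\<lambda>r. integral {a..b} Z1 - integral {a..r} Z1)"
  have Pz: "primitive_on a b z (\<lambda>r. - Z1 r)"
    unfolding primitive_on_def z_def using Z1i by (auto simp: absolutely_integrable_minus_real)
  have PZ1': "primitive_on a b (\<lambda>r. - Z1 r) (\<lambda>t. - (\<bar>f t\<bar> / lam))"
    using PZ1 fa unfolding primitive_on_def by (auto simp: absolutely_integrable_minus_real)
  have zb: "z b = 0" by (simp add: z_def)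
  have z_nonneg: "0 \<le> z r" "z r \<le> z a" if "r \<in> {a..b}" for r
  proof -
    have "integral {r..b} (\<lambda>r. - Z1 r) = z b - z r" "integral {a..r} (\<lambda>r. - Z1 r) = z r - z a"
      using primitive_on_diff[OF Pz] that by auto
    moreover have "0 \<le> integral {r..b} Z1" "0 \<le> integral {a..r} Z1"
      using Z1n that absolutely_integrable_on_subset_real[OF Z1i]
      by (auto intro!: Henstock_Kurzweil_Integration.integral_nonneg simp: set_lebesgue_integral_eq_integral)
    ultimately show "0 \<le> z r" "z r \<le> z a" using zb by auto
  qed
  have op_z: "pucci_op t (- Z1 t) (- (\<bar>f t\<bar> / lam)) \<le> - \<bar>f t\<bar>" if "t \<in> {a..b}" for t
  proof -
    have "th (- (\<bar>f t\<bar> / lam)) * (- (\<bar>f t\<bar> / lam)) = - \<bar>f t\<bar>"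
      using lam by (auto simp: theta_def divide_le_0_iff)
    moreover have "n / t * (th (- Z1 t) * (- Z1 t)) \<le> 0"
      using n that a Z1n[OF that] th_bounds(3)[of "- Z1 t"] by (intro mult_nonneg_nonpos mult_nonneg_nonpos) auto
    ultimately show ?thesis by (simp add: pucci_op_def)
  qed
  show thesis
    by (rule that[OF Pz PZ1']) (use zb z_nonneg op_z in \<open>auto simp: Z1_def\<close>)
qed

lemma pucci_op_minus:
  assumes "0 < t"
  shows "- pucci_op t p q \<le> pucci_op t (- p) (- q)"
  using pucci_op_subadd[OF assms, of p "- p" q "- q"] by (simp add: pucci_op_def)

text \<open>Shooting: the initial value \<alpha> at a, with slope 0, is adjusted until the solution
  vanishes at b. Truncating the power at height M = z a makes the equation globally Lipschitz;
  comparison with z and -z then shows that the solution found stays where the truncation changes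
  nothing.\<close>

theorem exists_solution_bounded_interval:
  assumes a: "0 < a" "a \<le> b" and f: "f absolutely_integrable_on {a..b}"
  shows "\<exists>u p. sol_on f a b u p \<and> p a = 0"
proof -
  have fa: "(\<lambda>t. \<bar>f t\<bar> / lam) absolutely_integrable_on {a..b}"
    using set_integrable_abs[OF f] by simp
  obtain z z1 where Pz: "primitive_on a b z z1" "primitive_on a b z1 (\<lambda>t. - (\<bar>f t\<bar> / lam))"
    and z1a: "z1 a = 0" and zb: "z b = 0"
    and z_nonneg: "\<And>r. r \<in> {a..b} \<Longrightarrow> 0 \<le> z r" "\<And>r. r \<in> {a..b} \<Longrightarrow> z r \<le> z a"
    and op_z: "\<And>t. t \<in> {a..b} \<Longrightarrow> pucci_op t (z1 t) (- (\<bar>f t\<bar> / lam)) \<le> - \<bar>f t\<bar>"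
    using linear_supersolution[OF a f] by blast
  define M where "M = z a"
  have M: "0 \<le> M" using z_nonneg[of a] a by (simp add: M_def)
  define g where "g = (\<lambda>x. pw s (max (- M) (min x M)))"
  have gc: "continuous_on UNIV g" unfolding g_def by (intro continuous_intros s)
  have g0: "g 0 = 0" using M by (simp add: g_def)
  have g_sign: "0 \<le> g x" if "0 \<le> x" for x using that M by (simp add: g_def pw_def)
  have g_sign': "g x \<le> 0" if "x \<le> 0" for x using that M by (auto simp: g_def pw_def mult_le_0_iff)
  define Lg where "Lg = s * M powr (s - 1)"
  have g_lip: "\<bar>g x - g y\<bar> \<le> Lg * \<bar>x - y\<bar>" for x y
  proof -
    have "\<bar>g x - g y\<bar> \<le> Lg * \<bar>max (- M) (min x M) - max (- M) (min y M)\<bar>"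
      unfolding g_def Lg_def using M by (intro pw_lipschitz s) auto
    also have "\<dots> \<le> Lg * \<bar>x - y\<bar>" using s by (intro mult_left_mono) (auto simp: Lg_def)
    finally show ?thesis .
  qed
  define L where "L = (Lg + Lam * n / a) / lam"
  have Lg0: "0 \<le> Lg" using s by (simp add: Lg_def)
  have L0: "0 \<le> L" using Lg0 Lam n a lam by (simp add: L_def)
  have lip: "\<bar>rhs g f t x y - rhs g f t x' y'\<bar> \<le> L * (\<bar>x - x'\<bar> + \<bar>y - y'\<bar>)" if t: "t \<in> {a..b}" for t x y x' y'
  proof -
    have "\<bar>rhs g f t x y - rhs g f t x' y'\<bar> \<le>
        \<bar>(- th y * n * (y / t) + g x - f t) - (- th y' * n * (y' / t) + g x' - f t)\<bar> / lam"
      unfolding rhs_def by (rule K_lipschitz)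
    also have "\<dots> \<le> (Lam * n / a * \<bar>y - y'\<bar> + Lg * \<bar>x - x'\<bar>) / lam"
    proof (rule divide_right_mono)
      have "\<bar>th y * n * (y / t) - th y' * n * (y' / t)\<bar> = \<bar>th y * y - th y' * y'\<bar> * (n / t)"
      proof -
        have "th y * n * (y / t) - th y' * n * (y' / t) = (th y * y - th y' * y') * (n / t)"
          by (simp add: algebra_simps diff_divide_distrib)
        then show ?thesis using t a n by (simp add: abs_mult)
      qed
      also have "\<dots> \<le> (Lam * \<bar>y - y'\<bar>) * (n / a)"
        using t a n th_mult_lipschitz[of y y'] by (intro mult_mono frac_le) auto
      finally have "\<bar>th y * n * (y / t) - th y' * n * (y' / t)\<bar> \<le> Lam * n / a * \<bar>y - y'\<bar>" by (simp add: mult_ac)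
      then show "\<bar>(- th y * n * (y / t) + g x - f t) - (- th y' * n * (y' / t) + g x' - f t)\<bar> \<le>
          Lam * n / a * \<bar>y - y'\<bar> + Lg * \<bar>x - x'\<bar>"
        using g_lip[of x x'] by (auto simp: abs_if split: if_splits)
    qed (use lam in simp)
    also have "\<dots> \<le> ((Lg + Lam * n / a) * \<bar>y - y'\<bar> + (Lg + Lam * n / a) * \<bar>x - x'\<bar>) / lam"
      using lam Lam n a Lg0 by (intro divide_right_mono add_mono mult_right_mono) auto
    also have "\<dots> = L * (\<bar>x - x'\<bar> + \<bar>y - y'\<bar>)" by (simp add: L_def field_simps)
    finally show ?thesis .
  qed
  obtain U P where UP: "\<And>\<alpha>. primitive_on a b (U \<alpha>) (P \<alpha>)"
    "\<And>\<alpha>. primitive_on a b (P \<alpha>) (\<lambda>t. rhs g f t (U \<alpha> t) (P \<alpha> t))"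
    "\<And>\<alpha>. U \<alpha> a = \<alpha>" "\<And>\<alpha>. P \<alpha> a = 0" "continuous_on UNIV (\<lambda>\<alpha>. U \<alpha> b)"
  proof (rule lipschitz_initial_value_problem[of a b L "rhs g f" "\<lambda>t. \<bar>f t\<bar> / lam"])
    show "(\<lambda>t. rhs g f t (u t) (p t)) \<in> borel_measurable (lebesgue_on {a..b})"
      if "continuous_on {a..b} u" "continuous_on {a..b} p" for u p
      using that by (intro rhs_measurable continuous_imp_measurable_on_sets_lebesgue
          absolutely_integrable_imp_measurable_on f gc) simp_all
    show "(\<lambda>t. \<bar>f t\<bar> / lam) integrable_on {a..b}" using fa by (simp add: set_lebesgue_integral_eq_integral)
    show "\<bar>rhs g f t 0 0\<bar> \<le> \<bar>f t\<bar> / lam" if "t \<in> {a..b}" for t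
      using rhs_bound[of t g f 0 0] that a g0 by simp
  qed (use a L0 lip in auto)
  have PD: "primitive_on a b (\<lambda>t. U \<alpha> t - z t) (\<lambda>t. P \<alpha> t - z1 t)"
      "primitive_on a b (\<lambda>t. P \<alpha> t - z1 t) (\<lambda>t. rhs g f t (U \<alpha> t) (P \<alpha> t) - - (\<bar>f t\<bar> / lam))"
      "primitive_on a b (\<lambda>t. - z t - U \<alpha> t) (\<lambda>t. - z1 t - P \<alpha> t)"
      "primitive_on a b (\<lambda>t. - z1 t - P \<alpha> t) (\<lambda>t. - (- (\<bar>f t\<bar> / lam)) - rhs g f t (U \<alpha> t) (P \<alpha> t))" for \<alpha>
    using primitive_on_subtract[OF UP(1) Pz(1)] primitive_on_subtract[OF UP(2) Pz(2)]
      primitive_on_subtract[OF primitive_on_minus[OF Pz(1)] UP(1)]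
      primitive_on_subtract[OF primitive_on_minus[OF Pz(2)] UP(2)] by blast+
  have opD: "0 \<le> pucci_op t (P \<alpha> t - z1 t) (rhs g f t (U \<alpha> t) (P \<alpha> t) - - (\<bar>f t\<bar> / lam))"
    if t: "t \<in> {a..b}" and D: "0 < U \<alpha> t - z t" for t \<alpha>
  proof -
    have "0 \<le> g (U \<alpha> t)" using D z_nonneg[OF t] by (intro g_sign) auto
    then have "0 \<le> pucci_op t (P \<alpha> t) (rhs g f t (U \<alpha> t) (P \<alpha> t)) - pucci_op t (z1 t) (- (\<bar>f t\<bar> / lam))"
      using op_z[OF t] unfolding pucci_op_rhs by linarith
    also have "\<dots> \<le> pucci_op t (P \<alpha> t - z1 t) (rhs g f t (U \<alpha> t) (P \<alpha> t) - - (\<bar>f t\<bar> / lam))"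
      using t a by (intro pucci_op_diff) auto
    finally show ?thesis .
  qed
  have opD': "0 \<le> pucci_op t (- z1 t - P \<alpha> t) (- (- (\<bar>f t\<bar> / lam)) - rhs g f t (U \<alpha> t) (P \<alpha> t))"
    if t: "t \<in> {a..b}" and D: "0 < - z t - U \<alpha> t" for t \<alpha>
  proof -
    have "g (U \<alpha> t) \<le> 0" using D z_nonneg[OF t] by (intro g_sign') auto
    then have "0 \<le> pucci_op t (- z1 t) (- (- (\<bar>f t\<bar> / lam))) - pucci_op t (P \<alpha> t) (rhs g f t (U \<alpha> t) (P \<alpha> t))"
      using op_z[OF t] pucci_op_minus[of t "z1 t" "- (\<bar>f t\<bar> / lam)"] t a unfolding pucci_op_rhs by auto
    also have "\<dots> \<le> pucci_op t (- z1 t - P \<alpha> t) (- (- (\<bar>f t\<bar> / lam)) - rhs g f t (U \<alpha> t) (P \<alpha> t))"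
      using t a by (intro pucci_op_diff) auto
    finally show ?thesis .
  qed
  \<comment> \<open>With this initial value the difference to z starts at 1 with slope 0 and does
    not fall below 1 up to b. Together with the mirrored estimate, this brackets the target value
    0.\<close>
  have "0 < U (z a + 1) b"
  proof -
    have "U (z a + 1) a - z a \<le> U (z a + 1) b - z b"
      by (rule comparison_right[OF a(1) PD(1,2) negligible_empty])
        (use opD a UP z1a in auto)
    then show ?thesis using zb UP(3) by simp
  qed
  moreover have "U (- z a - 1) b < 0"
  proof -
    have "- z a - U (- z a - 1) a \<le> - z b - U (- z a - 1) b"
      by (rule comparison_right[OF a(1) PD(3,4) negligible_empty])
        (use opD' a UP z1a in auto)
    then show ?thesis using zb UP(3) by simp
  qed
  moreover have "- z a - 1 \<le> z a + 1" using M by (simp add: M_def)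
  ultimately obtain \<alpha> where \<alpha>: "U \<alpha> b = 0"
    using IVT'[of "\<lambda>\<alpha>. U \<alpha> b" "- z a - 1" 0 "z a + 1"] UP(5) continuous_on_subset by (metis less_imp_le subset_UNIV)
  have "U \<alpha> r \<le> z r" if r: "r \<in> {a..b}" for r
  proof (rule ccontr)
    assume "\<not> U \<alpha> r \<le> z r"
    then have D: "0 < U \<alpha> r - z r" by simp
    show False
    proof (cases "0 \<le> P \<alpha> r - z1 r")
      case True
      have "U \<alpha> r - z r \<le> U \<alpha> b - z b"
        by (rule comparison_right[OF a(1) PD(1,2) negligible_empty]) (use opD D True r in auto)
      then show False using \<alpha> zb D by simp
    next
      case False
      \<comment> \<open>A negative slope of the difference would persist down to a, where both
        slopes are 0.\<close>
      have "U \<alpha> r - z r \<le> U \<alpha> a - z a \<and> P \<alpha> a - z1 a < 0"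
        by (rule comparison_left[OF a(1) PD(1,2) negligible_empty]) (use opD D False r in auto)
      then show False using UP(4) z1a by simp
    qed
  qed
  moreover have "- z r \<le> U \<alpha> r" if r: "r \<in> {a..b}" for r
  proof (rule ccontr)
    assume "\<not> - z r \<le> U \<alpha> r"
    then have D: "0 < - z r - U \<alpha> r" by simp
    show False
    proof (cases "0 \<le> - z1 r - P \<alpha> r")
      case True
      have "- z r - U \<alpha> r \<le> - z b - U \<alpha> b"
        by (rule comparison_right[OF a(1) PD(3,4) negligible_empty]) (use opD' D True r in auto)
      then show False using \<alpha> zb D by simp
    next
      case False
      have "- z r - U \<alpha> r \<le> - z a - U \<alpha> a \<and> - z1 a - P \<alpha> a < 0"
        by (rule comparison_left[OF a(1) PD(3,4) negligible_empty]) (use opD' D False r in auto)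
      then show False using UP(4) z1a by simp
    qed
  qed
  ultimately have "\<bar>U \<alpha> r\<bar> \<le> M" if "r \<in> {a..b}" for r
    using that z_nonneg[OF that] unfolding M_def by force
  then have "g (U \<alpha> r) = pw s (U \<alpha> r)" if "r \<in> {a..b}" for r
    using that by (force simp: g_def max_def min_def)
  then have "primitive_on a b (P \<alpha>) (\<lambda>t. rhs (pw s) f t (U \<alpha> t) (P \<alpha> t))"
    by (intro primitive_on_spike[OF UP(2) negligible_empty]) (simp add: rhs_def)
  then show ?thesis using UP(1,4) unfolding sol_on_def by blast
qed

end

section \<open>Keller-Osserman barriers and a priori bounds\<close>

lemma primitive_onI_continuous:
  assumes "\<And>t. t \<in> {a..b} \<Longrightarrow> (u has_real_derivative g t) (at t)" "continuous_on {a..b} g"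
  shows "primitive_on a b u g"
  unfolding primitive_on_def
proof (intro conjI ballI)
  show "g absolutely_integrable_on {a..b}" by (rule absolutely_integrable_continuous_real[OF assms(2)])
  fix x assume x: "x \<in> {a..b}"
  have "(g has_integral u x - u a) {a..x}"
    using x assms(1) by (intro fundamental_theorem_of_calculus)
      (auto intro: has_field_derivative_at_within simp flip: has_real_derivative_iff_has_vector_derivative)
  then show "integral {a..x} g = u x - u a" by (rule integral_unique)
qed

lemma primitive_on_add:
  assumes "primitive_on a b u g" "primitive_on a b v h"
  shows "primitive_on a b (\<lambda>x. u x + v x) (\<lambda>x. g x + h x)"
  using primitive_on_subtract[OF assms(1) primitive_on_minus[OF assms(2)]] by simp

context pucci
begin

definition bexp :: real where "bexp = 2 / (s - 1)"

lemma bexp_pos: "0 < bexp"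
  using s by (simp add: bexp_def)

text \<open>The Keller-Osserman profile \<open>A Y powr (- 2 / (s - 1))\<close>: the exponent makes both sides
  homogeneous of the same degree in \<open>Y\<close>.\<close>

lemma power_barrier:
  fixes y y1 y2 A Q t :: real
  assumes "0 < t" "0 < y" "0 < A"
    and Q: "(bexp + 1) * y1\<^sup>2 + y * \<bar>y2\<bar> + n * y * \<bar>y1\<bar> / t \<le> Q"
    and A: "2 powr s * bexp * Lam * Q \<le> A powr (s - 1)"
  shows "pucci_op t (- (A * bexp * y powr (- bexp - 1) * y1))
     (A * bexp * (bexp + 1) * y powr (- bexp - 2) * y1\<^sup>2 - A * bexp * y powr (- bexp - 1) * y2)
     \<le> pw s (A * y powr (- bexp) / 2)"
proof -
  define \<beta> where "\<beta> = bexp"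
  have \<beta>: "0 < \<beta>" using bexp_pos by (simp add: \<beta>_def)
  \<comment> \<open>All terms share the factor y powr (- bexp - 2). As bexp * s = bexp + 2, the
    right-hand side carries the same power of y, and only a condition on A remains.\<close>
  define w where "w = A * \<beta> * y powr (- \<beta> - 2)"
  have w: "0 < w" using assms \<beta> by (simp add: w_def)
  have y1: "y powr (- \<beta> - 1) = y powr (- \<beta> - 2) * y"
  proof -
    have "- \<beta> - 1 = (- \<beta> - 2) + 1" by simp
    then show ?thesis using assms(2) by (simp only: powr_add powr_one)
  qed
  have op: "pucci_op t p q \<le> Lam * \<bar>q\<bar> + n / t * (Lam * \<bar>p\<bar>)" for p q
    unfolding pucci_op_def using abs_th_mult[of p] abs_th_mult[of q] assms(1) n
    by (intro add_mono mult_left_mono) auto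
  have "pucci_op t (- (A * \<beta> * y powr (- \<beta> - 1) * y1))
     (A * \<beta> * (\<beta> + 1) * y powr (- \<beta> - 2) * y1\<^sup>2 - A * \<beta> * y powr (- \<beta> - 1) * y2)
     \<le> Lam * \<bar>w * ((\<beta> + 1) * y1\<^sup>2 - y * y2)\<bar> + n / t * (Lam * \<bar>w * (y * y1)\<bar>)"
    using op[of "- (A * \<beta> * y powr (- \<beta> - 1) * y1)"
        "A * \<beta> * (\<beta> + 1) * y powr (- \<beta> - 2) * y1\<^sup>2 - A * \<beta> * y powr (- \<beta> - 1) * y2"]
    unfolding y1 w_def by (simp add: algebra_simps)
  also have "\<dots> \<le> Lam * (w * ((\<beta> + 1) * y1\<^sup>2 + y * \<bar>y2\<bar>)) + n / t * (Lam * (w * (y * \<bar>y1\<bar>)))"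
  proof (intro add_mono mult_left_mono)
    have "\<bar>(\<beta> + 1) * y1\<^sup>2 - y * y2\<bar> \<le> (\<beta> + 1) * y1\<^sup>2 + y * \<bar>y2\<bar>"
      using \<beta> assms(2) abs_triangle_ineq4[of "(\<beta> + 1) * y1\<^sup>2" "y * y2"] by (simp add: abs_mult)
    then show "\<bar>w * ((\<beta> + 1) * y1\<^sup>2 - y * y2)\<bar> \<le> w * ((\<beta> + 1) * y1\<^sup>2 + y * \<bar>y2\<bar>)"
      using w by (simp add: abs_mult)
    show "\<bar>w * (y * y1)\<bar> \<le> w * (y * \<bar>y1\<bar>)" using w assms by (simp add: abs_mult)
  qed (use Lam n assms in auto)
  also have "\<dots> = Lam * w * ((\<beta> + 1) * y1\<^sup>2 + y * \<bar>y2\<bar> + n * y * \<bar>y1\<bar> / t)" by (simp add: algebra_simps)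
  also have "\<dots> \<le> Lam * w * Q" using Q w Lam unfolding \<beta>_def by (intro mult_left_mono) auto
  also have "\<dots> = A * y powr (- \<beta> - 2) * (\<beta> * Lam * Q)" by (simp add: w_def mult_ac)
  also have "\<dots> \<le> A * y powr (- \<beta> - 2) * (A powr (s - 1) / 2 powr s)"
    using A assms unfolding \<beta>_def by (intro mult_left_mono) (auto simp: field_simps)
  also have "\<dots> = pw s (A * y powr (- \<beta>) / 2)"
  proof -
    have "pw s (A * y powr (- \<beta>) / 2) = A powr s * (y powr (- \<beta>)) powr s / 2 powr s"
      using assms by (simp add: pw_nonneg powr_divide powr_mult)
    also have "(y powr (- \<beta>)) powr s = y powr (- \<beta> - 2)"
      using s by (simp add: powr_powr \<beta>_def bexp_def field_simps)
    also have "A powr s = A * A powr (s - 1)"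
      using assms powr_add[of A 1 "s - 1"] by simp
    finally show ?thesis by (simp add: mult_ac)
  qed
  finally show ?thesis unfolding \<beta>_def .
qed

text \<open>y2 is a constant because every barrier below is a power of a quadratic polynomial
  Y.\<close>

lemma power_barrier_primitive:
  fixes Y Y1 :: "real \<Rightarrow> real" and y2 :: real
  assumes "\<And>t. (Y has_real_derivative Y1 t) (at t)" "\<And>t. (Y1 has_real_derivative y2) (at t)"
    and pos: "\<And>t. t \<in> {a..b} \<Longrightarrow> 0 < Y t"
  shows "primitive_on a b (\<lambda>t. A * Y t powr (- \<beta>)) (\<lambda>t. - (A * \<beta> * Y t powr (- \<beta> - 1) * Y1 t))"
    "primitive_on a b (\<lambda>t. - (A * \<beta> * Y t powr (- \<beta> - 1) * Y1 t))
      (\<lambda>t. A * \<beta> * (\<beta> + 1) * Y t powr (- \<beta> - 2) * (Y1 t)\<^sup>2 - A * \<beta> * Y t powr (- \<beta> - 1) * y2)"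
proof -
  have cY: "continuous_on {a..b} Y" "continuous_on {a..b} Y1"
    using assms(1,2) by (auto intro!: continuous_at_imp_continuous_on DERIV_isCont)
  have np: "Y t \<noteq> 0" if "t \<in> {a..b}" for t using pos[OF that] by simp
  have dp: "((\<lambda>t. Y t powr c) has_real_derivative c * Y t powr (c - 1) * Y1 t) (at t)" if "t \<in> {a..b}" for t c
    using pos[OF that] assms(1) by (auto intro!: derivative_eq_intros simp: powr_diff field_simps)
  show "primitive_on a b (\<lambda>t. A * Y t powr (- \<beta>)) (\<lambda>t. - (A * \<beta> * Y t powr (- \<beta> - 1) * Y1 t))"
  proof (rule primitive_onI_continuous)
    show "((\<lambda>t. A * Y t powr (- \<beta>)) has_real_derivative - (A * \<beta> * Y t powr (- \<beta> - 1) * Y1 t)) (at t)"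
      if "t \<in> {a..b}" for t
      using DERIV_cmult[OF dp[OF that, of "- \<beta>"], of A] by (simp add: mult_ac)
    show "continuous_on {a..b} (\<lambda>t. - (A * \<beta> * Y t powr (- \<beta> - 1) * Y1 t))"
      using np by (intro continuous_intros cY) auto
  qed
  show "primitive_on a b (\<lambda>t. - (A * \<beta> * Y t powr (- \<beta> - 1) * Y1 t))
      (\<lambda>t. A * \<beta> * (\<beta> + 1) * Y t powr (- \<beta> - 2) * (Y1 t)\<^sup>2 - A * \<beta> * Y t powr (- \<beta> - 1) * y2)"
  proof (rule primitive_onI_continuous)
    fix t assume t: "t \<in> {a..b}"
    have "((\<lambda>t. (- (A * \<beta>)) * (Y t powr (- \<beta> - 1) * Y1 t)) has_real_derivative
       (- (A * \<beta>)) * ((- \<beta> - 1) * Y t powr (- \<beta> - 1 - 1) * Y1 t * Y1 t + y2 * Y t powr (- \<beta> - 1))) (at t)"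
      by (rule DERIV_cmult[OF DERIV_mult[OF dp[OF t] assms(2)]])
    moreover have "(- (A * \<beta>)) * ((- \<beta> - 1) * Y t powr (- \<beta> - 1 - 1) * Y1 t * Y1 t + y2 * Y t powr (- \<beta> - 1)) =
        A * \<beta> * (\<beta> + 1) * Y t powr (- \<beta> - 2) * (Y1 t)\<^sup>2 - A * \<beta> * Y t powr (- \<beta> - 1) * y2"
      by (simp add: algebra_simps power2_eq_square)
    ultimately show "((\<lambda>t. - (A * \<beta> * Y t powr (- \<beta> - 1) * Y1 t)) has_real_derivative
        A * \<beta> * (\<beta> + 1) * Y t powr (- \<beta> - 2) * (Y1 t)\<^sup>2 - A * \<beta> * Y t powr (- \<beta> - 1) * y2) (at t)"
      by (simp add: mult.assoc)
  next
    show "continuous_on {a..b} (\<lambda>t. A * \<beta> * (\<beta> + 1) * Y t powr (- \<beta> - 2) * (Y1 t)\<^sup>2 - A * \<beta> * Y t powr (- \<beta> - 1) * y2)"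
      using np by (intro continuous_intros cY) auto
  qed
qed

text \<open>One w bounds u from both sides: |f| covers either sign of f, and -w serves as a lower
  barrier because of \<open>pucci_op_minus\<close>.\<close>

lemma supersolution_bound:
  assumes a: "0 < a" and u: "sol_on f a b u p" and w: "primitive_on a b w w1" "primitive_on a b w1 w2"
    and op: "\<And>t. t \<in> {a..b} \<Longrightarrow> pucci_op t (w1 t) (w2 t) \<le> pw s (w t) - \<bar>f t\<bar>"
    and ends: "\<bar>u a\<bar> \<le> w a" "\<bar>u b\<bar> \<le> w b" and r: "r \<in> {a..b}"
  shows "\<bar>u r\<bar> \<le> w r"
proof -
  let ?q = "\<lambda>t. rhs (pw s) f t (u t) (p t)"
  have P: "primitive_on a b u p" "primitive_on a b p ?q" using u by (auto simp: sol_on_def)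
  have "u r \<le> w r"
  proof (rule ccontr)
    assume "\<not> u r \<le> w r"
    then have D: "0 < u r - w r" by simp
    have PD: "primitive_on a b (\<lambda>t. u t - w t) (\<lambda>t. p t - w1 t)" "primitive_on a b (\<lambda>t. p t - w1 t) (\<lambda>t. ?q t - w2 t)"
      using primitive_on_subtract P w by blast+
    have opD: "0 \<le> pucci_op t (p t - w1 t) (?q t - w2 t)" if "t \<in> {a..b} - {}" "0 < u t - w t" for t
    proof -
      have "pw s (w t) \<le> pw s (u t)" using that s by (intro pw_mono) auto
      then have "0 \<le> pucci_op t (p t) (?q t) - pucci_op t (w1 t) (w2 t)"
        using op[of t] that unfolding pucci_op_rhs by auto
      also have "\<dots> \<le> pucci_op t (p t - w1 t) (?q t - w2 t)" using that a by (intro pucci_op_diff) auto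
      finally show ?thesis .
    qed
    show False
    proof (cases "0 \<le> p r - w1 r")
      case True
      have "u r - w r \<le> u b - w b"
        by (rule comparison_right[OF a PD negligible_empty opD]) (use D True r in auto)
      then show False using ends D by (auto simp: abs_le_iff)
    next
      case False
      have "u r - w r \<le> u a - w a \<and> p a - w1 a < 0"
        by (rule comparison_left[OF a PD negligible_empty opD]) (use D False r in auto)
      then show False using ends D by (auto simp: abs_le_iff)
    qed
  qed
  moreover have "- w r \<le> u r"
  proof (rule ccontr)
    assume "\<not> - w r \<le> u r"
    then have D: "0 < - w r - u r" by simp
    have PD: "primitive_on a b (\<lambda>t. - w t - u t) (\<lambda>t. - w1 t - p t)" "primitive_on a b (\<lambda>t. - w1 t - p t) (\<lambda>t. - w2 t - ?q t)"
      using primitive_on_subtract[OF primitive_on_minus P(1)] primitive_on_subtract[OF primitive_on_minus P(2)] w by blast+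
    have opD: "0 \<le> pucci_op t (- w1 t - p t) (- w2 t - ?q t)" if "t \<in> {a..b} - {}" "0 < - w t - u t" for t
    proof -
      have "pw s (u t) \<le> pw s (- w t)" using that s by (intro pw_mono) auto
      then have "0 \<le> pucci_op t (- w1 t) (- w2 t) - pucci_op t (p t) (?q t)"
        using op[of t] that pucci_op_minus[of t "w1 t" "w2 t"] a unfolding pucci_op_rhs pw_minus by auto
      also have "\<dots> \<le> pucci_op t (- w1 t - p t) (- w2 t - ?q t)" using that a by (intro pucci_op_diff) auto
      finally show ?thesis .
    qed
    show False
    proof (cases "0 \<le> - w1 r - p r")
      case True
      have "- w r - u r \<le> - w b - u b"
        by (rule comparison_right[OF a PD negligible_empty opD]) (use D True r in auto)
      then show False using ends D by (auto simp: abs_le_iff)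
    next
      case False
      have "- w r - u r \<le> - w a - u a \<and> - w1 a - p a < 0"
        by (rule comparison_left[OF a PD negligible_empty opD]) (use D False r in auto)
      then show False using ends D by (auto simp: abs_le_iff)
    qed
  qed
  ultimately show ?thesis by simp
qed

lemma sol_on_subinterval:
  "sol_on f a b u p \<Longrightarrow> a \<le> x \<Longrightarrow> y \<le> b \<Longrightarrow> sol_on f x y u p"
  using primitive_on_subinterval[of a b u p x y]
    primitive_on_subinterval[of a b p "\<lambda>t. rhs (pw s) f t (u t) (p t)" x y]
  by (simp add: sol_on_def)

text \<open>Local a priori bound, independent of the boundary values: Keller-Osserman barrier blowing up
  at both end points plus a linear supersolution absorbing \<open>f\<close>.\<close>

lemma local_bound:
  assumes r: "0 < r1" "r1 < r2" and f: "f absolutely_integrable_on {r1..r2}"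
  obtains \<Psi> where "continuous_on {r1<..<r2} \<Psi>"
    "\<And>u p r. sol_on f r1 r2 u p \<Longrightarrow> r \<in> {r1<..<r2} \<Longrightarrow> \<bar>u r\<bar> \<le> \<Psi> r"
proof -
  obtain z z1 where z: "primitive_on r1 r2 z z1" "primitive_on r1 r2 z1 (\<lambda>t. - (\<bar>f t\<bar> / lam))"
    and "z1 r1 = 0" "z r2 = 0" and z0: "\<And>r. r \<in> {r1..r2} \<Longrightarrow> 0 \<le> z r"
    and "\<And>r. r \<in> {r1..r2} \<Longrightarrow> z r \<le> z r1"
    and op_z: "\<And>t. t \<in> {r1..r2} \<Longrightarrow> pucci_op t (z1 t) (- (\<bar>f t\<bar> / lam)) \<le> - \<bar>f t\<bar>"
    using linear_supersolution[OF r(1) less_imp_le[OF r(2)] f] by blast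
  define d where "d = r2 - r1"
  have d: "0 < d" using r by (simp add: d_def)
  define Y where "Y = (\<lambda>t. (t - r1) * (r2 - t))"
  define Y1 where "Y1 = (\<lambda>t. r1 + r2 - 2 * t)"
  have Yd: "(Y has_real_derivative Y1 t) (at t)" "(Y1 has_real_derivative -2) (at t)" for t
    unfolding Y_def Y1_def by (auto intro!: derivative_eq_intros)
  have Yb: "0 < Y t" "Y t \<le> d * d" "\<bar>Y1 t\<bar> \<le> d" if "t \<in> {r1<..<r2}" for t
    using that unfolding Y_def Y1_def d_def by (auto intro!: mult_mono)
  note bp = bexp_pos
  \<comment> \<open>Bounds the left side of the barrier condition on the whole interval, using Y <=
    d^2, |Y'| <= d, |Y''| = 2 and 1 / t <= 1 / r1.\<close>
  define Q where "Q = (bexp + 1) * d\<^sup>2 + d * d * 2 + n * (d * d) * d / r1"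
  have "0 < bexp + 1" using bp by linarith
  then have Q: "0 < Q" unfolding Q_def using d n r bp
    by (intro add_pos_nonneg mult_pos_pos zero_less_power) auto
  define A where "A = (2 powr s * bexp * Lam * Q) powr (1 / (s - 1))"
  have X: "(X powr (1 / (s - 1))) powr (s - 1) = X \<and> 0 < X powr (1 / (s - 1))" if "0 < X" for X :: real
    using that s by (simp add: powr_powr)
  have "0 < 2 powr s * bexp * Lam * Q" using bp Lam Q by (intro mult_pos_pos) auto
  from X[OF this] have A: "0 < A" "A powr (s - 1) = 2 powr s * bexp * Lam * Q"
    unfolding A_def by blast+
  define \<psi> where "\<psi> = (\<lambda>t. A * Y t powr (- bexp))"
  have \<psi>_op: "pucci_op t (- (A * bexp * Y t powr (- bexp - 1) * Y1 t))
     (A * bexp * (bexp + 1) * Y t powr (- bexp - 2) * (Y1 t)\<^sup>2 - A * bexp * Y t powr (- bexp - 1) * (-2))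
     \<le> pw s (\<psi> t / 2)" if t: "t \<in> {r1<..<r2}" for t
    unfolding \<psi>_def
  proof (rule power_barrier)
    have "(Y1 t)\<^sup>2 \<le> d\<^sup>2" using Yb(3)[OF t] d by (metis abs_le_square_iff abs_of_pos)
    moreover have "n * Y t * \<bar>Y1 t\<bar> / t \<le> n * (d * d) * d / r1"
      using Yb[OF t] n t r d by (intro frac_le mult_mono) auto
    ultimately show "(bexp + 1) * (Y1 t)\<^sup>2 + Y t * \<bar>-2\<bar> + n * Y t * \<bar>Y1 t\<bar> / t \<le> Q"
      unfolding Q_def using \<open>0 < bexp + 1\<close> Yb[OF t] by (intro add_mono mult_left_mono) auto
  qed (use t r Yb[OF t] A in auto)
  show thesis
  proof (rule that[of "\<lambda>t. \<psi> t + z t"])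
    show "continuous_on {r1<..<r2} (\<lambda>t. \<psi> t + z t)"
      unfolding \<psi>_def using Yb(1)
      by (intro continuous_intros continuous_on_subset[OF primitive_on_continuous[OF z(1)]]
            continuous_at_imp_continuous_on ballI DERIV_isCont[OF Yd(1)]) force+
    fix u p r assume u: "sol_on f r1 r2 u p" and rr: "r \<in> {r1<..<r2}"
    have Pu: "primitive_on r1 r2 u p" using u by (simp add: sol_on_def)
    obtain M where M: "0 < M" "\<And>x. x \<in> {r1..r2} \<Longrightarrow> \<bar>u x\<bar> \<le> M"
      using primitive_on_bounded[OF Pu] by blast
    \<comment> \<open>The profile is at least M, a bound for |u|, wherever Y <= \<delta>. The end
      points are moved inwards to a and b in that region, still on both sides of r, so the barrier
      dominates u there. M then no longer occurs in the conclusion.\<close>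
    define \<delta> where "\<delta> = (A / M) powr (1 / bexp)"
    have \<delta>: "0 < \<delta>" "\<delta> powr bexp = A / M" using A M bp by (auto simp: \<delta>_def powr_powr)
    have big: "M \<le> \<psi> t" if "t \<in> {r1<..<r2}" "Y t \<le> \<delta>" for t
    proof -
      have "Y t powr bexp \<le> A / M" using powr_mono2[of bexp "Y t" \<delta>] that Yb[OF that(1)] bp \<delta> by simp
      then show ?thesis using M Yb(1)[OF that(1)] by (simp add: \<psi>_def powr_minus field_simps)
    qed
    define a where "a = min ((r1 + r) / 2) (r1 + \<delta> / d)"
    define b where "b = max ((r + r2) / 2) (r2 - \<delta> / d)"
    have a: "r1 < a" "a < r" "(a - r1) * d \<le> \<delta>"
      using rr \<delta> d unfolding a_def by (auto simp: min_def field_simps)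
    have b: "r < b" "b < r2" "(r2 - b) * d \<le> \<delta>"
      using rr \<delta> d unfolding b_def by (auto simp: max_def field_simps)
    have "Y a \<le> (a - r1) * d" unfolding Y_def d_def using a by (intro mult_left_mono) auto
    moreover have "Y b \<le> d * (r2 - b)" unfolding Y_def d_def using b by (intro mult_right_mono) auto
    ultimately have "M \<le> \<psi> a" "M \<le> \<psi> b"
      using a b rr by (auto intro!: big simp: mult.commute)
    moreover have ends: "a \<in> {r1..r2}" "b \<in> {r1..r2}" using a b rr by auto
    ultimately have e: "\<bar>u a\<bar> \<le> \<psi> a + z a" "\<bar>u b\<bar> \<le> \<psi> b + z b"
      using M(2)[OF ends(1)] M(2)[OF ends(2)] z0[OF ends(1)] z0[OF ends(2)] by linarith+
    have pos: "0 < Y t" if "t \<in> {a..b}" for t using Yb(1)[of t] that a b by auto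
    note B = power_barrier_primitive[OF Yd pos, where A = A and \<beta> = bexp]
    have za: "primitive_on a b z z1" "primitive_on a b z1 (\<lambda>t. - (\<bar>f t\<bar> / lam))"
      using primitive_on_subinterval[OF z(1)] primitive_on_subinterval[OF z(2)] a b by auto
    have us: "sol_on f a b u p" using sol_on_subinterval[OF u] a b by auto
    show "\<bar>u r\<bar> \<le> \<psi> r + z r"
    proof (rule supersolution_bound[OF _ us primitive_on_add[OF B(1)[folded \<psi>_def] za(1)] primitive_on_add[OF B(2) za(2)]])
      fix t assume t: "t \<in> {a..b}"
      then have t': "t \<in> {r1<..<r2}" "t \<in> {r1..r2}" "0 < t" using a b r by auto
      have "pw s (\<psi> t / 2) \<le> pw s (\<psi> t + z t)"
        using z0[OF t'(2)] A s by (intro pw_mono) (auto simp: \<psi>_def)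
      then show "pucci_op t (- (A * bexp * Y t powr (- bexp - 1) * Y1 t) + z1 t)
        (A * bexp * (bexp + 1) * Y t powr (- bexp - 2) * (Y1 t)\<^sup>2 - A * bexp * Y t powr (- bexp - 1) * (-2)
          + - (\<bar>f t\<bar> / lam)) \<le> pw s (\<psi> t + z t) - \<bar>f t\<bar>"
        using pucci_op_subadd[OF t'(3)] \<psi>_op[OF t'(1)] op_z[OF t'(2)] by (smt (verit, best))
    qed (use a b r e in auto)
  qed
qed

text \<open>This is N_+ - 1, the exponent in the integrability condition on f.\<close>

abbreviation "kexp \<equiv> lam / Lam * n"

text \<open>Integrating from the last zero of the slope: on the way to \<open>b\<close> the solution is monotone, so
  the absorption term is controlled by its value at \<open>b\<close>.\<close>

lemma slope_bound:
  assumes a: "0 < a" "a \<le> b" and u: "sol_on f a b u p" and "p a = 0"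
    and f: "f absolutely_integrable_on {a..b}" and e: "e = 1 \<or> e = -1"
  shows "e * p b \<le> (integral {a..b} (\<lambda>t. t powr kexp * \<bar>f t\<bar>) / b powr kexp + (b - a) * pw s (max (e * u b) 0)) / lam"
proof -
  let ?q = "\<lambda>t. rhs (pw s) f t (u t) (p t)"
  define m where "m = pw s (max (e * u b) 0)"
  have m0: "0 \<le> m" by (simp add: m_def pw_def)
  have P: "primitive_on a b u p" "primitive_on a b p ?q" using u by (auto simp: sol_on_def)
  have powr_cont: "continuous_on {a..b} (\<lambda>t. t powr kexp)" using a by (intro continuous_intros) auto
  have fk: "(\<lambda>t. t powr kexp * \<bar>f t\<bar>) absolutely_integrable_on {a..b}"
  proof (rule absolutely_integrable_bounded_measurable_product_real)
    show "(\<lambda>t. t powr kexp) \<in> borel_measurable (lebesgue_on {a..b})"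
      using powr_cont by (rule continuous_imp_measurable_on_sets_lebesgue) simp
    show "bounded ((\<lambda>t. t powr kexp) ` {a..b})"
      using compact_continuous_image[OF powr_cont] compact_imp_bounded by blast
  qed (use set_integrable_abs[OF f] in auto)
  have R0: "0 \<le> integral {a..b} (\<lambda>t. t powr kexp * \<bar>f t\<bar>)"
    using fk by (intro Henstock_Kurzweil_Integration.integral_nonneg) (auto simp: set_lebesgue_integral_eq_integral)
  show ?thesis
  proof (cases "e * p b \<le> 0")
    case True
    have "0 \<le> (integral {a..b} (\<lambda>t. t powr kexp * \<bar>f t\<bar>) / b powr kexp + (b - a) * m) / lam"
      using R0 m0 a lam by auto
    then show ?thesis using True unfolding m_def by linarith
  next
    case False
    define S where "S = {t \<in> {a..b}. e * p t \<le> 0}"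
    have "continuous_on {a..b} (\<lambda>t. e * p t)"
      by (intro continuous_intros primitive_on_continuous[OF P(2)])
    then have "closed ({a..b} \<inter> (\<lambda>t. e * p t) -` {..0})" by (rule continuous_closed_preimage) auto
    moreover have "{a..b} \<inter> (\<lambda>t. e * p t) -` {..0} = S" by (auto simp: S_def)
    moreover have "bounded S" by (rule bounded_subset[of "{a..b}"]) (auto simp: S_def)
    ultimately have "compact S" by (simp add: compact_eq_bounded_closed)
    moreover have "a \<in> S" using a assms(4) by (simp add: S_def)
    ultimately obtain c where c: "c \<in> S" "\<And>t. t \<in> S \<Longrightarrow> t \<le> c"
      using compact_attains_sup[of S] by blast
    have cab: "a \<le> c" "c \<le> b" "e * p c \<le> 0" using c(1) by (auto simp: S_def)
    have pos: "0 < e * p t" if "t \<in> {c<..b}" for t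
      using c(2)[of t] that cab by (force simp: S_def)
    have Pc: "primitive_on c b (\<lambda>t. e * u t) (\<lambda>t. e * p t)" "primitive_on c b (\<lambda>t. e * p t) (\<lambda>t. e * ?q t)"
    proof -
      have "primitive_on c b u p" "primitive_on c b p ?q"
        using primitive_on_subinterval[OF P(1)] primitive_on_subinterval[OF P(2)] cab by auto
      then show "primitive_on c b (\<lambda>t. e * u t) (\<lambda>t. e * p t)" "primitive_on c b (\<lambda>t. e * p t) (\<lambda>t. e * ?q t)"
        using e primitive_on_minus by auto
    qed
    have up: "e * u t \<le> e * u b" if "t \<in> {c..b}" for t
    proof -
      have "integral {t..b} (\<lambda>x. 0) \<le> integral {t..b} (\<lambda>t. e * p t)"
        by (rule integral_le_off_negligible[of _ _ _ "{c}"])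
          (use primitive_on_has_integral[OF Pc(1), of t b] that pos in \<open>auto intro: less_imp_le\<close>)
      then show ?thesis using primitive_on_diff[OF Pc(1), of t b] that by simp
    qed
    \<comment> \<open>The true drift is at least kexp / t and multiplies a positive slope, so it may
      be lowered to kexp / t, whose integrating factor is the explicit quotient t powr kexp / c powr
      kexp.\<close>
    define d where "d = (\<lambda>t. kexp / t)"
    define G where "G = (\<lambda>t. (m + \<bar>f t\<bar>) / lam)"
    have c0: "0 < c" using cab a by simp
    have dc: "d absolutely_integrable_on {c..b}"
      unfolding d_def using c0 by (intro absolutely_integrable_continuous_real continuous_intros) auto
    have int_d: "integral {c..t} d = kexp * (ln t - ln c)" if "t \<in> {c..b}" for t
    proof (rule integral_unique)
      have "(d has_integral kexp * ln t - kexp * ln c) {c..t}"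
        unfolding d_def using that c0 Lam by (intro fundamental_theorem_of_calculus)
          (auto intro!: derivative_eq_intros simp flip: has_real_derivative_iff_has_vector_derivative)
      then show "(d has_integral kexp * (ln t - ln c)) {c..t}" by (simp add: right_diff_distrib)
    qed
    have exp_d: "exp (integral {c..t} d) = t powr kexp / c powr kexp" if "t \<in> {c..b}" for t
      using int_d[OF that] that c0 by (simp add: powr_def exp_diff right_diff_distrib)
    have fc: "(\<lambda>t. t powr kexp * \<bar>f t\<bar>) integrable_on {c..b}"
      using absolutely_integrable_on_subset_real[OF fk, of c b] cab by (auto simp: set_lebesgue_integral_eq_integral)
    have pc: "(\<lambda>t. t powr kexp) integrable_on {c..b}"
      using c0 by (intro integrable_continuous_real continuous_intros) auto
    have Gi: "(\<lambda>t. (t powr kexp * m + t powr kexp * \<bar>f t\<bar>) / (lam * c powr kexp)) integrable_on {c..b}"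
      by (intro integrable_on_divide integrable_add fc integrable_on_mult_left pc)
    have GG: "exp (integral {c..t} d) * G t = (t powr kexp * m + t powr kexp * \<bar>f t\<bar>) / (lam * c powr kexp)"
      if "t \<in> {c..b}" for t
      unfolding exp_d[OF that] G_def using lam c0 by (simp add: field_simps)
    have Gi': "(\<lambda>t. exp (integral {c..t} d) * G t) integrable_on {c..b}"
      using Gi by (rule integrable_eq) (simp add: GG)
    have "exp (integral {c..b} d) * (e * p b) \<le> e * p c + integral {c..b} (\<lambda>t. exp (integral {c..t} d) * G t)"
    proof (rule linear_differential_inequality[OF cab(2) Pc(2) dc _ _ Gi'])
      show "negligible {c}" by simp
      fix t assume t: "t \<in> {c..b} - {c}"
      then have t0: "0 < t" and pt: "0 < e * p t" using c0 pos by auto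
      have "th (?q t) * (?q t + drift t (p t) (?q t) * p t) = pw s (u t) - f t"
        using pucci_op_rhs[of t "p t" "pw s" f "u t"] th_bounds[of "?q t"]
        by (simp add: pucci_op_def drift_def field_simps)
      then have "?q t + drift t (p t) (?q t) * p t = (pw s (u t) - f t) / th (?q t)"
        using th_bounds[of "?q t"] by (simp add: field_simps)
      then have "e * ?q t + drift t (p t) (?q t) * (e * p t) = (e * pw s (u t) - e * f t) / th (?q t)"
        by (metis (no_types, opaque_lifting) distrib_left mult.left_commute right_diff_distrib times_divide_eq_right)
      also have "\<dots> \<le> (m + \<bar>f t\<bar>) / lam"
      proof (rule frac_le)
        have "e * pw s (u t) = pw s (e * u t)" using e by (auto simp: pw_minus)
        also have "\<dots> \<le> m" unfolding m_def using up[of t] t s by (intro pw_mono) auto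
        finally show "e * pw s (u t) - e * f t \<le> m + \<bar>f t\<bar>" using e by auto
      qed (use m0 lam th_bounds in auto)
      finally have "e * ?q t + drift t (p t) (?q t) * (e * p t) \<le> G t" by (simp add: G_def)
      moreover have "d t * (e * p t) \<le> drift t (p t) (?q t) * (e * p t)"
        unfolding d_def using drift_bounds(1)[OF t0] pt by (intro mult_right_mono) auto
      ultimately show "e * ?q t + d t * (e * p t) \<le> G t" by linarith
    qed
    also have "\<dots> \<le> integral {c..b} (\<lambda>t. (t powr kexp * m + t powr kexp * \<bar>f t\<bar>) / (lam * c powr kexp))"
      using cab integral_cong[of "{c..b}" "\<lambda>t. exp (integral {c..t} d) * G t"] GG by simp
    also have "\<dots> = (integral {c..b} (\<lambda>t. t powr kexp * m) + integral {c..b} (\<lambda>t. t powr kexp * \<bar>f t\<bar>)) / (lam * c powr kexp)"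
      using pc fc by (simp add: Henstock_Kurzweil_Integration.integral_add integrable_on_mult_left)
    also have "\<dots> \<le> ((b - a) * (b powr kexp * m) + integral {a..b} (\<lambda>t. t powr kexp * \<bar>f t\<bar>)) / (lam * c powr kexp)"
    proof (intro divide_right_mono add_mono)
      have "integral {c..b} (\<lambda>t. t powr kexp * m) \<le> integral {c..b} (\<lambda>t. b powr kexp * m)"
        using pc c0 m0 lam Lam n by (intro integral_le integrable_on_mult_left) (auto intro!: mult_right_mono powr_mono2)
      also have "\<dots> = (b - c) * (b powr kexp * m)" using cab by simp
      also have "\<dots> \<le> (b - a) * (b powr kexp * m)" using cab m0 by (intro mult_right_mono) auto
      finally show "integral {c..b} (\<lambda>t. t powr kexp * m) \<le> (b - a) * (b powr kexp * m)" .
      show "integral {c..b} (\<lambda>t. t powr kexp * \<bar>f t\<bar>) \<le> integral {a..b} (\<lambda>t. t powr kexp * \<bar>f t\<bar>)"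
        using cab fc fk by (intro integral_subset_le) (auto simp: set_lebesgue_integral_eq_integral)
    qed (use lam in auto)
    finally have "b powr kexp / c powr kexp * (e * p b) \<le>
      ((b - a) * (b powr kexp * m) + integral {a..b} (\<lambda>t. t powr kexp * \<bar>f t\<bar>)) / (lam * c powr kexp)"
      using exp_d[of b] cab by simp
    moreover have "0 < b powr kexp" "0 < c powr kexp" using a c0 by auto
    ultimately have "e * p b \<le> ((b - a) * (b powr kexp * m) + integral {a..b} (\<lambda>t. t powr kexp * \<bar>f t\<bar>)) / (lam * b powr kexp)"
      using lam by (simp add: field_simps)
    also have "\<dots> = (integral {a..b} (\<lambda>t. t powr kexp * \<bar>f t\<bar>) / b powr kexp + (b - a) * m) / lam"
      using \<open>0 < b powr kexp\<close> lam by (simp add: field_simps)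
    finally show ?thesis unfolding m_def .
  qed
qed

end

section \<open>Entire solutions\<close>

text \<open>The bound and the modulus of continuity on \<open>S i\<close> hold only from index i on.
  The finitely many earlier functions are continuous on a compact set and are absorbed into larger
  constants; then Arzela-Ascoli on each \<open>S i\<close> is combined with a diagonal
  subsequence.\<close>

lemma compact_family_diagonal:
  fixes F :: "nat \<Rightarrow> real \<Rightarrow> real \<times> real" and S :: "nat \<Rightarrow> real set"
  assumes S: "\<And>i. compact (S i)" and cont: "\<And>m. continuous_on UNIV (F m)"
    and bdd: "\<And>i. \<exists>M. \<forall>m\<ge>i. \<forall>x\<in>S i. norm (F m x) \<le> M"
    and equi: "\<And>i x e. x \<in> S i \<Longrightarrow> 0 < e \<Longrightarrow> \<exists>d>0. \<forall>m\<ge>i. \<forall>y\<in>S i. \<bar>x - y\<bar> < d \<longrightarrow> norm (F m x - F m y) < e"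
  obtains k where "strict_mono (k::nat \<Rightarrow> nat)" "\<And>i x. x \<in> S i \<Longrightarrow> convergent (\<lambda>m. F (k m) x)"
proof -
  have bdd': "\<exists>M. \<forall>m. \<forall>x\<in>S i. norm (F m x) \<le> M" for i
  proof -
    obtain M where M: "\<And>m x. i \<le> m \<Longrightarrow> x \<in> S i \<Longrightarrow> norm (F m x) \<le> M" using bdd by blast
    have "\<exists>B. \<forall>x\<in>S i. norm (F m x) \<le> B" for m
    proof -
      have "compact (F m ` S i)" by (rule compact_continuous_image[OF continuous_on_subset[OF cont] S]) simp
      then have "bounded (F m ` S i)" by (rule compact_imp_bounded)
      then show ?thesis by (auto simp: bounded_iff)
    qed
    then obtain B where B: "\<And>m x. x \<in> S i \<Longrightarrow> norm (F m x) \<le> B m" by metis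
    have "norm (F m x) \<le> \<bar>M\<bar> + (\<Sum>m<i. \<bar>B m\<bar>)" if "x \<in> S i" for m x
    proof (cases "i \<le> m")
      case True
      have "0 \<le> (\<Sum>m<i. \<bar>B m\<bar>)" by (rule sum_nonneg) simp
      then show ?thesis using M[OF True that] by linarith
    next
      case False
      then have "\<bar>B m\<bar> \<le> (\<Sum>m<i. \<bar>B m\<bar>)" by (intro member_le_sum) auto
      then show ?thesis using B[OF that, of m] by linarith
    qed
    then show ?thesis by blast
  qed
  have equi': "\<exists>d>0. \<forall>m. \<forall>y\<in>S i. \<bar>x - y\<bar> < d \<longrightarrow> norm (F m x - F m y) < e"
    if x: "x \<in> S i" "0 < e" for i x e
  proof -
    obtain d0 where d0: "d0 > 0" "\<And>m y. i \<le> m \<Longrightarrow> y \<in> S i \<Longrightarrow> \<bar>x - y\<bar> < d0 \<Longrightarrow> norm (F m x - F m y) < e"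
      using equi[OF x] by blast
    have "\<exists>d>0. \<forall>y. \<bar>x - y\<bar> < d \<longrightarrow> norm (F m x - F m y) < e" for m
    proof -
      obtain d where "d > 0" "\<And>y. dist y x < d \<Longrightarrow> dist (F m y) (F m x) < e"
        using cont[of m] x(2) unfolding continuous_on_iff by (metis UNIV_I)
      then show ?thesis by (intro exI[of _ d]) (auto simp: dist_norm norm_minus_commute dist_real_def abs_minus_commute)
    qed
    then obtain d where d: "\<And>m. d m > 0" "\<And>m y. \<bar>x - y\<bar> < d m \<Longrightarrow> norm (F m x - F m y) < e" by metis
    define D where "D = Min (insert d0 (d ` {..<i}))"
    have D: "D \<le> d0" "\<And>m. m < i \<Longrightarrow> D \<le> d m" "0 < D" unfolding D_def using d0 d by auto
    show ?thesis
    proof (intro exI[of _ D] conjI allI ballI impI)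
      fix m y assume "y \<in> S i" "\<bar>x - y\<bar> < D"
      then show "norm (F m x - F m y) < e"
      proof (cases "i \<le> m")
        case True
        then show ?thesis using d0(2)[of m y] \<open>y \<in> S i\<close> \<open>\<bar>x - y\<bar> < D\<close> D(1) by simp
      next
        case False
        then have "\<bar>x - y\<bar> < d m" using \<open>\<bar>x - y\<bar> < D\<close> D(2)[of m] by simp
        then show ?thesis by (rule d(2))
      qed
    qed (use D in auto)
  qed
  define Q where "Q = (\<lambda>i (r::nat \<Rightarrow> nat). \<exists>g. \<forall>e>0. \<exists>N. \<forall>n x. n \<ge> N \<and> x \<in> S i \<longrightarrow> norm (F (r n) x - g x) < e)"
  have "\<exists>k. strict_mono (k::nat \<Rightarrow> nat) \<and> Q i (r \<circ> k)" for i r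
  proof -
    obtain M where M: "\<And>m x. x \<in> S i \<Longrightarrow> norm (F m x) \<le> M" using bdd' by blast
    have eq: "\<exists>d. 0 < d \<and> (\<forall>n y. y \<in> S i \<and> norm (x - y) < d \<longrightarrow> norm (F (r n) x - F (r n) y) < e)"
      if "x \<in> S i" "0 < e" for x e
      using equi'[OF that] by (metis real_norm_def)
    obtain g k where "strict_mono (k::nat \<Rightarrow> nat)"
        "\<And>e. 0 < e \<Longrightarrow> \<exists>N. \<forall>n x. n \<ge> N \<and> x \<in> S i \<longrightarrow> norm (F (r (k n)) x - g x) < e"
      by (rule Arzela_Ascoli[of "S i" "\<lambda>n. F (r n)" M]) (use S M eq in blast)+
    then show ?thesis unfolding Q_def by auto
  qed
  moreover have "Q i (r \<circ> k2)" if Q: "Q i (r \<circ> k1)" and N: "\<And>j. N \<le> j \<Longrightarrow> \<exists>j'\<ge>j. k2 j = k1 j'"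
    for i r N and k1 k2 :: "nat \<Rightarrow> nat"
  proof -
    obtain g where g: "\<And>e. e > 0 \<Longrightarrow> \<exists>N. \<forall>n x. n \<ge> N \<and> x \<in> S i \<longrightarrow> norm (F ((r \<circ> k1) n) x - g x) < e"
      using Q unfolding Q_def by blast
    show ?thesis unfolding Q_def
    proof (intro exI[of _ g] allI impI)
      fix e :: real assume "e > 0"
      then obtain M where M: "\<And>n x. n \<ge> M \<and> x \<in> S i \<Longrightarrow> norm (F ((r \<circ> k1) n) x - g x) < e" using g by blast
      show "\<exists>N. \<forall>n x. n \<ge> N \<and> x \<in> S i \<longrightarrow> norm (F ((r \<circ> k2) n) x - g x) < e"
      proof (intro exI[of _ "max N M"] allI impI)
        fix n x assume nx: "n \<ge> max N M \<and> x \<in> S i"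
        then obtain j where "j \<ge> n" "k2 n = k1 j" using N by auto
        then show "norm (F ((r \<circ> k2) n) x - g x) < e" using M[of j x] nx by auto
      qed
    qed
  qed
  ultimately obtain k where k: "strict_mono (k::nat \<Rightarrow> nat)" "\<And>i. Q i (id \<circ> k)"
    using subsequence_diagonalization_lemma[of Q id] by metis
  show thesis
  proof (rule that[OF k(1)])
    fix i x assume x: "x \<in> S i"
    obtain g where g: "\<And>e. e > 0 \<Longrightarrow> \<exists>N. \<forall>n x. n \<ge> N \<and> x \<in> S i \<longrightarrow> norm (F (k n) x - g x) < e"
      using k(2)[of i] unfolding Q_def by auto
    have "(\<lambda>m. F (k m) x) \<longlonglongrightarrow> g x"
      unfolding lim_sequentially dist_norm using g x by meson
    then show "convergent (\<lambda>m. F (k m) x)" by (rule convergentI)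
  qed
qed

context pucci
begin

text \<open>\<open>th\<close> jumps at 0, so the slope must stay next to its coefficient: only the
  product \<open>th p * p\<close> is continuous.\<close>

lemma rhs_tendsto:
  assumes "0 < t" "(\<lambda>m. a m) \<longlonglongrightarrow> x" "(\<lambda>m. b m) \<longlonglongrightarrow> y"
  shows "(\<lambda>m. rhs (pw s) f t (a m) (b m)) \<longlonglongrightarrow> rhs (pw s) f t x y"
proof -
  have cK: "isCont K w" for w using K_continuous by (simp add: continuous_on_eq_continuous_at)
  have cT: "isCont (\<lambda>p. th p * p) w" for w using th_mult_continuous by (simp add: continuous_on_eq_continuous_at)
  have cp: "isCont (pw s) w" for w using pw_has_derivative[OF s] by (rule DERIV_isCont)
  have "(\<lambda>m. - (th (b m) * b m) * (n / t) + pw s (a m) - f t) \<longlonglongrightarrow> - (th y * y) * (n / t) + pw s x - f t"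
    by (intro tendsto_intros isCont_tendsto_compose[OF cT] isCont_tendsto_compose[OF cp] assms)
  then have "(\<lambda>m. - th (b m) * n * (b m / t) + pw s (a m) - f t) \<longlonglongrightarrow> - th y * n * (y / t) + pw s x - f t"
    by (simp add: mult_ac)
  then show ?thesis unfolding rhs_def by (rule isCont_tendsto_compose[OF cK])
qed

text \<open>Compactness needs three local bounds: \<open>local_bound\<close> for the values,
  \<open>slope_bound\<close> for the slopes, and an integrable majorant of the second derivatives.
  The last one makes the slopes equicontinuous although f need not be bounded.\<close>

theorem exists_entire_solution:
  assumes fint: "\<And>a b. 0 < a \<Longrightarrow> f absolutely_integrable_on {a..b}"
    and fk: "\<And>R. (\<lambda>t. t powr kexp * \<bar>f t\<bar>) absolutely_integrable_on {0..R}"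
  obtains u p where "\<And>a b. 0 < a \<Longrightarrow> a \<le> b \<Longrightarrow> sol_on f a b u p"
    "\<And>e r. e = 1 \<or> e = -1 \<Longrightarrow> 0 < r \<Longrightarrow>
      e * p r \<le> (integral {0..r} (\<lambda>t. t powr kexp * \<bar>f t\<bar>) / r powr kexp + r * pw s (max (e * u r) 0)) / lam"
proof -
  \<comment> \<open>The shift by 2 gives A m < B m already for m = 0.\<close>
  define A where "A = (\<lambda>m::nat. 1 / (real m + 2))"
  define B where "B = (\<lambda>m::nat. real m + 2)"
  have AB: "0 < A m" "A m < B m" for m
    by (auto simp: A_def B_def field_simps) (smt (verit) mult_nonneg_nonneg of_nat_0_le_iff)
  have Amono: "A m < A i" "B i < B m" if "i < m" for i m using that by (auto simp: A_def B_def frac_less2)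
  have Amono': "A m \<le> A i" "B i \<le> B m" if "i \<le> m" for i m using that by (auto simp: A_def B_def frac_le)
  have "\<exists>u p. sol_on f (A m) (B m) u p \<and> p (A m) = 0" for m
    by (rule exists_solution_bounded_interval[OF AB(1) less_imp_le[OF AB(2)] fint[OF AB(1)]])
  then obtain U P where UP: "\<And>m. sol_on f (A m) (B m) (U m) (P m)" "\<And>m. P m (A m) = 0" by metis
  define Sf where "Sf = (\<lambda>r. integral {0..r} (\<lambda>t. t powr kexp * \<bar>f t\<bar>))"
  have slope: "e * P m r \<le> (Sf r / r powr kexp + r * pw s (max (e * U m r) 0)) / lam"
    if "e = 1 \<or> e = -1" "r \<in> {A m..B m}" for e m r
  proof -
    have r: "0 < A m" "A m \<le> r" "r \<le> B m" "0 < r" using that AB[of m] by auto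
    have "integral {A m..r} (\<lambda>t. t powr kexp * \<bar>f t\<bar>) \<le> Sf r"
      unfolding Sf_def using r fk[of r] absolutely_integrable_on_subset_real[OF fk[of r], of "A m" r]
      by (intro integral_subset_le) (auto simp: set_lebesgue_integral_eq_integral)
    then have "integral {A m..r} (\<lambda>t. t powr kexp * \<bar>f t\<bar>) / r powr kexp \<le> Sf r / r powr kexp"
      by (rule divide_right_mono) simp
    moreover have "(r - A m) * pw s (max (e * U m r) 0) \<le> r * pw s (max (e * U m r) 0)"
      using r by (intro mult_right_mono) (auto simp: pw_def)
    ultimately show ?thesis
      using slope_bound[OF r(1,2) sol_on_subinterval[OF UP(1) order.refl r(3)] UP(2) fint[OF r(1)] that(1)] lam
      by (smt (verit, best) divide_right_mono)
  qed
  have loc: "\<exists>M C. 0 < M \<and> 0 < C \<and> (\<forall>m>i. \<forall>x\<in>{A i..B i}. \<bar>U m x\<bar> \<le> M \<and> \<bar>P m x\<bar> \<le> C)" for i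
  proof -
    obtain \<Psi> where \<Psi>: "continuous_on {A (Suc i)<..<B (Suc i)} \<Psi>"
      "\<And>u p r. sol_on f (A (Suc i)) (B (Suc i)) u p \<Longrightarrow> r \<in> {A (Suc i)<..<B (Suc i)} \<Longrightarrow> \<bar>u r\<bar> \<le> \<Psi> r"
      using local_bound[OF AB(1) AB(2) fint[OF AB(1)]] by metis
    have sub: "{A i..B i} \<subseteq> {A (Suc i)<..<B (Suc i)}" using Amono[of i "Suc i"] by auto
    have "compact (\<Psi> ` {A i..B i})" by (rule compact_continuous_image[OF continuous_on_subset[OF \<Psi>(1) sub]]) simp
    then obtain M where M: "0 < M" "\<And>x. x \<in> {A i..B i} \<Longrightarrow> \<bar>\<Psi> x\<bar> \<le> M"
      using compact_imp_bounded by (force simp: bounded_pos)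
    have Ub: "\<bar>U m x\<bar> \<le> M" if "m > i" "x \<in> {A i..B i}" for m x
    proof -
      have "sol_on f (A (Suc i)) (B (Suc i)) (U m) (P m)"
        using sol_on_subinterval[OF UP(1)] Amono'[of "Suc i" m] that by auto
      then have "\<bar>U m x\<bar> \<le> \<Psi> x" using \<Psi>(2) sub that(2) by blast
      then show ?thesis using M(2)[OF that(2)] by linarith
    qed
    define C where "C = (Sf (B i) / A i powr kexp + B i * pw s M) / lam + 1"
    have kpos: "0 \<le> kexp" using lam Lam n by simp
    have Sf_mono: "0 \<le> Sf x" "Sf x \<le> Sf (B i)" if "x \<in> {A i..B i}" for x
      unfolding Sf_def using fk[of x] fk[of "B i"] that AB[of i]
      by (auto intro!: integral_subset_le Henstock_Kurzweil_Integration.integral_nonneg simp: set_lebesgue_integral_eq_integral)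
    have Pb: "\<bar>P m x\<bar> \<le> C" if "m > i" "x \<in> {A i..B i}" for m x
    proof -
      have x: "x \<in> {A m..B m}" "0 < x" using that Amono[of i m] AB[of i] by auto
      have "e * P m x \<le> C" if e: "e = 1 \<or> e = -1" for e
      proof -
        have "e * P m x \<le> (Sf x / x powr kexp + x * pw s (max (e * U m x) 0)) / lam" by (rule slope[OF e x(1)])
        also have "\<dots> \<le> (Sf (B i) / A i powr kexp + B i * pw s M) / lam"
        proof (intro divide_right_mono add_mono frac_le mult_mono)
          show "A i powr kexp \<le> x powr kexp" using \<open>x \<in> {A i..B i}\<close> AB[of i] kpos by (intro powr_mono2) auto
          show "pw s (max (e * U m x) 0) \<le> pw s M"
            using Ub[OF \<open>m > i\<close> \<open>x \<in> {A i..B i}\<close>] e M(1) s by (intro pw_mono) auto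
        qed (use Sf_mono[OF \<open>x \<in> {A i..B i}\<close>] Sf_mono[of "B i"] \<open>x \<in> {A i..B i}\<close> AB[of i] lam in \<open>auto simp: pw_def\<close>)
        finally show ?thesis by (simp add: C_def)
      qed
      from this[of 1] this[of "-1"] show ?thesis by (simp add: abs_le_iff)
    qed
    have "0 \<le> Sf (B i)" using Sf_mono(1)[of "B i"] AB[of i] by auto
    then have "0 < C" unfolding C_def using M(1) AB[of i] lam by (intro add_nonneg_pos divide_nonneg_pos) (auto simp: pw_def)
    then show ?thesis using M(1) Ub Pb by blast
  qed
  \<comment> \<open>U m and P m solve the equation only on [A m, B m]; clamping extends them to
    continuous functions on the line.\<close>
  define cl where "cl = (\<lambda>m x. max (A m) (min x (B m)))"
  have cl_in: "cl m x \<in> {A m..B m}" for m x using AB[of m] by (auto simp: cl_def)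
  have cl_id: "cl m x = x" if "x \<in> {A m..B m}" for m x using that by (auto simp: cl_def)
  define F where "F = (\<lambda>m x. (U m (cl m x), P m (cl m x)))"
  have prim: "primitive_on (A m) (B m) (U m) (P m)"
    "primitive_on (A m) (B m) (P m) (\<lambda>t. rhs (pw s) f t (U m t) (P m t))" for m
    using UP(1) by (auto simp: sol_on_def)
  have Fcont: "continuous_on UNIV (F m)" for m
    unfolding F_def using cl_in
    by (intro continuous_on_Pair continuous_on_compose2[OF primitive_on_continuous[OF prim(1)]]
        continuous_on_compose2[OF primitive_on_continuous[OF prim(2)]]) (auto simp: cl_def intro!: continuous_intros)
  define S where "S = (\<lambda>i. {A i..B i})"
  have F_eq: "F m x = (U m x, P m x)" if "x \<in> S i" "i \<le> m" for m i x
    using that Amono'[OF that(2)] unfolding F_def S_def by (subst (1 2) cl_id) auto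
  obtain M C where MC: "\<And>i. 0 < M i" "\<And>i. 0 < C i" "\<And>i m x. i < m \<Longrightarrow> x \<in> {A i..B i} \<Longrightarrow> \<bar>U m x\<bar> \<le> M i \<and> \<bar>P m x\<bar> \<le> C i"
    using loc by metis
  define g where "g = (\<lambda>i t. (Lam * n * C i / t + pw s (M i) + \<bar>f t\<bar>) / lam)"
  have gi: "g i absolutely_integrable_on {a..b}" if "0 < a" for i a b
  proof -
    have "(\<lambda>t. Lam * n * C i / t + pw s (M i)) absolutely_integrable_on {a..b}"
      using that by (intro absolutely_integrable_continuous_real continuous_intros) auto
    from set_integrable_divide[OF set_integral_add(1)[OF this set_integrable_abs[OF fint[OF that, of b]]]]
    show ?thesis unfolding g_def by blast
  qed
  have rhs_g: "\<bar>rhs (pw s) f t (U m t) (P m t)\<bar> \<le> g i t" if "i < m" "t \<in> {A i..B i}" for i m t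
  proof -
    have t: "0 < t" using that AB[of i] by auto
    have "\<bar>rhs (pw s) f t (U m t) (P m t)\<bar> \<le> (Lam * n * \<bar>P m t\<bar> / t + \<bar>pw s (U m t)\<bar> + \<bar>f t\<bar>) / lam"
      by (rule rhs_bound[OF t])
    also have "\<dots> \<le> g i t"
      unfolding g_def
    proof (intro divide_right_mono add_mono mult_left_mono)
      show "\<bar>P m t\<bar> \<le> C i" using MC(3)[OF that] by simp
      have "\<bar>U m t\<bar> powr s \<le> M i powr s" using MC(3)[OF that] s by (intro powr_mono2) auto
      then show "\<bar>pw s (U m t)\<bar> \<le> pw s (M i)" using MC(1)[of i] by (simp add: abs_pw pw_nonneg less_imp_le)
    qed (use lam Lam n t in auto)
    finally show ?thesis .
  qed
  have "\<exists>k. strict_mono (k::nat \<Rightarrow> nat) \<and> (\<forall>i x. x \<in> S (i::nat) \<longrightarrow> convergent (\<lambda>m. F (k m) x))"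
  proof -
    have bdd: "\<exists>Q. \<forall>m\<ge>Suc i. \<forall>x\<in>S i. norm (F m x) \<le> Q" for i
    proof (intro exI[of _ "M i + C i"] allI impI ballI)
      fix m x assume m: "Suc i \<le> m" and x: "x \<in> S i"
      have "norm (F m x) \<le> \<bar>U m x\<bar> + \<bar>P m x\<bar>"
        using F_eq[OF x, of m] m norm_Pair_le[of "U m x" "P m x"] by simp
      then show "norm (F m x) \<le> M i + C i" using MC(3)[of i m x] m x by (simp add: S_def)
    qed
    have equi: "\<exists>d>0. \<forall>m\<ge>Suc i. \<forall>y\<in>S i. \<bar>x - y\<bar> < d \<longrightarrow> norm (F m x - F m y) < e" if x: "x \<in> S i" "0 < e" for i x e
    proof -
      define G where "G = (\<lambda>x. integral {A i..x} (g i))"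
      have PG: "primitive_on (A i) (B i) G (g i)"
        unfolding G_def by (rule primitive_on_indefinite[OF gi[OF AB(1)]])
      obtain d0 where d0: "d0 > 0" "\<And>y. y \<in> S i \<Longrightarrow> \<bar>y - x\<bar> < d0 \<Longrightarrow> \<bar>G y - G x\<bar> < e / 2"
        using primitive_on_continuous[OF PG] x unfolding continuous_on_iff S_def dist_real_def
        by (metis half_gt_zero)
      define d where "d = min d0 (e / (2 * C i))"
      have d: "d > 0" "d \<le> d0" "C i * d \<le> e / 2" using d0 x(2) MC(2)[of i] by (auto simp: d_def min_def field_simps)
      have le: "\<bar>U m b - U m a\<bar> \<le> C i * (b - a) \<and> \<bar>P m b - P m a\<bar> \<le> G b - G a"
        if ab: "a \<in> S i" "b \<in> S i" "a \<le> b" "i < m" for a b m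
      proof -
        have in_m: "A m \<le> a" "b \<le> B m" and in_i: "A i \<le> a" "b \<le> B i" using ab Amono[of i m] by (auto simp: S_def)
        have sub: "t \<in> {A i..B i}" if "t \<in> {a..b}" for t using that in_i by auto
        have "norm (integral {a..b} (P m)) \<le> integral {a..b} (\<lambda>_. C i)"
          by (rule integral_norm_bound_integral)
            (use primitive_on_has_integral[OF prim(1) in_m(1) ab(3) in_m(2)] MC(3)[OF ab(4) sub] in auto)
        moreover have "norm (integral {a..b} (\<lambda>t. rhs (pw s) f t (U m t) (P m t))) \<le> integral {a..b} (g i)"
          by (rule integral_norm_bound_integral)
            (use primitive_on_has_integral[OF prim(2) in_m(1) ab(3) in_m(2)]
              primitive_on_has_integral[OF PG in_i(1) ab(3) in_i(2)] rhs_g[OF ab(4) sub] in auto)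
        ultimately show ?thesis
          using primitive_on_diff[OF prim(1) in_m(1) ab(3) in_m(2)] primitive_on_diff[OF prim(2) in_m(1) ab(3) in_m(2)]
            primitive_on_diff[OF PG in_i(1) ab(3) in_i(2)] ab(3) by (simp add: mult.commute)
      qed
      show ?thesis
      proof (intro exI[of _ d] conjI allI impI ballI d(1))
        fix m y assume m: "Suc i \<le> m" and y: "y \<in> S i" "\<bar>x - y\<bar> < d"
        have "\<bar>U m x - U m y\<bar> \<le> C i * \<bar>x - y\<bar> \<and> \<bar>P m x - P m y\<bar> \<le> \<bar>G y - G x\<bar>"
          using le[of x y m] le[of y x m] x(1) y(1) m by (cases "x \<le> y") (auto simp: abs_minus_commute)
        moreover have "C i * \<bar>x - y\<bar> \<le> C i * d" using y MC(2)[of i] by (intro mult_left_mono) auto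
        moreover have "\<bar>G y - G x\<bar> < e / 2" using d0(2)[OF y(1)] y(2) d(2) by (simp add: abs_minus_commute)
        moreover have "norm (F m x - F m y) \<le> \<bar>U m x - U m y\<bar> + \<bar>P m x - P m y\<bar>"
          using F_eq[OF x(1), of m] F_eq[OF y(1), of m] m norm_Pair_le[of "U m x - U m y" "P m x - P m y"] by simp
        ultimately show "norm (F m x - F m y) < e" using d(3) by linarith
      qed
    qed
    \<comment> \<open>The bounds on \<open>S i\<close> hold for m > i. Shifting the sequence by one
      turns this into m >= i, as the diagonal lemma expects.\<close>
    define F' where "F' = (\<lambda>m. F (Suc m))"
    obtain k where "strict_mono (k::nat \<Rightarrow> nat)" "\<And>i x. x \<in> S i \<Longrightarrow> convergent (\<lambda>m. F' (k m) x)"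
    proof (rule compact_family_diagonal[of S F'])
      show "compact (S i)" for i by (simp add: S_def)
      show "continuous_on UNIV (F' m)" for m unfolding F'_def by (rule Fcont)
      show "\<exists>M. \<forall>m\<ge>i. \<forall>x\<in>S i. norm (F' m x) \<le> M" for i
        using bdd[of i] unfolding F'_def by (meson Suc_le_mono)
      show "\<exists>d>0. \<forall>m\<ge>i. \<forall>y\<in>S i. \<bar>x - y\<bar> < d \<longrightarrow> norm (F' m x - F' m y) < e" if "x \<in> S i" "0 < e" for i x e
        using equi[OF that] unfolding F'_def by (meson Suc_le_mono)
    qed (rule that)
    then show ?thesis unfolding F'_def
      by (intro exI[of _ "\<lambda>m. Suc (k m)"]) (auto simp: strict_mono_def)
  qed
  then obtain k where k: "strict_mono (k::nat \<Rightarrow> nat)" "\<And>i x. x \<in> S i \<Longrightarrow> convergent (\<lambda>m. F (k m) x)" by blast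
  have km: "i < k m" if "i < m" for i m using seq_suble[OF k(1), of m] that by simp
  define u where "u = (\<lambda>x. fst (lim (\<lambda>m. F (k m) x)))"
  define p where "p = (\<lambda>x. snd (lim (\<lambda>m. F (k m) x)))"
  have inS: "\<exists>i. x \<in> S i \<and> y \<in> S i" if "0 < x" "x \<le> y" for x y
  proof -
    obtain i :: nat where i: "1 / x + y \<le> real i" using real_arch_simple by blast
    have "0 < 1 / x" using that by simp
    then have "1 / x \<le> real i + 2" "y \<le> real i + 2" using i that by linarith+
    then have "A i \<le> x" using that by (simp add: A_def field_simps)
    then show ?thesis using that \<open>y \<le> real i + 2\<close> unfolding S_def B_def by (intro exI[of _ i]) auto
  qed
  have conv: "(\<lambda>m. U (k m) x) \<longlonglongrightarrow> u x" "(\<lambda>m. P (k m) x) \<longlonglongrightarrow> p x" if x0: "0 < x" for x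
  proof -
    obtain i where i: "x \<in> S i" using inS[OF x0 order.refl] by blast
    have L: "(\<lambda>m. F (k m) x) \<longlonglongrightarrow> lim (\<lambda>m. F (k m) x)" using k(2)[OF i] by (simp add: convergent_LIMSEQ_iff)
    have ev: "\<forall>\<^sub>F m in sequentially. F (k m) x = (U (k m) x, P (k m) x)"
      unfolding eventually_sequentially using F_eq[OF i less_imp_le[OF km]] by (intro exI[of _ "Suc i"]) (auto simp: Suc_le_eq)
    have "(\<lambda>m. fst (F (k m) x)) \<longlonglongrightarrow> u x" unfolding u_def by (rule tendsto_fst[OF L])
    then show "(\<lambda>m. U (k m) x) \<longlonglongrightarrow> u x"
      by (rule Lim_transform_eventually) (use ev in \<open>auto elim: eventually_mono\<close>)
    have "(\<lambda>m. snd (F (k m) x)) \<longlonglongrightarrow> p x" unfolding p_def by (rule tendsto_snd[OF L])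
    then show "(\<lambda>m. P (k m) x) \<longlonglongrightarrow> p x"
      by (rule Lim_transform_eventually) (use ev in \<open>auto elim: eventually_mono\<close>)
  qed
  have sol: "sol_on f a b u p" if ab: "0 < a" "a \<le> b" for a b
  proof -
    obtain i where i: "a \<in> S i" "b \<in> S i" using inS[OF ab] by blast
    have sub: "t \<in> {A i..B i}" "0 < t" if "t \<in> {a..b}" for t using that i ab by (auto simp: S_def)
    define k' where "k' = (\<lambda>m. k (m + Suc i))"
    have k': "i < k' m" for m unfolding k'_def by (rule km) simp
    have lims: "(\<lambda>m. U (k' m) x) \<longlonglongrightarrow> u x" "(\<lambda>m. P (k' m) x) \<longlonglongrightarrow> p x" if "0 < x" for x
      unfolding k'_def using LIMSEQ_ignore_initial_segment[OF conv(1)[OF that], of "Suc i"]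
        LIMSEQ_ignore_initial_segment[OF conv(2)[OF that], of "Suc i"] by auto
    have in_m: "A (k' m) \<le> a" "b \<le> B (k' m)" for m using Amono[OF k'[of m]] i by (auto simp: S_def)
    have hi: "(P (k' m) has_integral U (k' m) x - U (k' m) a) {a..x}"
      "((\<lambda>t. rhs (pw s) f t (U (k' m) t) (P (k' m) t)) has_integral P (k' m) x - P (k' m) a) {a..x}"
      if "x \<in> {a..b}" for x m
      using primitive_on_has_integral[OF prim(1)[of "k' m"] in_m(1)[of m], of x]
        primitive_on_has_integral[OF prim(2)[of "k' m"] in_m(1)[of m], of x] in_m(2)[of m] that by auto
    have D1: "p integrable_on {a..x} \<and> integral {a..x} p = u x - u a" if x: "x \<in> {a..b}" for x
    proof -
      have i1: "P (k' m) integrable_on {a..x}" for m using hi(1)[OF x] by blast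
      have bd: "norm (P (k' m) t) \<le> C i" if "t \<in> {a..x}" for m t
        using MC(3)[OF k'[of m] sub(1)[of t]] that x by simp
      have cv: "(\<lambda>m. P (k' m) t) \<longlonglongrightarrow> p t" if "t \<in> {a..x}" for t using lims(2)[of t] sub(2)[of t] that x by simp
      note dc = dominated_convergence[OF i1 integrable_const_ivl bd cv]
      have "(\<lambda>m. U (k' m) x - U (k' m) a) \<longlonglongrightarrow> integral {a..x} p"
        using dc(2) by (simp add: integral_unique[OF hi(1)[OF x]])
      moreover have "(\<lambda>m. U (k' m) x - U (k' m) a) \<longlonglongrightarrow> u x - u a"
        using x ab by (intro tendsto_diff lims) auto
      ultimately show ?thesis using dc(1) LIMSEQ_unique by blast
    qed
    have D2: "(\<lambda>t. rhs (pw s) f t (u t) (p t)) integrable_on {a..x} \<and>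
        integral {a..x} (\<lambda>t. rhs (pw s) f t (u t) (p t)) = p x - p a" if x: "x \<in> {a..b}" for x
    proof -
      have i1: "(\<lambda>t. rhs (pw s) f t (U (k' m) t) (P (k' m) t)) integrable_on {a..x}" for m using hi(2)[OF x] by blast
      have g1: "g i integrable_on {a..x}" using gi[OF ab(1)] by (simp add: set_lebesgue_integral_eq_integral)
      have bd: "norm (rhs (pw s) f t (U (k' m) t) (P (k' m) t)) \<le> g i t" if "t \<in> {a..x}" for m t
        using rhs_g[OF k'[of m] sub(1)[of t]] that x by simp
      have cv: "(\<lambda>m. rhs (pw s) f t (U (k' m) t) (P (k' m) t)) \<longlonglongrightarrow> rhs (pw s) f t (u t) (p t)" if "t \<in> {a..x}" for t
        using lims[of t] sub(2)[of t] that x by (intro rhs_tendsto) auto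
      note dc = dominated_convergence[OF i1 g1 bd cv]
      have "(\<lambda>m. P (k' m) x - P (k' m) a) \<longlonglongrightarrow> integral {a..x} (\<lambda>t. rhs (pw s) f t (u t) (p t))"
        using dc(2) by (simp add: integral_unique[OF hi(2)[OF x]])
      moreover have "(\<lambda>m. P (k' m) x - P (k' m) a) \<longlonglongrightarrow> p x - p a"
        using x ab by (intro tendsto_diff lims) auto
      ultimately show ?thesis using dc(1) LIMSEQ_unique by blast
    qed
    have pb: "norm (p t) \<le> C i" if "t \<in> {a..b}" for t
      by (rule LIMSEQ_le_const2[OF tendsto_norm[OF lims(2)[OF sub(2)[OF that]]]])
        (use MC(3)[OF k' sub(1)[OF that]] in auto)
    have qb: "norm (rhs (pw s) f t (u t) (p t)) \<le> g i t" if "t \<in> {a..b}" for t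
      by (rule LIMSEQ_le_const2[OF tendsto_norm[OF rhs_tendsto[OF sub(2)[OF that] lims[OF sub(2)[OF that]]]]])
        (use rhs_g[OF k' sub(1)[OF that]] in auto)
    have "p absolutely_integrable_on {a..b}"
      by (rule absolutely_integrable_integrable_bound[OF pb]) (use D1[of b] ab in auto)
    moreover have "(\<lambda>t. rhs (pw s) f t (u t) (p t)) absolutely_integrable_on {a..b}"
      by (rule absolutely_integrable_integrable_bound[OF qb])
        (use D2[of b] ab gi[OF ab(1)] in \<open>auto simp: set_lebesgue_integral_eq_integral\<close>)
    ultimately show ?thesis using D1 D2 unfolding sol_on_def primitive_on_def by blast
  qed
  show thesis
  proof (rule that[OF sol])
    fix e r :: real assume e: "e = 1 \<or> e = -1" and r: "0 < r"
    obtain i where i: "r \<in> S i" using inS[OF r order.refl] by blast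
    have pc: "isCont (pw s) w" for w using pw_has_derivative[OF s] by (rule DERIV_isCont)
    have "e * p r \<le> (Sf r / r powr kexp + r * pw s (max (e * u r) 0)) / lam"
    proof (rule LIMSEQ_le)
      show "(\<lambda>m. e * P (k m) r) \<longlonglongrightarrow> e * p r" by (intro tendsto_intros conv r)
      show "(\<lambda>m. (Sf r / r powr kexp + r * pw s (max (e * U (k m) r) 0)) / lam)
          \<longlonglongrightarrow> (Sf r / r powr kexp + r * pw s (max (e * u r) 0)) / lam"
        using lam by (intro tendsto_intros isCont_tendsto_compose[OF pc] conv r) auto
      have "r \<in> {A (k m)..B (k m)}" if "Suc i \<le> m" for m
        using i Amono[OF km[of i m]] that by (auto simp: S_def)
      then show "\<exists>N. \<forall>m\<ge>N. e * P (k m) r \<le> (Sf r / r powr kexp + r * pw s (max (e * U (k m) r) 0)) / lam"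
        using slope[OF e] by blast
    qed
    then show "e * p r \<le> (integral {0..r} (\<lambda>t. t powr kexp * \<bar>f t\<bar>) / r powr kexp + r * pw s (max (e * u r) 0)) / lam"
      by (simp add: Sf_def)
  qed
qed

end

section \<open>Behaviour at the origin\<close>

lemma primitive_on_cong:
  assumes "primitive_on a b u g" "\<And>x. x \<in> {a..b} \<Longrightarrow> v x = u x" "\<And>x. x \<in> {a..b} \<Longrightarrow> h x = g x"
  shows "primitive_on a b v h"
proof -
  have "primitive_on a b u h" by (rule primitive_on_spike[OF assms(1) negligible_empty]) (use assms(3) in auto)
  then show ?thesis unfolding primitive_on_def using assms(2) by auto
qed

lemma primitive_on_cmult:
  assumes "primitive_on a b u g"
  shows "primitive_on a b (\<lambda>x. C * u x) (\<lambda>x. C * g x)"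
  using assms unfolding primitive_on_def by (auto simp: right_diff_distrib)

lemma absolutely_integrable_Icc_combine:
  fixes g :: "real \<Rightarrow> real"
  assumes "g absolutely_integrable_on {a..b}" "g absolutely_integrable_on {b..c}" "a \<le> b" "b \<le> c"
  shows "g absolutely_integrable_on {a..c}"
  using absolutely_integrable_Un[OF assms(1,2)] assms(3,4) by (simp add: ivl_disj_un_two_touch)

lemma absolutely_integrable_continuous_mult:
  fixes g r :: "real \<Rightarrow> real"
  assumes "continuous_on {a..b} r" "g absolutely_integrable_on {a..b}"
  shows "(\<lambda>t. r t * g t) absolutely_integrable_on {a..b}"
proof (rule absolutely_integrable_bounded_measurable_product_real)
  show "r \<in> borel_measurable (lebesgue_on {a..b})"
    using assms(1) by (rule continuous_imp_measurable_on_sets_lebesgue) simp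
  show "bounded (r ` {a..b})"
    using compact_continuous_image[OF assms(1)] compact_imp_bounded by blast
qed (use assms in auto)

text \<open>Subtracting the integrable minorant l leaves a nonnegative function, for which bounded
  integrals over compact subintervals suffice. In the proof the minorant is redefined at 0, where l
  is not compared with g.\<close>

lemma absolutely_integrable_lower_improper:
  fixes g l :: "real \<Rightarrow> real"
  assumes g: "\<And>a. 0 < a \<Longrightarrow> a \<le> b \<Longrightarrow> g absolutely_integrable_on {a..b}"
    and l: "l absolutely_integrable_on {0..b}" "\<And>t. 0 < t \<Longrightarrow> t \<le> b \<Longrightarrow> l t \<le> g t"
    and B: "\<And>c d. 0 < c \<Longrightarrow> c \<le> d \<Longrightarrow> d \<le> b \<Longrightarrow> \<bar>integral {c..d} g\<bar> \<le> B"
  shows "g absolutely_integrable_on {0..b}"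
proof -
  have "g absolutely_integrable_on cbox 0 b"
  proof (rule absolutely_integrable_improper)
    have gi: "g integrable_on {c..d}" if "0 < c" "d \<le> b" for c d
    proof (cases "c \<le> d")
      case True
      have "g absolutely_integrable_on {c..d}"
        by (rule absolutely_integrable_on_subset_real[OF g[of c]]) (use that True in auto)
      then show ?thesis by (simp add: set_lebesgue_integral_eq_integral)
    qed auto
    have sub: "0 < c \<and> d < b" if "cbox c d \<subseteq> box 0 b" "c \<le> d" for c d :: real
      using that by (auto simp: subset_iff)
    show "g integrable_on cbox c d" if "cbox c d \<subseteq> box 0 b" for c d
      using gi[of c d] sub[OF that] by (cases "c \<le> d") auto
    show "bounded {integral (cbox c d) g |c d. cbox c d \<subseteq> box 0 b}"
      unfolding bounded_iff
    proof (intro exI[of _ "max B 0"] ballI)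
      fix x assume "x \<in> {integral (cbox c d) g |c d. cbox c d \<subseteq> box 0 b}"
      then obtain c d where cd: "x = integral (cbox c d) g" "cbox c d \<subseteq> box 0 b" by blast
      show "norm x \<le> max B 0"
        using B[of c d] sub[OF cd(2)] cd(1) by (cases "c \<le> d") auto
    qed
    fix i :: real assume "i \<in> Basis"
    have "(\<lambda>t. if t = 0 then g 0 else l t) absolutely_integrable_on {0..b}"
      by (rule absolutely_integrable_spike[OF l(1), of "{0}"]) auto
    moreover have "(if t = 0 then g 0 else l t) \<le> g t" if "t \<in> {0..b}" for t
      using l(2)[of t] that by (cases "t = 0") auto
    ultimately show "\<exists>l. l absolutely_integrable_on cbox 0 b \<and>
       ((\<forall>x\<in>cbox 0 b. g x \<bullet> i \<le> l x) \<or> (\<forall>x\<in>cbox 0 b. l x \<le> g x \<bullet> i))"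
      using \<open>i \<in> Basis\<close>
      by (intro exI[of _ "\<lambda>t. if t = 0 then g 0 else l t"] conjI disjI2 ballI) simp_all
  qed
  then show ?thesis by simp
qed

lemma absolutely_integrable_dominated_at_0:
  fixes g w :: "real \<Rightarrow> real"
  assumes g: "\<And>a. 0 < a \<Longrightarrow> a \<le> b \<Longrightarrow> g absolutely_integrable_on {a..b}"
    and w: "w absolutely_integrable_on {0..b}" "\<And>t. 0 < t \<Longrightarrow> t \<le> b \<Longrightarrow> \<bar>g t\<bar> \<le> w t"
  shows "g absolutely_integrable_on {0..b}"
proof (rule absolutely_integrable_lower_improper[OF g absolutely_integrable_minus_real[OF w(1)]])
  show "- w t \<le> g t" if "0 < t" "t \<le> b" for t using w(2)[OF that] by simp
  fix c d assume cd: "0 < c" "c \<le> d" "d \<le> b"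
  have wi: "w integrable_on {c..d}" "(\<lambda>t. \<bar>w t\<bar>) integrable_on {c..d}" "(\<lambda>t. \<bar>w t\<bar>) integrable_on {0..b}" "g integrable_on {c..d}"
    using absolutely_integrable_on_subset_real[OF w(1), of c d] w(1) cd
      absolutely_integrable_on_subset_real[OF g[of c], of c d] set_integrable_abs[OF w(1)]
      set_integrable_abs[OF absolutely_integrable_on_subset_real[OF w(1), of c d]]
    by (auto simp: set_lebesgue_integral_eq_integral)
  have "norm (integral {c..d} g) \<le> integral {c..d} (\<lambda>t. \<bar>w t\<bar>)"
  proof (rule integral_norm_bound_integral[OF wi(4,2)])
    show "norm (g x) \<le> \<bar>w x\<bar>" if "x \<in> {c..d}" for x using w(2)[of x] that cd by auto
  qed
  also have "\<dots> \<le> integral {0..b} (\<lambda>t. \<bar>w t\<bar>)"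
    by (rule integral_subset_le) (use wi cd in auto)
  finally show "\<bar>integral {c..d} g\<bar> \<le> integral {0..b} (\<lambda>t. \<bar>w t\<bar>)" by simp
qed

lemma absolutely_integrable_nonneg_at_0:
  fixes g :: "real \<Rightarrow> real"
  assumes g: "\<And>a. 0 < a \<Longrightarrow> a \<le> b \<Longrightarrow> g absolutely_integrable_on {a..b}"
    and nn: "\<And>t. 0 < t \<Longrightarrow> t \<le> b \<Longrightarrow> 0 \<le> g t"
    and B: "\<And>a. 0 < a \<Longrightarrow> a \<le> b \<Longrightarrow> integral {a..b} g \<le> B"
  shows "g absolutely_integrable_on {0..b}"
proof (rule absolutely_integrable_lower_improper[OF g absolutely_integrable_zero nn])
  fix c d assume cd: "0 < c" "c \<le> d" "d \<le> b"
  have gi: "g integrable_on {c..d}" "g integrable_on {c..b}"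
    using absolutely_integrable_on_subset_real[OF g[of c], of c d] g[of c] cd
    by (auto simp: set_lebesgue_integral_eq_integral)
  have "0 \<le> integral {c..d} g" using gi cd nn by (intro Henstock_Kurzweil_Integration.integral_nonneg) auto
  moreover have "integral {c..d} g \<le> integral {c..b} g" using gi cd nn by (intro integral_subset_le) auto
  ultimately show "\<bar>integral {c..d} g\<bar> \<le> B" using B[of c] cd by auto
qed auto

text \<open>The factor rho for an arbitrary drift c, normalized to 1 at r = 1. The two cases spell
  out the orientation of the integral from 1 to r.\<close>

definition weight :: "(real \<Rightarrow> real) \<Rightarrow> real \<Rightarrow> real" where
  "weight c r = exp (if 1 \<le> r then integral {1..r} c else - integral {r..1} c)"

lemma weight_pos: "0 < weight c r"
  by (simp add: weight_def)

lemma weight_1: "weight c 1 = 1"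
  by (simp add: weight_def)

lemma weight_step:
  assumes c: "\<And>a b. 0 < a \<Longrightarrow> c absolutely_integrable_on {a..b}" and xy: "0 < x" "x \<le> y"
  shows "weight c y = weight c x * exp (integral {x..y} c)"
proof -
  have ci: "c integrable_on {a..b}" if "0 < a" for a b
    using c[OF that] by (simp add: set_lebesgue_integral_eq_integral)
  have comb: "integral {a..m} c + integral {m..b} c = integral {a..b} c" if "0 < a" "a \<le> m" "m \<le> b" for a m b
    using Henstock_Kurzweil_Integration.integral_combine[OF that(2,3) ci[OF that(1)]] .
  consider "1 \<le> x" | "y < 1" | "x < 1" "1 \<le> y" by linarith
  then have "(if 1 \<le> y then integral {1..y} c else - integral {y..1} c) =
      (if 1 \<le> x then integral {1..x} c else - integral {x..1} c) + integral {x..y} c"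
    using comb[of 1 x y] comb[of x y 1] comb[of x 1 y] xy by cases auto
  then show ?thesis by (simp add: weight_def exp_add)
qed

lemma weight_primitive:
  assumes c: "\<And>a b. 0 < a \<Longrightarrow> c absolutely_integrable_on {a..b}" and ab: "0 < a" "a \<le> b"
  shows "primitive_on a b (weight c) (\<lambda>t. weight c t * c t)"
proof (rule primitive_on_cong)
  show "primitive_on a b (\<lambda>t. weight c a * exp (integral {a..t} c)) (\<lambda>t. weight c a * (exp (integral {a..t} c) * c t))"
    by (rule primitive_on_cmult[OF primitive_on_exp_integral[OF ab(2) c[OF ab(1)]]])
  fix t assume "t \<in> {a..b}"
  then have *: "weight c t = weight c a * exp (integral {a..t} c)"
    by (intro weight_step[OF c ab(1)]) auto
  then show "weight c t = weight c a * exp (integral {a..t} c)" .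
  show "weight c t * c t = weight c a * (exp (integral {a..t} c) * c t)"
    by (simp only: *[symmetric] mult.assoc[symmetric])
qed

text \<open>Monotonicity of weight c t / t powr k, written without division: the logarithmic
  derivative of this quotient is c t - k / t >= 0.\<close>

lemma weight_ratio:
  assumes c: "\<And>a b. 0 < a \<Longrightarrow> c absolutely_integrable_on {a..b}" and k: "\<And>t. 0 < t \<Longrightarrow> k / t \<le> c t"
    and xy: "0 < x" "x \<le> y"
  shows "weight c x * y powr k \<le> weight c y * x powr k"
proof -
  have "((\<lambda>t. k / t) has_integral k * ln y - k * ln x) {x..y}"
    using xy by (intro fundamental_theorem_of_calculus)
      (auto intro!: derivative_eq_intros simp flip: has_real_derivative_iff_has_vector_derivative)
  moreover have "integral {x..y} (\<lambda>t. k / t) \<le> integral {x..y} c"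
  proof (rule integral_le)
    show "(\<lambda>t. k / t) integrable_on {x..y}"
      using xy by (intro integrable_continuous_real continuous_intros) auto
    show "c integrable_on {x..y}" using c[OF xy(1), of y] by (simp add: set_lebesgue_integral_eq_integral)
  qed (use xy k in auto)
  ultimately have "k * ln y - k * ln x \<le> integral {x..y} c" by (simp add: integral_unique)
  then have "exp (k * ln y) \<le> exp (integral {x..y} c) * exp (k * ln x)"
    unfolding exp_add[symmetric] exp_le_cancel_iff by linarith
  then have "y powr k \<le> exp (integral {x..y} c) * x powr k" using xy by (simp add: powr_def)
  then have "weight c x * y powr k \<le> weight c x * (exp (integral {x..y} c) * x powr k)"
    using weight_pos[of c x] by (intro mult_left_mono) auto
  then show ?thesis using weight_step[OF c xy] by (simp add: mult.assoc)
qed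

lemma integral_tendsto_0_at_right:
  fixes k :: "real \<Rightarrow> real"
  assumes "k absolutely_integrable_on {0..1}"
  shows "((\<lambda>x. integral {0..x} k) \<longlongrightarrow> 0) (at_right 0)"
proof -
  have "continuous_on {0..1} (\<lambda>x. integral {0..x} k)"
    using assms by (intro indefinite_integral_continuous_1) (simp add: set_lebesgue_integral_eq_integral)
  then have "((\<lambda>x. integral {0..x} k) \<longlongrightarrow> integral {0..0} k) (at 0 within {0..1})"
    unfolding continuous_on_def by (rule bspec) simp
  then show ?thesis by (simp add: at_within_Icc_at_right)
qed

section \<open>Weight and flux of a fixed solution\<close>

locale pucci_sol = pucci +
  fixes f u p :: "real \<Rightarrow> real"
  assumes sol: "\<And>a b. 0 < a \<Longrightarrow> a \<le> b \<Longrightarrow> sol_on f a b u p"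
    and fint: "\<And>a b. 0 < a \<Longrightarrow> f absolutely_integrable_on {a..b}"
    and fk: "\<And>R. (\<lambda>t. t powr kexp * \<bar>f t\<bar>) absolutely_integrable_on {0..R}"
begin

text \<open>Dictionary: q is u'', c the drift, R the weight rho, h = rho u' the flux, and k the
  derivative of the flux, that is, rho tilde times (|u|^(s-1) u - f).\<close>

definition q :: "real \<Rightarrow> real" where "q t = rhs (pw s) f t (u t) (p t)"
definition c :: "real \<Rightarrow> real" where "c t = drift t (p t) (q t)"
definition R :: "real \<Rightarrow> real" where "R = weight c"
definition h :: "real \<Rightarrow> real" where "h t = R t * p t"
definition k :: "real \<Rightarrow> real" where "k t = R t / th (q t) * (pw s (u t) - f t)"

lemma prim_u: "0 < a \<Longrightarrow> a \<le> b \<Longrightarrow> primitive_on a b u p"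
  and prim_p: "0 < a \<Longrightarrow> a \<le> b \<Longrightarrow> primitive_on a b p q"
  using sol unfolding sol_on_def q_def[abs_def] by auto

lemma c_int: "0 < a \<Longrightarrow> c absolutely_integrable_on {a..b}"
proof (cases "a \<le> b")
  case True
  assume "0 < a"
  then show ?thesis unfolding c_def using prim_p[OF _ True]
    by (intro drift_absolutely_integrable primitive_on_measurable[OF prim_p[OF _ True]]
        absolutely_integrable_imp_measurable_on) (auto simp: primitive_on_def)
qed auto

lemma R_pos: "0 < R t" by (simp add: R_def weight_pos)

lemma prim_R: "0 < a \<Longrightarrow> a \<le> b \<Longrightarrow> primitive_on a b R (\<lambda>t. R t * c t)"
  unfolding R_def by (rule weight_primitive[OF c_int])

lemma R_ratio: "0 < x \<Longrightarrow> x \<le> y \<Longrightarrow> R x * y powr kexp \<le> R y * x powr kexp"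
  unfolding R_def
proof (rule weight_ratio[OF c_int])
  show "kexp / t \<le> c t" if "0 < t" for t
    unfolding c_def by (rule drift_bounds(1)[OF that])
qed auto

lemma R_nonneg: "0 \<le> R t"
  using R_pos[of t] by simp

lemma R_le: "0 < t \<Longrightarrow> t \<le> 1 \<Longrightarrow> R t \<le> t powr kexp"
  using R_ratio[of t 1] by (simp add: R_def weight_1)

lemma R_le_1: "0 < t \<Longrightarrow> t \<le> 1 \<Longrightarrow> R t \<le> 1"
  using R_le[of t] powr_le1[of kexp t] lam Lam n by auto

lemma eq_q: "q t + c t * p t = (pw s (u t) - f t) / th (q t)"
  unfolding q_def c_def by (rule rhs_drift)

text \<open>R is the integrating factor of the drift, so the first-order term disappears from the
  derivative of R * p.\<close>

lemma prim_h:
  assumes "0 < a" "a \<le> b"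
  shows "primitive_on a b h k"
proof (rule primitive_on_cong[OF primitive_on_mult[OF assms(2) prim_R[OF assms] prim_p[OF assms]]])
  fix t
  have "R t * c t * p t + R t * q t = R t * (q t + c t * p t)" by (simp add: algebra_simps)
  then show "k t = R t * c t * p t + R t * q t" unfolding eq_q by (simp add: k_def)
qed (simp add: h_def)

lemma continuous_all:
  assumes "0 < a"
  shows "continuous_on {a..b} u" "continuous_on {a..b} p" "continuous_on {a..b} R" "continuous_on {a..b} h"
proof -
  have *: "continuous_on {a..b} w" if "\<And>b. a \<le> b \<Longrightarrow> primitive_on a b w w'" for w w'
    by (cases "a \<le> b") (use primitive_on_continuous[OF that] in auto)
  show "continuous_on {a..b} u" "continuous_on {a..b} p" "continuous_on {a..b} R" "continuous_on {a..b} h"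
    using *[OF prim_u[OF assms]] *[OF prim_p[OF assms]] *[OF prim_R[OF assms]] *[OF prim_h[OF assms]] by auto
qed

text \<open>Multiplies the flux equation by \<gamma> (u). For nondecreasing \<gamma> the last term
  is nonnegative, and for bounded \<gamma> the boundary terms are controlled by the flux
  alone.\<close>

lemma test_identity:
  assumes "0 < a" "a \<le> b" and \<gamma>: "\<And>x. (\<gamma> has_real_derivative \<gamma>' x) (at x)" "continuous_on UNIV \<gamma>'"
  shows "primitive_on a b (\<lambda>t. h t * \<gamma> (u t)) (\<lambda>t. k t * \<gamma> (u t) + R t * (p t)\<^sup>2 * \<gamma>' (u t))"
  using primitive_on_mult[OF assms(2) prim_h[OF assms(1,2)] primitive_on_compose[OF assms(2) prim_u[OF assms(1,2)] \<gamma>]]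
  by (rule primitive_on_cong) (simp_all add: h_def power2_eq_square)

text \<open>On (0, 1] the weight is at most t powr kexp, so the condition on f applies; beyond 1
  everything is locally integrable.\<close>

lemma Rf_int: "(\<lambda>t. R t * \<bar>f t\<bar>) absolutely_integrable_on {0..b}"
proof -
  have I: "(\<lambda>t. R t * \<bar>f t\<bar>) absolutely_integrable_on {a..b}" if "0 < a" for a b
    using set_integrable_abs[OF fint[OF that]] by (intro absolutely_integrable_continuous_mult continuous_all that)
  have I1: "(\<lambda>t. R t * \<bar>f t\<bar>) absolutely_integrable_on {0..1}"
  proof (rule absolutely_integrable_dominated_at_0[OF I fk])
    show "\<bar>R t * \<bar>f t\<bar>\<bar> \<le> t powr kexp * \<bar>f t\<bar>" if "0 < t" "t \<le> 1" for t
      using mult_right_mono[OF R_le[OF that], of "\<bar>f t\<bar>"] R_nonneg[of t] by (simp add: abs_mult)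
  qed
  show ?thesis
  proof (cases "b \<le> 1")
    case True
    then show ?thesis by (intro absolutely_integrable_on_subset_real[OF I1]) auto
  next
    case False
    then show ?thesis by (intro absolutely_integrable_Icc_combine[OF I1 I]) auto
  qed
qed

definition "Sf r = integral {0..r} (\<lambda>t. t powr kexp * \<bar>f t\<bar>)"

lemma Sf_tendsto_0: "(Sf \<longlongrightarrow> 0) (at_right 0)"
  unfolding Sf_def[abs_def] by (rule integral_tendsto_0_at_right[OF fk])

text \<open>The slope bound forces the flux \<open>h\<close> to become small along a sequence: either the slope
  vanishes there, or it has a sign near \<open>0\<close> and the relevant part of \<open>u\<close> is bounded.\<close>

lemma flux_small:
  assumes B: "\<And>e r. e = 1 \<or> e = -1 \<Longrightarrow> 0 < r \<Longrightarrow>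
      e * p r \<le> (Sf r / r powr kexp + r * pw s (max (e * u r) 0)) / lam" and "0 < \<delta>"
  shows "\<exists>x. 0 < x \<and> x < \<delta> \<and> \<bar>h x\<bar> < \<delta>"
proof (cases "\<exists>x. 0 < x \<and> x < \<delta> \<and> p x = 0")
  case True
  then show ?thesis using assms(2) by (auto simp: h_def)
next
  case False
  then have nz: "p x \<noteq> 0" if "0 < x" "x < \<delta>" for x using that by blast
  define x0 where "x0 = min (\<delta> / 2) 1"
  have x0: "0 < x0" "x0 < \<delta>" "x0 \<le> 1" using assms(2) by (auto simp: x0_def)
  define e :: real where "e = (if 0 < p x0 then 1 else -1)"
  have e: "e = 1 \<or> e = -1" by (simp add: e_def)
  have sgn: "0 < e * p x" if x: "0 < x" "x \<le> x0" for x
  proof (rule ccontr)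
    assume "\<not> 0 < e * p x"
    moreover have "0 \<le> e * p x0" by (auto simp: e_def)
    moreover have "continuous_on {x..x0} (\<lambda>t. e * p t)" using x by (intro continuous_intros continuous_all)
    ultimately obtain y where "x \<le> y" "y \<le> x0" "e * p y = 0"
      using IVT'[of "\<lambda>t. e * p t" x 0 x0] x by force
    then show False using nz[of y] x x0 e by auto
  qed
  have mono: "e * u x \<le> e * u x0" if x: "0 < x" "x \<le> x0" for x
  proof -
    have "0 \<le> integral {x..x0} (\<lambda>t. e * p t)"
      using x sgn primitive_on_has_integral[OF prim_u[OF x] order.refl x(2) order.refl]
      by (intro Henstock_Kurzweil_Integration.integral_nonneg integrable_on_mult_right) (force intro: less_imp_le)+
    then show ?thesis using primitive_on_diff[OF prim_u[OF x] order.refl x(2) order.refl] e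
      by (auto simp: right_diff_distrib)
  qed
  define m where "m = pw s (max (e * u x0) 0)"
  have m: "0 \<le> m" by (simp add: m_def pw_def)
  have le: "\<bar>h x\<bar> \<le> (Sf x + x * m) / lam" if x: "0 < x" "x \<le> x0" for x
  proof -
    have "\<bar>h x\<bar> = R x * (e * p x)" using sgn[OF x] e R_pos[of x] by (auto simp: h_def abs_mult)
    also have "\<dots> \<le> x powr kexp * ((Sf x / x powr kexp + x * m) / lam)"
    proof (rule mult_mono)
      have "e * p x \<le> (Sf x / x powr kexp + x * pw s (max (e * u x) 0)) / lam" by (rule B[OF e x(1)])
      also have "\<dots> \<le> (Sf x / x powr kexp + x * m) / lam"
        unfolding m_def using mono[OF x] x lam s by (intro divide_right_mono add_mono mult_left_mono pw_mono) auto
      finally show "e * p x \<le> (Sf x / x powr kexp + x * m) / lam" .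
    qed (use R_le[of x] x x0 sgn[OF x] in auto)
    also have "\<dots> = (Sf x + x powr kexp * (x * m)) / lam"
    proof -
      have "y * ((S / y + z) / l) = (S + y * z) / l" if "y \<noteq> 0" for y S z l :: real
        using that by (simp add: distrib_left)
      then show ?thesis using x by (metis less_irrefl powr_gt_zero)
    qed
    also have "\<dots> \<le> (Sf x + 1 * (x * m)) / lam"
      using x x0 m lam Lam n powr_le1[of kexp x] by (intro divide_right_mono add_left_mono mult_right_mono) auto
    finally show ?thesis by simp
  qed
  have "((\<lambda>x. (Sf x + x * m) / lam) \<longlongrightarrow> (0 + 0 * m) / lam) (at_right 0)"
    using lam by (intro tendsto_intros Sf_tendsto_0) auto
  then have "\<forall>\<^sub>F x in at_right 0. (Sf x + x * m) / lam < \<delta>"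
    using assms(2) by (auto dest: order_tendstoD(2)[of _ _ _ \<delta>])
  moreover have "\<forall>\<^sub>F x in at_right 0. 0 < x \<and> x < x0"
    using x0 by (auto simp: eventually_at_right_field)
  ultimately have "\<forall>\<^sub>F x in at_right 0. (Sf x + x * m) / lam < \<delta> \<and> 0 < x \<and> x < x0" by (rule eventually_conj)
  then obtain x where "(Sf x + x * m) / lam < \<delta>" "0 < x" "x < x0"
    using eventually_happens'[OF trivial_limit_at_right_real] by blast
  then show ?thesis using le[of x] x0 by (intro exI[of _ x]) auto
qed

end

text \<open>Smallness along a sequence is all that the existence proof yields directly;
  \<open>h_eq\<close> and \<open>h_tendsto_0\<close> upgrade it to convergence of the whole
  flux.\<close>

locale pucci_sol_small_flux = pucci_sol +
  assumes small: "\<And>\<delta>. 0 < \<delta> \<Longrightarrow> \<exists>x. 0 < x \<and> x < \<delta> \<and> \<bar>h x\<bar> < \<delta>"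
begin

text \<open>Testing with \<open>arctan u\<close>.\<close>

lemma Rus_int: "(\<lambda>t. R t * \<bar>u t\<bar> powr s) absolutely_integrable_on {0..b}"
proof -
  have I: "(\<lambda>t. R t * \<bar>u t\<bar> powr s) absolutely_integrable_on {a..b}" if "0 < a" for a b
  proof -
    have "continuous_on {a..b} (\<lambda>t. R t * \<bar>pw s (u t)\<bar>)"
      by (intro continuous_intros continuous_all[OF that] s)
    then show ?thesis by (intro absolutely_integrable_continuous_real) (simp add: abs_pw)
  qed
  define w where "w = (\<lambda>t. k t * arctan (u t) + R t * (p t)\<^sup>2 * inverse (1 + (u t)\<^sup>2))"
  have Pw: "primitive_on x 1 (\<lambda>t. h t * arctan (u t)) w" if "0 < x" "x \<le> 1" for x
    unfolding w_def
    by (rule test_identity[OF that]) (auto intro!: DERIV_arctan continuous_intros simp: add_nonneg_eq_0_iff)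
  \<comment> \<open>Constants: |arctan| < 2, and arctan is at least pi / 4 > 1 / 2 from 1 on. Where
    |u| <= 1 the integrand is at most R <= 1; elsewhere it is at most twice the tested absorption
    term. The gradient term in w is nonnegative and is dropped.\<close>
  have pt: "R t * \<bar>u t\<bar> powr s \<le> 1 + 2 * Lam * w t + 4 * Lam / lam * (t powr kexp * \<bar>f t\<bar>)" if t: "0 < t" "t \<le> 1" for t
  proof -
    have R: "0 < R t" "R t \<le> 1" "R t \<le> t powr kexp" using R_pos R_le_1[OF t] R_le[OF t] by auto
    have at: "\<bar>arctan x\<bar> \<le> 2" for x using arctan_bounded[of x] pi_less_4 by auto
    have k: "k t * arctan (u t) = R t / th (q t) * (\<bar>u t\<bar> powr s * \<bar>arctan (u t)\<bar> - f t * arctan (u t))"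
    proof -
      have "pw s (u t) * arctan (u t) = \<bar>u t\<bar> powr s * \<bar>arctan (u t)\<bar>"
      proof (cases "0 \<le> u t")
        case True then show ?thesis by (simp add: pw_nonneg zero_le_arctan_iff)
      next
        case False
        then have "arctan (u t) \<le> 0" "pw s (u t) = - (\<bar>u t\<bar> powr s)"
          using pw_nonneg[of "- u t" s] by (auto simp: pw_minus arctan_le_zero_iff)
        then show ?thesis by simp
      qed
      then show ?thesis unfolding k_def by (simp add: left_diff_distrib)
    qed
    have "R t / Lam * (\<bar>u t\<bar> powr s * \<bar>arctan (u t)\<bar>) \<le> R t / th (q t) * (\<bar>u t\<bar> powr s * \<bar>arctan (u t)\<bar>)"
      using R th_bounds[of "q t"] lam by (intro mult_right_mono divide_left_mono) auto
    moreover have "R t / th (q t) * (f t * arctan (u t)) \<le> t powr kexp / lam * (\<bar>f t\<bar> * 2)"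
    proof -
      have "R t / th (q t) * (f t * arctan (u t)) \<le> R t / th (q t) * (\<bar>f t\<bar> * 2)"
      proof (intro mult_left_mono)
        have "f t * arctan (u t) \<le> \<bar>f t\<bar> * \<bar>arctan (u t)\<bar>" by (metis abs_ge_self abs_mult)
        also have "\<dots> \<le> \<bar>f t\<bar> * 2" using at by (intro mult_left_mono) auto
        finally show "f t * arctan (u t) \<le> \<bar>f t\<bar> * 2" .
      qed (use R th_bounds[of "q t"] in auto)
      also have "\<dots> \<le> t powr kexp / lam * (\<bar>f t\<bar> * 2)"
        using R th_bounds[of "q t"] lam by (intro mult_right_mono frac_le) auto
      finally show ?thesis .
    qed
    moreover have "0 \<le> R t * (p t)\<^sup>2 * inverse (1 + (u t)\<^sup>2)" using R by simp
    ultimately have w: "R t / Lam * (\<bar>u t\<bar> powr s * \<bar>arctan (u t)\<bar>) - t powr kexp / lam * (\<bar>f t\<bar> * 2) \<le> w t"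
      unfolding w_def k right_diff_distrib by linarith
    have "R t * \<bar>u t\<bar> powr s \<le> 1 + 2 * (R t * (\<bar>u t\<bar> powr s * \<bar>arctan (u t)\<bar>))"
    proof (cases "\<bar>u t\<bar> \<le> 1")
      case True
      then have "\<bar>u t\<bar> powr s \<le> 1" using s by (intro powr_le1) auto
      then have "R t * \<bar>u t\<bar> powr s \<le> 1 * 1" using R by (intro mult_mono) auto
      moreover have "0 \<le> R t * (\<bar>u t\<bar> powr s * \<bar>arctan (u t)\<bar>)" using R by simp
      ultimately show ?thesis by linarith
    next
      case False
      have "pi / 4 \<le> arctan \<bar>u t\<bar>" using False arctan_monotone'[of 1 "\<bar>u t\<bar>"] by (simp add: arctan_one)
      moreover have "arctan \<bar>u t\<bar> = \<bar>arctan (u t)\<bar>"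
        by (cases "0 \<le> u t") (auto simp: arctan_minus zero_le_arctan_iff)
      ultimately have "1 \<le> 2 * \<bar>arctan (u t)\<bar>" using pi_gt3 by linarith
      then have "R t * \<bar>u t\<bar> powr s * 1 \<le> R t * \<bar>u t\<bar> powr s * (2 * \<bar>arctan (u t)\<bar>)"
        using R by (intro mult_left_mono) auto
      then show ?thesis by (simp add: mult_ac)
    qed
    also have "R t * (\<bar>u t\<bar> powr s * \<bar>arctan (u t)\<bar>) \<le> Lam * w t + Lam * (t powr kexp / lam * (\<bar>f t\<bar> * 2))"
      using mult_left_mono[OF w, of Lam] Lam by (simp add: algebra_simps)
    finally show ?thesis by (simp add: algebra_simps)
  qed
  define B where "B = 1 + 2 * Lam * (2 * \<bar>h 1\<bar> + 2) + 4 * Lam / lam * Sf 1"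
  have I1: "(\<lambda>t. R t * \<bar>u t\<bar> powr s) absolutely_integrable_on {0..1}"
  proof (rule absolutely_integrable_nonneg_at_0[OF I])
    show "0 \<le> R t * \<bar>u t\<bar> powr s" for t using R_pos[of t] by simp
    fix a :: real assume a: "0 < a" "a \<le> 1"
    \<comment> \<open>The lower limit is moved to a point of small flux, so the boundary term h x *
      arctan (u x) stays bounded even if u is not bounded near 0.\<close>
    obtain x where x: "0 < x" "x < a" "\<bar>h x\<bar> < a" using small[OF a(1)] by blast
    then have x1: "x \<le> 1" using a by simp
    have int: "(\<lambda>t. R t * \<bar>u t\<bar> powr s) integrable_on {y..1}" if "0 < y" for y
      using I[OF that] by (simp add: set_lebesgue_integral_eq_integral)
    have fi: "(\<lambda>t. t powr kexp * \<bar>f t\<bar>) integrable_on {x..1}" "(\<lambda>t. t powr kexp * \<bar>f t\<bar>) integrable_on {0..1}"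
      using absolutely_integrable_on_subset_real[OF fk[of 1], of x 1] fk[of 1] x
      by (auto simp: set_lebesgue_integral_eq_integral)
    have w: "(w has_integral h 1 * arctan (u 1) - h x * arctan (u x)) {x..1}"
      by (rule primitive_on_has_integral[OF Pw[OF x(1) x1] order.refl x1 order.refl])
    have "integral {a..1} (\<lambda>t. R t * \<bar>u t\<bar> powr s) \<le> integral {x..1} (\<lambda>t. R t * \<bar>u t\<bar> powr s)"
      using x a int R_nonneg by (intro integral_subset_le) auto
    also have "\<dots> \<le> integral {x..1} (\<lambda>t. 1 + 2 * Lam * w t + 4 * Lam / lam * (t powr kexp * \<bar>f t\<bar>))"
      using x pt w fi int by (intro integral_le integrable_add integrable_on_mult_right) auto
    also have "\<dots> = (1 - x) + 2 * Lam * (h 1 * arctan (u 1) - h x * arctan (u x))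
        + 4 * Lam / lam * integral {x..1} (\<lambda>t. t powr kexp * \<bar>f t\<bar>)"
    proof (rule integral_unique)
      have "((\<lambda>t. 1) has_integral (1 - x)) {x..1}" using has_integral_const_real[of "1::real" x 1] x1 by simp
      moreover have "((\<lambda>t. t powr kexp * \<bar>f t\<bar>) has_integral integral {x..1} (\<lambda>t. t powr kexp * \<bar>f t\<bar>)) {x..1}"
        using fi(1) by (rule integrable_integral)
      ultimately show "((\<lambda>t. 1 + 2 * Lam * w t + 4 * Lam / lam * (t powr kexp * \<bar>f t\<bar>)) has_integral
         (1 - x) + 2 * Lam * (h 1 * arctan (u 1) - h x * arctan (u x))
        + 4 * Lam / lam * integral {x..1} (\<lambda>t. t powr kexp * \<bar>f t\<bar>)) {x..1}"
        using w by (intro has_integral_add has_integral_mult_right)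
    qed
    also have "\<dots> \<le> B"
      unfolding B_def
    proof (intro add_mono mult_left_mono)
      have at: "\<bar>arctan x\<bar> \<le> 2" for x using arctan_bounded[of x] pi_less_4 by auto
      have "\<bar>h 1 * arctan (u 1)\<bar> \<le> \<bar>h 1\<bar> * 2" "\<bar>h x * arctan (u x)\<bar> \<le> 1 * 2"
        unfolding abs_mult using at x a by (intro mult_mono; simp)+
      then show "h 1 * arctan (u 1) - h x * arctan (u x) \<le> 2 * \<bar>h 1\<bar> + 2" by linarith
      show "integral {x..1} (\<lambda>t. t powr kexp * \<bar>f t\<bar>) \<le> Sf 1"
        unfolding Sf_def using fi x by (intro integral_subset_le) auto
    qed (use x Lam lam in auto)
    finally show "integral {a..1} (\<lambda>t. R t * \<bar>u t\<bar> powr s) \<le> B" .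
  qed
  show ?thesis
  proof (cases "b \<le> 1")
    case True
    then show ?thesis by (intro absolutely_integrable_on_subset_real[OF I1]) auto
  next
    case False
    then show ?thesis by (intro absolutely_integrable_Icc_combine[OF I1 I]) auto
  qed
qed

lemma abs_k_le: "\<bar>k t\<bar> \<le> (R t * \<bar>u t\<bar> powr s + R t * \<bar>f t\<bar>) / lam"
proof -
  have "\<bar>k t\<bar> = R t * \<bar>pw s (u t) - f t\<bar> / th (q t)"
    using R_pos[of t] th_bounds[of "q t"] by (simp add: k_def abs_mult)
  also have "\<dots> \<le> R t * (\<bar>u t\<bar> powr s + \<bar>f t\<bar>) / lam"
    using R_pos[of t] th_bounds[of "q t"] lam abs_triangle_ineq4[of "pw s (u t)" "f t"]
    by (intro frac_le mult_left_mono) (auto simp: abs_pw)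
  finally show ?thesis by (simp add: distrib_left)
qed

lemma k_int: "k absolutely_integrable_on {0..b}"
proof (rule absolutely_integrable_dominated_at_0)
  show "k absolutely_integrable_on {a..b}" if "0 < a" "a \<le> b" for a
    using prim_h[OF that] by (simp add: primitive_on_def)
  show "(\<lambda>t. (R t * \<bar>u t\<bar> powr s + R t * \<bar>f t\<bar>) / lam) absolutely_integrable_on {0..b}"
    by (intro set_integrable_divide set_integral_add(1) Rus_int Rf_int)
qed (rule abs_k_le)

text \<open>The difference of the two sides is constant on (0, r]; along points of small flux it
  tends to 0.\<close>

lemma h_eq:
  assumes "0 < r"
  shows "h r = integral {0..r} k"
proof -
  have ki: "k integrable_on {0..b}" for b using k_int by (simp add: set_lebesgue_integral_eq_integral)
  have d: "h r - integral {0..r} k = h x - integral {0..x} k" if "0 < x" "x \<le> r" for x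
    using Henstock_Kurzweil_Integration.integral_combine[of 0 x r k] that ki
      primitive_on_diff[OF prim_h[of x r], of x r] by auto
  have T: "((\<lambda>x. integral {0..x} k) \<longlongrightarrow> 0) (at_right 0)"
    by (rule integral_tendsto_0_at_right[OF k_int])
  have "\<bar>h r - integral {0..r} k\<bar> \<le> 0 + e" if e: "0 < e" for e
  proof -
    have "\<forall>\<^sub>F x in at_right 0. \<bar>integral {0..x} k\<bar> < e / 2"
      using tendstoD[OF T, of "e / 2"] e by (simp add: dist_real_def)
    then obtain b where b: "0 < b" "\<And>x. 0 < x \<Longrightarrow> x < b \<Longrightarrow> \<bar>integral {0..x} k\<bar> < e / 2"
      by (auto simp: eventually_at_right_field)
    obtain x where "0 < x" "x < min (min b r) (e / 2)" "\<bar>h x\<bar> < min (min b r) (e / 2)"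
      using small[of "min (min b r) (e / 2)"] b assms e by auto
    then show ?thesis using d[of x] b(2)[of x] by auto
  qed
  then have "\<bar>h r - integral {0..r} k\<bar> \<le> 0" by (rule field_le_epsilon)
  then show ?thesis by simp
qed

lemma h_tendsto_0: "(h \<longlongrightarrow> 0) (at_right 0)"
  by (rule Lim_transform_eventually[OF integral_tendsto_0_at_right[OF k_int]])
    (auto simp: eventually_at_right_field h_eq intro!: exI[of _ 1])

text \<open>The flux extended continuously by 0 to the origin; \<open>h 0\<close> itself is an
  arbitrary value, since the solution lives on t > 0.\<close>

definition h0 :: "real \<Rightarrow> real" where "h0 t = integral {0..t} k"

lemma prim_h0: "primitive_on 0 b h0 k"
  unfolding h0_def[abs_def] by (rule primitive_on_indefinite[OF k_int])

lemma h_h0: "0 < t \<Longrightarrow> h t = h0 t"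
  by (simp add: h_eq h0_def)

lemma abs_h_int: "(\<lambda>t. R t * \<bar>p t\<bar>) absolutely_integrable_on {0..b}"
proof -
  have "(\<lambda>t. \<bar>h0 t\<bar>) absolutely_integrable_on {0..b}"
    by (intro absolutely_integrable_continuous_real continuous_intros primitive_on_continuous[OF prim_h0])
  then show ?thesis
    by (rule absolutely_integrable_spike[of _ _ "{0}"])
      (auto simp: h_h0[symmetric] h_def abs_mult R_pos less_imp_le)
qed

text \<open>\<open>h0\<close> vanishes at 0 and \<phi> vanishes at b, so the product rule leaves no
  boundary term.\<close>

lemma weak_identity:
  assumes "0 < b" "primitive_on 0 b \<phi> \<phi>'" "\<phi> b = 0"
  shows "((\<lambda>t. h t * \<phi>' t + k t * \<phi> t) has_integral 0) {0..b}"
proof -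
  have P: "primitive_on 0 b (\<lambda>t. h0 t * \<phi> t) (\<lambda>t. k t * \<phi> t + h0 t * \<phi>' t)"
    by (rule primitive_on_mult[OF _ prim_h0 assms(2)]) (use assms in simp)
  have "((\<lambda>t. k t * \<phi> t + h0 t * \<phi>' t) has_integral h0 b * \<phi> b - h0 0 * \<phi> 0) {0..b}"
    by (rule primitive_on_has_integral[OF P]) (use assms in auto)
  then have "((\<lambda>t. k t * \<phi> t + h0 t * \<phi>' t) has_integral 0) {0..b}" using assms by (simp add: h0_def)
  then show ?thesis by (rule has_integral_spike_finite[of "{0}", rotated 2]) (auto simp: h_h0)
qed

text \<open>Testing with a bounded odd function \<open>\<gamma> u\<close> with \<open>\<gamma>' = (1 + |u|) powr (- 1 - m)\<close> bounds the weighted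
  integral of \<open>(u')\<^sup>2 \<gamma>'(u)\<close>. Young's inequality then gives the power \<open>q'\<close> exactly when some \<open>m > 0\<close>
  satisfies \<open>q' (1 + m) = s (2 - q')\<close>.\<close>

lemma power_int:
  assumes q: "1 < q'" "q' < 2 * s / (s + 1)"
  shows "(\<lambda>t. R t * \<bar>p t\<bar> powr q') absolutely_integrable_on {0..b}"
proof -
  have I: "(\<lambda>t. R t * \<bar>p t\<bar> powr q') absolutely_integrable_on {a..b}" if "0 < a" for a b
    using q by (intro absolutely_integrable_continuous_real continuous_intros continuous_all[OF that] continuous_on_powr') auto
  define m where "m = s * (2 - q') / q' - 1"
  have q2: "q' * (s + 1) < 2 * s" using q s by (simp add: field_simps)
  then have m: "0 < m" using q s by (simp add: m_def field_simps)
  have "q' * (s + 1) < 2 * (s + 1)" using q2 by simp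
  then have "q' < 2" by (rule mult_right_less_imp_less) (use s in simp)
  define A where "A = (\<lambda>t. (1 - (1 + t) powr (- m)) / m)"
  define \<gamma> where "\<gamma> = (\<lambda>t. if 0 \<le> t then A t else - A (- t))"
  define \<gamma>' where "\<gamma>' = (\<lambda>t::real. (1 + \<bar>t\<bar>) powr (- 1 - m))"
  have dA: "(A has_real_derivative (1 + t) powr (- 1 - m)) (at t)" if "-1 < t" for t
  proof -
    have "((\<lambda>t. (1 + t) powr (- m)) has_real_derivative - m * (1 + t) powr (- m - 1) * 1) (at t)"
      using that by (intro DERIV_chain2[OF has_real_derivative_powr]) (auto intro!: derivative_eq_intros)
    from DERIV_cdivide[OF DERIV_diff[OF DERIV_const[of 1] this], of m]
    have "(A has_real_derivative (0 - - m * (1 + t) powr (- m - 1) * 1) / m) (at t)" unfolding A_def .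
    moreover have "- m - 1 = - 1 - m" by simp
    ultimately show ?thesis using m by simp
  qed
  have dA': "((\<lambda>t. - A (- t)) has_real_derivative (1 - t) powr (- 1 - m)) (at t)" if "t < 1" for t
    using DERIV_minus[OF DERIV_chain2[OF dA[of "- t"] DERIV_minus[OF DERIV_ident]]] that by simp
  have d\<gamma>: "(\<gamma> has_real_derivative \<gamma>' t) (at t)" for t
  proof -
    consider "0 < t" | "t < 0" | "t = 0" by linarith
    then show ?thesis
    proof cases
      case 1
      have "(A has_real_derivative \<gamma>' t) (at t)" using dA[of t] 1 by (simp add: \<gamma>'_def)
      then show ?thesis
        by (rule has_field_derivative_transform_within_open[of _ _ _ "{0<..}"]) (use 1 in \<open>auto simp: \<gamma>_def\<close>)
    next
      case 2
      have "((\<lambda>t. - A (- t)) has_real_derivative \<gamma>' t) (at t)" using dA'[of t] 2 by (simp add: \<gamma>'_def)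
      then show ?thesis
        by (rule has_field_derivative_transform_within_open[of _ _ _ "{..<0}"]) (use 2 in \<open>auto simp: \<gamma>_def\<close>)
    next
      case 3
      have A0: "A 0 = 0" by (simp add: A_def)
      \<comment> \<open>At 0 the two branches meet with the value 0 and the common one-sided
        derivative 1.\<close>
      have "((\<lambda>h. if 0 \<le> h then (A (0 + h) - A 0) / h else (- A (- (0 + h)) - - A (- 0)) / h) \<longlongrightarrow> 1) (at 0)"
        using dA[of 0] dA'[of 0] unfolding DERIV_def
        by (intro filterlim_If) (auto intro: tendsto_mono[OF inf_le1])
      then have "((\<lambda>h. (\<gamma> (0 + h) - \<gamma> 0) / h) \<longlongrightarrow> 1) (at 0)"
        by (rule Lim_transform_eventually) (auto simp: \<gamma>_def A0)
      then show ?thesis using 3 by (simp add: DERIV_def \<gamma>'_def)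
    qed
  qed
  have c\<gamma>: "continuous_on UNIV \<gamma>'"
    unfolding \<gamma>'_def by (intro continuous_intros) (auto simp: add_nonneg_eq_0_iff)
  have bA: "\<bar>A t\<bar> \<le> 1 / m" if "0 \<le> t" for t
  proof -
    have "(1 + t) powr (- m) \<le> 1" using that m powr_mono[of "- m" 0 "1 + t"] by simp
    moreover have "0 \<le> (1 + t) powr (- m)" by simp
    ultimately show ?thesis using m by (simp add: A_def divide_right_mono)
  qed
  have b\<gamma>: "\<bar>\<gamma> t\<bar> \<le> 1 / m" for t using bA[of t] bA[of "- t"] by (simp add: \<gamma>_def)
  define J where "J = integral {0..1} (\<lambda>t. \<bar>k t\<bar>)"
  have ka: "(\<lambda>t. \<bar>k t\<bar>) integrable_on {0..1}"
    using set_integrable_abs[OF k_int] by (simp add: set_lebesgue_integral_eq_integral)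
  have I2: "(\<lambda>t. R t * (p t)\<^sup>2 * \<gamma>' (u t)) absolutely_integrable_on {0..1}"
  proof (rule absolutely_integrable_nonneg_at_0)
    show "(\<lambda>t. R t * (p t)\<^sup>2 * \<gamma>' (u t)) absolutely_integrable_on {a..1}" if "0 < a" "a \<le> 1" for a
      by (intro absolutely_integrable_continuous_real continuous_intros continuous_all[OF that(1)]
            continuous_on_compose2[OF c\<gamma> continuous_all(1)[OF that(1)]]) auto
    show "0 \<le> R t * (p t)\<^sup>2 * \<gamma>' (u t)" for t using R_pos[of t] by (simp add: \<gamma>'_def)
    fix a :: real assume a: "0 < a" "a \<le> 1"
    have P: "((\<lambda>t. k t * \<gamma> (u t) + R t * (p t)\<^sup>2 * \<gamma>' (u t)) has_integral h 1 * \<gamma> (u 1) - h a * \<gamma> (u a)) {a..1}"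
      by (rule primitive_on_has_integral[OF test_identity[OF a d\<gamma> c\<gamma>] order.refl a(2) order.refl])
    have ka': "(\<lambda>t. \<bar>k t\<bar>) integrable_on {a..1}" by (rule integrable_subinterval_real[OF ka]) (use a in auto)
    have pt: "R t * (p t)\<^sup>2 * \<gamma>' (u t) \<le> (k t * \<gamma> (u t) + R t * (p t)\<^sup>2 * \<gamma>' (u t)) + 1 / m * \<bar>k t\<bar>" for t
    proof -
      have "\<bar>k t * \<gamma> (u t)\<bar> \<le> \<bar>k t\<bar> * (1 / m)" unfolding abs_mult using b\<gamma> by (intro mult_left_mono) auto
      then show ?thesis by (simp add: mult.commute abs_le_iff)
    qed
    have c2: "(\<lambda>t. R t * (p t)\<^sup>2 * \<gamma>' (u t)) integrable_on {a..1}"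
      by (intro integrable_continuous_real continuous_intros continuous_all[OF a(1)]
            continuous_on_compose2[OF c\<gamma> continuous_all(1)[OF a(1)]]) auto
    have hJ: "\<bar>h r\<bar> \<le> J" if "0 < r" "r \<le> 1" for r
    proof -
      have "norm (integral {0..r} k) \<le> integral {0..r} (\<lambda>t. \<bar>k t\<bar>)"
        using integrable_subinterval_real[OF ka, of 0 r] k_int[of r] that
        by (intro integral_norm_bound_integral) (auto simp: set_lebesgue_integral_eq_integral)
      also have "\<dots> \<le> J"
        unfolding J_def using integrable_subinterval_real[OF ka, of 0 r] ka that by (intro integral_subset_le) auto
      finally show ?thesis by (simp add: h_eq that)
    qed
    have hb: "\<bar>h r * \<gamma> (u r)\<bar> \<le> J * (1 / m)" if "0 < r" "r \<le> 1" for r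
      unfolding abs_mult using hJ[OF that] b\<gamma> by (intro mult_mono) auto
    note Q = has_integral_add[OF P has_integral_mult_right[OF integrable_integral[OF ka'], of "1 / m"]]
    have "integral {a..1} (\<lambda>t. R t * (p t)\<^sup>2 * \<gamma>' (u t)) \<le>
      integral {a..1} (\<lambda>t. (k t * \<gamma> (u t) + R t * (p t)\<^sup>2 * \<gamma>' (u t)) + 1 / m * \<bar>k t\<bar>)"
      by (rule integral_le[OF c2 has_integral_integrable[OF Q] pt])
    also have "\<dots> = (h 1 * \<gamma> (u 1) - h a * \<gamma> (u a)) + 1 / m * integral {a..1} (\<lambda>t. \<bar>k t\<bar>)"
      by (rule integral_unique[OF Q])
    also have "\<dots> \<le> (J * (1 / m) + J * (1 / m)) + 1 / m * J"
    proof (intro add_mono mult_left_mono)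
      show "h 1 * \<gamma> (u 1) - h a * \<gamma> (u a) \<le> J * (1 / m) + J * (1 / m)"
        using hb[of 1] hb[OF a] by linarith
      show "integral {a..1} (\<lambda>t. \<bar>k t\<bar>) \<le> J" unfolding J_def using ka ka' a by (intro integral_subset_le) auto
    qed (use m in auto)
    finally show "integral {a..1} (\<lambda>t. R t * (p t)\<^sup>2 * \<gamma>' (u t)) \<le> J * (1 / m) + J * (1 / m) + 1 / m * J" .
  qed
  have I1: "(\<lambda>t. R t * \<bar>p t\<bar> powr q') absolutely_integrable_on {0..1}"
  proof (rule absolutely_integrable_dominated_at_0[OF I])
    show "(\<lambda>t. R t * (p t)\<^sup>2 * \<gamma>' (u t) + 2 powr s * (1 + R t * \<bar>u t\<bar> powr s)) absolutely_integrable_on {0..1}"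
      by (intro set_integral_add(1) I2 set_integrable_mult_right Rus_int absolutely_integrable_on_const) auto
    fix t :: real assume t: "0 < t" "t \<le> 1"
    have R: "0 < R t" "R t \<le> 1" using R_pos R_le_1[OF t] by auto
    define w where "w = 1 + \<bar>u t\<bar>"
    have w: "1 \<le> w" by (simp add: w_def)
    \<comment> \<open>The threshold w powr (s / q') balances the two terms: below it |p|^q' is at
      most w^s; above it |p|^(q' - 2) is at most the threshold raised to the negative power q' - 2,
      and that number is \<gamma>' (u t) by the choice of m.\<close>
    have young: "\<bar>p t\<bar> powr q' \<le> (p t)\<^sup>2 * \<gamma>' (u t) + w powr s"
    proof (cases "\<bar>p t\<bar> \<le> w powr (s / q')")
      case True
      then have "\<bar>p t\<bar> powr q' \<le> (w powr (s / q')) powr q'" using q by (intro powr_mono2) auto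
      also have "\<dots> = w powr s" using q by (simp add: powr_powr)
      finally show ?thesis by (simp add: \<gamma>'_def add_increasing)
    next
      case False
      have "0 < w powr (s / q')" using w by simp
      then have pp: "0 < \<bar>p t\<bar>" using False by linarith
      have "\<bar>p t\<bar> powr q' = (p t)\<^sup>2 * \<bar>p t\<bar> powr (q' - 2)"
        using pp powr_add[of "\<bar>p t\<bar>" 2 "q' - 2"] by simp
      also have "\<dots> \<le> (p t)\<^sup>2 * (w powr (s / q')) powr (q' - 2)"
        using False \<open>q' < 2\<close> \<open>0 < w powr (s / q')\<close> by (intro mult_left_mono powr_mono2') auto
      also have "(w powr (s / q')) powr (q' - 2) = \<gamma>' (u t)"
        using q by (simp add: powr_powr \<gamma>'_def w_def m_def field_simps)
      finally show ?thesis by (simp add: add_increasing2)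
    qed
    have "w powr s \<le> 2 powr s * (1 + \<bar>u t\<bar> powr s)"
    proof -
      have "w \<le> 2 * max 1 \<bar>u t\<bar>" by (auto simp: w_def)
      then have "w powr s \<le> (2 * max 1 \<bar>u t\<bar>) powr s" using w s by (intro powr_mono2) auto
      also have "\<dots> = 2 powr s * (max 1 \<bar>u t\<bar>) powr s" by (simp add: powr_mult)
      also have "\<dots> \<le> 2 powr s * (1 + \<bar>u t\<bar> powr s)" by (intro mult_left_mono) (auto simp: max_def)
      finally show ?thesis .
    qed
    with young have "\<bar>p t\<bar> powr q' \<le> (p t)\<^sup>2 * \<gamma>' (u t) + 2 powr s * (1 + \<bar>u t\<bar> powr s)" by linarith
    then have "R t * \<bar>p t\<bar> powr q' \<le> R t * ((p t)\<^sup>2 * \<gamma>' (u t) + 2 powr s * (1 + \<bar>u t\<bar> powr s))"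
      using R by (intro mult_left_mono) auto
    also have "\<dots> = R t * (p t)\<^sup>2 * \<gamma>' (u t) + 2 powr s * (R t + R t * \<bar>u t\<bar> powr s)" by (simp add: algebra_simps)
    also have "\<dots> \<le> R t * (p t)\<^sup>2 * \<gamma>' (u t) + 2 powr s * (1 + R t * \<bar>u t\<bar> powr s)"
      using R by (intro add_left_mono mult_left_mono) auto
    finally show "\<bar>R t * \<bar>p t\<bar> powr q'\<bar> \<le> R t * (p t)\<^sup>2 * \<gamma>' (u t) + 2 powr s * (1 + R t * \<bar>u t\<bar> powr s)"
      using R by (simp add: abs_mult)
  qed
  show ?thesis
  proof (cases "b \<le> 1")
    case True
    then show ?thesis by (intro absolutely_integrable_on_subset_real[OF I1]) auto
  next
    case False
    then show ?thesis by (intro absolutely_integrable_Icc_combine[OF I1 I]) auto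
  qed
qed

end

section \<open>Radial test functions\<close>

text \<open>The classical flat function exp (-1 / t) with additional negative powers of t, which
  make the family closed under differentiation up to linear combinations.\<close>

definition flat_exp :: "nat \<Rightarrow> real \<Rightarrow> real" where
  "flat_exp j t = (if t > 0 then inverse t ^ j * exp (- inverse t) else 0)"

lemma flat_exp_tendsto_0: "(flat_exp j \<longlongrightarrow> 0) (at 0)"
proof -
  have "((\<lambda>t::real. inverse t ^ j / exp (inverse t)) \<longlongrightarrow> 0) (at_right 0)"
    by (rule filterlim_compose[OF tendsto_power_div_exp_0 filterlim_inverse_at_top_right])
  then have "(flat_exp j \<longlongrightarrow> 0) (at_right 0)"
    by (rule Lim_transform_eventually)
      (auto simp: eventually_at_right_less flat_exp_def exp_minus divide_inverse eventually_at_filter)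
  moreover have "(flat_exp j \<longlongrightarrow> 0) (at_left 0)"
    by (rule tendsto_eventually) (auto simp: flat_exp_def eventually_at_filter)
  ultimately show ?thesis by (rule filterlim_split_at_real[rotated])
qed

lemma flat_exp_has_derivative:
  "(flat_exp j has_real_derivative flat_exp (j + 2) t - real j * flat_exp (j + 1) t) (at t)"
proof -
  consider "t < 0" | "t = 0" | "t > 0" by linarith
  then show ?thesis
  proof cases
    case 1
    have "((\<lambda>_. 0) has_real_derivative 0) (at t)" by simp
    then have "(flat_exp j has_real_derivative 0) (at t)"
      by (rule has_field_derivative_transform_within_open[of _ _ _ "{..<0}"]) (use 1 in \<open>auto simp: flat_exp_def\<close>)
    then show ?thesis using 1 by (simp add: flat_exp_def)
  next
    case 2
    have "((\<lambda>h. (flat_exp j (0 + h) - flat_exp j 0) / h) \<longlongrightarrow> 0) (at 0)"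
      by (rule Lim_transform_eventually[OF flat_exp_tendsto_0[of "Suc j"]])
        (auto simp: eventually_at_filter flat_exp_def divide_inverse)
    then show ?thesis using 2 by (simp add: DERIV_def flat_exp_def)
  next
    case 3
    have "((\<lambda>t. inverse t ^ j * exp (- inverse t)) has_real_derivative
        real j * inverse t ^ (j - Suc 0) * - (inverse t * inverse t) * exp (- inverse t)
        + inverse t ^ j * (exp (- inverse t) * (inverse t * inverse t))) (at t)"
      using 3 by (auto intro!: derivative_eq_intros simp: power2_eq_square)
    moreover have "real j * inverse t ^ (j - Suc 0) * - (inverse t * inverse t) * exp (- inverse t)
        + inverse t ^ j * (exp (- inverse t) * (inverse t * inverse t)) =
        flat_exp (j + 2) t - real j * flat_exp (j + 1) t"
      using 3 by (cases j) (simp_all add: flat_exp_def algebra_simps)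
    ultimately have "((\<lambda>t. inverse t ^ j * exp (- inverse t)) has_real_derivative
        flat_exp (j + 2) t - real j * flat_exp (j + 1) t) (at t)"
      by (simp only:)
    then show ?thesis
      by (rule has_field_derivative_transform_within_open[of _ _ _ "{0<..}"]) (use 3 in \<open>auto simp: flat_exp_def\<close>)
  qed
qed

text \<open>The recursion in \<open>Ck\<close> passes to partial derivatives, so the induction must
  run over a class containing all iterated partials at once.\<close>

lemma Ck_derivative_closed:
  fixes F :: "('a::euclidean_space \<Rightarrow> real) set"
  assumes "\<And>\<psi>. \<psi> \<in> F \<Longrightarrow> \<exists>\<psi>'. (\<forall>x. (\<psi> has_derivative \<psi>' x) (at x)) \<and> (\<forall>b\<in>Basis. (\<lambda>x. \<psi>' x b) \<in> F)"
  shows "\<psi> \<in> F \<Longrightarrow> Ck k \<psi>"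
proof (induction k arbitrary: \<psi>)
  case 0
  then obtain \<psi>' where "\<And>x. (\<psi> has_derivative \<psi>' x) (at x)" using assms by blast
  then show ?case
    by (auto intro!: continuous_at_imp_continuous_on has_derivative_continuous)
next
  case (Suc k)
  then show ?case using assms[OF Suc.prems] by auto
qed

text \<open>The point of this algebra is that it is stable under partial derivatives, so that its members,
  among them the standard bump function, are smooth in the sense of \<open>Ck\<close>.\<close>

inductive_set bump_algebra :: "'a::euclidean_space \<Rightarrow> real \<Rightarrow> ('a \<Rightarrow> real) set"
  for x0 :: "'a::euclidean_space" and e :: real where
  const: "(\<lambda>x. c) \<in> bump_algebra x0 e"
| coord: "(\<lambda>x. (x - x0) \<bullet> b) \<in> bump_algebra x0 e"
| flat: "(\<lambda>x. flat_exp j (e - (x - x0) \<bullet> (x - x0))) \<in> bump_algebra x0 e"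
| add: "u \<in> bump_algebra x0 e \<Longrightarrow> v \<in> bump_algebra x0 e \<Longrightarrow> (\<lambda>x. u x + v x) \<in> bump_algebra x0 e"
| mult: "u \<in> bump_algebra x0 e \<Longrightarrow> v \<in> bump_algebra x0 e \<Longrightarrow> (\<lambda>x. u x * v x) \<in> bump_algebra x0 e"

lemma bump_algebra_derivative:
  "\<psi> \<in> bump_algebra x0 e \<Longrightarrow>
    \<exists>\<psi>'. (\<forall>x. (\<psi> has_derivative \<psi>' x) (at x)) \<and> (\<forall>b\<in>Basis. (\<lambda>x. \<psi>' x b) \<in> bump_algebra x0 e)"
proof (induction rule: bump_algebra.induct)
  case (const c)
  show ?case by (intro exI[of _ "\<lambda>x v. 0"]) (auto intro: bump_algebra.const)
next
  case (coord b)
  show ?case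
    by (intro exI[of _ "\<lambda>x v. v \<bullet> b"])
      (auto intro!: derivative_eq_intros bump_algebra.const)
next
  case (flat j)
  show ?case
  proof (intro exI[of _ "\<lambda>x v. ((-2) * ((x - x0) \<bullet> v)) * (flat_exp (j + 2) (e - (x - x0) \<bullet> (x - x0))
      + (- real j) * flat_exp (j + 1) (e - (x - x0) \<bullet> (x - x0)))"] conjI allI ballI)
    fix x
    have "((\<lambda>x. e - (x - x0) \<bullet> (x - x0)) has_derivative (\<lambda>v. (-2) * ((x - x0) \<bullet> v))) (at x)"
      by (auto intro!: derivative_eq_intros simp: inner_commute)
    from DERIV_compose_FDERIV[OF flat_exp_has_derivative this]
    show "((\<lambda>x. flat_exp j (e - (x - x0) \<bullet> (x - x0))) has_derivative (\<lambda>v. ((-2) * ((x - x0) \<bullet> v)) *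
      (flat_exp (j + 2) (e - (x - x0) \<bullet> (x - x0)) + (- real j) * flat_exp (j + 1) (e - (x - x0) \<bullet> (x - x0))))) (at x)"
      by simp
  qed (intro bump_algebra.intros)
next
  case (add u v)
  then obtain u' v' where "\<forall>x. (u has_derivative u' x) (at x)" "\<forall>b\<in>Basis. (\<lambda>x. u' x b) \<in> bump_algebra x0 e"
    "\<forall>x. (v has_derivative v' x) (at x)" "\<forall>b\<in>Basis. (\<lambda>x. v' x b) \<in> bump_algebra x0 e" by blast
  then show ?case
    by (intro exI[of _ "\<lambda>x h. u' x h + v' x h"] conjI allI ballI)
      (simp_all add: has_derivative_add bump_algebra.add)
next
  case (mult u v)
  then obtain u' v' where "\<forall>x. (u has_derivative u' x) (at x)" "\<forall>b\<in>Basis. (\<lambda>x. u' x b) \<in> bump_algebra x0 e"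
    "\<forall>x. (v has_derivative v' x) (at x)" "\<forall>b\<in>Basis. (\<lambda>x. v' x b) \<in> bump_algebra x0 e" by blast
  then show ?case
    using mult.hyps
    by (intro exI[of _ "\<lambda>x h. u x * v' x h + u' x h * v x"] conjI allI ballI)
      (simp_all add: has_derivative_mult bump_algebra.add bump_algebra.mult)
qed

text \<open>The parameter e is the square of the radius of the support; the total mass is not
  normalized.\<close>

definition bump :: "'a::euclidean_space \<Rightarrow> real \<Rightarrow> 'a \<Rightarrow> real" where
  "bump x0 e x = flat_exp 0 (e - (x - x0) \<bullet> (x - x0))"

lemma bump_outside: "e > 0 \<Longrightarrow> e \<le> dist x0 x ^ 2 \<Longrightarrow> bump x0 e x = 0"
  by (simp add: bump_def flat_exp_def dist_norm norm_minus_commute power2_norm_eq_inner)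

lemma bump_nonneg: "0 \<le> bump x0 e x"
  by (simp add: bump_def flat_exp_def)

lemma bump_Cc_infinity:
  assumes "e > 0"
  shows "bump x0 e \<in> Cc_infinity"
  unfolding Cc_infinity_def compact_support_def
proof (intro CollectI conjI allI)
  fix k
  show "Ck k (bump x0 e)"
    by (rule Ck_derivative_closed[OF bump_algebra_derivative])
      (auto simp: bump_def[abs_def] intro: bump_algebra.flat)
  have "{x. bump x0 e x \<noteq> 0} \<subseteq> cball x0 (sqrt e)"
  proof
    fix x assume "x \<in> {x. bump x0 e x \<noteq> 0}"
    then have "dist x0 x ^ 2 < e" using bump_outside[OF assms, of x0 x] by force
    then show "x \<in> cball x0 (sqrt e)" by (simp add: real_le_rsqrt)
  qed
  then show "compact (closure {x. bump x0 e x \<noteq> 0})"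
    unfolding compact_closure by (rule bounded_subset[OF bounded_cball])
qed

lemma bump_has_derivative:
  "(bump x0 e has_derivative (\<lambda>v. ((-2) * ((x - x0) \<bullet> v)) * flat_exp 2 (e - (x - x0) \<bullet> (x - x0)))) (at x)"
proof -
  have "((\<lambda>x. e - (x - x0) \<bullet> (x - x0)) has_derivative (\<lambda>v. (-2) * ((x - x0) \<bullet> v))) (at x)"
    by (auto intro!: derivative_eq_intros simp: inner_commute)
  from DERIV_compose_FDERIV[OF flat_exp_has_derivative this, of 0]
  show ?thesis by (simp add: bump_def[abs_def] numeral_2_eq_2)
qed

lemma Cc_infinity_derivative:
  fixes \<psi> :: "'a::euclidean_space \<Rightarrow> real"
  assumes "\<psi> \<in> Cc_infinity"
  obtains \<psi>' R where "\<And>x. (\<psi> has_derivative \<psi>' x) (at x)" "\<And>b. b \<in> Basis \<Longrightarrow> continuous_on UNIV (\<lambda>x. \<psi>' x b)"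
    "R > 0" "\<And>x. norm x > R \<Longrightarrow> \<psi> x = 0" "\<And>x b. norm x > R \<Longrightarrow> \<psi>' x b = 0"
proof -
  have "Ck (Suc 0) \<psi>" using assms by (auto simp: Cc_infinity_def)
  then obtain \<psi>' where d: "\<And>x. (\<psi> has_derivative \<psi>' x) (at x)"
    "\<And>b. b \<in> Basis \<Longrightarrow> continuous_on UNIV (\<lambda>x. \<psi>' x b)" by auto
  have "bounded {x. \<psi> x \<noteq> 0}" using assms by (auto simp: Cc_infinity_def compact_support_def)
  then obtain R where R: "R > 0" "\<And>x. \<psi> x \<noteq> 0 \<Longrightarrow> norm x \<le> R" by (auto simp: bounded_pos)
  have "\<psi>' x b = 0" if "norm x > R" for x b
  proof -
    have "((\<lambda>_. 0) has_derivative (\<lambda>_. 0)) (at x)" by simp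
    then have "(\<psi> has_derivative (\<lambda>_. 0)) (at x)"
    proof (rule has_derivative_transform_within_open)
      show "open {x::'a. norm x > R}" by (intro open_Collect_less continuous_intros)
    qed (use that R(2) in force)+
    from has_derivative_unique[OF d(1) this] show ?thesis by simp
  qed
  then show thesis using that[OF d R(1)] R(2) by force
qed

lemma continuous_vanishing_integral:
  fixes f :: "'a::euclidean_space \<Rightarrow> real"
  assumes "continuous_on UNIV f" "\<And>x. x \<notin> cbox p q \<Longrightarrow> f x = 0"
  shows "integrable lebesgue f" "(LINT x|lebesgue. f x) = integral (cbox p q) f"
proof -
  have *: "(\<lambda>x. indicat_real (cbox p q) x *\<^sub>R f x) = f"
  proof
    fix x
    show "indicat_real (cbox p q) x *\<^sub>R f x = f x"
      using assms(2)[of x] by (cases "x \<in> cbox p q") auto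
  qed
  have ai: "f absolutely_integrable_on cbox p q"
    using assms(1) by (intro absolutely_integrable_continuous) (auto intro: continuous_on_subset)
  then show "integrable lebesgue f" unfolding set_integrable_def * .
  show "(LINT x|lebesgue. f x) = integral (cbox p q) f"
    using set_lebesgue_integral_eq_integral(2)[OF ai] unfolding set_lebesgue_integral_def * .
qed

lemma lebesgue_integral_translation:
  fixes f :: "'a::euclidean_space \<Rightarrow> real"
  assumes "continuous_on UNIV f"
  shows "(LINT x|lebesgue. f (x + c)) = (LINT x|lebesgue. f x)"
proof -
  have b: "f \<in> borel_measurable borel" "(\<lambda>x. f (x + c)) \<in> borel_measurable borel"
    using assms by (auto intro!: borel_measurable_continuous_onI continuous_on_compose2[OF assms] continuous_intros)
  have "(LINT x|lborel. f (x + c)) = (LINT x|distr lborel borel ((+) c). f x)"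
    using b by (subst integral_distr) (auto simp: add.commute)
  then show ?thesis using b by (simp add: integral_completion lborel_distr_plus)
qed

section \<open>Ramps as radial test functions\<close>

lemma norm_line_has_derivative:
  fixes y b :: "'a::euclidean_space"
  assumes "y \<noteq> 0"
  shows "((\<lambda>t. norm (y + t *\<^sub>R b)) has_real_derivative (y \<bullet> b / norm y)) (at 0)"
proof -
  have "((\<lambda>t. sqrt (y \<bullet> y + 2 * t * (y \<bullet> b) + t * t * (b \<bullet> b))) has_real_derivative (y \<bullet> b / sqrt (y \<bullet> y))) (at 0)"
  proof -
    have "0 < y \<bullet> y" using assms by simp
    then show ?thesis
      by (auto intro!: derivative_eq_intros simp: divide_simps) (use inner_ge_zero[of y] in linarith)
  qed
  moreover have "(\<lambda>t. sqrt (y \<bullet> y + 2 * t * (y \<bullet> b) + t * t * (b \<bullet> b))) = (\<lambda>t. norm (y + t *\<^sub>R b))"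
    by (rule ext) (simp add: norm_eq_sqrt_inner inner_add_left inner_add_right inner_commute algebra_simps)
  ultimately show ?thesis by (simp add: norm_eq_sqrt_inner)
qed

text \<open>For h > 0 this is the trapezoidal cut-off: 1 up to x, affine in between, 0 from x + h
  on.\<close>

definition ramp :: "real \<Rightarrow> real \<Rightarrow> real \<Rightarrow> real" where
  "ramp x h r = max 0 (min 1 ((x + h - r) / h))"

lemma ramp_lipschitz: "h > 0 \<Longrightarrow> \<bar>ramp x h r - ramp x h s\<bar> \<le> \<bar>r - s\<bar> / h"
proof -
  assume "h > 0"
  have "\<bar>max 0 (min 1 A) - max 0 (min 1 B)\<bar> \<le> \<bar>A - B\<bar>" for A B :: real by auto
  then have "\<bar>ramp x h r - ramp x h s\<bar> \<le> \<bar>(x + h - r) / h - (x + h - s) / h\<bar>" unfolding ramp_def .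
  also have "\<dots> = \<bar>r - s\<bar> / h" using \<open>h > 0\<close> by (simp flip: diff_divide_distrib)
  finally show ?thesis .
qed

lemma ramp_continuous [continuous_intros]:
  "continuous_on S f \<Longrightarrow> continuous_on S (\<lambda>t. ramp x h (f t))"
  unfolding ramp_def by (cases "h = 0") (auto intro!: continuous_intros)

lemma ramp_line_has_derivative:
  fixes y b :: "'a::euclidean_space"
  assumes "0 < x" "0 < h" "norm y \<noteq> x" "norm y \<noteq> x + h"
  shows "((\<lambda>t. ramp x h (norm (y + t *\<^sub>R b))) has_real_derivative
    (if x < norm y \<and> norm y < x + h then - (y \<bullet> b) / (norm y * h) else 0)) (at 0)"
proof -
  have ct: "continuous_on UNIV (\<lambda>t. norm (y + t *\<^sub>R b))" by (intro continuous_intros)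
  consider "norm y < x" | "x < norm y" "norm y < x + h" | "norm y > x + h" using assms by linarith
  then show ?thesis
  proof cases
    case 1
    have "((\<lambda>_. 1) has_real_derivative 0) (at 0)" by simp
    then have "((\<lambda>t. ramp x h (norm (y + t *\<^sub>R b))) has_real_derivative 0) (at 0)"
      by (rule has_field_derivative_transform_within_open[of _ _ _ "{t. norm (y + t *\<^sub>R b) < x}"])
        (use 1 assms in \<open>auto intro!: open_Collect_less ct continuous_intros simp: ramp_def field_simps\<close>)
    then show ?thesis using 1 by simp
  next
    case 2
    then have "y \<noteq> 0" using assms by auto
    have "((\<lambda>t. (x + h - norm (y + t *\<^sub>R b)) / h) has_real_derivative (- (y \<bullet> b) / (norm y * h))) (at 0)"
      using assms \<open>y \<noteq> 0\<close> by (auto intro!: derivative_eq_intros norm_line_has_derivative simp: divide_simps)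
    then have "((\<lambda>t. ramp x h (norm (y + t *\<^sub>R b))) has_real_derivative (- (y \<bullet> b) / (norm y * h))) (at 0)"
    proof (rule has_field_derivative_transform_within_open)
      show "open ({t. x < norm (y + t *\<^sub>R b)} \<inter> {t. norm (y + t *\<^sub>R b) < x + h})"
        by (intro open_Int open_Collect_less ct continuous_intros)
    qed (use 2 assms in \<open>auto simp: ramp_def field_simps\<close>)
    then show ?thesis using 2 by simp
  next
    case 3
    have "((\<lambda>_. 0) has_real_derivative 0) (at 0)" by simp
    then have "((\<lambda>t. ramp x h (norm (y + t *\<^sub>R b))) has_real_derivative 0) (at 0)"
      by (rule has_field_derivative_transform_within_open[of _ _ _ "{t. x + h < norm (y + t *\<^sub>R b)}"])
        (use 3 assms in \<open>auto intro!: open_Collect_less ct continuous_intros simp: ramp_def field_simps\<close>)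
    then show ?thesis using 3 by simp
  qed
qed

lemma DERIV_imp_sequential_quotient:
  fixes k :: "real \<Rightarrow> real"
  assumes "(k has_real_derivative D) (at 0)" "t \<longlonglongrightarrow> 0" "\<And>n. t n \<noteq> 0"
  shows "(\<lambda>n. (k (t n) - k 0) / t n) \<longlonglongrightarrow> D"
proof -
  have "((\<lambda>h. (k h - k 0) / h) \<longlongrightarrow> D) (at 0)" using assms(1) by (simp add: DERIV_def)
  moreover have "filterlim t (at 0) sequentially"
    using assms(2,3) by (auto simp: filterlim_at)
  ultimately show ?thesis by (rule filterlim_compose)
qed

text \<open>Integration by parts for difference quotients: a translation moves the quotient in
  direction b from \<psi> to the ramp (\<open>swap\<close>), and dominated convergence is applied on
  both sides. The ramp has a derivative along b off two spheres, which are null sets, and its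
  quotients are bounded by 1 / h.\<close>

lemma ramp_weak_partial:
  fixes b :: "'a::euclidean_space"
  assumes "0 < x" "0 < h" "b \<in> Basis"
  shows "has_weak_partial (\<lambda>y::'a. ramp x h (norm y)) b
    (\<lambda>y. if x < norm y \<and> norm y < x + h then - (y \<bullet> b) / (norm y * h) else 0)"
    (is "has_weak_partial ?\<Phi> b ?g")
  unfolding has_weak_partial_def
proof
  fix \<psi> :: "'a \<Rightarrow> real" assume "\<psi> \<in> Cc_infinity"
  then obtain \<psi>' R where d: "\<And>x. (\<psi> has_derivative \<psi>' x) (at x)"
    "\<And>b. b \<in> Basis \<Longrightarrow> continuous_on UNIV (\<lambda>x. \<psi>' x b)"
    and R: "R > 0" "\<And>x. norm x > R \<Longrightarrow> \<psi> x = 0" "\<And>x b. norm x > R \<Longrightarrow> \<psi>' x b = 0"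
    using Cc_infinity_derivative by blast
  have nb: "norm b = 1" using assms by auto
  have c\<psi>: "continuous_on UNIV \<psi>"
    using d(1) by (auto intro!: continuous_at_imp_continuous_on has_derivative_continuous)
  have c\<Phi>: "continuous_on UNIV ?\<Phi>" by (intro continuous_intros)
  define t where "t = (\<lambda>n. 1 / (real n + 1))"
  have t: "t n > 0" "t n \<le> 1" for n by (auto simp: t_def)
  have t0: "t \<longlonglongrightarrow> 0" unfolding t_def by real_asymp
  have line: "((\<lambda>s. \<psi> (y + s *\<^sub>R b)) has_real_derivative \<psi>' (y + s *\<^sub>R b) b) (at s)" for y s
  proof -
    have "((\<lambda>s. y + s *\<^sub>R b) has_derivative (\<lambda>s. s *\<^sub>R b)) (at s)" by (auto intro!: derivative_eq_intros)
    from has_derivative_compose[OF this d(1)]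
    have "((\<lambda>s. \<psi> (y + s *\<^sub>R b)) has_derivative (\<lambda>v. \<psi>' (y + s *\<^sub>R b) (v *\<^sub>R b))) (at s)" .
    moreover have "(\<lambda>v. \<psi>' (y + s *\<^sub>R b) (v *\<^sub>R b)) = (*) (\<psi>' (y + s *\<^sub>R b) b)"
      using linear_cmul[OF has_derivative_linear[OF d(1)]] by (intro ext) (simp add: mult.commute)
    ultimately show ?thesis by (simp only: has_field_derivative_def)
  qed
  have "bounded ((\<lambda>x. \<psi>' x b) ` cball 0 R)"
    using compact_continuous_image[OF continuous_on_subset[OF d(2)[OF assms(3)]], of "cball 0 R"]
      compact_imp_bounded by auto
  then obtain M where M0: "M > 0" "\<And>y. norm y \<le> R \<Longrightarrow> \<bar>\<psi>' y b\<bar> \<le> M" by (auto simp: bounded_pos)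
  have M: "\<bar>\<psi>' y b\<bar> \<le> M" for y using M0 R(3)[of y b] by (cases "norm y \<le> R") auto
  have quot: "\<bar>(\<psi> (y + s *\<^sub>R b) - \<psi> y) / s\<bar> \<le> M * indicat_real (cball 0 (R + 1)) y" if "0 < s" "s \<le> 1" for y s
  proof (cases "norm y \<le> R + 1")
    case True
    have "norm (\<psi> (y + s *\<^sub>R b) - \<psi> (y + 0 *\<^sub>R b)) \<le> M * norm (s - 0)"
      by (rule field_differentiable_bound[of UNIV _ "\<lambda>s. \<psi>' (y + s *\<^sub>R b) b"]) (use line M in auto)
    then show ?thesis using that True by (simp add: field_simps abs_mult)
  next
    case False
    have "norm y \<le> norm (y + s *\<^sub>R b) + norm (s *\<^sub>R b)" by (metis add_diff_cancel_right' norm_triangle_ineq4)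
    then have "norm (y + s *\<^sub>R b) > R" using False that nb by simp
    then show ?thesis using R(2) False by simp
  qed
  have ball_int: "integrable lebesgue (\<lambda>y::'a. M * indicat_real (cball 0 (R + 1)) y)"
    using lmeasurable_cball[of "0::'a" "R + 1"]
    by (intro integrable_mult_right integrable_real_indicator) (auto simp: fmeasurable_def)
  have bm: "f \<in> borel_measurable lebesgue" if "continuous_on UNIV f" for f :: "'a \<Rightarrow> real"
    using borel_measurable_continuous_onI[OF that] by (simp add: measurable_completion)
  have cts: "continuous_on UNIV (\<lambda>y. \<psi> (y + s *\<^sub>R b))" "continuous_on UNIV (\<lambda>y. ?\<Phi> (y - s *\<^sub>R b))" for s
    by (intro continuous_on_compose2[OF c\<psi>] continuous_intros; simp)+
  have \<Phi>1: "\<bar>?\<Phi> y\<bar> \<le> 1" for y :: 'a by (simp add: ramp_def)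
  have lim1: "(\<lambda>n. LINT y|lebesgue. ?\<Phi> y * ((\<psi> (y + t n *\<^sub>R b) - \<psi> y) / t n)) \<longlonglongrightarrow>
      (LINT y|lebesgue. ?\<Phi> y * \<psi>' y b)"
  proof (rule integral_dominated_convergence[OF _ _ ball_int])
    show "(\<lambda>y. ?\<Phi> y * \<psi>' y b) \<in> borel_measurable lebesgue"
      using c\<Phi> d(2)[OF assms(3)] by (intro bm continuous_intros) auto
    show "(\<lambda>y. ?\<Phi> y * ((\<psi> (y + t n *\<^sub>R b) - \<psi> y) / t n)) \<in> borel_measurable lebesgue" for n
      using t(1)[of n] by (intro bm continuous_intros cts c\<psi>) auto
    show "AE y in lebesgue. (\<lambda>n. ?\<Phi> y * ((\<psi> (y + t n *\<^sub>R b) - \<psi> y) / t n)) \<longlonglongrightarrow> ?\<Phi> y * \<psi>' y b"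
    proof (rule AE_I2)
      fix y
      have "((\<lambda>s. \<psi> (y + s *\<^sub>R b)) has_real_derivative \<psi>' y b) (at 0)" using line[of y 0] by simp
      from DERIV_imp_sequential_quotient[OF this t0] t(1)
      have "(\<lambda>n. (\<psi> (y + t n *\<^sub>R b) - \<psi> y) / t n) \<longlonglongrightarrow> \<psi>' y b" by (simp add: less_imp_neq[THEN not_sym])
      then show "(\<lambda>n. ?\<Phi> y * ((\<psi> (y + t n *\<^sub>R b) - \<psi> y) / t n)) \<longlonglongrightarrow> ?\<Phi> y * \<psi>' y b"
        by (rule tendsto_mult_left)
    qed
    show "AE y in lebesgue. norm (?\<Phi> y * ((\<psi> (y + t n *\<^sub>R b) - \<psi> y) / t n)) \<le> M * indicat_real (cball 0 (R + 1)) y" for n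
    proof (rule AE_I2)
      fix y
      have "norm (?\<Phi> y * ((\<psi> (y + t n *\<^sub>R b) - \<psi> y) / t n)) \<le> 1 * (M * indicat_real (cball 0 (R + 1)) y)"
        unfolding norm_mult using quot[OF t, of y n] \<Phi>1[of y] by (intro mult_mono) auto
      then show "norm (?\<Phi> y * ((\<psi> (y + t n *\<^sub>R b) - \<psi> y) / t n)) \<le> M * indicat_real (cball 0 (R + 1)) y" by simp
    qed
  qed
  have box: "\<exists>p q. \<forall>y. y \<notin> cbox p q \<longrightarrow> norm (y::'a) > R + 1"
  proof -
    obtain p q where "cball (0::'a) (R + 1) \<subseteq> cbox p q"
      using bounded_subset_cbox_symmetric[OF bounded_cball] by metis
    then show ?thesis by (intro exI[of _ p] exI[of _ q]) (auto simp: subset_iff not_le[symmetric])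
  qed
  then obtain p q where pq: "\<And>y::'a. y \<notin> cbox p q \<Longrightarrow> norm y > R + 1" by blast
  have far: "\<psi> (y + s *\<^sub>R b) = 0" if "norm y > R + 1" "\<bar>s\<bar> \<le> 1" for y s
  proof -
    have "norm y \<le> norm (y + s *\<^sub>R b) + norm (s *\<^sub>R b)" by (metis add_diff_cancel_right' norm_triangle_ineq4)
    then show ?thesis using that nb R(2)[of "y + s *\<^sub>R b"] by simp
  qed
  have swap: "(LINT y|lebesgue. ?\<Phi> y * ((\<psi> (y + t n *\<^sub>R b) - \<psi> y) / t n)) =
      (LINT y|lebesgue. ((?\<Phi> (y - t n *\<^sub>R b) - ?\<Phi> y) / t n) * \<psi> y)" for n
  proof -
    have i1: "integrable lebesgue (\<lambda>y. ?\<Phi> y * \<psi> (y + t n *\<^sub>R b))"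
      by (rule continuous_vanishing_integral(1)[of _ p q])
        (use far pq t[of n] c\<Phi> cts in \<open>auto intro!: continuous_intros\<close>)
    have i2: "integrable lebesgue (\<lambda>y. ?\<Phi> y * \<psi> y)"
      by (rule continuous_vanishing_integral(1)[of _ p q])
        (use far[of _ 0] pq c\<Phi> c\<psi> in \<open>auto intro!: continuous_intros\<close>)
    have i3: "integrable lebesgue (\<lambda>y. ?\<Phi> (y - t n *\<^sub>R b) * \<psi> y)"
      by (rule continuous_vanishing_integral(1)[of _ p q])
        (use far[of _ 0] pq c\<psi> cts in \<open>auto intro!: continuous_intros\<close>)
    have "(LINT y|lebesgue. ?\<Phi> (y - t n *\<^sub>R b) * \<psi> y) = (LINT y|lebesgue. ?\<Phi> y * \<psi> (y + t n *\<^sub>R b))"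
      using lebesgue_integral_translation[OF continuous_on_mult[OF cts(2)[of "t n"] c\<psi>], of "t n *\<^sub>R b"]
      by simp
    then have "(LINT y|lebesgue. (?\<Phi> y * \<psi> (y + t n *\<^sub>R b) - ?\<Phi> y * \<psi> y) / t n) =
       (LINT y|lebesgue. (?\<Phi> (y - t n *\<^sub>R b) * \<psi> y - ?\<Phi> y * \<psi> y) / t n)"
      using i1 i2 i3 by simp
    then show ?thesis by (simp add: algebra_simps diff_divide_distrib)
  qed
  have sph: "AE y in lebesgue. norm (y::'a) \<noteq> x \<and> norm y \<noteq> x + h"
  proof -
    have "sphere (0::'a) x \<union> sphere 0 (x + h) \<in> null_sets lebesgue"
      using negligible_sphere negligible_Un negligible_iff_null_sets by blast
    then show ?thesis by (rule AE_not_in[THEN AE_mp]) auto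
  qed
  have lim2: "(\<lambda>n. LINT y|lebesgue. ((?\<Phi> (y - t n *\<^sub>R b) - ?\<Phi> y) / t n) * \<psi> y) \<longlonglongrightarrow>
      (LINT y|lebesgue. (- ?g y) * \<psi> y)"
  proof (rule integral_dominated_convergence)
    show "integrable lebesgue (\<lambda>y. (1 / h) * \<bar>\<psi> y\<bar>)"
      by (rule continuous_vanishing_integral(1)[of _ p q])
        (use far[of _ 0] pq c\<psi> assms(2) in \<open>auto intro!: continuous_intros\<close>)
    have "(\<lambda>y. (- ?g y) * \<psi> y) \<in> borel_measurable borel"
      using borel_measurable_continuous_onI[OF c\<psi>] by measurable
    then show "(\<lambda>y. (- ?g y) * \<psi> y) \<in> borel_measurable lebesgue" by (simp add: measurable_completion)
    show "(\<lambda>y. (?\<Phi> (y - t n *\<^sub>R b) - ?\<Phi> y) / t n * \<psi> y) \<in> borel_measurable lebesgue" for n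
      using t(1)[of n] by (intro bm continuous_intros cts c\<psi>) auto
    show "AE y in lebesgue. (\<lambda>n. (?\<Phi> (y - t n *\<^sub>R b) - ?\<Phi> y) / t n * \<psi> y) \<longlonglongrightarrow> - ?g y * \<psi> y"
      using sph
    proof (rule AE_mp, intro AE_I2 impI)
      fix y :: 'a assume y: "norm y \<noteq> x \<and> norm y \<noteq> x + h"
      have "(\<lambda>n. - t n) \<longlonglongrightarrow> 0" using tendsto_minus[OF t0] by simp
      from DERIV_imp_sequential_quotient[OF ramp_line_has_derivative[OF assms(1,2), of y b] this] y t(1)
      have "(\<lambda>n. (?\<Phi> (y + (- t n) *\<^sub>R b) - ?\<Phi> y) / (- t n)) \<longlonglongrightarrow> ?g y"
        by (simp add: less_imp_neq[THEN not_sym])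
      then have "(\<lambda>n. - ((?\<Phi> (y + (- t n) *\<^sub>R b) - ?\<Phi> y) / (- t n))) \<longlonglongrightarrow> - ?g y" by (rule tendsto_minus)
      then have "(\<lambda>n. (?\<Phi> (y - t n *\<^sub>R b) - ?\<Phi> y) / t n) \<longlonglongrightarrow> - ?g y" by simp
      then show "(\<lambda>n. (?\<Phi> (y - t n *\<^sub>R b) - ?\<Phi> y) / t n * \<psi> y) \<longlonglongrightarrow> - ?g y * \<psi> y"
        by (rule tendsto_mult_right)
    qed
    show "AE y in lebesgue. norm ((?\<Phi> (y - t n *\<^sub>R b) - ?\<Phi> y) / t n * \<psi> y) \<le> 1 / h * \<bar>\<psi> y\<bar>" for n
    proof (rule AE_I2)
      fix y
      have "\<bar>?\<Phi> (y - t n *\<^sub>R b) - ?\<Phi> y\<bar> \<le> \<bar>norm (y - t n *\<^sub>R b) - norm y\<bar> / h" by (rule ramp_lipschitz[OF assms(2)])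
      also have "\<dots> \<le> t n / h"
        using norm_triangle_ineq3[of "y - t n *\<^sub>R b" y] nb t(1)[of n] assms(2) by (intro divide_right_mono) auto
      finally have "\<bar>(?\<Phi> (y - t n *\<^sub>R b) - ?\<Phi> y) / t n\<bar> \<le> 1 / h" using t(1)[of n] by (simp add: field_simps)
      then have "\<bar>(?\<Phi> (y - t n *\<^sub>R b) - ?\<Phi> y) / t n\<bar> * \<bar>\<psi> y\<bar> \<le> 1 / h * \<bar>\<psi> y\<bar>"
        by (intro mult_right_mono) auto
      then show "norm ((?\<Phi> (y - t n *\<^sub>R b) - ?\<Phi> y) / t n * \<psi> y) \<le> 1 / h * \<bar>\<psi> y\<bar>"
        by (simp only: real_norm_def abs_mult)
    qed
  qed
  have "(LINT y|lebesgue. ?\<Phi> y * \<psi>' y b) = (LINT y|lebesgue. (- ?g y) * \<psi> y)"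
    using LIMSEQ_unique[OF lim1] lim2 unfolding swap by blast
  also have "\<dots> = - (LINT y|lebesgue. ?g y * \<psi> y)" by (simp flip: Bochner_Integration.integral_minus)
  finally show "(LINT y|lebesgue. ?\<Phi> y * frechet_derivative \<psi> (at y) b) = - (LINT y|lebesgue. ?g y * \<psi> y)"
    using frechet_derivative_at[OF d(1)] by simp
qed

lemma ramp_radial_test_function:
  assumes "0 < x" "0 < h"
  shows "ramp x h \<in> radial_test_functions TYPE('a::euclidean_space)"
  unfolding radial_test_functions_def
proof (intro CollectI conjI)
  show "continuous_on {0..} (ramp x h)" by (intro continuous_intros)
  have c: "continuous_on UNIV (\<lambda>y::'a. ramp x h (norm y))" by (intro continuous_intros)
  have "(\<lambda>y::'a. ramp x h (norm y)) \<in> L_infinity"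
    using borel_measurable_continuous_onI[OF c]
    by (auto simp: L_infinity_def measurable_completion ramp_def intro!: exI[of _ 1])
  moreover have "(\<lambda>y. if x < norm y \<and> norm y < x + h then - (y \<bullet> b) / (norm y * h) else 0) \<in> L_infinity"
    if "b \<in> Basis" for b :: 'a
    unfolding L_infinity_def
  proof (intro CollectI conjI exI AE_I2)
    show "(\<lambda>y. if x < norm y \<and> norm y < x + h then - (y \<bullet> b) / (norm y * h) else 0) \<in> borel_measurable lebesgue"
      by (intro measurable_completion) measurable
    fix y :: 'a
    have "\<bar>y \<bullet> b\<bar> \<le> norm y" using Basis_le_norm[OF that] .
    moreover have "\<bar>y \<bullet> b\<bar> / (norm y * h) \<le> norm y / (norm y * h)"
      using calculation assms(2) by (intro divide_right_mono) auto
    ultimately show "\<bar>if x < norm y \<and> norm y < x + h then - (y \<bullet> b) / (norm y * h) else 0\<bar> \<le> 1 / h"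
      using assms by (auto simp: abs_mult split: if_splits)
  qed
  ultimately show "(\<lambda>y::'a. ramp x h (norm y)) \<in> W1_infinity"
    using ramp_weak_partial[OF assms] unfolding W1_infinity_def by blast
  have "{y::'a. ramp x h (norm y) \<noteq> 0} \<subseteq> cball 0 (x + h)"
    using assms by (auto simp: ramp_def field_simps max_def min_def split: if_splits)
  then show "compact_support (\<lambda>y::'a. ramp x h (norm y))"
    unfolding compact_support_def compact_closure by (rule bounded_subset[OF bounded_cball])
qed

section \<open>Radial test functions are Lipschitz\<close>

lemma integral_abs_le_AE:
  fixes f w :: "'b \<Rightarrow> real"
  assumes "f \<in> borel_measurable M" "integrable M w" "AE x in M. \<bar>f x\<bar> \<le> w x"
  shows "\<bar>integral\<^sup>L M f\<bar> \<le> integral\<^sup>L M w"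
proof -
  have f: "integrable M f"
    by (rule Bochner_Integration.integrable_bound[OF assms(2,1)]) (use assms(3) in \<open>auto elim: eventually_mono\<close>)
  have "\<bar>integral\<^sup>L M f\<bar> \<le> (\<integral>x. \<bar>f x\<bar> \<partial>M)" by (rule integral_abs_bound)
  also have "\<dots> \<le> integral\<^sup>L M w" using f assms by (intro integral_mono_AE) auto
  finally show ?thesis .
qed

lemma lebesgue_integral_vanishing_bound:
  fixes f g :: "'a::euclidean_space \<Rightarrow> real"
  assumes "continuous_on UNIV f" "\<And>x. x \<notin> cbox p q \<Longrightarrow> f x = 0" "\<And>x. 0 \<le> f x"
    and "g \<in> borel_measurable lebesgue" "AE x in lebesgue. \<bar>g x\<bar> \<le> C"
  shows "\<bar>LINT x|lebesgue. g x * f x\<bar> \<le> C * (LINT x|lebesgue. f x)"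
proof -
  have f: "integrable lebesgue f" by (rule continuous_vanishing_integral(1)[OF assms(1,2)])
  have le: "AE x in lebesgue. norm (g x * f x) \<le> C * f x"
    using assms(5) by eventually_elim (auto simp: abs_mult assms(3) intro: mult_right_mono)
  have "\<bar>LINT x|lebesgue. g x * f x\<bar> \<le> (LINT x|lebesgue. C * f x)"
    by (rule integral_abs_le_AE) (use f le assms(4) in auto)
  then show ?thesis using f by simp
qed

text \<open>Mollification along the line spanned by a basis vector b: F t is the integral of \<Phi>
  against a bump centred at t b. Differentiating in t is minus differentiating the bump in direction
  b, so the weak partial derivative bounds |F'| by C times the mass I of the bump, while F t differs
  from I times the value of \<Phi> at t b by an arbitrarily small multiple of I.\<close>

lemma radial_test_function_lipschitz:
  fixes \<phi> :: "real \<Rightarrow> real"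
  assumes "\<phi> \<in> radial_test_functions TYPE('a::euclidean_space)"
  obtains L R where "L > 0" "\<And>r s. 0 \<le> r \<Longrightarrow> 0 \<le> s \<Longrightarrow> \<bar>\<phi> r - \<phi> s\<bar> \<le> L * \<bar>r - s\<bar>"
    "R > 0" "\<And>r. R \<le> r \<Longrightarrow> \<phi> r = 0"
proof -
  define \<Phi> where "\<Phi> = (\<lambda>x::'a. \<phi> (norm x))"
  have c: "continuous_on {0..} \<phi>" and W: "\<Phi> \<in> W1_infinity" and S: "compact_support \<Phi>"
    using assms by (auto simp: radial_test_functions_def \<Phi>_def)
  have c\<Phi>: "continuous_on UNIV \<Phi>"
    unfolding \<Phi>_def by (rule continuous_on_compose2[OF c]) (auto intro!: continuous_intros)
  obtain b :: 'a where b: "b \<in> Basis" using nonempty_Basis by blast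
  have nb: "norm b = 1" using b by simp
  have "bounded {x. \<Phi> x \<noteq> 0}" using S by (auto simp: compact_support_def)
  then obtain R where R: "R > 0" "\<And>x. \<Phi> x \<noteq> 0 \<Longrightarrow> norm x \<le> R" by (auto simp: bounded_pos)
  have vanish: "\<phi> r = 0" if "R + 1 \<le> r" for r
    using R(2)[of "r *\<^sub>R b"] that R(1) nb by (force simp: \<Phi>_def)
  obtain g where "g \<in> L_infinity" and weak: "has_weak_partial \<Phi> b g"
    using W b by (auto simp: W1_infinity_def)
  then obtain C0 where gm: "g \<in> borel_measurable lebesgue" and "AE x in lebesgue. \<bar>g x\<bar> \<le> C0"
    by (auto simp: L_infinity_def)
  then have gC: "AE x in lebesgue. \<bar>g x\<bar> \<le> \<bar>C0\<bar> + 1"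
    by (auto elim: eventually_mono)
  define C where "C = \<bar>C0\<bar> + 1"
  have "\<bar>\<Phi> (r *\<^sub>R b) - \<Phi> (s *\<^sub>R b)\<bar> \<le> C * \<bar>r - s\<bar>" for r s :: real
  proof (rule field_le_epsilon)
    fix \<epsilon> :: real assume "\<epsilon> > 0"
    have close: "\<exists>d>0. \<forall>y. norm (y - x) < d \<longrightarrow> \<bar>\<Phi> y - \<Phi> x\<bar> < \<epsilon> / 2" for x
      using c\<Phi> \<open>\<epsilon> > 0\<close> unfolding continuous_on_iff dist_norm real_norm_def by (meson UNIV_I half_gt_zero)
    obtain d1 where d1: "d1 > 0" "\<And>y. norm (y - r *\<^sub>R b) < d1 \<Longrightarrow> \<bar>\<Phi> y - \<Phi> (r *\<^sub>R b)\<bar> < \<epsilon> / 2"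
      using close by blast
    obtain d2 where d2: "d2 > 0" "\<And>y. norm (y - s *\<^sub>R b) < d2 \<Longrightarrow> \<bar>\<Phi> y - \<Phi> (s *\<^sub>R b)\<bar> < \<epsilon> / 2"
      using close by blast
    \<comment> \<open>The radius of the bumps: within distance d of either end point, \<Phi> varies
      by less than \<epsilon> / 2.\<close>
    define d where "d = min (min d1 d2) 1"
    define e where "e = d ^ 2"
    have d: "0 < d" "d \<le> d1" "d \<le> d2" "d \<le> 1" using d1 d2 by (auto simp: d_def)
    have e: "e > 0" using d by (simp add: e_def)
    define B where "B = (\<lambda>t. bump (t *\<^sub>R b) e)"
    have Bout: "B t y = 0" if "d \<le> norm (y - t *\<^sub>R b)" for t y
      unfolding B_def using that d by (intro bump_outside[OF e]) (auto simp: e_def dist_norm norm_minus_commute)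
    \<comment> \<open>All bumps centred between the two points vanish outside the ball of radius K,
      since their radius d is at most 1; thus every integral can be taken over one fixed
      box.\<close>
    define K where "K = max \<bar>r\<bar> \<bar>s\<bar> + 2"
    obtain p q where pq: "cball (0::'a) K \<subseteq> cbox p q"
      using bounded_subset_cbox_symmetric[OF bounded_cball] by metis
    have Bbox: "B t y = 0" if "y \<notin> cbox p q" "\<bar>t\<bar> \<le> max \<bar>r\<bar> \<bar>s\<bar>" for t y
    proof (rule Bout)
      have "norm y > K" using that(1) pq by (auto simp: subset_iff not_le[symmetric])
      moreover have "norm y \<le> norm (y - t *\<^sub>R b) + norm (t *\<^sub>R b)" by (metis norm_triangle_sub add.commute)
      ultimately show "d \<le> norm (y - t *\<^sub>R b)" using that(2) nb d(4) by (simp add: K_def)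
    qed
    have cB: "continuous_on UNIV (B t)" for t
      unfolding B_def using bump_has_derivative
      by (auto intro!: continuous_at_imp_continuous_on has_derivative_continuous)
    define I where "I = (LINT y|lebesgue. B 0 y)"
    have BI: "(LINT y|lebesgue. B t y) = I" for t
      using lebesgue_integral_translation[OF cB, of t "t *\<^sub>R b"] by (simp add: B_def bump_def I_def)
    have Ipos: "I > 0"
    proof -
      have *: "I = integral (cbox p q) (B 0)" "B 0 integrable_on cbox p q"
        unfolding I_def using continuous_vanishing_integral(2)[OF cB[of 0], of p q] Bbox[of _ 0]
        by (auto intro!: integrable_continuous continuous_on_subset[OF cB])
      have "0 \<in> cball (0::'a) K" by (simp add: K_def)
      then have "0 \<in> cbox p q" using pq by blast
      have "cball (0::'a) K \<subseteq> cbox p q" "ball (0::'a) 1 \<noteq> {}" by (use pq in auto)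
      have "measure lborel (cbox p q) \<noteq> 0"
      proof
        assume "measure lborel (cbox p q) = 0"
        then have "interior (cbox p q) = {}" by (simp add: content_eq_0_interior)
        moreover have "ball (0::'a) K \<subseteq> interior (cbox p q)"
          using pq ball_subset_cball by (intro interior_maximal) auto
        ultimately show False by (auto simp: K_def)
      qed
      have "I \<noteq> 0"
      proof
        assume "I = 0"
        then have "(B 0 has_integral 0) (cbox p q)" using * by (simp add: has_integral_integrable_integral)
        then have "B 0 0 = 0"
        proof (rule has_integral_0_cbox_imp_0[rotated 2])
          show "continuous_on (cbox p q) (B 0)" by (rule continuous_on_subset[OF cB]) simp
          show "box p q \<noteq> {}" using \<open>measure lborel (cbox p q) \<noteq> 0\<close> by (auto simp: content_eq_0_interior interior_cbox)
        qed (use \<open>0 \<in> cbox p q\<close> in \<open>auto simp: B_def bump_nonneg\<close>)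
        then show False using e by (simp add: B_def bump_def flat_exp_def)
      qed
      moreover have "I \<ge> 0" unfolding I_def by (rule Bochner_Integration.integral_nonneg) (simp add: B_def bump_nonneg)
      ultimately show ?thesis by simp
    qed
    define F where "F = (\<lambda>t. LINT y|lebesgue. \<Phi> y * B t y)"
    have FI: "F t = integral (cbox p q) (\<lambda>y. \<Phi> y * B t y)" if "\<bar>t\<bar> \<le> max \<bar>r\<bar> \<bar>s\<bar>" for t
      unfolding F_def using Bbox[OF _ that] by (intro continuous_vanishing_integral(2)) (auto intro!: continuous_intros c\<Phi> cB)
    define U where "U = {- max \<bar>r\<bar> \<bar>s\<bar>..max \<bar>r\<bar> \<bar>s\<bar>}"
    define B' where "B' = (\<lambda>t y. 2 * ((y - t *\<^sub>R b) \<bullet> b) * flat_exp 2 (e - (y - t *\<^sub>R b) \<bullet> (y - t *\<^sub>R b)))"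
    have Bt: "((\<lambda>t. B t y) has_real_derivative B' t y) (at t)" for t y
    proof -
      have "((\<lambda>t. e - (y - t *\<^sub>R b) \<bullet> (y - t *\<^sub>R b)) has_derivative (\<lambda>v. 2 * ((y - t *\<^sub>R b) \<bullet> b) * v)) (at t)"
        by (auto intro!: derivative_eq_intros simp: inner_commute)
      from DERIV_compose_FDERIV[OF flat_exp_has_derivative this, of 0]
      show ?thesis unfolding has_field_derivative_def B_def bump_def B'_def
        by (rule has_derivative_eq_rhs) (auto simp: fun_eq_iff numeral_2_eq_2)
    qed
    have cont_flat: "continuous_on UNIV (flat_exp j)" for j
      using flat_exp_has_derivative by (auto intro!: continuous_at_imp_continuous_on DERIV_isCont)
    have F': "(F has_real_derivative integral (cbox p q) (\<lambda>y. \<Phi> y * B' t y)) (at t within U)" if "t \<in> U" for t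
    proof -
      have "((\<lambda>t. integral (cbox p q) (\<lambda>y. \<Phi> y * B t y)) has_real_derivative integral (cbox p q) (\<lambda>y. \<Phi> y * B' t y)) (at t within U)"
      proof (rule leibniz_rule_field_derivative)
        show "((\<lambda>t. \<Phi> y * B t y) has_real_derivative \<Phi> y * B' t y) (at t within U)" for t y
          by (rule DERIV_cmult[OF has_field_derivative_at_within[OF Bt]])
        show "(\<lambda>y. \<Phi> y * B t y) integrable_on cbox p q" for t
          by (intro integrable_continuous continuous_on_mult continuous_on_subset[OF cB] continuous_on_subset[OF c\<Phi>]) auto
        show "continuous_on (U \<times> cbox p q) (\<lambda>(t, y). \<Phi> y * B' t y)"
          unfolding B'_def split_beta
          by (intro continuous_intros continuous_on_compose2[OF c\<Phi>] continuous_on_compose2[OF cont_flat]) auto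
      qed (use that in \<open>auto simp: U_def\<close>)
      then show ?thesis
        by (rule has_field_derivative_transform_within[OF _ zero_less_one that]) (auto simp: FI U_def abs_le_iff)
    qed
    have F'b: "\<bar>integral (cbox p q) (\<lambda>y. \<Phi> y * B' t y)\<bar> \<le> C * I" if "t \<in> U" for t
    proof -
      have tU: "\<bar>t\<bar> \<le> max \<bar>r\<bar> \<bar>s\<bar>" using that by (auto simp: U_def abs_le_iff)
      have fd: "frechet_derivative (B t) (at y) b = - B' t y" for y
      proof -
        have "frechet_derivative (bump (t *\<^sub>R b) e) (at y) =
            (\<lambda>v. ((-2) * ((y - t *\<^sub>R b) \<bullet> v)) * flat_exp 2 (e - (y - t *\<^sub>R b) \<bullet> (y - t *\<^sub>R b)))"
          by (rule frechet_derivative_at[OF bump_has_derivative, symmetric])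
        then show ?thesis by (simp add: B_def B'_def)
      qed
      have "B t \<in> Cc_infinity" unfolding B_def by (rule bump_Cc_infinity[OF e])
      then have "(LINT y|lebesgue. \<Phi> y * (- B' t y)) = - (LINT y|lebesgue. g y * B t y)"
        using weak unfolding has_weak_partial_def fd[symmetric] by blast
      moreover have "\<bar>LINT y|lebesgue. g y * B t y\<bar> \<le> C * (LINT y|lebesgue. B t y)"
        by (rule lebesgue_integral_vanishing_bound[of _ p q])
          (use cB Bbox[OF _ tU] gm gC in \<open>auto simp: B_def bump_nonneg C_def\<close>)
      moreover have "(LINT y|lebesgue. \<Phi> y * (- B' t y)) = integral (cbox p q) (\<lambda>y. \<Phi> y * (- B' t y))"
      proof (rule continuous_vanishing_integral(2))
        show "continuous_on UNIV (\<lambda>y. \<Phi> y * (- B' t y))"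
          unfolding B'_def by (intro continuous_intros c\<Phi> continuous_on_compose2[OF cont_flat]) auto
        fix y assume "y \<notin> cbox p q"
        then have "B t y = 0" using Bbox[OF _ tU] by simp
        then have "B' t y = 0" by (auto simp: B_def B'_def bump_def flat_exp_def split: if_splits)
        then show "\<Phi> y * (- B' t y) = 0" by simp
      qed
      moreover have "integral (cbox p q) (\<lambda>y. \<Phi> y * (- B' t y)) = - integral (cbox p q) (\<lambda>y. \<Phi> y * B' t y)"
        by simp
      moreover have "C * (LINT y|lebesgue. B t y) = C * I" using BI[of t] by simp
      ultimately show ?thesis by linarith
    qed
    have "norm (F r - F s) \<le> C * I * norm (r - s)"
      by (rule field_differentiable_bound[of U F "\<lambda>t. integral (cbox p q) (\<lambda>y. \<Phi> y * B' t y)"])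
        (use F' F'b in \<open>auto simp: U_def\<close>)
    moreover have app: "\<bar>F t - \<Phi> (t *\<^sub>R b) * I\<bar> \<le> \<epsilon> / 2 * I"
      if tt: "\<bar>t\<bar> \<le> max \<bar>r\<bar> \<bar>s\<bar>" "\<And>y. norm (y - t *\<^sub>R b) < d \<Longrightarrow> \<bar>\<Phi> y - \<Phi> (t *\<^sub>R b)\<bar> < \<epsilon> / 2" for t
    proof -
      have i: "integrable lebesgue (\<lambda>y. \<Phi> y * B t y)" "integrable lebesgue (B t)"
        by (rule continuous_vanishing_integral(1)[of _ p q]; use Bbox[OF _ tt(1)] in \<open>auto intro!: continuous_intros c\<Phi> cB\<close>)+
      have "F t - \<Phi> (t *\<^sub>R b) * I = (LINT y|lebesgue. \<Phi> y * B t y - \<Phi> (t *\<^sub>R b) * B t y)"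
        using i BI[of t] by (simp add: F_def)
      also have "\<bar>\<dots>\<bar> \<le> (LINT y|lebesgue. \<epsilon> / 2 * B t y)"
      proof -
        show "\<bar>LINT y|lebesgue. \<Phi> y * B t y - \<Phi> (t *\<^sub>R b) * B t y\<bar> \<le> (LINT y|lebesgue. \<epsilon> / 2 * B t y)"
        proof (rule integral_abs_le_AE[OF _ _ AE_I2])
          fix y
          show "\<bar>\<Phi> y * B t y - \<Phi> (t *\<^sub>R b) * B t y\<bar> \<le> \<epsilon> / 2 * B t y"
          proof (cases "norm (y - t *\<^sub>R b) < d")
            case True
            have "\<bar>\<Phi> y * B t y - \<Phi> (t *\<^sub>R b) * B t y\<bar> = \<bar>\<Phi> y - \<Phi> (t *\<^sub>R b)\<bar> * B t y"
              by (simp add: B_def bump_nonneg abs_mult flip: left_diff_distrib)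
            also have "\<dots> \<le> \<epsilon> / 2 * B t y"
              using tt(2)[OF True] by (intro mult_right_mono) (auto simp: B_def bump_nonneg)
            finally show ?thesis .
          next
            case False
            then show ?thesis using Bout[of y t] by simp
          qed
        qed (use i in auto)
      qed
      also have "\<dots> = \<epsilon> / 2 * I" using i BI[of t] by simp
      finally show ?thesis .
    qed
    have "\<bar>F r - \<Phi> (r *\<^sub>R b) * I\<bar> \<le> \<epsilon> / 2 * I" using d1 d by (intro app) auto
    moreover have "\<bar>F s - \<Phi> (s *\<^sub>R b) * I\<bar> \<le> \<epsilon> / 2 * I" using d2 d by (intro app) auto
    ultimately have "\<bar>\<Phi> (r *\<^sub>R b) * I - \<Phi> (s *\<^sub>R b) * I\<bar> \<le> C * I * \<bar>r - s\<bar> + \<epsilon> / 2 * I + \<epsilon> / 2 * I"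
      unfolding real_norm_def by linarith
    moreover have "\<bar>\<Phi> (r *\<^sub>R b) * I - \<Phi> (s *\<^sub>R b) * I\<bar> = \<bar>\<Phi> (r *\<^sub>R b) - \<Phi> (s *\<^sub>R b)\<bar> * I"
      using Ipos by (simp add: abs_mult flip: left_diff_distrib)
    moreover have "C * I * \<bar>r - s\<bar> + \<epsilon> / 2 * I + \<epsilon> / 2 * I = (C * \<bar>r - s\<bar> + \<epsilon>) * I"
      by (simp add: algebra_simps)
    ultimately have "\<bar>\<Phi> (r *\<^sub>R b) - \<Phi> (s *\<^sub>R b)\<bar> * I \<le> (C * \<bar>r - s\<bar> + \<epsilon>) * I"
      by simp
    then show "\<bar>\<Phi> (r *\<^sub>R b) - \<Phi> (s *\<^sub>R b)\<bar> \<le> C * \<bar>r - s\<bar> + \<epsilon>" using Ipos by simp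
  qed
  then have "\<bar>\<phi> r - \<phi> s\<bar> \<le> C * \<bar>r - s\<bar>" if "0 \<le> r" "0 \<le> s" for r s
    using that nb unfolding \<Phi>_def by (metis abs_of_nonneg mult.right_neutral norm_scaleR)
  then show thesis using that[of C "R + 1"] vanish R(1) by (auto simp: C_def)
qed

section \<open>Comparison principle\<close>

context pucci
begin

text \<open>If \<open>D = u - v - \<psi>\<close> were positive somewhere with negative slope, then the weighted slope of \<open>v\<close>
  would stay away from \<open>0\<close> near the origin, while \<open>v\<close> would be bounded above there; the latter makes
  the flux of \<open>v\<close> vanish.\<close>

lemma flux_not_bounded_below:
  assumes V: "pucci_sol_small_flux lam Lam s n f v p" and "0 < x0" "x0 \<le> 1" "0 < \<delta>"
    and ge: "\<And>x. 0 < x \<Longrightarrow> x \<le> x0 \<Longrightarrow> \<delta> \<le> x powr kexp * p x"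
  shows False
proof -
  interpret V: pucci_sol_small_flux lam Lam s n f v p by (rule V)
  have p_pos: "0 < p x" if "0 < x" "x \<le> x0" for x
    using ge[OF that] assms(4) powr_gt_zero[of x kexp] that by (smt (verit) mult_nonneg_nonpos)
  have mono: "v x \<le> v x0" if x: "0 < x" "x \<le> x0" for x
  proof -
    have "(p has_integral v x0 - v x) {x..x0}"
      by (rule primitive_on_has_integral[OF V.prim_u[OF x] order.refl x(2) order.refl])
    then have "0 \<le> v x0 - v x" by (rule has_integral_nonneg) (use p_pos x in \<open>force intro: less_imp_le\<close>)
    then show ?thesis by simp
  qed
  define m where "m = pw s (max (v x0) 0)"
  have m: "0 \<le> m" by (simp add: m_def pw_def)
  define G where "G = (\<lambda>t. (t powr kexp * m + t powr kexp * \<bar>f t\<bar>) / lam)"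
  have powr_int: "(\<lambda>t. t powr kexp * m) absolutely_integrable_on {0..1}"
  proof (rule absolutely_integrable_dominated_at_0)
    show "(\<lambda>t. t powr kexp * m) absolutely_integrable_on {a..1}" if "0 < a" for a
      using that by (intro absolutely_integrable_continuous_real continuous_intros) auto
    show "(\<lambda>t. m) absolutely_integrable_on {0..1::real}" by (rule absolutely_integrable_on_const) simp
    show "\<bar>t powr kexp * m\<bar> \<le> m" if "0 < t" "t \<le> 1" for t
      using mult_right_mono[OF powr_le1[of kexp t] m] that lam Lam n m by (simp add: abs_mult)
  qed
  have G: "G absolutely_integrable_on {0..b}" if "b \<le> 1" for b
  proof (rule absolutely_integrable_on_subset_real)
    show "G absolutely_integrable_on {0..1}"
      unfolding G_def by (intro set_integrable_divide set_integral_add(1) powr_int V.fk)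
  qed (use that in auto)
  have le: "x powr kexp * p x \<le> integral {0..x} G" if x: "0 < x" "x \<le> x0" for x
  proof -
    \<comment> \<open>As R t / t powr kexp is nondecreasing, the weight at t is at most the weight
      at x times (t / x) powr kexp. The positive factor R x then cancels, leaving an estimate free
      of the weight of v.\<close>
    have "V.h x \<le> integral {0..x} (\<lambda>t. V.R x / x powr kexp * G t)"
      unfolding V.h_eq[OF x(1)]
    proof (rule integral_le_off_negligible[of _ _ _ "{0}"])
      show "V.k integrable_on {0..x}" using V.k_int[of x] by (simp add: set_lebesgue_integral_eq_integral)
      show "(\<lambda>t. V.R x / x powr kexp * G t) integrable_on {0..x}"
        using G[of x] x assms(3) by (intro integrable_on_mult_right) (simp add: set_lebesgue_integral_eq_integral)
      fix t assume "t \<in> {0..x} - {0}"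
      then have t: "0 < t" "t \<le> x" by auto
      have "V.k t \<le> V.R t / th (V.q t) * (m + \<bar>f t\<bar>)"
        unfolding V.k_def
      proof (intro mult_left_mono)
        have "pw s (v t) \<le> m" unfolding m_def using mono[of t] t x s by (intro pw_mono) auto
        then show "pw s (v t) - f t \<le> m + \<bar>f t\<bar>" by linarith
        show "0 \<le> V.R t / th (V.q t)" using V.R_pos[of t] th_bounds[of "V.q t"] by simp
      qed
      also have "\<dots> \<le> V.R t / lam * (m + \<bar>f t\<bar>)"
        using V.R_pos[of t] th_bounds[of "V.q t"] lam m by (intro mult_right_mono divide_left_mono) auto
      also have "\<dots> \<le> V.R x * t powr kexp / x powr kexp / lam * (m + \<bar>f t\<bar>)"
      proof -
        have "V.R t \<le> V.R x * t powr kexp / x powr kexp"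
          using V.R_ratio[OF t] x powr_gt_zero[of x kexp] by (subst pos_le_divide_eq) auto
        then show ?thesis using m lam by (intro mult_right_mono divide_right_mono) auto
      qed
      also have "\<dots> = V.R x / x powr kexp * G t"
      proof -
        have "r * y / x / l * (m + a) = r / x * ((y * m + y * a) / l)" for r y x l a :: real
          by (simp add: distrib_left add_divide_distrib mult.assoc)
        then show ?thesis unfolding G_def .
      qed
      finally show "V.k t \<le> V.R x / x powr kexp * G t" .
    qed auto
    then have "V.R x * p x \<le> V.R x / x powr kexp * integral {0..x} G" by (simp only: V.h_def integral_mult_right)
    then have "V.R x * p x \<le> V.R x * (integral {0..x} G / x powr kexp)" by simp
    then have "p x \<le> integral {0..x} G / x powr kexp" using V.R_pos[of x] by (rule mult_left_le_imp_le)
    then show ?thesis using x powr_gt_zero[of x kexp] by (subst (asm) pos_le_divide_eq) (auto simp only: mult.commute)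
  qed
  have "\<forall>\<^sub>F x in at_right 0. integral {0..x} G < \<delta>"
    using order_tendstoD(2)[OF integral_tendsto_0_at_right[OF G[OF order.refl]] assms(4)] .
  moreover have "\<forall>\<^sub>F x in at_right 0. 0 < x \<and> x < x0"
    using assms by (auto simp: eventually_at_right_field)
  ultimately have "\<forall>\<^sub>F x in at_right 0. integral {0..x} G < \<delta> \<and> 0 < x \<and> x < x0" by (rule eventually_conj)
  then obtain x where "integral {0..x} G < \<delta>" "0 < x" "x < x0"
    using eventually_happens'[OF trivial_limit_at_right_real] by blast
  then show False using le[of x] ge[of x] by simp
qed

text \<open>The linearization is taken at u, so D satisfies an inequality with the drift of u, and
  the weight of u times D' is monotone. Where D > 0 the gap u - v exceeds \<psi>, and the absorption
  terms differ by at least \<open>pw s (\<psi> / 2)\<close>, which pays for the barrier.\<close>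

lemma comparison_barrier:
  assumes U: "pucci_sol_small_flux lam Lam s n f1 u pu" and V: "pucci_sol_small_flux lam Lam s n f2 v pv"
    and N: "negligible N" "\<And>t. 0 < t \<Longrightarrow> t \<notin> N \<Longrightarrow> f1 t \<le> f2 t"
    and r: "0 < r0" "r0 < Rad"
    and A: "0 < A" "2 powr s * bexp * Lam * (Rad\<^sup>2 * (4 * bexp + 6 + 2 * n)) \<le> A powr (s - 1)"
  shows "u r0 - v r0 \<le> A * (Rad\<^sup>2 - r0\<^sup>2) powr (- bexp)"
proof (rule ccontr)
  assume "\<not> ?thesis"
  then have D0: "0 < u r0 - v r0 - A * (Rad\<^sup>2 - r0\<^sup>2) powr (- bexp)" by simp
  interpret U: pucci_sol_small_flux lam Lam s n f1 u pu by (rule U)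
  interpret V: pucci_sol_small_flux lam Lam s n f2 v pv by (rule V)
  define Y where "Y = (\<lambda>t. Rad\<^sup>2 - t\<^sup>2)"
  have Y_pos: "0 < Y t" if "0 < t" "t < Rad" for t
    using that power_strict_mono[of t Rad 2] by (simp add: Y_def)
  define \<psi> where "\<psi> = (\<lambda>t. A * Y t powr (- bexp))"
  define \<psi>1 where "\<psi>1 = (\<lambda>t. - (A * bexp * Y t powr (- bexp - 1) * (-2 * t)))"
  define \<psi>2 where "\<psi>2 = (\<lambda>t. A * bexp * (bexp + 1) * Y t powr (- bexp - 2) * (-2 * t)\<^sup>2
      - A * bexp * Y t powr (- bexp - 1) * (-2))"
  have dY: "(Y has_real_derivative -2 * t) (at t)" "((\<lambda>t. -2 * t) has_real_derivative -2) (at t)" for t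
    unfolding Y_def by (auto intro!: derivative_eq_intros)
  have prim_\<psi>: "primitive_on a b \<psi> \<psi>1" "primitive_on a b \<psi>1 \<psi>2" if "0 < a" "b < Rad" for a b
    unfolding \<psi>_def \<psi>1_def \<psi>2_def using Y_pos that by (intro power_barrier_primitive[OF dY]; auto)+
  \<comment> \<open>Centring the barrier at 0 gives Y' = -2 t, which cancels the singular factor n /
    t, so the bound holds down to the origin. The terms add up to at most 4 * (bexp + 1) * Rad^2 +
    (2 + 2 * n) * Rad^2, the constant in the hypothesis on A.\<close>
  have op_\<psi>: "pucci_op t (\<psi>1 t) (\<psi>2 t) \<le> pw s (\<psi> t / 2)" if t: "0 < t" "t < Rad" for t
    unfolding \<psi>_def \<psi>1_def \<psi>2_def
  proof (rule power_barrier[OF t(1) Y_pos[OF t] A(1) _ A(2)])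
    have t2: "t\<^sup>2 \<le> Rad\<^sup>2" using t by (intro power_mono) auto
    have y2: "Y t \<le> Rad\<^sup>2" by (simp add: Y_def)
    have "(bexp + 1) * (- 2 * t)\<^sup>2 + Y t * \<bar>- 2\<bar> + n * Y t * \<bar>- 2 * t\<bar> / t = (bexp + 1) * 4 * t\<^sup>2 + (2 + 2 * n) * Y t"
      using t by (simp add: power_mult_distrib algebra_simps)
    also have "\<dots> \<le> (bexp + 1) * 4 * Rad\<^sup>2 + (2 + 2 * n) * Rad\<^sup>2"
      using t2 y2 bexp_pos n by (intro add_mono mult_left_mono) auto
    finally show "(bexp + 1) * (- 2 * t)\<^sup>2 + Y t * \<bar>- 2\<bar> + n * Y t * \<bar>- 2 * t\<bar> / t \<le> Rad\<^sup>2 * (4 * bexp + 6 + 2 * n)"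
      by (simp add: algebra_simps)
  qed
  define D where "D = (\<lambda>t. u t - v t - \<psi> t)"
  define D1 where "D1 = (\<lambda>t. pu t - pv t - \<psi>1 t)"
  define D2 where "D2 = (\<lambda>t. U.q t - V.q t - \<psi>2 t)"
  have prim_D: "primitive_on a b D D1" "primitive_on a b D1 D2" if "0 < a" "a \<le> b" "b < Rad" for a b
    unfolding D_def D1_def D2_def using that
    by (intro primitive_on_subtract U.prim_u V.prim_u U.prim_p V.prim_p prim_\<psi>; simp)+
  have ineq: "0 \<le> D2 t + U.c t * D1 t" if t: "0 < t" "t < Rad" "t \<notin> N" "0 < D t" for t
    unfolding U.c_def
  proof (rule drift_nonneg_of_op)
    have \<psi>_pos: "0 < \<psi> t" using A Y_pos[OF t(1,2)] by (simp add: \<psi>_def)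
    have "pw s (\<psi> t / 2) \<le> pw s (u t) - pw s (v t)"
      by (rule pw_superadditive[OF s \<psi>_pos]) (use t(4) in \<open>simp add: D_def\<close>)
    also have "\<dots> \<le> pucci_op t (pu t) (U.q t) - pucci_op t (pv t) (V.q t)"
      using N(2)[OF t(1,3)] by (simp add: U.q_def V.q_def pucci_op_rhs)
    finally have "0 \<le> pucci_op t (pu t) (U.q t) - pucci_op t (pv t + \<psi>1 t) (V.q t + \<psi>2 t)"
      using op_\<psi>[OF t(1,2)] pucci_op_subadd[OF t(1), of "pv t" "\<psi>1 t" "V.q t" "\<psi>2 t"] by linarith
    also have "\<dots> \<le> th (U.q t) * (U.q t - (V.q t + \<psi>2 t)) + n / t * (th (pu t) * (pu t - (pv t + \<psi>1 t)))"
      by (rule pucci_op_linearize[OF t(1)])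
    finally show "0 \<le> th (U.q t) * D2 t + n / t * (th (pu t) * D1 t)"
      by (simp add: D1_def D2_def diff_diff_eq)
  qed
  have D_r0: "0 < D r0" using D0 by (simp add: D_def \<psi>_def Y_def)
  show False
  proof (cases "0 \<le> D1 r0")
    case True
    have ge: "D r0 \<le> D t" if t: "r0 \<le> t" "t < Rad" for t
      using max_principle_right[OF prim_D[OF r(1) t] U.c_int[OF r(1)] N(1) ineq order.refl t(1) order.refl D_r0 True] r t
      by auto
    have "continuous_on {r0..Rad} (\<lambda>t. u t - v t)"
      by (intro continuous_intros U.continuous_all V.continuous_all r)
    then have "bounded ((\<lambda>t. u t - v t) ` {r0..Rad})"
      using compact_continuous_image compact_imp_bounded by blast
    then obtain M where M: "\<And>t. t \<in> {r0..Rad} \<Longrightarrow> \<bar>u t - v t\<bar> \<le> M"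
      unfolding bounded_iff by (metis imageI real_norm_def)
    \<comment> \<open>Multiplying \<psi> <= M by Y powr bexp leaves a right side that tends to 0 at
      Rad, contradicting A > 0.\<close>
    have le: "A \<le> M * Y t powr bexp" if t: "r0 \<le> t" "t < Rad" for t
    proof -
      have "A * Y t powr (- bexp) \<le> M"
        using ge[OF t] D_r0 M[of t] t by (auto simp: D_def \<psi>_def)
      then have "A * Y t powr (- bexp) * Y t powr bexp \<le> M * Y t powr bexp" by (intro mult_right_mono) auto
      moreover have "A * Y t powr (- bexp) * Y t powr bexp = A"
        using Y_pos[of t] t r by (simp add: powr_minus)
      ultimately show ?thesis by simp
    qed
    have "((\<lambda>t. Y t powr bexp) \<longlongrightarrow> 0) (at_left Rad)"
    proof (rule tendsto_zero_powrI[OF _ tendsto_const _ bexp_pos])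
      show "(Y \<longlongrightarrow> 0) (at_left Rad)" unfolding Y_def by (auto intro!: tendsto_eq_intros)
      show "\<forall>\<^sub>F t in at_left Rad. 0 \<le> Y t"
        using Y_pos r by (auto simp: eventually_at_left_field intro!: exI[of _ r0] less_imp_le)
    qed
    from tendsto_mult[OF tendsto_const[of M] this] have "((\<lambda>t. M * Y t powr bexp) \<longlongrightarrow> 0) (at_left Rad)" by simp
    then have "A \<le> 0"
      by (rule tendsto_lowerbound)
        (use le r in \<open>auto simp: eventually_at_left_field intro!: exI[of _ r0]\<close>)
    then show False using A by simp
  next
    case False
    have left: "U.R x * D1 x \<le> U.R r0 * D1 r0" if x: "0 < x" "x \<le> r0" for x
    proof -
      have "D1 x \<le> exp (integral {x..r0} U.c) * D1 r0"
        by (rule max_principle_left(2)[OF prim_D[OF x r(2)] U.c_int[OF x(1)] N(1) ineq order.refl x(2) order.refl D_r0])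
          (use x r False in auto)
      then have "U.R x * D1 x \<le> U.R x * (exp (integral {x..r0} U.c) * D1 r0)"
        using U.R_pos[of x] by (intro mult_left_mono) auto
      also have "\<dots> = U.R r0 * D1 r0"
        using weight_step[OF U.c_int x] by (simp add: U.R_def)
      finally show ?thesis .
    qed
    \<comment> \<open>\<open>U.R x * D1 x\<close> stays at or below -\<delta> down to the origin.
      The flux of u tends to 0 and the barrier slope is at most C * x, so the remaining term
      \<open>U.R x * pv x\<close> is at least \<delta> / 2 near 0.\<close>
    define \<delta> where "\<delta> = - (U.R r0 * D1 r0)"
    have \<delta>: "0 < \<delta>" using False U.R_pos[of r0] by (simp add: \<delta>_def mult_pos_neg)
    define C where "C = A * bexp * (Rad\<^sup>2 - r0\<^sup>2) powr (- bexp - 1) * 2"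
    have \<psi>1_le: "\<psi>1 x \<le> C * x" if x: "0 < x" "x \<le> r0" for x
    proof -
      have "Rad\<^sup>2 - r0\<^sup>2 \<le> Y x" unfolding Y_def using x by (simp add: power_mono)
      moreover have "0 < Rad\<^sup>2 - r0\<^sup>2" using Y_pos[of r0] r by (simp add: Y_def)
      ultimately have "Y x powr (- bexp - 1) \<le> (Rad\<^sup>2 - r0\<^sup>2) powr (- bexp - 1)"
        using bexp_pos by (intro powr_mono2') auto
      then have "A * bexp * Y x powr (- bexp - 1) * (2 * x) \<le> A * bexp * (Rad\<^sup>2 - r0\<^sup>2) powr (- bexp - 1) * (2 * x)"
        using A bexp_pos x by (intro mult_right_mono mult_left_mono) auto
      then show ?thesis by (simp add: \<psi>1_def C_def mult_ac)
    qed
    have "((\<lambda>x. U.h x - C * x) \<longlongrightarrow> 0 - C * 0) (at_right 0)"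
      by (intro tendsto_intros U.h_tendsto_0)
    then have "\<forall>\<^sub>F x in at_right 0. - (\<delta> / 2) < U.h x - C * x"
      using \<delta> by (intro order_tendstoD(1)[of _ "0 - C * 0"]) auto
    then obtain b where b: "0 < b" "\<And>x. 0 < x \<Longrightarrow> x < b \<Longrightarrow> - (\<delta> / 2) < U.h x - C * x"
      by (auto simp: eventually_at_right_field)
    have C0: "0 \<le> C" using A bexp_pos by (simp add: C_def)
    define x0 where "x0 = min (b / 2) (min r0 1)"
    show False
    proof (rule flux_not_bounded_below[OF V, of x0 "\<delta> / 2"])
      show "0 < x0" "x0 \<le> 1" "0 < \<delta> / 2" using b r \<delta> by (auto simp: x0_def)
      fix x assume x: "0 < x" "x \<le> x0"
      then have x': "x \<le> r0" "x \<le> 1" "x < b" using b(1) by (auto simp: x0_def)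
      have R: "0 < U.R x" "U.R x \<le> 1" "U.R x \<le> x powr kexp" using U.R_pos U.R_le_1 U.R_le x x' by auto
      have "U.R x * D1 x = U.h x - U.R x * pv x - U.R x * \<psi>1 x"
        by (simp add: D1_def U.h_def right_diff_distrib)
      moreover have "U.R x * \<psi>1 x \<le> 1 * (C * x)"
        using R C0 x \<psi>1_le[OF x(1) x'(1)]
        by (meson mult_left_mono mult_right_mono order.trans less_imp_le mult_nonneg_nonneg)
      ultimately have ge: "\<delta> / 2 \<le> U.R x * pv x" using left[OF x(1) x'(1)] b(2)[OF x(1) x'(3)] by (simp add: \<delta>_def)
      then have "0 \<le> U.R x * pv x" using \<delta> by simp
      then have "0 \<le> pv x" using R by (simp add: zero_le_mult_iff)
      \<comment> \<open>Here the weight of u is traded for a quantity independent of u: since pv x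
        is nonnegative, the weight may be enlarged to x powr kexp.\<close>
      then have "U.R x * pv x \<le> x powr kexp * pv x" using R by (intro mult_right_mono)
      then show "\<delta> / 2 \<le> x powr kexp * pv x" using ge by (rule order.trans[rotated])
    qed
  qed
qed

text \<open>The blow-up radius of the barrier tends to infinity. A grows like its power 2 / (s - 1),
  while the profile at the fixed point r decays like its power -4 / (s - 1), so the bound tends to 0
  without any growth condition on u or v.\<close>

theorem comparison:
  assumes U: "pucci_sol_small_flux lam Lam s n f1 u pu" and V: "pucci_sol_small_flux lam Lam s n f2 v pv"
    and N: "negligible N" "\<And>t. 0 < t \<Longrightarrow> t \<notin> N \<Longrightarrow> f1 t \<le> f2 t" and r: "0 < r"
  shows "u r \<le> v r"
proof -
  define C where "C = 2 powr s * bexp * Lam * (4 * bexp + 6 + 2 * n)"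
  have C: "0 < C" using bexp_pos Lam n by (simp add: C_def)
  define g where "g = (\<lambda>x. C * x\<^sup>2 / (x\<^sup>2 - r\<^sup>2)\<^sup>2)"
  have "\<forall>\<^sub>F x in at_top. u r - v r \<le> g x powr (1 / (s - 1))"
    using eventually_gt_at_top[of r]
  proof eventually_elim
    case (elim x)
    define A where "A = (C * x\<^sup>2) powr (1 / (s - 1))"
    have x: "0 < x" using elim r by simp
    have pos: "0 < C * x\<^sup>2" using C x by simp
    have "u r - v r \<le> A * (x\<^sup>2 - r\<^sup>2) powr (- bexp)"
    proof (rule comparison_barrier[OF U V N r elim])
      show "0 < A" using C x by (simp add: A_def)
      have "A powr (s - 1) = C * x\<^sup>2" using pos s by (simp add: A_def powr_powr)
      then show "2 powr s * bexp * Lam * (x\<^sup>2 * (4 * bexp + 6 + 2 * n)) \<le> A powr (s - 1)"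
        by (simp add: C_def mult_ac)
    qed
    also have "(x\<^sup>2 - r\<^sup>2) powr (- bexp) = inverse (((x\<^sup>2 - r\<^sup>2)\<^sup>2) powr (1 / (s - 1)))"
    proof -
      have d: "0 < x\<^sup>2 - r\<^sup>2" using elim r power_strict_mono[of r x 2] by simp
      then have "(x\<^sup>2 - r\<^sup>2)\<^sup>2 = (x\<^sup>2 - r\<^sup>2) powr 2" by simp
      then show ?thesis by (simp add: powr_powr powr_minus bexp_def)
    qed
    also have "A * inverse (((x\<^sup>2 - r\<^sup>2)\<^sup>2) powr (1 / (s - 1))) = g x powr (1 / (s - 1))"
      using pos C unfolding g_def A_def by (subst powr_divide) (auto simp: divide_inverse)
    finally show ?case .
  qed
  moreover have "((\<lambda>x. g x powr (1 / (s - 1))) \<longlongrightarrow> 0) at_top"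
  proof (rule tendsto_zero_powrI[OF _ tendsto_const])
    show "(g \<longlongrightarrow> 0) at_top" unfolding g_def by real_asymp
    show "\<forall>\<^sub>F x in at_top. 0 \<le> g x" using C by (simp add: g_def)
  qed (use s in simp)
  ultimately have "u r - v r \<le> 0"
    using tendsto_lowerbound[of _ _ _ "u r - v r"] by (metis trivial_limit_at_top_linorder)
  then show ?thesis by simp
qed

end

section \<open>Weak solutions\<close>

text \<open>Turns division by a weight into multiplication by another weight, to which
  \<open>weight_primitive\<close> applies.\<close>

lemma weight_minus: "weight (\<lambda>t. - c t) r = inverse (weight c r)"
  by (simp add: weight_def exp_minus)

text \<open>\<open>deriv u\<close> is a total function with arbitrary values where u is not
  differentiable; such points form a null set, so it is still a density of u.\<close>

lemma abs_cont_on_interval_primitive_deriv: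
  assumes "a \<le> b" "abs_cont_on_interval a b u"
  shows "primitive_on a b u (deriv u)"
proof -
  obtain g where g: "primitive_on a b u g" using abs_cont_on_interval_primitive[OF assms] by blast
  obtain N where N: "negligible N" "\<And>x. x \<in> {a<..<b} - N \<Longrightarrow> (u has_real_derivative g x) (at x)"
    using primitive_on_has_real_derivative[OF g] by blast
  show ?thesis
  proof (rule primitive_on_spike[OF g])
    show "negligible (N \<union> {a, b})" by (rule negligible_Un[OF N(1)]) simp
    show "deriv u x = g x" if "x \<in> {a..b} - (N \<union> {a, b})" for x
      using N(2)[of x] that by (intro DERIV_imp_deriv) auto
  qed
qed

lemma primitive_on_continuous_deriv:
  assumes P: "primitive_on a b u g" and g: "continuous_on {a..b} g" and t: "a < t" "t < b"
  shows "deriv u t = g t"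
proof (rule DERIV_imp_deriv)
  have "((\<lambda>x. integral {a..x} g) has_real_derivative g t) (at t within {a..b})"
    by (rule integral_has_real_derivative[OF g]) (use t in auto)
  then have "((\<lambda>x. integral {a..x} g) has_real_derivative g t) (at t)"
    using t by (simp add: at_within_Icc_at)
  then have "((\<lambda>x. u a + integral {a..x} g) has_real_derivative g t) (at t)"
    by (auto intro!: derivative_eq_intros)
  then show "(u has_real_derivative g t) (at t)"
  proof (rule has_field_derivative_transform_within_open[of _ _ _ "{a<..<b}"])
    show "u a + integral {a..x} g = u x" if "x \<in> {a<..<b}" for x
      using P that by (simp add: primitive_on_def)
  qed (use t in auto)
qed

text \<open>Bridge from the half-line integrals in the definition of weak solutions to integrals
  over [0, b], where b lies beyond the support of the test function and T collects its
  kinks.\<close>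

lemma LINT_half_line_eq_integral:
  fixes F G :: "real \<Rightarrow> real"
  assumes G: "G absolutely_integrable_on {0..b}" and T: "negligible T"
    and eq: "\<And>r. 0 < r \<Longrightarrow> r \<le> b \<Longrightarrow> r \<notin> T \<Longrightarrow> F r = G r" and z: "\<And>r. b < r \<Longrightarrow> F r = 0" and "0 \<le> b"
  shows "(LINT r:{0<..}|lebesgue. F r) = integral {0..b} G"
proof -
  define F' where "F' = (\<lambda>r. if r = 0 then 0 else F r)"
  have T0: "negligible (T \<union> {0})" using T by (intro negligible_Un) auto
  have eq': "F' r = G r" if "r \<in> {0..b} - (T \<union> {0})" for r using eq[of r] that by (simp add: F'_def)
  have F': "F' absolutely_integrable_on {0..b}"
    by (rule absolutely_integrable_spike[OF G T0 eq'])
  have "(LINT r:{0<..}|lebesgue. F r) = (LINT r:{0..b}|lebesgue. F' r)"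
    unfolding set_lebesgue_integral_def
    by (rule Bochner_Integration.integral_cong) (use z \<open>0 \<le> b\<close> in \<open>auto simp: F'_def indicator_def not_le\<close>)
  also have "\<dots> = integral {0..b} F'" using set_lebesgue_integral_eq_integral[OF F'] by simp
  also have "\<dots> = integral {0..b} G" by (rule integral_spike[OF T0]) (use eq' in auto)
  finally show ?thesis .
qed

section \<open>The weights of the definition in terms of the drift\<close>

context pucci
begin

lemma Theta_eq_th:
  assumes "n = real N - 1"
  shows "Theta lam Lam N s f t a p = th (rhs (pw s) f t a p)"
  by (simp add: Theta_def rhs_def th_K assms[symmetric] pw_def)

lemma variable_dim_eq_drift:
  assumes "n = real N - 1"
  shows "(variable_dim lam Lam N s f t a p - 1) / t = drift t p (rhs (pw s) f t a p)"
  unfolding variable_dim_def Theta_eq_th[OF assms] drift_def assms[symmetric] by simp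

definition udrift :: "(real \<Rightarrow> real) \<Rightarrow> (real \<Rightarrow> real) \<Rightarrow> real \<Rightarrow> real" where
  "udrift f u t = drift t (deriv u t) (rhs (pw s) f t (u t) (deriv u t))"

text \<open>The integrand in \<open>rho\<close> is the drift formed with \<open>deriv u\<close>, and
  the oriented integral from 1 to r is the case distinction in \<open>weight\<close>.\<close>

lemma rho_eq_weight:
  assumes N: "n = real N - 1" and c: "\<And>a b. 0 < a \<Longrightarrow> udrift f u absolutely_integrable_on {a..b}" and "0 < r"
  shows "rho lam Lam N s f u r = weight (udrift f u) r"
proof -
  have eq: "(\<lambda>t. (variable_dim lam Lam N s f t (u t) (deriv u t) - 1) / t) = udrift f u"
    unfolding variable_dim_eq_drift[OF N] udrift_def ..
  have I: "(LINT t:{a<..<b}|lebesgue. udrift f u t) = integral {a..b} (udrift f u)" if "0 < a" for a b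
    using set_lebesgue_integral_eq_integral(2)[of "{a<..<b}" "udrift f u"] c[OF that, of b]
    by (simp add: absolutely_integrable_on_Icc_iff_Ioo integral_open_interval_real)
  show ?thesis
    unfolding rho_def eq weight_def using I[of 1 r] I[of r 1] \<open>0 < r\<close>
    by (simp add: interval_lebesgue_integral_def)
qed

lemma weighted_absolutely_integrable:
  fixes \<rho> q g :: "real \<Rightarrow> real"
  assumes "continuous_on {a..b} \<rho>" "q \<in> borel_measurable (lebesgue_on {a..b})" "g absolutely_integrable_on {a..b}"
  shows "(\<lambda>t. \<rho> t / th (q t) * g t) absolutely_integrable_on {a..b}"
proof -
  have th: "th \<in> borel_measurable borel" unfolding theta_def by measurable
  have "(\<lambda>t. 1 / th (q t) * g t) absolutely_integrable_on {a..b}"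
  proof (rule absolutely_integrable_bounded_measurable_product_real)
    show "(\<lambda>t. 1 / th (q t)) \<in> borel_measurable (lebesgue_on {a..b})"
      using measurable_compose[OF assms(2) th] by (intro borel_measurable_divide borel_measurable_const)
    have "norm (1 / th (q t)) \<le> 1 / lam" for t using th_bounds[of "q t"] lam by (simp add: frac_le)
    then show "bounded ((\<lambda>t. 1 / th (q t)) ` {a..b})" unfolding bounded_iff by blast
  qed (use assms in auto)
  from absolutely_integrable_continuous_mult[OF assms(1) this] show ?thesis by simp
qed

text \<open>Stated for an abstract weight because it serves twice: for a weak solution not yet known
  to satisfy the equation pointwise, and for a constructed solution.\<close>

lemma weighted_source_integrable:
  fixes \<rho> q f :: "real \<Rightarrow> real"
  assumes \<rho>: "\<And>a b. 0 < a \<Longrightarrow> continuous_on {a..b} \<rho>" "\<And>t. 0 < \<rho> t"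
      "\<And>x y. 0 < x \<Longrightarrow> x \<le> y \<Longrightarrow> \<rho> x * y powr kexp \<le> \<rho> y * x powr kexp"
    and q: "\<And>a b. 0 < a \<Longrightarrow> q \<in> borel_measurable (lebesgue_on {a..b})"
    and f: "\<And>a b. 0 < a \<Longrightarrow> f absolutely_integrable_on {a..b}"
      "\<And>R. (\<lambda>t. t powr kexp * \<bar>f t\<bar>) absolutely_integrable_on {0..R}"
  shows "(\<lambda>t. \<rho> t / th (q t) * f t) absolutely_integrable_on {0..b}"
proof (rule absolutely_integrable_dominated_at_0)
  show "(\<lambda>t. \<rho> t / th (q t) * f t) absolutely_integrable_on {a..b}" if "0 < a" for a
    by (intro weighted_absolutely_integrable \<rho> q f that)
  show "(\<lambda>t. \<rho> b / b powr kexp / lam * (t powr kexp * \<bar>f t\<bar>)) absolutely_integrable_on {0..b}"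
    by (intro set_integrable_mult_right f)
  fix t assume t: "0 < t" "t \<le> b"
  have "\<bar>\<rho> t / th (q t) * f t\<bar> = \<rho> t / th (q t) * \<bar>f t\<bar>"
    using \<rho>(2)[of t] th_bounds[of "q t"] by (simp add: abs_mult)
  also have "\<dots> \<le> \<rho> b * t powr kexp / b powr kexp / lam * \<bar>f t\<bar>"
  proof (intro mult_right_mono frac_le)
    show "\<rho> t \<le> \<rho> b * t powr kexp / b powr kexp"
      using \<rho>(3)[OF t] powr_gt_zero[of b kexp] t by (subst pos_le_divide_eq) auto
    show "0 \<le> \<rho> b * t powr kexp / b powr kexp" using \<rho>(2)[of b] by simp
  qed (use th_bounds lam in auto)
  also have "\<dots> = \<rho> b / b powr kexp / lam * (t powr kexp * \<bar>f t\<bar>)" by simp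
  finally show "\<bar>\<rho> t / th (q t) * f t\<bar> \<le> \<rho> b / b powr kexp / lam * (t powr kexp * \<bar>f t\<bar>)" .
qed

lemma weighted_absorption_integrable:
  fixes \<rho> q v :: "real \<Rightarrow> real"
  assumes \<rho>: "\<And>a b. 0 < a \<Longrightarrow> continuous_on {a..b} \<rho>" "\<And>t. 0 < \<rho> t"
    and q: "\<And>a b. 0 < a \<Longrightarrow> q \<in> borel_measurable (lebesgue_on {a..b})"
    and v: "\<And>a b. 0 < a \<Longrightarrow> continuous_on {a..b} v" "(\<lambda>t. \<rho> t * \<bar>v t\<bar> powr s) absolutely_integrable_on {0..b}"
  shows "(\<lambda>t. \<rho> t / th (q t) * pw s (v t)) absolutely_integrable_on {0..b}"
proof (rule absolutely_integrable_dominated_at_0)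
  show "(\<lambda>t. \<rho> t / th (q t) * pw s (v t)) absolutely_integrable_on {a..b}" if "0 < a" for a
    by (intro weighted_absolutely_integrable \<rho> q absolutely_integrable_continuous_real pw_continuous s v that)
  show "(\<lambda>t. \<rho> t * \<bar>v t\<bar> powr s / lam) absolutely_integrable_on {0..b}"
    by (intro set_integrable_divide v)
  show "\<bar>\<rho> t / th (q t) * pw s (v t)\<bar> \<le> \<rho> t * \<bar>v t\<bar> powr s / lam" for t
    using \<rho>(2)[of t] th_bounds[of "q t"] lam by (simp add: abs_mult abs_pw frac_le)
qed

end

section \<open>Weak solutions solve the equation and have small flux\<close>

lemma ramp_eq:
  assumes "0 < h"
  shows "r \<le> x \<Longrightarrow> ramp x h r = 1" "x + h \<le> r \<Longrightarrow> ramp x h r = 0" "0 \<le> ramp x h r" "ramp x h r \<le> 1"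
  using assms by (auto simp: ramp_def field_simps)

lemma deriv_ramp:
  assumes "0 < h" "r \<noteq> x" "r \<noteq> x + h"
  shows "deriv (ramp x h) r = (if x < r \<and> r < x + h then - (1 / h) else 0)"
proof (rule DERIV_imp_deriv)
  consider "r < x" | "x < r" "r < x + h" | "x + h < r" using assms by linarith
  then show "(ramp x h has_real_derivative (if x < r \<and> r < x + h then - (1 / h) else 0)) (at r)"
  proof cases
    case 1
    have "((\<lambda>_. 1) has_real_derivative 0) (at r)" by simp
    then have "(ramp x h has_real_derivative 0) (at r)"
      by (rule has_field_derivative_transform_within_open[of _ _ _ "{..<x}"])
        (use 1 assms in \<open>auto simp: ramp_eq\<close>)
    then show ?thesis using 1 by simp
  next
    case 2
    have "((\<lambda>r. (x + h - r) / h) has_real_derivative - (1 / h)) (at r)"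
      using assms by (auto intro!: derivative_eq_intros)
    then have "(ramp x h has_real_derivative - (1 / h)) (at r)"
      by (rule has_field_derivative_transform_within_open[of _ _ _ "{x<..<x + h}"])
        (use 2 assms in \<open>auto simp: ramp_def field_simps\<close>)
    then show ?thesis using 2 by simp
  next
    case 3
    have "((\<lambda>_. 0) has_real_derivative 0) (at r)" by simp
    then have "(ramp x h has_real_derivative 0) (at r)"
      by (rule has_field_derivative_transform_within_open[of _ _ _ "{x + h<..}"])
        (use 3 assms in \<open>auto simp: ramp_eq\<close>)
    then show ?thesis using 3 assms by simp
  qed
qed


context pucci
begin

text \<open>Testing with \<open>ramp x h\<close> and letting \<open>h \<rightarrow> 0\<close> identifies the flux \<open>\<rho> v'\<close> at almost every \<open>x\<close> with the
  integral of the right-hand side over \<open>(0, x)\<close>.\<close>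

theorem weak_solution_imp_sol:
  assumes n_eq: "n = real DIM('a::euclidean_space) - 1"
    and fint: "\<And>a b. 0 < a \<Longrightarrow> f absolutely_integrable_on {a..b}"
    and fk: "\<And>R. (\<lambda>t. t powr kexp * \<bar>f t\<bar>) absolutely_integrable_on {0..R}"
    and weak: "weak_solution TYPE('a) lam Lam s f v"
  shows "pucci_sol_small_flux lam Lam s n f v (deriv v)"
proof -
  define g where "g = deriv v"
  define q where "q = (\<lambda>t. rhs (pw s) f t (v t) (g t))"
  define c where "c = udrift f v"
  have c_eq: "c = (\<lambda>t. drift t (g t) (q t))" by (simp add: c_def udrift_def g_def q_def fun_eq_iff)
  define \<rho> where "\<rho> = weight c"
  define k where "k = (\<lambda>t. \<rho> t / th (q t) * pw s (v t) - \<rho> t / th (q t) * f t)"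
  have ac: "abs_cont_on_interval a b v" if "0 < a" "a \<le> b" for a b
    using weak that by (simp add: weak_solution_def Let_def)
  have cont_v: "continuous_on {a..b} v" if "0 < a" for a b
    by (cases "a \<le> b") (use abs_cont_on_interval_continuous[OF ac[OF that]] in auto)
  have prim_v: "primitive_on a b v g" if "0 < a" "a \<le> b" for a b
    unfolding g_def by (rule abs_cont_on_interval_primitive_deriv[OF that(2) ac[OF that]])
  have g_int: "g absolutely_integrable_on {a..b}" if "0 < a" for a b
    by (cases "a \<le> b") (use primitive_on_abs_integrable[OF prim_v[OF that]] in auto)
  have gm: "g \<in> borel_measurable (lebesgue_on {a..b})" if "0 < a" for a b
    by (rule absolutely_integrable_imp_measurable_on[OF g_int[OF that]])
  have qm: "q \<in> borel_measurable (lebesgue_on {a..b})" if "0 < a" for a b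
    unfolding q_def
    by (intro rhs_measurable gm continuous_imp_measurable_on_sets_lebesgue cont_v
        absolutely_integrable_imp_measurable_on fint that pw_continuous s continuous_on_id) simp
  have c_int: "c absolutely_integrable_on {a..b}" if "0 < a" for a b
    unfolding c_eq by (intro drift_absolutely_integrable gm qm that)
  have rho: "rho lam Lam DIM('a) s f v r = \<rho> r" if "0 < r" for r
    unfolding \<rho>_def c_def by (rule rho_eq_weight[OF n_eq c_int[unfolded c_def] that])
  have rho_tilde: "rho_tilde lam Lam DIM('a) s f v r = \<rho> r / th (q r)" if "0 < r" for r
    unfolding rho_tilde_def rho[OF that] Theta_eq_th[OF n_eq] q_def g_def ..
  have \<rho>_pos: "0 < \<rho> t" for t by (simp add: \<rho>_def weight_pos)
  have prim_\<rho>: "primitive_on a b \<rho> (\<lambda>t. \<rho> t * c t)" if "0 < a" "a \<le> b" for a b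
    unfolding \<rho>_def by (rule weight_primitive[OF c_int that])
  have cont_\<rho>: "continuous_on {a..b} \<rho>" if "0 < a" for a b
    by (cases "a \<le> b") (use primitive_on_continuous[OF prim_\<rho>[OF that]] in auto)
  have ratio: "\<rho> x * y powr kexp \<le> \<rho> y * x powr kexp" if "0 < x" "x \<le> y" for x y
    unfolding \<rho>_def by (rule weight_ratio[OF c_int _ that], assumption, unfold c_eq, rule drift_bounds(1))
  have I_f: "(\<lambda>t. \<rho> t / th (q t) * f t) absolutely_integrable_on {0..b}" for b
    by (rule weighted_source_integrable[OF cont_\<rho> \<rho>_pos ratio qm fint fk])
  have I_v: "(\<lambda>t. \<rho> t / th (q t) * pw s (v t)) absolutely_integrable_on {0..b}" for b
  proof (rule weighted_absorption_integrable[OF cont_\<rho> \<rho>_pos qm cont_v])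
    have "set_integrable lebesgue {0<..<max b 1} (\<lambda>r. rho lam Lam DIM('a) s f v r * \<bar>v r\<bar> powr s)"
      using weak by (simp add: weak_solution_def Let_def)
    then have "(\<lambda>r. \<rho> r * \<bar>v r\<bar> powr s) absolutely_integrable_on {0<..<max b 1}"
      by (rule absolutely_integrable_spike[OF _ negligible_empty]) (simp add: rho)
    then have "(\<lambda>r. \<rho> r * \<bar>v r\<bar> powr s) absolutely_integrable_on {0..max b 1}"
      by (simp only: absolutely_integrable_on_Icc_iff_Ioo)
    then show "(\<lambda>t. \<rho> t * \<bar>v t\<bar> powr s) absolutely_integrable_on {0..b}"
      by (rule absolutely_integrable_on_subset_real) simp
  qed
  have k_int: "k absolutely_integrable_on {0..b}" for b
    unfolding k_def by (intro set_integral_diff(1) I_v I_f)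
  have ki: "k integrable_on {a..b}" "(\<lambda>t. \<bar>k t\<bar>) integrable_on {a..b}" if "0 \<le> a" for a b
    using absolutely_integrable_on_subset_real[OF k_int[of b], of a b] that
      set_integrable_abs[OF absolutely_integrable_on_subset_real[OF k_int[of b], of a b]]
    by (auto simp: set_lebesgue_integral_eq_integral)
  have \<rho>g_int: "(\<lambda>t. \<rho> t * g t) absolutely_integrable_on {a..b}" if "0 < a" for a b
    by (intro absolutely_integrable_continuous_mult cont_\<rho> g_int that)
  \<comment> \<open>The expected flux at x: it vanishes at the origin and has the density k.\<close>
  define H where "H x = integral {0..x} k" for x

  \<comment> \<open>The derivative of the ramp produces the mean of the flux over [x, x + h], the
    part left of x, where the ramp is 1, produces H x, and the transition zone contributes at most
    the integral of |k| over [x, x + h].\<close>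
  have ramp_test: "\<bar>integral {x..x + h} (\<lambda>t. \<rho> t * g t) / h - H x\<bar> \<le> integral {x..x + h} (\<lambda>t. \<bar>k t\<bar>)"
    if x: "0 < x" and h: "0 < h" for x h
  proof -
    define b where "b = x + h"
    define \<phi> where "\<phi> = ramp x h"
    have b: "x < b" "0 < b" using x h by (auto simp: b_def)
    have \<phi>: "r \<le> x \<Longrightarrow> \<phi> r = 1" "b \<le> r \<Longrightarrow> \<phi> r = 0" "0 \<le> \<phi> r" "\<phi> r \<le> 1" for r
      unfolding \<phi>_def b_def using ramp_eq[OF h] by auto
    have d\<phi>: "deriv \<phi> r = (if x < r \<and> r < b then - (1 / h) else 0)" if "r \<noteq> x" "r \<noteq> b" for r
      unfolding \<phi>_def b_def by (rule deriv_ramp[OF h]) (use that in \<open>auto simp: b_def\<close>)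
    have c\<phi>: "continuous_on {0..b} \<phi>" unfolding \<phi>_def by (intro continuous_intros)
    define P where "P = (\<lambda>r. if x < r then - (1 / h) * (\<rho> r * g r) else 0)"
    have P1: "P absolutely_integrable_on {0..x}"
      by (rule absolutely_integrable_spike[OF absolutely_integrable_zero negligible_empty]) (simp add: P_def)
    have "(\<lambda>t. - (1 / h) * (\<rho> t * g t)) absolutely_integrable_on {x..b}"
      by (intro set_integrable_mult_right \<rho>g_int x)
    then have P2: "P absolutely_integrable_on {x..b}"
      by (rule absolutely_integrable_spike[of _ _ "{x}"]) (auto simp: P_def)
    have P: "P absolutely_integrable_on {0..b}" by (rule absolutely_integrable_Icc_combine[OF P1 P2]) (use x b in auto)
    have Pval: "integral {0..b} P = - (1 / h) * integral {x..b} (\<lambda>t. \<rho> t * g t)"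
    proof -
      have "integral {0..b} P = integral {0..x} P + integral {x..b} P"
        using P x b by (intro Henstock_Kurzweil_Integration.integral_combine[symmetric])
          (auto simp: set_lebesgue_integral_eq_integral)
      also have "integral {0..x} P = integral {0..x} (\<lambda>_. 0)"
        by (rule Henstock_Kurzweil_Integration.integral_cong) (simp add: P_def)
      also have "integral {x..b} P = integral {x..b} (\<lambda>t. - (1 / h) * (\<rho> t * g t))"
        by (rule integral_spike[of "{x}"]) (auto simp: P_def)
      finally show ?thesis by (simp only: integral_mult_right Henstock_Kurzweil_Integration.integral_0 add_0)
    qed
    define A where "A = (\<lambda>r. \<phi> r * (\<rho> r / th (q r) * pw s (v r)))"
    define B where "B = (\<lambda>r. \<phi> r * (\<rho> r / th (q r) * f r))"
    have AB: "A absolutely_integrable_on {0..b}" "B absolutely_integrable_on {0..b}"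
      unfolding A_def B_def by (intro absolutely_integrable_continuous_mult c\<phi> I_v I_f)+
    have "\<phi> \<in> radial_test_functions TYPE('a)"
      unfolding \<phi>_def by (rule ramp_radial_test_function[OF x h])
    then have "(LINT r:{0<..}|lebesgue. rho lam Lam DIM('a) s f v r * deriv v r * deriv \<phi> r
         + rho_tilde lam Lam DIM('a) s f v r * (\<bar>v r\<bar> powr (s - 1) * v r) * \<phi> r)
       = (LINT r:{0<..}|lebesgue. rho_tilde lam Lam DIM('a) s f v r * f r * \<phi> r)"
      using weak unfolding weak_solution_def Let_def by blast
    moreover have "(LINT r:{0<..}|lebesgue. rho lam Lam DIM('a) s f v r * deriv v r * deriv \<phi> r
         + rho_tilde lam Lam DIM('a) s f v r * (\<bar>v r\<bar> powr (s - 1) * v r) * \<phi> r)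
       = integral {0..b} (\<lambda>r. P r + A r)"
    proof (rule LINT_half_line_eq_integral[where T = "{x, b}"])
      show "(\<lambda>r. P r + A r) absolutely_integrable_on {0..b}" by (intro set_integral_add(1) P AB)
      show "rho lam Lam DIM('a) s f v r * deriv v r * deriv \<phi> r
         + rho_tilde lam Lam DIM('a) s f v r * (\<bar>v r\<bar> powr (s - 1) * v r) * \<phi> r = P r + A r"
        if "0 < r" "r \<le> b" "r \<notin> {x, b}" for r
        unfolding rho[OF that(1)] rho_tilde[OF that(1)] A_def P_def g_def[symmetric] pw_def[symmetric]
        using that d\<phi>[of r] by auto
      show "rho lam Lam DIM('a) s f v r * deriv v r * deriv \<phi> r
         + rho_tilde lam Lam DIM('a) s f v r * (\<bar>v r\<bar> powr (s - 1) * v r) * \<phi> r = 0" if "b < r" for r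
        using that d\<phi>[of r] b \<phi>(2)[of r] by simp
    qed (use b in auto)
    moreover have "(LINT r:{0<..}|lebesgue. rho_tilde lam Lam DIM('a) s f v r * f r * \<phi> r) = integral {0..b} B"
      by (rule LINT_half_line_eq_integral[OF AB(2) negligible_empty])
        (use b \<phi>(2) in \<open>auto simp: rho_tilde B_def\<close>)
    moreover have "integral {0..b} (\<lambda>r. P r + A r) = integral {0..b} P + integral {0..b} A"
      using P AB by (intro Henstock_Kurzweil_Integration.integral_add) (auto simp: set_lebesgue_integral_eq_integral)
    moreover have "integral {0..b} (\<lambda>r. A r - B r) = integral {0..b} A - integral {0..b} B"
      using AB by (intro Henstock_Kurzweil_Integration.integral_diff) (auto simp: set_lebesgue_integral_eq_integral)
    moreover have "(\<lambda>r. A r - B r) = (\<lambda>r. \<phi> r * k r)"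
      unfolding A_def B_def k_def right_diff_distrib ..
    ultimately have id: "integral {x..b} (\<lambda>t. \<rho> t * g t) / h = integral {0..b} (\<lambda>r. \<phi> r * k r)"
      unfolding Pval by simp
    have \<phi>k: "(\<lambda>r. \<phi> r * k r) absolutely_integrable_on {0..b}"
      by (intro absolutely_integrable_continuous_mult c\<phi> k_int)
    have \<phi>k': "(\<lambda>r. \<phi> r * k r) integrable_on {0..b}" "(\<lambda>r. \<phi> r * k r) integrable_on {x..b}"
      using \<phi>k absolutely_integrable_on_subset_real[OF \<phi>k, of x b] x
      by (auto simp: set_lebesgue_integral_eq_integral)
    have "integral {0..b} (\<lambda>r. \<phi> r * k r) = integral {0..x} (\<lambda>r. \<phi> r * k r) + integral {x..b} (\<lambda>r. \<phi> r * k r)"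
      using \<phi>k' x b by (intro Henstock_Kurzweil_Integration.integral_combine[symmetric]) auto
    also have "integral {0..x} (\<lambda>r. \<phi> r * k r) = H x"
      unfolding H_def by (rule Henstock_Kurzweil_Integration.integral_cong) (simp add: \<phi>(1))
    finally have "integral {x..b} (\<lambda>t. \<rho> t * g t) / h - H x = integral {x..b} (\<lambda>r. \<phi> r * k r)" using id by simp
    moreover have "norm (integral {x..b} (\<lambda>r. \<phi> r * k r)) \<le> integral {x..b} (\<lambda>t. \<bar>k t\<bar>)"
    proof (rule integral_norm_bound_integral)
      show "norm (\<phi> r * k r) \<le> \<bar>k r\<bar>" for r
        using mult_right_mono[OF \<phi>(4)[of r], of "\<bar>k r\<bar>"] \<phi>(3)[of r] by (simp add: abs_mult)
    qed (use \<phi>k' ki x in auto)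
    ultimately show ?thesis by (simp add: b_def)
  qed

  have flux: "\<exists>N. negligible N \<and> (\<forall>x\<in>{a<..<b} - N. \<rho> x * g x = H x)" if ab: "0 < a" "a \<le> b" for a b
  proof -
    define W where "W x = integral {a..x} (\<lambda>t. \<rho> t * g t)" for x
    define Z where "Z x = integral {a..x} (\<lambda>t. \<bar>k t\<bar>)" for x
    have PW: "primitive_on a b W (\<lambda>t. \<rho> t * g t)"
      unfolding W_def[abs_def] by (rule primitive_on_indefinite[OF \<rho>g_int[OF ab(1)]])
    have PZ: "primitive_on a b Z (\<lambda>t. \<bar>k t\<bar>)"
      unfolding Z_def[abs_def]
      by (rule primitive_on_indefinite[OF absolutely_integrable_on_subset_real[OF set_integrable_abs[OF k_int[of b]]]])
        (use ab in auto)
    obtain N where N: "negligible N" "\<And>x. x \<in> {a<..<b} - N \<Longrightarrow> (W has_real_derivative \<rho> x * g x) (at x)"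
      using primitive_on_has_real_derivative[OF PW] by blast
    have "\<rho> x * g x = H x" if x: "x \<in> {a<..<b} - N" for x
    proof -
      have "((\<lambda>h. (W (x + h) - W x) / h) \<longlongrightarrow> \<rho> x * g x) (at_right 0)"
        using N(2)[OF x] unfolding DERIV_def by (rule tendsto_mono[OF at_le, rotated]) simp
      moreover have "((\<lambda>h. (W (x + h) - W x) / h) \<longlongrightarrow> H x) (at_right 0)"
      proof (rule LIM_zero_cancel, rule Lim_null_comparison)
        have "isCont Z x"
          using primitive_on_continuous[OF PZ] x by (simp add: continuous_on_interior)
        then have "((\<lambda>h. Z (x + h)) \<longlongrightarrow> Z x) (at 0)" by (simp add: isCont_iff)
        then have "((\<lambda>h. Z (x + h)) \<longlongrightarrow> Z x) (at_right 0)" by (rule tendsto_mono[OF at_le, rotated]) simp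
        from tendsto_diff[OF this tendsto_const[of "Z x"]]
        show "((\<lambda>h. Z (x + h) - Z x) \<longlongrightarrow> 0) (at_right 0)" by simp
        show "\<forall>\<^sub>F h in at_right 0. norm ((W (x + h) - W x) / h - H x) \<le> Z (x + h) - Z x"
          unfolding eventually_at_right_field
        proof (intro exI[of _ "b - x"] conjI allI impI)
          fix h assume h: "0 < h" "h < b - x"
          have "W (x + h) - W x = integral {x..x + h} (\<lambda>t. \<rho> t * g t)" "Z (x + h) - Z x = integral {x..x + h} (\<lambda>t. \<bar>k t\<bar>)"
            using primitive_on_diff[OF PW, of x "x + h"] primitive_on_diff[OF PZ, of x "x + h"] x h by auto
          then show "norm ((W (x + h) - W x) / h - H x) \<le> Z (x + h) - Z x"
            using ramp_test[of x h] x h ab by simp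
        qed (use x in simp)
      qed
      ultimately show ?thesis by (rule tendsto_unique[OF trivial_limit_at_right_real])
    qed
    then show ?thesis using N(1) by blast
  qed

  have prim_H: "primitive_on a b H k" if "0 < a" for a b
    using primitive_on_subinterval[OF primitive_on_indefinite[OF k_int[of b]], of a b] that
    unfolding H_def[abs_def] by simp
  \<comment> \<open>H / rho is a continuous representative of the slope, written as a product of
    primitives. Hence v is C1 on the positive half-line, its \<open>deriv\<close> equals p at every
    positive point rather than almost everywhere, and the product rule recovers the second-order
    equation.\<close>
  define p where "p = (\<lambda>t. H t * weight (\<lambda>t. - c t) t)"
  have p_eq: "p t = H t / \<rho> t" for t by (simp add: p_def weight_minus \<rho>_def divide_inverse)
  have prim_p: "primitive_on a b p (\<lambda>t. k t * weight (\<lambda>t. - c t) t + H t * (weight (\<lambda>t. - c t) t * - c t))"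
    if "0 < a" "a \<le> b" for a b
    unfolding p_def
    by (intro primitive_on_mult prim_H weight_primitive absolutely_integrable_minus_real c_int that)
  have prim_vp: "primitive_on a b v p" if ab: "0 < a" "a \<le> b" for a b
  proof -
    obtain N where N: "negligible N" "\<And>x. x \<in> {a<..<b} - N \<Longrightarrow> \<rho> x * g x = H x"
      using flux[OF ab] by blast
    show ?thesis
    proof (rule primitive_on_spike[OF prim_v[OF ab]])
      show "negligible (N \<union> {a, b})" by (rule negligible_Un[OF N(1)]) simp
      show "p x = g x" if "x \<in> {a..b} - (N \<union> {a, b})" for x
        unfolding p_eq using N(2)[of x] that \<rho>_pos[of x] by (auto simp: field_simps)
    qed
  qed
  have gp: "g t = p t" if "0 < t" for t
    unfolding g_def
    using primitive_on_continuous_deriv[OF prim_vp[of "t / 2" "t + 1"] primitive_on_continuous[OF prim_p[of "t / 2" "t + 1"]], of t] that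
    by simp
  have \<rho>g: "\<rho> t * g t = H t" if "0 < t" for t
    unfolding gp[OF that] p_eq using \<rho>_pos[of t] by simp
  have prim_g: "primitive_on a b g q" if ab: "0 < a" "a \<le> b" for a b
  proof (rule primitive_on_cong[OF prim_p[OF ab]])
    fix t assume "t \<in> {a..b}"
    then have t: "0 < t" using ab by auto
    show "g t = p t" by (rule gp[OF t])
    have "k t * weight (\<lambda>t. - c t) t = (pw s (v t) - f t) / th (q t)"
      unfolding k_def weight_minus \<rho>_def[symmetric] using \<rho>_pos[of t] th_bounds(3)[of "q t"] by (simp add: field_simps)
    moreover have "H t * (weight (\<lambda>t. - c t) t * - c t) = - (c t * g t)"
      unfolding gp[OF t] p_def by simp
    moreover have "q t + c t * g t = (pw s (v t) - f t) / th (q t)"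
      using rhs_drift[of f t "v t" "g t"] by (simp add: c_eq q_def)
    ultimately show "q t = k t * weight (\<lambda>t. - c t) t + H t * (weight (\<lambda>t. - c t) t * - c t)" by linarith
  qed
  interpret S: pucci_sol lam Lam s n f v "deriv v"
  proof
    show "sol_on f a b v (deriv v)" if "0 < a" "a \<le> b" for a b
      using prim_v[OF that] prim_g[OF that] unfolding sol_on_def q_def g_def by simp
  qed (rule fint fk, assumption?)+
  have "S.q = q" unfolding S.q_def q_def g_def by (simp add: fun_eq_iff S.q_def)
  then have "S.c = c" by (simp add: fun_eq_iff S.c_def c_eq g_def)
  then have h: "S.h t = H t" if "0 < t" for t
    using \<rho>g[OF that] by (simp add: S.h_def S.R_def \<rho>_def g_def)
  have H0: "(H \<longlongrightarrow> 0) (at_right 0)"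
    unfolding H_def[abs_def] by (rule integral_tendsto_0_at_right[OF k_int])
  show ?thesis
  proof
    fix \<delta> :: real assume \<delta>: "0 < \<delta>"
    have "\<forall>\<^sub>F x in at_right 0. \<bar>H x\<bar> < \<delta>" using tendstoD[OF H0 \<delta>] by (simp add: dist_real_def)
    moreover have "\<forall>\<^sub>F x in at_right 0. 0 < x \<and> x < \<delta>" using \<delta> by (auto simp: eventually_at_right_field)
    ultimately have "\<forall>\<^sub>F x in at_right 0. \<bar>H x\<bar> < \<delta> \<and> 0 < x \<and> x < \<delta>" by (rule eventually_conj)
    then obtain x where "\<bar>H x\<bar> < \<delta>" "0 < x" "x < \<delta>"
      using eventually_happens'[OF trivial_limit_at_right_real] by blast
    then show "\<exists>x>0. x < \<delta> \<and> \<bar>S.h x\<bar> < \<delta>" using h by auto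
  qed
qed

end

section \<open>Small-flux solutions are weak solutions with the stated regularity\<close>

locale pucci_deriv_sol = pucci_sol_small_flux lam Lam s n f u "deriv u" for lam Lam s n f u +
  fixes N :: nat
  assumes n_eq: "n = real N - 1"
begin

lemma rho_eq_R: "0 < r \<Longrightarrow> rho lam Lam N s f u r = R r"
proof -
  have c: "udrift f u = c" by (simp add: udrift_def c_def q_def fun_eq_iff)
  show "0 < r \<Longrightarrow> rho lam Lam N s f u r = R r"
    unfolding R_def c[symmetric] by (rule rho_eq_weight[OF n_eq]) (use c_int c in auto)
qed

lemma rho_tilde_eq:
  assumes "0 < r"
  shows "rho_tilde lam Lam N s f u r = R r / th (q r)"
  unfolding rho_tilde_def Theta_eq_th[OF n_eq] rho_eq_R[OF assms] q_def ..

text \<open>A test function is Lipschitz and vanishes beyond some b, so it is a primitive of its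
  pointwise derivative on [0, b], and \<open>weak_identity\<close> applies.\<close>

lemma weak_form:
  assumes \<phi>: "\<phi> \<in> radial_test_functions TYPE('a::euclidean_space)"
  shows "(LINT r:{0<..}|lebesgue. rho lam Lam N s f u r * deriv u r * deriv \<phi> r
         + rho_tilde lam Lam N s f u r * (\<bar>u r\<bar> powr (s - 1) * u r) * \<phi> r)
       = (LINT r:{0<..}|lebesgue. rho_tilde lam Lam N s f u r * f r * \<phi> r)"
proof (rule radial_test_function_lipschitz[OF \<phi>])
  fix L b :: real
  assume L: "\<And>r s. 0 \<le> r \<Longrightarrow> 0 \<le> s \<Longrightarrow> \<bar>\<phi> r - \<phi> s\<bar> \<le> L * \<bar>r - s\<bar>"
    and b: "0 < b" "\<And>r. b \<le> r \<Longrightarrow> \<phi> r = 0"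
  have "abs_cont_on_interval 0 b \<phi>" by (rule lipschitz_imp_abs_cont[of _ _ _ L]) (use L in auto)
  then have P\<phi>: "primitive_on 0 b \<phi> (deriv \<phi>)" using b(1) by (intro abs_cont_on_interval_primitive_deriv) auto
  have c\<phi>: "continuous_on {0..b} \<phi>" by (rule primitive_on_continuous[OF P\<phi>])
  have d\<phi>: "deriv \<phi> r = 0" if "b < r" for r
  proof (rule DERIV_imp_deriv)
    have "((\<lambda>_. 0) has_real_derivative 0) (at r)" by simp
    then show "(\<phi> has_real_derivative 0) (at r)"
      by (rule has_field_derivative_transform_within_open[of _ _ _ "{b<..}"]) (use that b in auto)
  qed
  have "q absolutely_integrable_on {a..b}" if "0 < a" for a b
    by (cases "a \<le> b") (use primitive_on_abs_integrable[OF prim_p[OF that]] in auto)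
  then have qm: "q \<in> borel_measurable (lebesgue_on {a..b})" if "0 < a" for a b
    using that by (intro absolutely_integrable_imp_measurable_on)
  have I_f: "(\<lambda>t. R t / th (q t) * f t) absolutely_integrable_on {0..b}"
    by (rule weighted_source_integrable[OF continuous_all(3) R_pos R_ratio qm fint fk])
  have I_u: "(\<lambda>t. R t / th (q t) * pw s (u t)) absolutely_integrable_on {0..b}"
    by (rule weighted_absorption_integrable[OF continuous_all(3) R_pos qm continuous_all(1) Rus_int])
  define A where "A = (\<lambda>r. \<phi> r * (R r / th (q r) * pw s (u r)))"
  define B where "B = (\<lambda>r. \<phi> r * (R r / th (q r) * f r))"
  have AB: "A absolutely_integrable_on {0..b}" "B absolutely_integrable_on {0..b}"
    unfolding A_def B_def by (intro absolutely_integrable_continuous_mult c\<phi> I_u I_f)+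
  have "(\<lambda>t. h0 t * deriv \<phi> t) absolutely_integrable_on {0..b}"
    by (intro absolutely_integrable_continuous_mult primitive_on_continuous[OF prim_h0] primitive_on_abs_integrable[OF P\<phi>])
  then have P: "(\<lambda>t. h t * deriv \<phi> t) absolutely_integrable_on {0..b}"
    by (rule absolutely_integrable_spike[of _ _ "{0}"]) (auto simp: h_h0)
  have PA: "(\<lambda>t. h t * deriv \<phi> t + A t) absolutely_integrable_on {0..b}"
    by (intro set_integral_add(1) P AB)
  have "integral {0..b} (\<lambda>t. h t * deriv \<phi> t + A t) - integral {0..b} B
      = integral {0..b} (\<lambda>t. (h t * deriv \<phi> t + A t) - B t)"
    using PA AB by (intro Henstock_Kurzweil_Integration.integral_diff[symmetric]) (auto simp: set_lebesgue_integral_eq_integral)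
  also have "(\<lambda>t. (h t * deriv \<phi> t + A t) - B t) = (\<lambda>t. h t * deriv \<phi> t + k t * \<phi> t)"
    unfolding A_def B_def k_def by (simp add: fun_eq_iff right_diff_distrib mult.commute[of _ "\<phi> _"])
  also have "integral {0..b} \<dots> = 0"
    by (rule integral_unique[OF weak_identity[OF b(1) P\<phi>]]) (simp add: b)
  finally have "integral {0..b} (\<lambda>t. h t * deriv \<phi> t + A t) = integral {0..b} B" by simp
  moreover have "(LINT r:{0<..}|lebesgue. rho lam Lam N s f u r * deriv u r * deriv \<phi> r
         + rho_tilde lam Lam N s f u r * (\<bar>u r\<bar> powr (s - 1) * u r) * \<phi> r)
       = integral {0..b} (\<lambda>t. h t * deriv \<phi> t + A t)"
    by (rule LINT_half_line_eq_integral[OF PA negligible_empty])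
      (use b d\<phi> in \<open>auto simp: rho_eq_R rho_tilde_eq A_def h_def pw_def\<close>)
  moreover have "(LINT r:{0<..}|lebesgue. rho_tilde lam Lam N s f u r * f r * \<phi> r) = integral {0..b} B"
    by (rule LINT_half_line_eq_integral[OF AB(2) negligible_empty]) (use b in \<open>auto simp: rho_tilde_eq B_def\<close>)
  ultimately show ?thesis by simp
qed

lemma set_integrable_rho:
  assumes "(\<lambda>t. R t * g t) absolutely_integrable_on {0..r}"
  shows "set_integrable lebesgue {0<..<r} (\<lambda>t. rho lam Lam N s f u t * g t)"
proof -
  have "(\<lambda>t. R t * g t) absolutely_integrable_on {0<..<r}"
    using assms by (simp only: absolutely_integrable_on_Icc_iff_Ioo)
  then show ?thesis
    by (rule absolutely_integrable_spike[OF _ negligible_empty]) (simp add: rho_eq_R)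
qed

lemma weak_solution:
  assumes "N = DIM('a)"
  shows "weak_solution TYPE('a::euclidean_space) lam Lam s f u"
  unfolding weak_solution_def Let_def assms[symmetric]
proof (intro conjI allI impI ballI)
  show "abs_cont_on_interval a b u" if "0 < a" "a \<le> b" for a b
    by (rule primitive_on_imp_abs_cont[OF prim_u[OF that]])
  show "set_integrable lebesgue {0<..<r} (\<lambda>r. rho lam Lam N s f u r * \<bar>u r\<bar> powr s)" for r
    by (rule set_integrable_rho[OF Rus_int])
  show "set_integrable lebesgue {0<..<r} (\<lambda>r. rho lam Lam N s f u r * \<bar>deriv u r\<bar>)" for r
    by (rule set_integrable_rho[OF abs_h_int])
qed (rule weak_form)

text \<open>The flux has a density on each of the countably many intervals [1 / (m + 1), m + 1], and
  the union of the exceptional null sets is still null.\<close>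

lemma flux_differentiable:
  "AE r in lebesgue. 0 < r \<longrightarrow> (\<lambda>t. rho lam Lam N s f u t * deriv u t) differentiable at r"
proof -
  have "\<exists>M. negligible M \<and> (\<forall>x\<in>{1 / real (Suc m)<..<real (Suc m)} - M. (h has_real_derivative k x) (at x))" for m
  proof -
    have "1 / real (Suc m) \<le> real (Suc m)" by (simp add: field_simps)
    then have P: "primitive_on (1 / real (Suc m)) (real (Suc m)) h k" by (intro prim_h) auto
    obtain M where "negligible M"
      "\<And>x. x \<in> {1 / real (Suc m)<..<real (Suc m)} - M \<Longrightarrow> (h has_real_derivative k x) (at x)"
      using primitive_on_has_real_derivative[OF P] by blast
    then show ?thesis by blast
  qed
  then obtain M where M: "\<And>m. negligible (M m)"
    "\<And>m x. x \<in> {1 / real (Suc m)<..<real (Suc m)} - M m \<Longrightarrow> (h has_real_derivative k x) (at x)"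
    by metis
  have neg: "negligible (\<Union>m. M m)" by (rule negligible_Union_nat[OF M(1)])
  have "(\<lambda>t. rho lam Lam N s f u t * deriv u t) differentiable at r" if r: "0 < r" "r \<notin> (\<Union>m. M m)" for r
  proof -
    obtain m where m: "max r (1 / r) < real m" using reals_Archimedean2 by blast
    then have "1 / r < real (Suc m)" "r < real (Suc m)" by auto
    then have "r \<in> {1 / real (Suc m)<..<real (Suc m)} - M m" using r by (auto simp: field_simps)
    then have "(h has_real_derivative k r) (at r)" by (rule M(2))
    then have "((\<lambda>t. rho lam Lam N s f u t * deriv u t) has_real_derivative k r) (at r)"
      by (rule has_field_derivative_transform_within_open[of _ _ _ "{0<..}"])
        (use r in \<open>auto simp: rho_eq_R h_def\<close>)
    then show ?thesis by (auto simp: real_differentiable_def)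
  qed
  then show ?thesis using neg
    by (intro AE_I'[of "\<Union>m. M m"]) (auto simp: negligible_iff_null_sets)
qed

lemma flux_tendsto_0: "((\<lambda>r. rho lam Lam N s f u r * deriv u r) \<longlongrightarrow> 0) (at_right 0)"
  by (rule Lim_transform_eventually[OF h_tendsto_0 eventually_mono[OF eventually_at_right_less]])
    (simp add: h_def rho_eq_R)

lemma flux_integral_tendsto_0:
  "((\<lambda>r. LINT t:{0<..<r}|lebesgue. rho lam Lam N s f u t * \<bar>deriv u t\<bar>) \<longlongrightarrow> 0) (at_right 0)"
proof (rule Lim_transform_eventually[OF integral_tendsto_0_at_right[OF abs_h_int]])
  have "integral {0..r} (\<lambda>t. R t * \<bar>deriv u t\<bar>) = (LINT t:{0<..<r}|lebesgue. rho lam Lam N s f u t * \<bar>deriv u t\<bar>)" for r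
  proof -
    have "(LINT t:{0<..<r}|lebesgue. rho lam Lam N s f u t * \<bar>deriv u t\<bar>)
        = integral {0<..<r} (\<lambda>t. rho lam Lam N s f u t * \<bar>deriv u t\<bar>)"
      by (rule set_lebesgue_integral_eq_integral(2)[OF set_integrable_rho[OF abs_h_int]])
    also have "\<dots> = integral {0<..<r} (\<lambda>t. R t * \<bar>deriv u t\<bar>)"
      by (rule Henstock_Kurzweil_Integration.integral_cong) (simp add: rho_eq_R)
    finally show ?thesis by (simp add: integral_open_interval_real)
  qed
  then show "\<forall>\<^sub>F r in at_right 0. integral {0..r} (\<lambda>t. R t * \<bar>deriv u t\<bar>) =
      (LINT t:{0<..<r}|lebesgue. rho lam Lam N s f u t * \<bar>deriv u t\<bar>)" by simp
qed

end

section \<open>Existence and conclusion\<close>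

context pucci
begin

text \<open>The lower function for the sign statement: with f >= 0 the comparison theorem puts u
  above it.\<close>

lemma zero_sol: "pucci_sol_small_flux lam Lam s n (\<lambda>_. 0) (\<lambda>_. 0) (\<lambda>_. 0)"
proof -
  have z: "primitive_on a b (\<lambda>_. 0) (\<lambda>_. 0)" for a b by (simp add: primitive_on_def)
  interpret S: pucci_sol lam Lam s n "\<lambda>_. 0" "\<lambda>_. 0" "\<lambda>_. 0"
    by unfold_locales (simp_all add: sol_on_def rhs_def K_def z)
  show ?thesis
    by unfold_locales (metis S.h_def abs_zero mult_zero_right field_lbound_gt_zero)
qed

text \<open>The slope of the entire solution is itself a primitive, hence continuous, so it equals
  \<open>deriv u\<close> at every positive point; the inherited slope bound is what
  \<open>flux_small\<close> asks for.\<close>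

lemma exists_sol_small_flux:
  assumes fint: "\<And>a b. 0 < a \<Longrightarrow> f absolutely_integrable_on {a..b}"
    and fk: "\<And>R. (\<lambda>t. t powr kexp * \<bar>f t\<bar>) absolutely_integrable_on {0..R}"
  obtains u where "pucci_sol_small_flux lam Lam s n f u (deriv u)"
proof -
  obtain u p where sol: "\<And>a b. 0 < a \<Longrightarrow> a \<le> b \<Longrightarrow> sol_on f a b u p"
    and B: "\<And>e r. e = 1 \<or> e = -1 \<Longrightarrow> 0 < r \<Longrightarrow>
      e * p r \<le> (integral {0..r} (\<lambda>t. t powr kexp * \<bar>f t\<bar>) / r powr kexp + r * pw s (max (e * u r) 0)) / lam"
    using exists_entire_solution[OF fint fk] by blast
  have P: "primitive_on a b u p" "primitive_on a b p (\<lambda>t. rhs (pw s) f t (u t) (p t))" if "0 < a" "a \<le> b" for a b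
    using sol[OF that] by (auto simp: sol_on_def)
  have d: "deriv u t = p t" if "0 < t" for t
    using primitive_on_continuous_deriv[OF P(1)[of "t / 2" "t + 1"] primitive_on_continuous[OF P(2)[of "t / 2" "t + 1"]], of t] that
    by simp
  interpret S: pucci_sol lam Lam s n f u "deriv u"
  proof
    fix a b :: real assume ab: "0 < a" "a \<le> b"
    show "sol_on f a b u (deriv u)"
      unfolding sol_on_def
      using primitive_on_cong[OF P(1)[OF ab], of u "deriv u"] primitive_on_cong[OF P(2)[OF ab], of "deriv u"] d ab
      by auto
  qed (rule fint fk, assumption?)+
  have "pucci_sol_small_flux lam Lam s n f u (deriv u)"
  proof
    show "\<exists>x>0. x < \<delta> \<and> \<bar>S.h x\<bar> < \<delta>" if "0 < \<delta>" for \<delta>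
    proof (rule S.flux_small[OF _ that])
      fix e r :: real assume "e = 1 \<or> e = - 1" "0 < r"
      then show "e * deriv u r \<le> (S.Sf r / r powr kexp + r * pw s (max (e * u r) 0)) / lam"
        unfolding d[OF \<open>0 < r\<close>] S.Sf_def by (rule B)
    qed
  qed
  then show thesis by (rule that)
qed

end

theorem theorem3p1:
  fixes lam Lam s :: real and f :: "real \<Rightarrow> real"
  assumes "0 < lam" and "lam \<le> Lam" and "1 < s"
    and "set_borel_measurable lebesgue {0<..} f"
    and "\<forall>R>0. set_integrable lebesgue {0<..<R} (\<lambda>r. r powr (N_plus lam Lam DIM('a::euclidean_space) - 1) * \<bar>f r\<bar>)"
  shows "\<exists>u. weak_solution TYPE('a) lam Lam s f u \<and>
     (\<forall>v. weak_solution TYPE('a) lam Lam s f v \<longrightarrow> (\<forall>r>0. v r = u r)) \<and>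
     ((AE r in lebesgue. 0 < r \<longrightarrow> 0 \<le> f r) \<longrightarrow> (\<forall>r>0. 0 \<le> u r)) \<and>
     (\<forall>q. 1 < q \<and> q < 2 * s / (s + 1) \<longrightarrow>
        (\<forall>R>0. set_integrable lebesgue {0<..<R}
           (\<lambda>r. rho lam Lam DIM('a) s f u r * \<bar>deriv u r\<bar> powr q))) \<and>
     (AE r in lebesgue. 0 < r \<longrightarrow>
        (\<lambda>t. rho lam Lam DIM('a) s f u t * deriv u t) differentiable at r) \<and>
     ((\<lambda>r. rho lam Lam DIM('a) s f u r * deriv u r) \<longlongrightarrow> 0) (at_right 0) \<and>
     ((\<lambda>r. LINT t:{0<..<r}|lebesgue. rho lam Lam DIM('a) s f u t * \<bar>deriv u t\<bar>)
        \<longlongrightarrow> 0) (at_right 0)"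
proof -
  define n where "n = real DIM('a) - 1"
  interpret pucci lam Lam s n
    by unfold_locales (use assms DIM_positive[where 'a='a] in \<open>auto simp: n_def Suc_le_eq\<close>)
  have N_plus: "N_plus lam Lam DIM('a) - 1 = kexp" by (simp add: N_plus_def n_def)
  have fk: "(\<lambda>t. t powr kexp * \<bar>f t\<bar>) absolutely_integrable_on {0..R}" for R
  proof (rule absolutely_integrable_on_subset_real)
    have "(\<lambda>t. t powr kexp * \<bar>f t\<bar>) absolutely_integrable_on {0<..<max R 1}"
      using assms(5) unfolding N_plus by simp
    then show "(\<lambda>t. t powr kexp * \<bar>f t\<bar>) absolutely_integrable_on {0..max R 1}"
      by (simp only: absolutely_integrable_on_Icc_iff_Ioo)
  qed simp
  have fint: "f absolutely_integrable_on {a..b}" if a: "0 < a" for a b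
  proof (rule measurable_bounded_by_integrable_imp_absolutely_integrable)
    have "(\<lambda>x. indicator {0<..} x *\<^sub>R f x) \<in> borel_measurable (lebesgue_on {a..b})"
      using assms(4) unfolding set_borel_measurable_def by (rule measurable_restrict_space1)
    then show "f \<in> borel_measurable (lebesgue_on {a..b})"
      by (rule measurable_cong[THEN iffD1, rotated]) (use a in auto)
    \<comment> \<open>Away from the origin the factor t powr (- kexp) is continuous, so the weighted
      condition gives plain integrability of f.\<close>
    have "(\<lambda>t. t powr (- kexp) * (t powr kexp * \<bar>f t\<bar>)) absolutely_integrable_on {a..b}"
    proof (rule absolutely_integrable_continuous_mult)
      show "continuous_on {a..b} (\<lambda>t. t powr (- kexp))" using a by (intro continuous_intros) auto
      show "(\<lambda>t. t powr kexp * \<bar>f t\<bar>) absolutely_integrable_on {a..b}"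
        by (rule absolutely_integrable_on_subset_real[OF fk[of b]]) (use a in auto)
    qed
    then have "(\<lambda>t. \<bar>f t\<bar>) absolutely_integrable_on {a..b}"
      by (rule absolutely_integrable_spike[OF _ negligible_empty]) (use a in \<open>auto simp: powr_minus\<close>)
    then show "(\<lambda>t. \<bar>f t\<bar>) integrable_on {a..b}" by (simp add: set_lebesgue_integral_eq_integral)
  qed auto
  obtain u where u: "pucci_sol_small_flux lam Lam s n f u (deriv u)"
    using exists_sol_small_flux[OF fint fk] by blast
  interpret U: pucci_deriv_sol lam Lam s n f u "DIM('a)"
    by (rule pucci_deriv_sol.intro[OF u pucci_deriv_sol_axioms.intro[OF n_def]])
  show ?thesis
  proof (intro exI[of _ u] conjI allI impI)
    show "weak_solution TYPE('a) lam Lam s f u" by (rule U.weak_solution) simp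
    show "v r = u r" if "weak_solution TYPE('a) lam Lam s f v" "0 < r" for v r
    proof (rule antisym)
      have v: "pucci_sol_small_flux lam Lam s n f v (deriv v)"
        by (rule weak_solution_imp_sol[OF n_def fint fk that(1)])
      show "v r \<le> u r" by (rule comparison[OF v u negligible_empty order.refl that(2)])
      show "u r \<le> v r" by (rule comparison[OF u v negligible_empty order.refl that(2)])
    qed
    show "0 \<le> u r" if "AE r in lebesgue. 0 < r \<longrightarrow> 0 \<le> f r" "0 < r" for r
    proof -
      have "\<exists>M\<in>null_sets lebesgue. {r \<in> space lebesgue. \<not> (0 < r \<longrightarrow> 0 \<le> f r)} \<subseteq> M"
        using that(1) by (simp only: eventually_ae_filter)
      then obtain M where M: "M \<in> null_sets lebesgue" "{r \<in> space lebesgue. \<not> (0 < r \<longrightarrow> 0 \<le> f r)} \<subseteq> M"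
        by (elim bexE)
      moreover have "0 \<le> f t" if "0 < t" "t \<notin> M" for t using M(2) that by auto
      ultimately show ?thesis
        using comparison[OF zero_sol u _ _ that(2), of M] M(1) by (simp add: negligible_iff_null_sets)
    qed
    show "set_integrable lebesgue {0<..<R} (\<lambda>r. rho lam Lam DIM('a) s f u r * \<bar>deriv u r\<bar> powr q)"
      if "1 < q \<and> q < 2 * s / (s + 1)" for q R
      by (rule U.set_integrable_rho[OF U.power_int]) (use that in auto)
  qed (rule U.flux_differentiable U.flux_tendsto_0 U.flux_integral_tendsto_0)+
qed

end
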